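(* Let $hCAT$ be the homotopy category of categories described in the context, let $Set$ be the category of very small sets, regarded as a dependent adder in $hCAT$ with coproducts as dependent sums, and let $M=Top_{open}$ be the category of very small topological spaces with open maps. With the morphism $p_M:F_M\to Top_{open}$, the dependent sum functions $\sum^m$ (étalé spaces of presheaves) and the flattening functions $f^{M,\flat}$ described in the context, $Top_{open}$ is a left $Set$-module (in $\mathscr{C}=hCAT$).
   Context: The category $hCAT$: fix strongly inaccessible cardinals $\kappa_0<\kappa_1$; a category is moderately small if it is smaller than $\kappa_1$; $CAT$ is the $1$-category of moderately small categories. For moderately small $I,J$ let $\mathrm{Hom}_{hCAT}(I,J)$ be a skeleton of the category of functors $I\to J$, so that for every functor $G:I\to J$ there is exactly one $\mathrm{Ho}(G)\in\mathrm{Hom}_{hCAT}(I,J)$ with $G\cong\mathrm{Ho}(G)$. Objects of $hCAT$ are the moderately small categories, morphisms are the elements of $\mathrm{Hom}_{hCAT}(I,J)$, and composites are $\mathrm{Ho}$ of the composites in $CAT$. $hCAT$ has finite limits, and pullbacks in $CAT$ of Grothendieck opfibrations are also pullbacks in $hCAT$. "Very small" is a size restriction under which $Set$ and $Top_{open}$ are objects of $hCAT$. Oplax colimits: for a functor $f:I\to CAT$, $\mathrm{colim}^{oplax}_{i\in I}f(i)$ is the category with objects the pairs $(i,j)$, $j\in f(i)$, and morphisms $(i,j)\to(i',j')$ the pairs $(\alpha,\beta)$ with $\alpha:i\to i'$ in $I$ and $\beta:f(\alpha)(j)\to j'$ in $f(i')$. Sets are regarded as discrete categories. The dependent adder $A=Set$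 in $hCAT$: $p:F\to Set$ is $\mathrm{Ho}$ of the Grothendieck opfibration corresponding to the inclusion $Set\to CAT$ (as discrete categories), and the unit $1_F$ picks out a one-element set with its element; put $1_A=p\circ 1_F$. For $x:U\to Set$, the pullback $\llbracket x\rrbracket$ of $x$ and $p$ in $hCAT$ satisfies $\llbracket x\rrbracket\cong\mathrm{colim}^{oplax}_{u\in U}x(u)$. For $f:\llbracket x\rrbracket\to Set$, $\sum^x f=\mathrm{Ho}\big(u\mapsto\coprod_{t\in x(u)}f(u,t)\big)$, and $f^\flat:\llbracket f\rrbracket\to\llbracket\sum^x f\rrbracket$ is $\mathrm{Ho}$ of the natural isomorphism $\mathrm{colim}^{oplax}_{(u,t)\in\mathrm{colim}^{oplax}_{u\in U}x(u)}f(u,t)\to\mathrm{colim}^{oplax}_{u\in U}\coprod_{t\in x(u)}f(u,t)$. Left modules: let $\mathscr{C}$ be a category with pullbacks and $A$ a dependent adder in $\mathscr{C}$. An $A$-dependent left module consists of: (1) an object $M$; (2) a morphism $p:F_M\to M$; for $m:U\to M$ write $\llbracket m\rrbracket_M$ for the pullback $U\times_M F_M$; (3) for every $m:U\to M$ a function $\sum^m:\mathrm{Hom}_{\mathscr{C}}(\llbracket m\rrbracket_M,A)\to\mathrm{Hom}_{\mathscr{C}}(U,M)$, natural in $m\in\mathscr{C}/M$; (4) for every $m:U\to M$ and $f:\llbracket m\rrbracket_M\to A$ a morphism $f^{M,\flat}:\llbracket f\rrbracket\to\llbracket\sum^m f\rrbracket_M$ over $U$. For $g:\llbracket\sum^m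 f\rrbracket_M\to A$ put $f\boxtimes g:=\sum^f(g\circ f^{M,\flat})$. These must satisfy, as equalities in $\mathscr{C}$, for all such $m,f,g$: (Unit) $\sum^m const_1=m$, where $const_1:\llbracket m\rrbracket_M\to A$ is the constant $1_A$ map; (Sum Associativity) $\sum^{\sum^m f}g=\sum^m\sum^f(g\circ f^{M,\flat})$; (Flatten Associativity) $g^{M,\flat}\circ(f^{M,\flat}\times_A\mathrm{id}_F)=(f\boxtimes g)^{M,\flat}\circ(g\circ f^{M,\flat})^\flat$ as morphisms $\llbracket g\circ f^{M,\flat}\rrbracket\to\llbracket\sum^m f\boxtimes g\rrbracket_M$. Étalé spaces: for a presheaf of sets $\mathscr{F}$ on a space $X$, $Et(\mathscr{F})=\coprod_{x\in X}\mathscr{F}_x$ (coproduct of the stalks), with the topology generated by the sets $\epsilon_{\mathscr{F}}(U,s)=\{(x,s_x)\mid x\in U\}$ for $U\subseteq X$ open and $s\in\mathscr{F}(U)$. A morphism of presheaves $\tau:\mathscr{F}\to\mathscr{G}$ on $X$ induces an open map $Et(\tau):Et(\mathscr{F})\to Et(\mathscr{G})$ via the maps on stalks. For an open map $\phi:X\to Y$ and a presheaf $\mathscr{F}$ on $Y$, let $\phi^*(\mathscr{F})(U)=\mathscr{F}(\phi(U))$; the maps $\phi^*(\mathscr{F})_x\to\mathscr{F}_{\phi(x)}$ give a natural open map $Et_\phi:Et(\phi^*(\mathscr{F}))\to Et(\mathscr{F})$. The module data on $M=Top_{open}$: let $\mathrm{Ouv}(X)$ be the poset of open subsets of $X$.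 Sending $X$ to $\mathrm{Ouv}(X)^{op}$ and an open map to its image functor is a functor $Top_{open}\to CAT$; it gives a Grothendieck opfibration $p^\heartsuit:F_M:=\mathrm{colim}^{oplax}_{X\in Top_{open}}\mathrm{Ouv}(X)^{op}\to Top_{open}$, and $p_M=\mathrm{Ho}(p^\heartsuit)$. For $m:D\to Top_{open}$ in $hCAT$, $\llbracket m\rrbracket_M$ is the pullback in $hCAT$, and $\llbracket m\rrbracket_M\cong\mathrm{colim}^{oplax}_{d\in D}\mathrm{Ouv}(m(d))^{op}$. For $f:\llbracket m\rrbracket_M\to Set$ in $hCAT$ and $d\in D$ let $\mathscr{F}_d=f(d,-)$, a presheaf on $m(d)$. Let $(\sum^m f)^\heartsuit:D\to Top_{open}$ be the functor with $(\sum^m f)^\heartsuit(d)=Et(\mathscr{F}_d)$, sending $\alpha:d\to e$ to the composite $Et(\mathscr{F}_d)\to Et(m(\alpha)^*(\mathscr{F}_e))\to Et(\mathscr{F}_e)$ of the map induced by the presheaf morphism $\mathscr{F}_d(U)=f(d,U)\to f(e,m(\alpha)(U))$ and of $Et_{m(\alpha)}$. Put $\sum^m f=\mathrm{Ho}((\sum^m f)^\heartsuit)$. The flattening function $f^{M,\flat}$ is $\mathrm{Ho}$ of the functor $$\mathrm{colim}^{oplax}_{d\in D}\,\mathrm{colim}^{oplax}_{U\in\mathrm{Ouv}(m(d))^{op}}\mathscr{F}_d(U)\to\mathrm{colim}^{oplax}_{d\in D}\mathrm{Ouv}(Et(\mathscr{F}_d))^{op}$$ which over each $d$ is given by $(U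,s)\mapsto\epsilon_{\mathscr{F}_d}(U,s)$.
   Formalization: The squares of oplax colimits, only weak pullbacks in hCAT, replace pullbacks, with designated induced maps; Flatten Associativity, false as a literal equality, is stated up to the self-map of the target induced by an automorphism of the sum functor. *)

theory Defs
  imports "HOL-Analysis.Analysis"
begin

unbundle cardinal_syntax

section \<open>Categories, functors, natural isomorphisms\<close>

record ('o, 'a) cat =
  Ob :: "'o set"
  Ar :: "'a set"
  Dm :: "'a \<Rightarrow> 'o"
  Cd :: "'a \<Rightarrow> 'o"
  Idn :: "'o \<Rightarrow> 'a"
  Cmp :: "'a \<Rightarrow> 'a \<Rightarrow> 'a"  \<comment> \<open>\<open>Cmp C g f\<close> is \<open>g\<close> after \<open>f\<close>\<close>

definition hom :: "('o, 'a) cat \<Rightarrow> 'o \<Rightarrow> 'o \<Rightarrow> 'a set" where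
  "hom C x y = {f \<in> Ar C. Dm C f = x \<and> Cd C f = y}"

definition category :: "('o, 'a) cat \<Rightarrow> bool" where
  "category C \<longleftrightarrow>
     (\<forall>f\<in>Ar C. Dm C f \<in> Ob C \<and> Cd C f \<in> Ob C) \<and>
     (\<forall>x\<in>Ob C. Idn C x \<in> hom C x x) \<and>
     (\<forall>x y z. \<forall>f\<in>hom C x y. \<forall>g\<in>hom C y z. Cmp C g f \<in> hom C x z) \<and>
     (\<forall>x y. \<forall>f\<in>hom C x y. Cmp C f (Idn C x) = f \<and> Cmp C (Idn C y) f = f) \<and>
     (\<forall>w x y z. \<forall>f\<in>hom C w x. \<forall>g\<in>hom C x y. \<forall>h\<in>hom C y z.
        Cmp C h (Cmp C g f) = Cmp C (Cmp C h g) f)"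

definition terminal :: "('o, 'a) cat \<Rightarrow> 'o \<Rightarrow> bool" where
  "terminal C t \<longleftrightarrow> t \<in> Ob C \<and> (\<forall>x\<in>Ob C. \<exists>!f. f \<in> hom C x t)"

definition invertible :: "('o, 'a) cat \<Rightarrow> 'a \<Rightarrow> bool" where
  "invertible C f \<longleftrightarrow>
     (\<exists>g\<in>hom C (Cd C f) (Dm C f). Cmp C g f = Idn C (Dm C f) \<and> Cmp C f g = Idn C (Cd C f))"

type_synonym 'u scat = "('u, 'u) cat"

record 'u func =
  Src :: "'u scat"
  Tgt :: "'u scat"
  FO :: "'u \<Rightarrow> 'u"
  FA :: "'u \<Rightarrow> 'u"

definition is_functor :: "'u func \<Rightarrow> bool" where
  "is_functor F \<longleftrightarrow> category (Src F) \<and> category (Tgt F) \<and>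
     (\<forall>x\<in>Ob (Src F). FO F x \<in> Ob (Tgt F) \<and> FA F (Idn (Src F) x) = Idn (Tgt F) (FO F x)) \<and>
     (\<forall>x y. \<forall>f\<in>hom (Src F) x y. FA F f \<in> hom (Tgt F) (FO F x) (FO F y)) \<and>
     (\<forall>x y z. \<forall>f\<in>hom (Src F) x y. \<forall>g\<in>hom (Src F) y z.
        FA F (Cmp (Src F) g f) = Cmp (Tgt F) (FA F g) (FA F f))"

definition id_func :: "'u scat \<Rightarrow> 'u func" where
  "id_func I = \<lparr>Src = I, Tgt = I, FO = id, FA = id\<rparr>"

definition comp_func :: "'u func \<Rightarrow> 'u func \<Rightarrow> 'u func" where
  "comp_func G F = \<lparr>Src = Src F, Tgt = Tgt G, FO = FO G \<circ> FO F, FA = FA G \<circ> FA F\<rparr>"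

definition nat_iso :: "('u \<Rightarrow> 'u) \<Rightarrow> 'u func \<Rightarrow> 'u func \<Rightarrow> bool" where
  "nat_iso \<phi> F G \<longleftrightarrow> is_functor F \<and> is_functor G \<and> Src F = Src G \<and> Tgt F = Tgt G \<and>
     (\<forall>x\<in>Ob (Src F). \<phi> x \<in> hom (Tgt F) (FO F x) (FO G x) \<and> invertible (Tgt F) (\<phi> x)) \<and>
     (\<forall>x y. \<forall>f\<in>hom (Src F) x y. Cmp (Tgt F) (\<phi> y) (FA F f) = Cmp (Tgt F) (FA G f) (\<phi> x))"


section \<open>Dependent left modules\<close>

text \<open>
  The dependent sums and flattening functions refer, for an arrow \<open>p : F \<rightarrow> B\<close>, to the pullback
  \<open>\<lbrakk>m\<rbrakk>\<close> of \<open>m : U \<rightarrow> B\<close> and \<open>p\<close>, and to the maps \<open>h \<times> id : \<lbrakk>m \<circ> h\<rbrakk> \<rightarrow> \<lbrakk>m\<rbrakk>\<close> induced by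
  \<open>h : U' \<rightarrow> U\<close>.  Pullbacks in \<open>CAT\<close> of opfibrations are only weak pullbacks in \<open>hCAT\<close>: mediating
  arrows exist, but are not unique.  (For the two-element set \<open>m : 1 \<rightarrow> Set\<close> the category \<open>\<lbrakk>m\<rbrakk>\<close>
  is discrete with two objects, but its two points have the same projections in \<open>hCAT\<close>.)
  Hence the following notion records weak pullback squares together with the arrows \<open>Ind m h\<close>
  that count as \<open>h \<times> id\<close>.  If the squares are pullbacks, then \<open>Ind m h\<close> consists of
  the unique arrow \<open>h \<times> id\<close>; see \<open>pb_system_pullback\<close> below.
\<close>

record ('o, 'a) pb_system =
  Base :: "'o"
  Total :: "'o"
  Proj :: "'a"
  Pb :: "'a \<Rightarrow> 'o"
  Pr1 :: "'a \<Rightarrow> 'a"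
  Pr2 :: "'a \<Rightarrow> 'a"
  Ind :: "'a \<Rightarrow> 'a \<Rightarrow> 'a set"

definition pb_system :: "('o, 'a) cat \<Rightarrow> ('o, 'a) pb_system \<Rightarrow> bool" where
  "pb_system C P \<longleftrightarrow> category C \<and> Base P \<in> Ob C \<and> Proj P \<in> hom C (Total P) (Base P) \<and>
     (\<forall>U\<in>Ob C. \<forall>m\<in>hom C U (Base P).
        Pr1 P m \<in> hom C (Pb P m) U \<and> Pr2 P m \<in> hom C (Pb P m) (Total P) \<and>
        Cmp C m (Pr1 P m) = Cmp C (Proj P) (Pr2 P m) \<and>
        (\<forall>T\<in>Ob C. \<forall>a\<in>hom C T U. \<forall>b\<in>hom C T (Total P). Cmp C m a = Cmp C (Proj P) b \<longrightarrow>
           (\<exists>c\<in>hom C T (Pb P m). Cmp C (Pr1 P m) c = a \<and> Cmp C (Pr2 P m) c = b))) \<and>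
     (\<forall>U\<in>Ob C. \<forall>V\<in>Ob C. \<forall>m\<in>hom C U (Base P). \<forall>h\<in>hom C V U.
        Ind P m h \<noteq> {} \<and>
        (\<forall>k\<in>Ind P m h. k \<in> hom C (Pb P (Cmp C m h)) (Pb P m) \<and>
           Cmp C (Pr1 P m) k = Cmp C h (Pr1 P (Cmp C m h)) \<and>
           Cmp C (Pr2 P m) k = Pr2 P (Cmp C m h)))"

text \<open>
  Equality of two arrows \<open>a, b : T \<rightarrow> \<lbrakk>m\<rbrakk>\<close> over \<open>U\<close> and \<open>F\<close>: up to an arrow that counts as
  \<open>id \<times> id : \<lbrakk>m\<rbrakk> \<rightarrow> \<lbrakk>m\<rbrakk>\<close>.  It implies that \<open>a\<close> and \<open>b\<close> have the same projections, and is
  equality if \<open>\<lbrakk>m\<rbrakk>\<close> is a pullback.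
\<close>

definition pb_eq :: "('o, 'a) cat \<Rightarrow> ('o, 'a) pb_system \<Rightarrow> 'a \<Rightarrow> 'a \<Rightarrow> 'a \<Rightarrow> bool" where
  "pb_eq C P m a b \<longleftrightarrow> (\<exists>j\<in>Ind P m (Idn C (Dm C m)). Cmp C j a = b)"

lemma pb_system_pullback:
  assumes P: "pb_system C P" and U: "U \<in> Ob C" and m: "m \<in> hom C U (Base P)"
    and uniq: "\<And>T c c'. c \<in> hom C T (Pb P m) \<Longrightarrow> c' \<in> hom C T (Pb P m) \<Longrightarrow>
      Cmp C (Pr1 P m) c = Cmp C (Pr1 P m) c' \<Longrightarrow> Cmp C (Pr2 P m) c = Cmp C (Pr2 P m) c' \<Longrightarrow> c = c'"
  shows "V \<in> Ob C \<Longrightarrow> h \<in> hom C V U \<Longrightarrow>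
      Ind P m h = {k \<in> hom C (Pb P (Cmp C m h)) (Pb P m).
        Cmp C (Pr1 P m) k = Cmp C h (Pr1 P (Cmp C m h)) \<and> Cmp C (Pr2 P m) k = Pr2 P (Cmp C m h)}"
    and "V \<in> Ob C \<Longrightarrow> h \<in> hom C V U \<Longrightarrow> \<exists>!k. k \<in> Ind P m h"
    and "a \<in> hom C T (Pb P m) \<Longrightarrow> pb_eq C P m a b \<longleftrightarrow> a = b"
proof -
  have C: "category C" using P by (simp add: pb_system_def)
  have Pr: "Pr1 P m \<in> hom C (Pb P m) U"
    using P U m unfolding pb_system_def by blast
  have Pr2: "Pr2 P m \<in> hom C (Pb P m) (Total P)"
    using P U m unfolding pb_system_def by blast
  have dm: "Dm C m = U" using m by (simp add: hom_def)
  have "\<forall>f\<in>Ar C. Dm C f \<in> Ob C" using C unfolding category_def by blast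
  then have PbO: "Pb P m \<in> Ob C" using Pr by (auto simp: hom_def)
  have ne: "Ind P m h \<noteq> {}"
    and ind: "\<And>k. k \<in> Ind P m h \<Longrightarrow> k \<in> hom C (Pb P (Cmp C m h)) (Pb P m) \<and>
        Cmp C (Pr1 P m) k = Cmp C h (Pr1 P (Cmp C m h)) \<and> Cmp C (Pr2 P m) k = Pr2 P (Cmp C m h)"
    if "V \<in> Ob C" "h \<in> hom C V U" for V h
    using P U m that unfolding pb_system_def by blast+
  show 1: "Ind P m h = {k \<in> hom C (Pb P (Cmp C m h)) (Pb P m).
        Cmp C (Pr1 P m) k = Cmp C h (Pr1 P (Cmp C m h)) \<and> Cmp C (Pr2 P m) k = Pr2 P (Cmp C m h)}"
    (is "_ = ?S") if Vh: "V \<in> Ob C" "h \<in> hom C V U" for V h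
  proof
    show "Ind P m h \<subseteq> ?S" using ind[OF Vh] by blast
    show "?S \<subseteq> Ind P m h"
    proof
      fix k assume k: "k \<in> ?S"
      obtain k' where k': "k' \<in> Ind P m h" using ne[OF Vh] by blast
      have "k = k'" by (rule uniq) (use k ind[OF Vh k'] in auto)
      then show "k \<in> Ind P m h" using k' by simp
    qed
  qed
  show 2: "\<exists>!k. k \<in> Ind P m h" if Vh: "V \<in> Ob C" "h \<in> hom C V U" for V h
  proof -
    have "k = k'" if "k \<in> Ind P m h" "k' \<in> Ind P m h" for k k'
      by (rule uniq) (use ind[OF Vh that(1)] ind[OF Vh that(2)] in auto)
    then show ?thesis using ne[OF Vh] by blast
  qed
  have idU: "Idn C U \<in> hom C U U" and idP: "Idn C (Pb P m) \<in> hom C (Pb P m) (Pb P m)"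
    using C U PbO unfolding category_def by blast+
  have lr: "\<And>f x y. f \<in> hom C x y \<Longrightarrow> Cmp C f (Idn C x) = f \<and> Cmp C (Idn C y) f = f"
    using C unfolding category_def by blast
  have "Idn C (Pb P m) \<in> Ind P m (Idn C U)"
    unfolding 1[OF U idU] using idP lr[OF Pr] lr[OF Pr2] lr[OF m] by simp
  then have "Ind P m (Idn C U) = {Idn C (Pb P m)}" using 2[OF U idU] by blast
  then show "pb_eq C P m a b \<longleftrightarrow> a = b" if "a \<in> hom C T (Pb P m)"
    using lr[OF that] by (simp add: pb_eq_def dm)
qed

text \<open>
  For the adder only its data and their types are recorded: these are all the notion of a
  left module refers to.
\<close>

record ('o, 'a) adder =
  Apb :: "('o, 'a) pb_system"
  Aterm :: "'o"
  Aone :: "'a"  \<comment> \<open>the unit \<open>1\<^sub>F : 1 \<rightarrow> F\<close>\<close>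
  Asum :: "'a \<Rightarrow> 'a \<Rightarrow> 'a"
  Aflat :: "'a \<Rightarrow> 'a \<Rightarrow> 'a"

definition adder_data :: "('o, 'a) cat \<Rightarrow> ('o, 'a) adder \<Rightarrow> bool" where
  "adder_data C A \<longleftrightarrow> pb_system C (Apb A) \<and> terminal C (Aterm A) \<and>
     Aone A \<in> hom C (Aterm A) (Total (Apb A)) \<and>
     (\<forall>U\<in>Ob C. \<forall>x\<in>hom C U (Base (Apb A)). \<forall>f\<in>hom C (Pb (Apb A) x) (Base (Apb A)).
        Asum A x f \<in> hom C U (Base (Apb A)) \<and>
        Aflat A x f \<in> hom C (Pb (Apb A) f) (Pb (Apb A) (Asum A x f)) \<and>
        Cmp C (Pr1 (Apb A) (Asum A x f)) (Aflat A x f) = Cmp C (Pr1 (Apb A) x) (Pr1 (Apb A) f))"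

definition const_one :: "('o, 'a) cat \<Rightarrow> ('o, 'a) adder \<Rightarrow> 'o \<Rightarrow> 'a" where
  "const_one C A X =
     Cmp C (Cmp C (Proj (Apb A)) (Aone A)) (THE t. t \<in> hom C X (Aterm A))"

record ('o, 'a) lmod =
  Mpb :: "('o, 'a) pb_system"
  Msum :: "'a \<Rightarrow> 'a \<Rightarrow> 'a"
  Mflat :: "'a \<Rightarrow> 'a \<Rightarrow> 'a"

definition boxtimes ::
    "('o, 'a) cat \<Rightarrow> ('o, 'a) adder \<Rightarrow> ('o, 'a) lmod \<Rightarrow> 'a \<Rightarrow> 'a \<Rightarrow> 'a \<Rightarrow> 'a" where
  "boxtimes C A M m f g = Asum A f (Cmp C g (Mflat M m f))"

definition dep_left_module ::
    "('o, 'a) cat \<Rightarrow> ('o, 'a) adder \<Rightarrow> ('o, 'a) lmod \<Rightarrow> bool" where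
  "dep_left_module C A M \<longleftrightarrow>
     adder_data C A \<and> pb_system C (Mpb M) \<and>
     (let S = Base (Apb A); B = Base (Mpb M) in
       \<forall>U\<in>Ob C. \<forall>m\<in>hom C U B.
         Msum M m (const_one C A (Pb (Mpb M) m)) = m \<and>
         (\<forall>f\<in>hom C (Pb (Mpb M) m) S.
           Msum M m f \<in> hom C U B \<and>
           (\<forall>V\<in>Ob C. \<forall>h\<in>hom C V U. \<forall>k\<in>Ind (Mpb M) m h.
              Msum M (Cmp C m h) (Cmp C f k) = Cmp C (Msum M m f) h) \<and>
           Mflat M m f \<in> hom C (Pb (Apb A) f) (Pb (Mpb M) (Msum M m f)) \<and>
           Cmp C (Pr1 (Mpb M) (Msum M m f)) (Mflat M m f) =
             Cmp C (Pr1 (Mpb M) m) (Pr1 (Apb A) f) \<and>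
           (\<forall>g\<in>hom C (Pb (Mpb M) (Msum M m f)) S.
              Msum M (Msum M m f) g = Msum M m (boxtimes C A M m f g) \<and>
              \<comment> \<open>\<open>k\<close> is the arrow \<open>f\<^sup>\<flat> \<times> id\<close> from \<open>\<lbrakk>g \<circ> f\<^sup>\<flat>\<rbrakk>\<close> to \<open>\<lbrakk>g\<rbrakk>\<close>\<close>
              (\<forall>k\<in>Ind (Apb A) g (Mflat M m f).
                 pb_eq C (Mpb M) (Msum M m (boxtimes C A M m f g))
                   (Cmp C (Mflat M (Msum M m f) g) k)
                   (Cmp C (Mflat M m (boxtimes C A M m f g))
                          (Aflat A f (Cmp C g (Mflat M m f))))))))"


section \<open>Very small and moderately small\<close>

definition strongly_inaccessible :: "'a rel \<Rightarrow> bool" where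
  "strongly_inaccessible r \<longleftrightarrow> Card_order r \<and> natLeq <o r \<and> regularCard r \<and>
     (\<forall>A :: 'a set. |A| <o r \<longrightarrow> |Pow A| <o r)"

definition grothendieck_universe :: "('u \<Rightarrow> 'u set) \<Rightarrow> 'u set \<Rightarrow> bool" where
  "grothendieck_universe el V \<longleftrightarrow>
     strongly_inaccessible |V| \<and> el ` V = {X. X \<subseteq> V \<and> |X| <o |V|}"

text \<open>
  The type plays the role of \<open>V\<^sub>\<kappa>\<close> for the larger cardinal \<open>\<kappa>\<^sub>1\<close>, and \<open>VS\<close> (the very small sets)
  that of \<open>V\<^sub>\<kappa>\<close> for the smaller one \<open>\<kappa>\<^sub>0\<close>: the elements of either universe are
  exactly its subsets of smaller cardinality.
\<close>

class two_universes =
  fixes elts :: "'a \<Rightarrow> 'a set" and VS :: "'a set"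
  assumes inj_elts: "inj elts"
    and universe_UNIV: "grothendieck_universe elts UNIV"
    and universe_VS: "grothendieck_universe elts VS"
    and VS_less_UNIV: "|VS| <o |UNIV :: 'a set|"

definition vset :: "'u::two_universes set \<Rightarrow> 'u" where
  "vset X = inv elts X"

definition vpair :: "'u::two_universes \<Rightarrow> 'u \<Rightarrow> 'u" where
  "vpair a b = vset {vset {a}, vset {a, b}}"

definition vfst :: "'u::two_universes \<Rightarrow> 'u" where
  "vfst p = (THE a. \<exists>b. p = vpair a b)"

definition vsnd :: "'u::two_universes \<Rightarrow> 'u" where
  "vsnd p = (THE b. \<exists>a. p = vpair a b)"

text \<open>Functions \<open>h\<close> with domain \<open>X\<close>, coded together with source and target objects \<open>a\<close>, \<open>b\<close>.\<close>

definition varr :: "'u::two_universes \<Rightarrow> 'u \<Rightarrow> 'u set \<Rightarrow> ('u \<Rightarrow> 'u) \<Rightarrow> 'u" where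
  "varr a b X h = vpair a (vpair b (vset ((\<lambda>x. vpair x (h x)) ` X)))"

definition vsrc :: "'u::two_universes \<Rightarrow> 'u" where
  "vsrc f = vfst f"

definition vtgt :: "'u::two_universes \<Rightarrow> 'u" where
  "vtgt f = vfst (vsnd f)"

definition vapp :: "'u::two_universes \<Rightarrow> 'u \<Rightarrow> 'u" where
  "vapp f x = (THE y. vpair x y \<in> elts (vsnd (vsnd f)))"


section \<open>The category hCAT\<close>

definition moderately_small :: "'u::two_universes scat \<Rightarrow> bool" where
  "moderately_small I \<longleftrightarrow> |Ob I| <o |UNIV :: 'u set| \<and> |Ar I| <o |UNIV :: 'u set|"

text \<open>The chosen representatives of the isomorphism classes of functors, and chosen isomorphisms.\<close>

definition Ho :: "'u func \<Rightarrow> 'u func" where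
  "Ho G = (SOME G'. \<exists>\<phi>. nat_iso \<phi> G G')"

definition Ho_iso :: "'u func \<Rightarrow> 'u \<Rightarrow> 'u" where
  "Ho_iso G = (SOME \<phi>. nat_iso \<phi> G (Ho G))"

definition hCAT :: "('u::two_universes scat, 'u func) cat" where
  "hCAT = \<lparr>Ob = {I. category I \<and> moderately_small I},
     Ar = {Ho G | G. is_functor G \<and> moderately_small (Src G) \<and> moderately_small (Tgt G)},
     Dm = Src, Cd = Tgt,
     Idn = (\<lambda>I. Ho (id_func I)),
     Cmp = (\<lambda>G F. Ho (comp_func G F))\<rparr>"


section \<open>Oplax colimits\<close>

text \<open>\<open>CAT\<close>-valued functors on a category; arrows of an oplax colimit from \<open>(i, j)\<close> are coded
  as \<open>(j, \<alpha>, \<beta>)\<close>, since \<open>(\<alpha>, \<beta>)\<close> does not determine \<open>j\<close>.\<close>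

record 'u fam =
  FamO :: "'u \<Rightarrow> 'u scat"
  FamA :: "'u \<Rightarrow> 'u func"

definition pre :: "'u fam \<Rightarrow> 'u func \<Rightarrow> 'u fam" where
  "pre K m = \<lparr>FamO = FamO K \<circ> FO m, FamA = FamA K \<circ> FA m\<rparr>"

definition oarr :: "'u::two_universes \<Rightarrow> 'u \<Rightarrow> 'u \<Rightarrow> 'u" where
  "oarr j \<alpha> \<beta> = vpair j (vpair \<alpha> \<beta>)"

definition osrc :: "'u::two_universes \<Rightarrow> 'u" where
  "osrc z = vfst z"

definition obase :: "'u::two_universes \<Rightarrow> 'u" where
  "obase z = vfst (vsnd z)"

definition ofib :: "'u::two_universes \<Rightarrow> 'u" where
  "ofib z = vsnd (vsnd z)"

definition oplax :: "'u::two_universes scat \<Rightarrow> 'u fam \<Rightarrow> 'u scat" where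
  "oplax I K = \<lparr>Ob = {vpair i j | i j. i \<in> Ob I \<and> j \<in> Ob (FamO K i)},
     Ar = {oarr j \<alpha> \<beta> | j \<alpha> \<beta>. \<alpha> \<in> Ar I \<and> j \<in> Ob (FamO K (Dm I \<alpha>)) \<and>
       \<beta> \<in> Ar (FamO K (Cd I \<alpha>)) \<and> Dm (FamO K (Cd I \<alpha>)) \<beta> = FO (FamA K \<alpha>) j},
     Dm = (\<lambda>z. vpair (Dm I (obase z)) (osrc z)),
     Cd = (\<lambda>z. vpair (Cd I (obase z)) (Cd (FamO K (Cd I (obase z))) (ofib z))),
     Idn = (\<lambda>x. oarr (vsnd x) (Idn I (vfst x)) (Idn (FamO K (vfst x)) (vsnd x))),
     Cmp = (\<lambda>w z. oarr (osrc z) (Cmp I (obase w) (obase z))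
       (Cmp (FamO K (Cd I (obase w))) (ofib w) (FA (FamA K (obase w)) (ofib z))))\<rparr>"

definition oplax_proj :: "'u::two_universes scat \<Rightarrow> 'u fam \<Rightarrow> 'u func" where
  "oplax_proj I K = \<lparr>Src = oplax I K, Tgt = I, FO = vfst, FA = obase\<rparr>"

text \<open>For functors \<open>h : J \<rightarrow> I\<close>, \<open>m : I \<rightarrow> B\<close>, \<open>n : J \<rightarrow> B\<close> and \<open>\<phi> : n \<Rightarrow> m \<circ> h\<close>, the induced functor
  between the oplax colimits of \<open>K \<circ> n\<close> and \<open>K \<circ> m\<close>.\<close>

definition oplax_map ::
    "'u::two_universes fam \<Rightarrow> 'u func \<Rightarrow> 'u func \<Rightarrow> 'u func \<Rightarrow> ('u \<Rightarrow> 'u) \<Rightarrow> 'u func" where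
  "oplax_map K n m h \<phi> = \<lparr>Src = oplax (Src n) (pre K n), Tgt = oplax (Src m) (pre K m),
     FO = (\<lambda>x. vpair (FO h (vfst x)) (FO (FamA K (\<phi> (vfst x))) (vsnd x))),
     FA = (\<lambda>z. oarr (FO (FamA K (\<phi> (Dm (Src n) (obase z)))) (osrc z)) (FA h (obase z))
       (FA (FamA K (\<phi> (Cd (Src n) (obase z)))) (ofib z)))\<rparr>"

text \<open>The square of \<open>m : I \<rightarrow> B\<close> and the opfibration over \<open>B\<close> classified by \<open>K\<close>.\<close>

definition oplax_pb :: "'u::two_universes scat \<Rightarrow> 'u fam \<Rightarrow> ('u scat, 'u func) pb_system" where
  "oplax_pb B K = \<lparr>Base = B, Total = oplax B K, Proj = Ho (oplax_proj B K),
     Pb = (\<lambda>m. oplax (Src m) (pre K m)),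
     Pr1 = (\<lambda>m. Ho (oplax_proj (Src m) (pre K m))),
     Pr2 = (\<lambda>m. Ho \<lparr>Src = oplax (Src m) (pre K m), Tgt = oplax B K,
       FO = (\<lambda>x. vpair (FO m (vfst x)) (vsnd x)),
       FA = (\<lambda>z. oarr (osrc z) (FA m (obase z)) (ofib z))\<rparr>),
     Ind = (\<lambda>m h. {Ho (oplax_map K (Cmp hCAT m h) m h \<phi>) | \<phi>.
       nat_iso \<phi> (Cmp hCAT m h) (comp_func m h)})\<rparr>"


section \<open>The dependent adder of very small sets\<close>

definition set_arr :: "'u::two_universes \<Rightarrow> 'u \<Rightarrow> ('u \<Rightarrow> 'u) \<Rightarrow> 'u" where
  "set_arr X Y h = varr X Y (elts X) h"

definition SetC :: "'u::two_universes scat" where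
  "SetC = \<lparr>Ob = VS, Ar = {set_arr X Y h | X Y h. X \<in> VS \<and> Y \<in> VS \<and> h ` elts X \<subseteq> elts Y},
     Dm = vsrc, Cd = vtgt, Idn = (\<lambda>X. set_arr X X id),
     Cmp = (\<lambda>g f. set_arr (vsrc f) (vtgt g) (vapp g \<circ> vapp f))\<rparr>"

definition disc :: "'u::two_universes \<Rightarrow> 'u scat" where
  "disc X = \<lparr>Ob = elts X, Ar = elts X, Dm = id, Cd = id, Idn = id, Cmp = (\<lambda>g f. f)\<rparr>"

definition disc_fam :: "'u::two_universes fam" where
  "disc_fam = \<lparr>FamO = disc,
     FamA = (\<lambda>f. \<lparr>Src = disc (vsrc f), Tgt = disc (vtgt f), FO = vapp f, FA = vapp f\<rparr>)\<rparr>"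

definition set_sum_fun :: "'u::two_universes func \<Rightarrow> 'u func \<Rightarrow> 'u func" where
  "set_sum_fun x f = \<lparr>Src = Src x, Tgt = SetC,
     FO = (\<lambda>u. vset {vpair t s | t s. t \<in> elts (FO x u) \<and> s \<in> elts (FO f (vpair u t))}),
     FA = (\<lambda>\<alpha>. let u = Dm (Src x) \<alpha>; v = Cd (Src x) \<alpha>; xa = vapp (FA x \<alpha>) in
       set_arr
         (vset {vpair t s | t s. t \<in> elts (FO x u) \<and> s \<in> elts (FO f (vpair u t))})
         (vset {vpair t s | t s. t \<in> elts (FO x v) \<and> s \<in> elts (FO f (vpair v t))})
         (\<lambda>w. vpair (xa (vfst w)) (vapp (FA f (oarr (vfst w) \<alpha> (xa (vfst w)))) (vsnd w))))\<rparr>"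

text \<open>\<open>((u, t), s) \<mapsto> (u, (t, s))\<close>\<close>

definition set_flat_fun :: "'u::two_universes func \<Rightarrow> 'u func \<Rightarrow> 'u func" where
  "set_flat_fun x f =
     (let E = oplax (Src f) (pre disc_fam f);
          q = (\<lambda>w. vpair (vsnd (vfst w)) (vsnd w))
      in \<lparr>Src = E, Tgt = oplax (Src x) (pre disc_fam (set_sum_fun x f)),
          FO = (\<lambda>w. vpair (vfst (vfst w)) (q w)),
          FA = (\<lambda>z. oarr (q (Dm E z)) (obase (obase z)) (q (Cd E z)))\<rparr>)"

definition unit_cat :: "'u::two_universes scat" where
  "unit_cat = \<lparr>Ob = {vset {}}, Ar = {vset {}}, Dm = id, Cd = id, Idn = id, Cmp = (\<lambda>g f. f)\<rparr>"

text \<open>In both flattening functions, \<open>oplax_map\<close> with \<open>Ho_iso\<close> is the identification of \<open>\<lbrakk>S\<rbrakk>\<close> with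
  \<open>\<lbrakk>Ho S\<rbrakk>\<close> for the functor \<open>S\<close> of which the dependent sum is the representative.\<close>

definition Set_adder :: "('u::two_universes scat, 'u func) adder" where
  "Set_adder = \<lparr>Apb = oplax_pb SetC disc_fam,
     Aterm = unit_cat,
     Aone = Ho \<lparr>Src = unit_cat, Tgt = oplax SetC disc_fam,
       FO = (\<lambda>_. vpair (vset {vset {}}) (vset {})),
       FA = (\<lambda>_. Idn (oplax SetC disc_fam) (vpair (vset {vset {}}) (vset {})))\<rparr>,
     Asum = (\<lambda>x f. Ho (set_sum_fun x f)),
     Aflat = (\<lambda>x f. let S = set_sum_fun x f in
       Ho (comp_func (oplax_map disc_fam S (Ho S) (id_func (Src x)) (Ho_iso S))
                     (set_flat_fun x f)))\<rparr>"


section \<open>Etale spaces of presheaves\<close>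

record 'u presheaf =
  Spc :: "'u topology"
  Sec :: "'u set \<Rightarrow> 'u set"
  Res :: "'u set \<Rightarrow> 'u set \<Rightarrow> 'u \<Rightarrow> 'u"  \<comment> \<open>\<open>Res F U V\<close> restricts from \<open>U\<close> to \<open>V \<subseteq> U\<close>\<close>

text \<open>The stalk at \<open>x\<close> consists of the germs of sections; a germ is the class of all
  its representatives.\<close>

definition germ :: "'u::two_universes presheaf \<Rightarrow> 'u \<Rightarrow> 'u set \<Rightarrow> 'u \<Rightarrow> 'u" where
  "germ F x U s = vset {vpair (vset V) t | V t. openin (Spc F) V \<and> x \<in> V \<and> t \<in> Sec F V \<and>
     (\<exists>W. openin (Spc F) W \<and> x \<in> W \<and> W \<subseteq> U \<inter> V \<and> Res F U W s = Res F V W t)}"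

definition eps :: "'u::two_universes presheaf \<Rightarrow> 'u set \<Rightarrow> 'u \<Rightarrow> 'u set" where
  "eps F U s = (\<lambda>x. vpair x (germ F x U s)) ` U"

definition Et :: "'u::two_universes presheaf \<Rightarrow> 'u topology" where
  "Et F = topology_generated_by {eps F U s | U s. openin (Spc F) U \<and> s \<in> Sec F U}"

text \<open>The map \<open>(x, s\<^sub>x) \<mapsto> (x, (\<tau> s)\<^sub>x)\<close> induced by a morphism \<open>\<tau>\<close> of presheaves on the same space.\<close>

definition Et_mor ::
    "'u::two_universes presheaf \<Rightarrow> 'u presheaf \<Rightarrow> ('u set \<Rightarrow> 'u \<Rightarrow> 'u) \<Rightarrow> 'u \<Rightarrow> 'u" where
  "Et_mor F G \<tau> p = (let x = vfst p in vpair x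
     (THE \<gamma>. \<exists>U s. openin (Spc F) U \<and> x \<in> U \<and> s \<in> Sec F U \<and> vsnd p = germ F x U s \<and>
        \<gamma> = germ G x U (\<tau> U s)))"

definition pull :: "'u topology \<Rightarrow> ('u \<Rightarrow> 'u) \<Rightarrow> 'u presheaf \<Rightarrow> 'u presheaf" where
  "pull X \<phi> G = \<lparr>Spc = X, Sec = (\<lambda>U. Sec G (\<phi> ` U)), Res = (\<lambda>U V. Res G (\<phi> ` U) (\<phi> ` V))\<rparr>"

definition Et_pull ::
    "'u::two_universes topology \<Rightarrow> ('u \<Rightarrow> 'u) \<Rightarrow> 'u presheaf \<Rightarrow> 'u \<Rightarrow> 'u" where
  "Et_pull X \<phi> G p = (let x = vfst p in vpair (\<phi> x)
     (THE \<gamma>. \<exists>U s. openin X U \<and> x \<in> U \<and> s \<in> Sec G (\<phi> ` U) \<and>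
        vsnd p = germ (pull X \<phi> G) x U s \<and> \<gamma> = germ G (\<phi> x) (\<phi> ` U) s))"


section \<open>The left module of very small spaces and open maps\<close>

definition top_code :: "'u::two_universes topology \<Rightarrow> 'u" where
  "top_code T = vset (vset ` {U. openin T U})"

definition top_of :: "'u::two_universes \<Rightarrow> 'u topology" where
  "top_of c = topology (\<lambda>U. U \<in> elts ` elts c)"

definition top_arr :: "'u::two_universes topology \<Rightarrow> 'u topology \<Rightarrow> ('u \<Rightarrow> 'u) \<Rightarrow> 'u" where
  "top_arr S T h = varr (top_code S) (top_code T) (topspace S) h"

definition TopC :: "'u::two_universes scat" where
  "TopC = \<lparr>Ob = {top_code T | T. topspace T \<in> elts ` VS},
     Ar = {top_arr S T h | S T h. topspace S \<in> elts ` VS \<and> topspace T \<in> elts ` VS \<and>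
       continuous_map S T h \<and> open_map S T h},
     Dm = vsrc, Cd = vtgt,
     Idn = (\<lambda>c. top_arr (top_of c) (top_of c) id),
     Cmp = (\<lambda>g f. top_arr (top_of (vsrc f)) (top_of (vtgt g)) (vapp g \<circ> vapp f))\<rparr>"

definition ouv_op :: "'u::two_universes \<Rightarrow> 'u scat" where
  "ouv_op c = \<lparr>Ob = {vset U | U. openin (top_of c) U},
     Ar = {vpair (vset U) (vset V) | U V.
       openin (top_of c) U \<and> openin (top_of c) V \<and> V \<subseteq> U},
     Dm = vfst, Cd = vsnd, Idn = (\<lambda>U. vpair U U), Cmp = (\<lambda>g f. vpair (vfst f) (vsnd g))\<rparr>"

definition vimg :: "'u::two_universes \<Rightarrow> 'u \<Rightarrow> 'u" where
  "vimg f U = vset (vapp f ` elts U)"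

definition ouv_fam :: "'u::two_universes fam" where
  "ouv_fam = \<lparr>FamO = ouv_op,
     FamA = (\<lambda>f. \<lparr>Src = ouv_op (vsrc f), Tgt = ouv_op (vtgt f), FO = vimg f,
       FA = (\<lambda>b. vpair (vimg f (vfst b)) (vimg f (vsnd b)))\<rparr>)\<rparr>"

text \<open>The presheaf \<open>f(d, -)\<close> on \<open>m(d)\<close>.\<close>

definition psh_at :: "'u::two_universes func \<Rightarrow> 'u func \<Rightarrow> 'u \<Rightarrow> 'u presheaf" where
  "psh_at m f d = \<lparr>Spc = top_of (FO m d),
     Sec = (\<lambda>U. elts (FO f (vpair d (vset U)))),
     Res = (\<lambda>U V. vapp (FA f (oarr (vset U) (Idn (Src m) d) (vpair (vset U) (vset V)))))\<rparr>"

definition top_sum_fun :: "'u::two_universes func \<Rightarrow> 'u func \<Rightarrow> 'u func" where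
  "top_sum_fun m f = \<lparr>Src = Src m, Tgt = TopC,
     FO = (\<lambda>d. top_code (Et (psh_at m f d))),
     FA = (\<lambda>\<alpha>. let F = psh_at m f (Dm (Src m) \<alpha>); G = psh_at m f (Cd (Src m) \<alpha>);
                   \<phi> = vapp (FA m \<alpha>);
                   \<tau> = (\<lambda>U. vapp (FA f (oarr (vset U) \<alpha> (vpair (vset (\<phi> ` U)) (vset (\<phi> ` U))))))
       in top_arr (Et F) (Et G)
            (Et_pull (Spc F) \<phi> G \<circ> Et_mor F (pull (Spc F) \<phi> G) \<tau>))\<rparr>"

text \<open>\<open>((d, U), s) \<mapsto> (d, \<epsilon>(U, s))\<close>\<close>

definition top_flat_fun :: "'u::two_universes func \<Rightarrow> 'u func \<Rightarrow> 'u func" where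
  "top_flat_fun m f =
     (let S = top_sum_fun m f; E = oplax (Src f) (pre disc_fam f);
          e = (\<lambda>w. vset (eps (psh_at m f (vfst (vfst w))) (elts (vsnd (vfst w))) (vsnd w)))
      in \<lparr>Src = E, Tgt = oplax (Src m) (pre ouv_fam S),
          FO = (\<lambda>w. vpair (vfst (vfst w)) (e w)),
          FA = (\<lambda>z. let \<alpha> = obase (obase z) in
            oarr (e (Dm E z)) \<alpha> (vpair (vimg (FA S \<alpha>) (e (Dm E z))) (e (Cd E z))))\<rparr>)"

definition Top_module :: "('u::two_universes scat, 'u func) lmod" where
  "Top_module = \<lparr>Mpb = oplax_pb TopC ouv_fam,
     Msum = (\<lambda>m f. Ho (top_sum_fun m f)),
     Mflat = (\<lambda>m f. let S = top_sum_fun m f in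
       Ho (comp_func (oplax_map ouv_fam S (Ho S) (id_func (Src m)) (Ho_iso S))
                     (top_flat_fun m f)))\<rparr>"

end

theory Submission
  imports Defs
begin

text \<open>
  An arrow of \<open>hCAT\<close> is an isomorphism class of functors, so every equation that a left module has to
  satisfy asks for a natural isomorphism between two functors (\<open>Ho_eqI\<close>), and a composite in \<open>hCAT\<close>
  may be computed with any representatives (\<open>Ho_comp\<close>).  The proof replaces all chosen
  representatives by the explicit functors that they represent, and compares those.

  The bookkeeping of the replacements is done with morphisms over a base category.  For functors \<open>n\<close>
  and \<open>m\<close> to the base, such a morphism is a functor \<open>h\<close> between their sources together with a natural
  isomorphism \<open>\<phi>\<close> from \<open>n\<close> to \<open>m \<circ> h\<close> (\<open>over\<close>).  It induces a functor between the oplax colimits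
  of a family of categories pulled back along \<open>n\<close> and \<open>m\<close>.  This construction is compatible with
  composition (\<open>oplax_map_comp\<close>), and depends on \<open>(h, \<phi>)\<close> only up to isomorphism
  (\<open>oplax_map_iso\<close>).  These two facts show that the squares of oplax colimits are weak pullbacks in
  \<open>hCAT\<close> (\<open>pb_system_oplax\<close>), and they also carry the last part of the proof.

  The geometric content lies in three statements on etale spaces.
  A presheaf of singletons has its base space as etale space (\<open>top_sum_unit\<close>): this is the unit law.
  The etale space is functorial for morphisms of presheaves over open maps, and so is the map
  \<open>(U, s) \<mapsto> eps(U, s)\<close> (\<open>top_sum_over\<close>, \<open>top_flat_over\<close>): this gives naturality of the sums.
  Finally let \<open>G\<close> be a presheaf on the etale space of \<open>F\<close>, and let \<open>Q(U)\<close> be the set of pairs of a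
  section \<open>s\<close> of \<open>F\<close> over \<open>U\<close> and a section \<open>t\<close> of \<open>G\<close> over \<open>eps(U, s)\<close>.  Because the sets \<open>eps(U, s)\<close>
  form a basis of the etale space of \<open>F\<close>, the germs of \<open>Q\<close> are the germs of \<open>G\<close>; the etale spaces of
  \<open>Q\<close> and \<open>G\<close> are homeomorphic, and \<open>eps(U, (s, t))\<close> corresponds to \<open>eps(eps(U, s), t)\<close>
  (\<open>bij_Et_sum\<close>, \<open>Et_sum_eps\<close>).  In families, the homeomorphism gives the associativity of sums
  (\<open>nat_iso_assoc\<close>) and the formula for the images of the basic open sets gives the associativity of
  flattening (\<open>top_flat_assoc\<close>).

  Both sides of the last law thereby become the same functor followed by two identifications of the
  same sum functor with its representative \<open>n\<close>.  The two identifications differ by an automorphism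
  of \<open>n\<close>, and such an automorphism induces one of the arrows that count as the identity of the weak
  pullback of \<open>n\<close> (\<open>pb_eq_oplax\<close>).
\<close>

section \<open>Coding in the universes\<close>

definition small :: "'u::two_universes set \<Rightarrow> bool" where
  "small X \<longleftrightarrow> |X| <o |UNIV :: 'u set|"

definition vsmall :: "'u::two_universes set \<Rightarrow> bool" where
  "vsmall X \<longleftrightarrow> X \<in> elts ` VS"

text \<open>This is regularity of the cardinal, stated for a set \<open>V\<close> so that it serves both universes.\<close>

lemma cardinal_UNION:
  assumes "strongly_inaccessible |V :: 'a set|" "|I| <o |V|" "\<And>i. i \<in> I \<Longrightarrow> |A i| <o |V|"
  shows "|\<Union>i\<in>I. A i| <o |V|"
proof -
  have r: "Card_order |V|" "natLeq <o |V|" "regularCard |V|"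
    using assms(1) by (auto simp: strongly_inaccessible_def)
  then have "infinite V"
    using infinite_iff_natLeq_ordLeq ordLess_imp_ordLeq by blast
  then have "Cinfinite |V|" using r(1) by (simp add: cinfinite_def Field_card_of)
  then show ?thesis
    using card_of_UNION_ordLess_infinite_Field_regularCard[OF r(3)] assms by blast
qed

lemma small_elts: "small (elts (x::'u::two_universes))"
proof -
  have "elts x \<in> {X. X \<subseteq> UNIV \<and> |X| <o |UNIV::'u set|}"
    using universe_UNIV[where ?'a='u] by (auto simp: grothendieck_universe_def)
  then show ?thesis by (simp add: small_def)
qed

lemma vset_elts [simp]: "vset (elts x) = (x::'u::two_universes)"
  by (simp add: vset_def inj_elts)

lemma elts_vset: "small (X::'u::two_universes set) \<Longrightarrow> elts (vset X) = X"
proof -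
  assume "small X"
  then have "X \<in> range elts"
    using universe_UNIV[where ?'a='u] by (auto simp: grothendieck_universe_def small_def)
  then show "elts (vset X) = X" by (simp add: vset_def f_inv_into_f)
qed

lemma small_subset: "small X \<Longrightarrow> Y \<subseteq> X \<Longrightarrow> small Y"
  unfolding small_def using card_of_mono1 ordLeq_ordLess_trans by blast

lemma card_image_less: "|X| <o r \<Longrightarrow> |f ` X| <o r"
  using card_of_image ordLeq_ordLess_trans by blast

lemma small_UNION:
  fixes I :: "'a set" and A :: "'a \<Rightarrow> 'u::two_universes set"
  shows "|I| <o |UNIV :: 'u set| \<Longrightarrow> (\<And>i. i \<in> I \<Longrightarrow> small (A i)) \<Longrightarrow> small (\<Union>i\<in>I. A i)"
  unfolding small_def
  using universe_UNIV[where ?'a='u] cardinal_UNION by (auto simp: grothendieck_universe_def)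

lemma small_finite [simp]: "finite (X::'u::two_universes set) \<Longrightarrow> small X"
proof -
  assume "finite X"
  have "natLeq <o |UNIV::'u set|"
    using universe_UNIV[where ?'a='u] 
    by (auto simp: grothendieck_universe_def strongly_inaccessible_def)
  moreover have "|X| <o natLeq" using \<open>finite X\<close> finite_iff_ordLess_natLeq by blast
  ultimately show "small X" unfolding small_def using ordLess_transitive by blast
qed

lemma elts_vset_finite [simp]: "finite X \<Longrightarrow> elts (vset X) = X"
  by (rule elts_vset) simp

lemma vset_inj: "small X \<Longrightarrow> small Y \<Longrightarrow> vset X = vset Y \<Longrightarrow> X = Y"
  by (metis elts_vset)

lemma vpair_eq [simp]: "vpair a b = vpair c d \<longleftrightarrow> a = c \<and> b = d"
proof
  assume "vpair a b = vpair c d"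
  then have "{vset {a}, vset {a, b}} = {vset {c}, vset {c, d}}"
    unfolding vpair_def by (metis elts_vset_finite finite.emptyI finite.insertI)
  moreover have "vset {a} = vset {c} \<longleftrightarrow> {a} = {c}" "vset {a} = vset {c,d} \<longleftrightarrow> {a} = {c,d}"
    "vset {a,b} = vset {c} \<longleftrightarrow> {a,b} = {c}" "vset {a,b} = vset {c,d} \<longleftrightarrow> {a,b} = {c,d}"
    by (metis elts_vset_finite finite.emptyI finite.insertI)+
  ultimately show "a = c \<and> b = d" by (metis doubleton_eq_iff insert_absorb2)
qed simp

lemma vfst_vpair [simp]: "vfst (vpair a b) = a"
  by (simp add: vfst_def)

lemma vsnd_vpair [simp]: "vsnd (vpair a b) = b"
  by (simp add: vsnd_def)

lemma osrc_oarr [simp]: "osrc (oarr j a b) = j"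
  and obase_oarr [simp]: "obase (oarr j a b) = a"
  and ofib_oarr [simp]: "ofib (oarr j a b) = b"
  by (simp_all add: oarr_def osrc_def obase_def ofib_def)

lemma oarr_eq [simp]: "oarr j a b = oarr j' a' b' \<longleftrightarrow> j = j' \<and> a = a' \<and> b = b'"
  by (simp add: oarr_def)

lemma vsrc_varr [simp]: "vsrc (varr a b X h) = a"
  and vtgt_varr [simp]: "vtgt (varr a b X h) = b"
  by (simp_all add: varr_def vsrc_def vtgt_def)

lemma small_image: fixes f :: "'u::two_universes \<Rightarrow> 'u" shows "small X \<Longrightarrow> small (f ` X)"
  unfolding small_def by (rule card_image_less)

lemma vapp_varr: "small X \<Longrightarrow> x \<in> X \<Longrightarrow> vapp (varr a b X h) x = h x"
  unfolding vapp_def varr_def by (rule the_equality) (auto simp: elts_vset small_image)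

lemma varr_cong: "(\<And>x. x \<in> X \<Longrightarrow> h x = h' x) \<Longrightarrow> varr a b X h = varr a b X h'"
  unfolding varr_def by (metis (mono_tags, lifting) image_cong)

lemma vsmall_iff: "vsmall (X::'u::two_universes set) \<longleftrightarrow> X \<subseteq> VS \<and> |X| <o |VS::'u set|"
  using universe_VS[where ?'a='u] by (auto simp: grothendieck_universe_def vsmall_def)

lemma vsmall_small: "vsmall X \<Longrightarrow> small X"
  by (auto simp: vsmall_def small_elts)

lemma vset_VS: assumes "small X" shows "vset X \<in> VS \<longleftrightarrow> vsmall X"
proof
  show "vsmall X" if "vset X \<in> VS"
    using imageI[OF that, of elts] elts_vset[OF assms] by (simp add: vsmall_def)
  show "vset X \<in> VS" if "vsmall X"
    using that by (auto simp: vsmall_def)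
qed

lemma vset_VS_I: "vsmall X \<Longrightarrow> vset X \<in> VS"
  using vset_VS vsmall_small by blast

lemma vsmall_elts: "x \<in> VS \<Longrightarrow> vsmall (elts x)"
  by (auto simp: vsmall_def)

lemma vsmall_subset: "vsmall X \<Longrightarrow> Y \<subseteq> X \<Longrightarrow> vsmall Y"
  unfolding vsmall_iff using card_of_mono1 ordLeq_ordLess_trans by blast

lemma vsmall_image:
  fixes f :: "'u::two_universes \<Rightarrow> 'u"
  shows "vsmall X \<Longrightarrow> f ` X \<subseteq> VS \<Longrightarrow> vsmall (f ` X)"
  by (simp add: vsmall_iff card_image_less)

lemma VS_inaccessible: "strongly_inaccessible |VS::'u::two_universes set|"
  using universe_VS[where ?'a='u] by (simp add: grothendieck_universe_def)

lemma vsmall_UNION: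
  fixes A :: "'u::two_universes \<Rightarrow> 'u set"
  assumes "vsmall I" "\<And>i. i \<in> I \<Longrightarrow> vsmall (A i)" shows "vsmall (\<Union>i\<in>I. A i)"
  using assms cardinal_UNION[OF VS_inaccessible, of I A] unfolding vsmall_iff by blast

lemma vsmall_finite [simp]: "finite X \<Longrightarrow> X \<subseteq> VS \<Longrightarrow> vsmall (X::'u::two_universes set)"
proof -
  assume "finite X" "X \<subseteq> VS"
  have "natLeq <o |VS::'u set|"
    using VS_inaccessible by (auto simp: strongly_inaccessible_def)
  moreover have "|X| <o natLeq" using \<open>finite X\<close> finite_iff_ordLess_natLeq by blast
  ultimately show "vsmall X" unfolding vsmall_iff using \<open>X \<subseteq> VS\<close> ordLess_transitive by blast
qed

lemma vpair_VS [simp]: "a \<in> VS \<Longrightarrow> b \<in> VS \<Longrightarrow> vpair a b \<in> VS"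
  unfolding vpair_def by (intro vset_VS_I vsmall_finite) (auto intro!: vset_VS_I)

lemma vsmall_subset_VS: "vsmall X \<Longrightarrow> X \<subseteq> VS"
  by (simp add: vsmall_iff)

lemma vsmallD: "vsmall X \<Longrightarrow> x \<in> X \<Longrightarrow> x \<in> VS"
  by (auto simp: vsmall_iff)

text \<open>The strong limit property of \<open>|VS|\<close> makes the set of open subsets of a very small space very small,
  so that such a space has a code in \<open>VS\<close>.\<close>

lemma vsmall_Pow: assumes "vsmall (X::'u::two_universes set)" shows "vsmall (vset ` Pow X)"
proof -
  have "vset ` Pow X \<subseteq> VS" using vsmall_subset[OF assms] vset_VS_I by blast
  moreover have "|Pow X| <o |VS::'u set|"
    using assms VS_inaccessible unfolding strongly_inaccessible_def vsmall_iff by blast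
  ultimately show ?thesis by (simp add: vsmall_iff card_image_less)
qed

lemma varr_VS:
  assumes "a \<in> VS" "b \<in> VS" "vsmall X" "h ` X \<subseteq> VS" shows "varr a b X h \<in> VS"
proof -
  have "(\<lambda>x. vpair x (h x)) ` X \<subseteq> VS"
    using assms(3,4) vsmallD by (fastforce intro!: vpair_VS)
  then show ?thesis
    unfolding varr_def using assms(1-3) by (simp add: vset_VS_I vsmall_image)
qed

lemma small_VS_subset: "X \<subseteq> VS \<Longrightarrow> small (X::'u::two_universes set)"
  unfolding small_def using VS_less_UNIV card_of_mono1 ordLeq_ordLess_trans by blast

text \<open>The set underlying a dependent sum of sets; as an explicit subset of the universe it is available
  without passing through codes.\<close>

definition vsigma :: "'u::two_universes \<Rightarrow> ('u \<Rightarrow> 'u) \<Rightarrow> 'u set" where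
  "vsigma a b = {vpair t s | t s. t \<in> elts a \<and> s \<in> elts (b t)}"

lemma vsigma_UN: "vsigma a b = (\<Union>t\<in>elts a. vpair t ` elts (b t))"
  by (auto simp: vsigma_def)

lemma small_vsigma [simp]: "small (vsigma a b)"
  unfolding vsigma_UN
  using small_elts[of a] by (intro small_UNION small_image small_elts) (simp add: small_def)

lemma vsmall_vsigma:
  assumes a: "a \<in> VS" and b: "\<And>t. t \<in> elts a \<Longrightarrow> b t \<in> VS"
  shows "vsmall (vsigma a b)"
  unfolding vsigma_UN
proof (rule vsmall_UNION)
  show va: "vsmall (elts a)" using a vsmall_elts by blast
  fix t assume t: "t \<in> elts a"
  then have "vsmall (elts (b t))" "t \<in> VS"
    using b va vsmall_elts vsmall_subset_VS by blast+
  then show "vsmall (vpair t ` elts (b t))"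
    by (intro vsmall_image) (auto dest: vsmallD)
qed

section \<open>Natural isomorphisms and the category hCAT\<close>

lemma hom_iff: "f \<in> hom C x y \<longleftrightarrow> f \<in> Ar C \<and> Dm C f = x \<and> Cd C f = y"
  by (auto simp: hom_def)

lemma hom_Ar: "f \<in> hom C x y \<Longrightarrow> f \<in> Ar C"
  by (auto simp: hom_def)

lemma Ar_hom: "f \<in> Ar C \<Longrightarrow> f \<in> hom C (Dm C f) (Cd C f)"
  by (auto simp: hom_def)

lemma
  assumes "category C"
  shows cat_id: "x \<in> Ob C \<Longrightarrow> Idn C x \<in> hom C x x"
    and cat_comp: "f \<in> hom C x y \<Longrightarrow> g \<in> hom C y z \<Longrightarrow> Cmp C g f \<in> hom C x z"
    and cat_idl: "f \<in> hom C x y \<Longrightarrow> Cmp C (Idn C y) f = f"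
    and cat_idr: "f \<in> hom C x y \<Longrightarrow> Cmp C f (Idn C x) = f"
    and cat_assoc: "f \<in> hom C w x \<Longrightarrow> g \<in> hom C x y \<Longrightarrow> h \<in> hom C y z \<Longrightarrow>
      Cmp C h (Cmp C g f) = Cmp C (Cmp C h g) f"
    and Dm_Ob: "f \<in> Ar C \<Longrightarrow> Dm C f \<in> Ob C"
    and Cd_Ob: "f \<in> Ar C \<Longrightarrow> Cd C f \<in> Ob C"
  using assms unfolding category_def by blast+

lemma
  assumes "category C" "f \<in> hom C x y"
  shows hom_Ob1: "x \<in> Ob C" and hom_Ob2: "y \<in> Ob C"
  using assms Dm_Ob Cd_Ob by (auto simp: hom_iff)

lemma categoryI:
  assumes "\<And>f. f \<in> Ar C \<Longrightarrow> Dm C f \<in> Ob C \<and> Cd C f \<in> Ob C"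
    and "\<And>x. x \<in> Ob C \<Longrightarrow> Idn C x \<in> hom C x x"
    and "\<And>x y z f g. f \<in> hom C x y \<Longrightarrow> g \<in> hom C y z \<Longrightarrow> Cmp C g f \<in> hom C x z"
    and "\<And>x y f. f \<in> hom C x y \<Longrightarrow> Cmp C f (Idn C x) = f"
    and "\<And>x y f. f \<in> hom C x y \<Longrightarrow> Cmp C (Idn C y) f = f"
    and "\<And>w x y z f g h. f \<in> hom C w x \<Longrightarrow> g \<in> hom C x y \<Longrightarrow> h \<in> hom C y z \<Longrightarrow>
      Cmp C h (Cmp C g f) = Cmp C (Cmp C h g) f"
  shows "category C"
  unfolding category_def by (intro conjI ballI allI) (use assms in blast)+

definition arr_inv :: "('o, 'a) cat \<Rightarrow> 'a \<Rightarrow> 'a" where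
  "arr_inv C f = (SOME g. g \<in> hom C (Cd C f) (Dm C f) \<and>
     Cmp C g f = Idn C (Dm C f) \<and> Cmp C f g = Idn C (Cd C f))"

lemma
  assumes "invertible C f" "f \<in> hom C x y"
  shows arr_inv_hom: "arr_inv C f \<in> hom C y x"
    and arr_inv_left: "Cmp C (arr_inv C f) f = Idn C x"
    and arr_inv_right: "Cmp C f (arr_inv C f) = Idn C y"
proof -
  have "\<exists>g. g \<in> hom C (Cd C f) (Dm C f) \<and> Cmp C g f = Idn C (Dm C f) \<and> Cmp C f g = Idn C (Cd C f)"
    using assms(1) unfolding invertible_def by blast
  from someI_ex[OF this] show "arr_inv C f \<in> hom C y x" "Cmp C (arr_inv C f) f = Idn C x"
      "Cmp C f (arr_inv C f) = Idn C y"
    using assms(2) unfolding arr_inv_def hom_iff by auto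
qed

lemma invertibleI:
  "f \<in> hom C x y \<Longrightarrow> g \<in> hom C y x \<Longrightarrow> Cmp C g f = Idn C x \<Longrightarrow> Cmp C f g = Idn C y \<Longrightarrow> invertible C f"
  by (auto simp: invertible_def hom_iff intro!: bexI[of _ g])

lemma invertible_arr_inv: "invertible C f \<Longrightarrow> f \<in> hom C x y \<Longrightarrow> invertible C (arr_inv C f)"
  using invertibleI[OF arr_inv_hom] arr_inv_left arr_inv_right by metis

lemma invertible_Idn: "category C \<Longrightarrow> x \<in> Ob C \<Longrightarrow> invertible C (Idn C x)"
  by (rule invertibleI[of _ _ x x "Idn C x"]) (auto simp: cat_id cat_idl[OF _ cat_id])

lemma invertible_Cmp:
  assumes C: "category C" and f: "f \<in> hom C x y" "invertible C f" and g: "g \<in> hom C y z" "invertible C g"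
  shows "invertible C (Cmp C g f)"
proof (rule invertibleI)
  let ?f = "arr_inv C f" and ?g = "arr_inv C g"
  note fi = arr_inv_hom[OF f(2,1)] and gi = arr_inv_hom[OF g(2,1)]
  show h: "Cmp C g f \<in> hom C x z" "Cmp C ?f ?g \<in> hom C z x"
    by (rule cat_comp[OF C f(1) g(1)], rule cat_comp[OF C gi fi])
  have "Cmp C (Cmp C ?f ?g) (Cmp C g f) = Cmp C ?f (Cmp C (Cmp C ?g g) f)"
    by (simp add: cat_assoc[OF C h(1) gi fi, symmetric] cat_assoc[OF C f(1) g(1) gi])
  then show "Cmp C (Cmp C ?f ?g) (Cmp C g f) = Idn C x"
    by (simp add: arr_inv_left[OF g(2,1)] arr_inv_left[OF f(2,1)] cat_idl[OF C f(1)])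
  have "Cmp C (Cmp C g f) (Cmp C ?f ?g) = Cmp C g (Cmp C (Cmp C f ?f) ?g)"
    by (simp add: cat_assoc[OF C h(2) f(1) g(1), symmetric] cat_assoc[OF C gi fi f(1)])
  then show "Cmp C (Cmp C g f) (Cmp C ?f ?g) = Idn C z"
    by (simp add: arr_inv_right[OF g(2,1)] arr_inv_right[OF f(2,1)] cat_idl[OF C gi])
qed

lemma
  assumes "is_functor F"
  shows func_Src: "category (Src F)" and func_Tgt: "category (Tgt F)"
    and func_Ob: "x \<in> Ob (Src F) \<Longrightarrow> FO F x \<in> Ob (Tgt F)"
    and func_Idn: "x \<in> Ob (Src F) \<Longrightarrow> FA F (Idn (Src F) x) = Idn (Tgt F) (FO F x)"
    and func_hom: "f \<in> hom (Src F) x y \<Longrightarrow> FA F f \<in> hom (Tgt F) (FO F x) (FO F y)"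
    and func_Cmp: "f \<in> hom (Src F) x y \<Longrightarrow> g \<in> hom (Src F) y z \<Longrightarrow>
      FA F (Cmp (Src F) g f) = Cmp (Tgt F) (FA F g) (FA F f)"
  using assms unfolding is_functor_def by blast+

lemma is_functorI:
  assumes "category (Src F)" "category (Tgt F)"
    and "\<And>x. x \<in> Ob (Src F) \<Longrightarrow> FO F x \<in> Ob (Tgt F)"
    and "\<And>x. x \<in> Ob (Src F) \<Longrightarrow> FA F (Idn (Src F) x) = Idn (Tgt F) (FO F x)"
    and "\<And>f x y. f \<in> hom (Src F) x y \<Longrightarrow> FA F f \<in> hom (Tgt F) (FO F x) (FO F y)"
    and "\<And>f g x y z. f \<in> hom (Src F) x y \<Longrightarrow> g \<in> hom (Src F) y z \<Longrightarrow>
      FA F (Cmp (Src F) g f) = Cmp (Tgt F) (FA F g) (FA F f)"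
  shows "is_functor F"
  unfolding is_functor_def by (intro conjI ballI allI) (use assms in blast)+

lemma func_invertible:
  assumes F: "is_functor F" and f: "f \<in> hom (Src F) x y" "invertible (Src F) f"
  shows "invertible (Tgt F) (FA F f)"
proof (rule invertibleI)
  note fi = arr_inv_hom[OF f(2,1)]
  show "FA F f \<in> hom (Tgt F) (FO F x) (FO F y)" "FA F (arr_inv (Src F) f) \<in> hom (Tgt F) (FO F y) (FO F x)"
    using F f(1) fi by (simp_all add: func_hom)
  show "Cmp (Tgt F) (FA F (arr_inv (Src F) f)) (FA F f) = Idn (Tgt F) (FO F x)"
    using func_Cmp[OF F f(1) fi] func_Idn[OF F] hom_Ob1[OF func_Src[OF F] f(1)]
    by (simp add: arr_inv_left[OF f(2,1)])
  show "Cmp (Tgt F) (FA F f) (FA F (arr_inv (Src F) f)) = Idn (Tgt F) (FO F y)"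
    using func_Cmp[OF F fi f(1)] func_Idn[OF F] hom_Ob2[OF func_Src[OF F] f(1)]
    by (simp add: arr_inv_right[OF f(2,1)])
qed

lemma id_func_simps [simp]: "Src (id_func I) = I" "Tgt (id_func I) = I" "FO (id_func I) = id" "FA (id_func I) = id"
  by (simp_all add: id_func_def)

lemma comp_func_simps [simp]: "Src (comp_func G F) = Src F" "Tgt (comp_func G F) = Tgt G"
  "FO (comp_func G F) = FO G \<circ> FO F" "FA (comp_func G F) = FA G \<circ> FA F"
  by (simp_all add: comp_func_def)

lemma is_functor_id: "category I \<Longrightarrow> is_functor (id_func I)"
  by (simp add: is_functor_def)

lemma is_functor_comp:
  assumes F: "is_functor F" and G: "is_functor G" and "Tgt F = Src G"
  shows "is_functor (comp_func G F)"
proof (rule is_functorI)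
  show "category (Src (comp_func G F))" "category (Tgt (comp_func G F))"
    using func_Src[OF F] func_Tgt[OF G] by simp_all
next
  fix x assume "x \<in> Ob (Src (comp_func G F))"
  then show "FO (comp_func G F) x \<in> Ob (Tgt (comp_func G F))"
    "FA (comp_func G F) (Idn (Src (comp_func G F)) x) = Idn (Tgt (comp_func G F)) (FO (comp_func G F) x)"
    using func_Ob[OF F] func_Ob[OF G] func_Idn[OF F] func_Idn[OF G] assms(3) by simp_all
next
  fix f x y assume f: "f \<in> hom (Src (comp_func G F)) x y"
  show "FA (comp_func G F) f \<in> hom (Tgt (comp_func G F)) (FO (comp_func G F) x) (FO (comp_func G F) y)"
    using func_hom[OF G] func_hom[OF F] f assms(3) by simp
  fix g z assume "g \<in> hom (Src (comp_func G F)) y z"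
  then show "FA (comp_func G F) (Cmp (Src (comp_func G F)) g f) =
      Cmp (Tgt (comp_func G F)) (FA (comp_func G F) g) (FA (comp_func G F) f)"
    using func_Cmp[OF F] func_Cmp[OF G func_hom[OF F, unfolded assms(3)] func_hom[OF F, unfolded assms(3)]]
      f assms(3) by simp
qed

lemma comp_func_assoc: "comp_func H (comp_func G F) = comp_func (comp_func H G) F"
  by (simp add: comp_func_def comp_assoc)

lemma comp_id_left: "Tgt F = I \<Longrightarrow> comp_func (id_func I) F = F"
  by (cases F) (simp add: comp_func_def id_func_def)

lemma comp_id_right: "Src F = I \<Longrightarrow> comp_func F (id_func I) = F"
  by (cases F) (simp add: comp_func_def id_func_def)

lemma
  assumes "nat_iso \<phi> F G"
  shows nat_iso_functor1: "is_functor F" and nat_iso_functor2: "is_functor G"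
    and nat_iso_Src: "Src G = Src F" and nat_iso_Tgt: "Tgt G = Tgt F"
    and nat_iso_hom: "x \<in> Ob (Src F) \<Longrightarrow> \<phi> x \<in> hom (Tgt F) (FO F x) (FO G x)"
    and nat_iso_invertible: "x \<in> Ob (Src F) \<Longrightarrow> invertible (Tgt F) (\<phi> x)"
    and nat_iso_natural: "f \<in> hom (Src F) x y \<Longrightarrow>
      Cmp (Tgt F) (\<phi> y) (FA F f) = Cmp (Tgt F) (FA G f) (\<phi> x)"
  using assms unfolding nat_iso_def by auto

lemma nat_isoI:
  assumes "is_functor F" "is_functor G" "Src F = Src G" "Tgt F = Tgt G"
    and "\<And>x. x \<in> Ob (Src F) \<Longrightarrow> \<phi> x \<in> hom (Tgt F) (FO F x) (FO G x)"
    and "\<And>x. x \<in> Ob (Src F) \<Longrightarrow> invertible (Tgt F) (\<phi> x)"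
    and "\<And>x y f. f \<in> hom (Src F) x y \<Longrightarrow>
      Cmp (Tgt F) (\<phi> y) (FA F f) = Cmp (Tgt F) (FA G f) (\<phi> x)"
  shows "nat_iso \<phi> F G"
  unfolding nat_iso_def using assms by auto

text \<open>In \<open>nid\<close>, \<open>ninv\<close> and \<open>ncmp\<close> the functor argument only tells in which category the components live.\<close>

definition nid :: "'u func \<Rightarrow> 'u \<Rightarrow> 'u" where
  "nid F x = Idn (Tgt F) (FO F x)"

definition ninv :: "'u func \<Rightarrow> ('u \<Rightarrow> 'u) \<Rightarrow> 'u \<Rightarrow> 'u" where
  "ninv F \<phi> x = arr_inv (Tgt F) (\<phi> x)"

definition ncmp :: "'u func \<Rightarrow> ('u \<Rightarrow> 'u) \<Rightarrow> ('u \<Rightarrow> 'u) \<Rightarrow> 'u \<Rightarrow> 'u" where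
  "ncmp F \<psi> \<phi> x = Cmp (Tgt F) (\<psi> x) (\<phi> x)"

lemma nat_iso_nid: "is_functor F \<Longrightarrow> nat_iso (nid F) F F"
proof (rule nat_isoI)
  assume F: "is_functor F"
  note T = func_Tgt[OF F]
  show "nid F x \<in> hom (Tgt F) (FO F x) (FO F x)" "invertible (Tgt F) (nid F x)" if "x \<in> Ob (Src F)" for x
    using func_Ob[OF F that] T by (simp_all add: nid_def cat_id invertible_Idn)
  show "Cmp (Tgt F) (nid F y) (FA F f) = Cmp (Tgt F) (FA F f) (nid F x)" if "f \<in> hom (Src F) x y" for f x y
    using func_hom[OF F that] T by (simp add: nid_def cat_idl cat_idr)
qed auto

lemma nat_iso_ninv: "nat_iso \<phi> F G \<Longrightarrow> nat_iso (ninv F \<phi>) G F"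
proof (rule nat_isoI)
  assume n: "nat_iso \<phi> F G"
  note F = nat_iso_functor1[OF n] and G = nat_iso_functor2[OF n]
  note S = nat_iso_Src[OF n] and T = nat_iso_Tgt[OF n] and inv = nat_iso_invertible[OF n] and h = nat_iso_hom[OF n]
  show "is_functor G" "is_functor F" "Src G = Src F" "Tgt G = Tgt F" by fact+
  show "ninv F \<phi> x \<in> hom (Tgt G) (FO G x) (FO F x)" "invertible (Tgt G) (ninv F \<phi> x)" if "x \<in> Ob (Src G)" for x
    using that arr_inv_hom[OF inv h] invertible_arr_inv[OF inv h] S T by (simp_all add: ninv_def)
  show "Cmp (Tgt G) (ninv F \<phi> y) (FA G f) = Cmp (Tgt G) (FA F f) (ninv F \<phi> x)"
    if "f \<in> hom (Src G) x y" for f x y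
  proof -
    have f: "f \<in> hom (Src F) x y" using that S by simp
    note C = func_Tgt[OF F]
    have x: "x \<in> Ob (Src F)" and y: "y \<in> Ob (Src F)"
      using hom_Ob1[OF func_Src[OF F] f] hom_Ob2[OF func_Src[OF F] f] by auto
    note ix = arr_inv_hom[OF inv h, OF x x] and iy = arr_inv_hom[OF inv h, OF y y]
    note Ff = func_hom[OF F f] and Gf = func_hom[OF G that, unfolded T]
    note hx = h[OF x] and hy = h[OF y]
    let ?D = "Cmp (Tgt F)"
    have "?D (?D (FA G f) (\<phi> x)) (ninv F \<phi> x) = FA G f"
      by (simp add: ninv_def cat_assoc[OF C ix hx Gf, symmetric] arr_inv_right[OF inv h, OF x x] cat_idr[OF C Gf])
    then have "?D (ninv F \<phi> y) (FA G f) = ?D (ninv F \<phi> y) (?D (?D (FA G f) (\<phi> x)) (ninv F \<phi> x))"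
      by simp
    also have "\<dots> = ?D (ninv F \<phi> y) (?D (?D (\<phi> y) (FA F f)) (ninv F \<phi> x))"
      using nat_iso_natural[OF n f] by simp
    also have "\<dots> = ?D (FA F f) (ninv F \<phi> x)"
      by (simp add: ninv_def cat_assoc[OF C ix Ff hy, symmetric] cat_assoc[OF C cat_comp[OF C ix Ff] hy iy]
          arr_inv_left[OF inv h, OF y y] cat_idl[OF C cat_comp[OF C ix Ff]])
    finally show ?thesis using T by simp
  qed
qed

lemma nat_iso_ncmp: "nat_iso \<phi> F G \<Longrightarrow> nat_iso \<psi> G H \<Longrightarrow> nat_iso (ncmp F \<psi> \<phi>) F H"
proof (rule nat_isoI)
  assume n: "nat_iso \<phi> F G" and n': "nat_iso \<psi> G H"
  note F = nat_iso_functor1[OF n] and G = nat_iso_functor2[OF n] and H = nat_iso_functor2[OF n']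
  note S = nat_iso_Src[OF n] nat_iso_Src[OF n'] and T = nat_iso_Tgt[OF n] nat_iso_Tgt[OF n']
  note C = func_Tgt[OF F]
  show "is_functor F" "is_functor H" "Src F = Src H" "Tgt F = Tgt H" using F H S T by auto
  have h: "\<phi> x \<in> hom (Tgt F) (FO F x) (FO G x)" "\<psi> x \<in> hom (Tgt F) (FO G x) (FO H x)"
    "invertible (Tgt F) (\<phi> x)" "invertible (Tgt F) (\<psi> x)" if "x \<in> Ob (Src F)" for x
    using that nat_iso_hom[OF n] nat_iso_hom[OF n'] nat_iso_invertible[OF n] nat_iso_invertible[OF n'] S T by auto
  show "ncmp F \<psi> \<phi> x \<in> hom (Tgt F) (FO F x) (FO H x)" "invertible (Tgt F) (ncmp F \<psi> \<phi> x)" if "x \<in> Ob (Src F)" for x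
    using cat_comp[OF C h(1,2)[OF that]] invertible_Cmp[OF C h(1,3,2,4)[OF that]] by (simp_all add: ncmp_def)
  show "Cmp (Tgt F) (ncmp F \<psi> \<phi> y) (FA F f) = Cmp (Tgt F) (FA H f) (ncmp F \<psi> \<phi> x)"
    if f: "f \<in> hom (Src F) x y" for f x y
  proof -
    have x: "x \<in> Ob (Src F)" and y: "y \<in> Ob (Src F)"
      using hom_Ob1[OF func_Src[OF F] f] hom_Ob2[OF func_Src[OF F] f] by auto
    have G': "FA G f \<in> hom (Tgt F) (FO G x) (FO G y)" "FA H f \<in> hom (Tgt F) (FO H x) (FO H y)"
      using func_hom[OF G] func_hom[OF H] f S T by auto
    note F' = func_hom[OF F f]
    have "Cmp (Tgt F) (\<psi> y) (FA G f) = Cmp (Tgt F) (FA H f) (\<psi> x)"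
      using nat_iso_natural[OF n'] f S T by auto
    then show ?thesis
      using nat_iso_natural[OF n f]
      by (simp add: ncmp_def cat_assoc[OF C F' h(1,2)[OF y], symmetric] cat_assoc[OF C h(1)[OF x] G'(1) h(2)[OF y]]
          cat_assoc[OF C h(1,2)[OF x] G'(2)])
  qed
qed

lemma nat_iso_whisker_left:
  assumes n: "nat_iso \<phi> F G" and H: "is_functor H" "Src H = Tgt F"
  shows "nat_iso (FA H \<circ> \<phi>) (comp_func H F) (comp_func H G)"
proof (rule nat_isoI)
  note F = nat_iso_functor1[OF n] and G = nat_iso_functor2[OF n]
  note S = nat_iso_Src[OF n] and T = nat_iso_Tgt[OF n]
  show "is_functor (comp_func H F)" "is_functor (comp_func H G)"
    using F G H T by (auto intro!: is_functor_comp)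
  show "Src (comp_func H F) = Src (comp_func H G)" "Tgt (comp_func H F) = Tgt (comp_func H G)"
    using S by auto
  show "(FA H \<circ> \<phi>) x \<in> hom (Tgt (comp_func H F)) (FO (comp_func H F) x) (FO (comp_func H G) x)"
    "invertible (Tgt (comp_func H F)) ((FA H \<circ> \<phi>) x)"
    if "x \<in> Ob (Src (comp_func H F))" for x
    using that func_hom[OF H(1)] func_invertible[OF H(1), unfolded H(2), OF nat_iso_hom[OF n]]
      nat_iso_hom[OF n] nat_iso_invertible[OF n] H(2)
    by auto
  show "Cmp (Tgt (comp_func H F)) ((FA H \<circ> \<phi>) y) (FA (comp_func H F) f) =
      Cmp (Tgt (comp_func H F)) (FA (comp_func H G) f) ((FA H \<circ> \<phi>) x)"
    if f': "f \<in> hom (Src (comp_func H F)) x y" for f x y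
  proof -
    have f: "f \<in> hom (Src F) x y" using f' by simp
    have x: "x \<in> Ob (Src F)" and y: "y \<in> Ob (Src F)"
      using hom_Ob1[OF func_Src[OF F] f] hom_Ob2[OF func_Src[OF F] f] by auto
    have G': "FA G f \<in> hom (Src H) (FO G x) (FO G y)"
      using func_hom[OF G] f S T H by auto
    show ?thesis
      using nat_iso_natural[OF n f] H(2)
        func_Cmp[OF H(1), of "FA F f" "FO F x" "FO F y" "\<phi> y" "FO G y"] func_hom[OF F f] nat_iso_hom[OF n y]
        func_Cmp[OF H(1), of "\<phi> x" "FO F x" "FO G x" "FA G f" "FO G y"] G' nat_iso_hom[OF n x] by simp
  qed
qed

lemma nat_iso_whisker_right:
  assumes n: "nat_iso \<phi> F G" and H: "is_functor H" "Tgt H = Src F"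
  shows "nat_iso (\<phi> \<circ> FO H) (comp_func F H) (comp_func G H)"
proof (rule nat_isoI)
  note F = nat_iso_functor1[OF n] and G = nat_iso_functor2[OF n]
  note S = nat_iso_Src[OF n] and T = nat_iso_Tgt[OF n]
  show "is_functor (comp_func F H)" "is_functor (comp_func G H)"
    using F G H S by (auto intro!: is_functor_comp)
  show "Src (comp_func F H) = Src (comp_func G H)" "Tgt (comp_func F H) = Tgt (comp_func G H)"
    using T by auto
  show "(\<phi> \<circ> FO H) x \<in> hom (Tgt (comp_func F H)) (FO (comp_func F H) x) (FO (comp_func G H) x)"
    "invertible (Tgt (comp_func F H)) ((\<phi> \<circ> FO H) x)"
    if "x \<in> Ob (Src (comp_func F H))" for x
    using that func_Ob[OF H(1)] nat_iso_hom[OF n] nat_iso_invertible[OF n] H(2) by (auto)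
  show "Cmp (Tgt (comp_func F H)) ((\<phi> \<circ> FO H) y) (FA (comp_func F H) f) =
      Cmp (Tgt (comp_func F H)) (FA (comp_func G H) f) ((\<phi> \<circ> FO H) x)"
    if "f \<in> hom (Src (comp_func F H)) x y" for f x y
    using nat_iso_natural[OF n] func_hom[OF H(1)] that H(2) by auto
qed

text \<open>Operations on functors are given by terms whose values outside the source category are arbitrary, so
  that equality of functors mostly holds only in the following sense.\<close>

definition fun_eq :: "'u func \<Rightarrow> 'u func \<Rightarrow> bool" where
  "fun_eq F G \<longleftrightarrow> Src F = Src G \<and> Tgt F = Tgt G \<and>
     (\<forall>x\<in>Ob (Src F). FO F x = FO G x) \<and> (\<forall>f\<in>Ar (Src F). FA F f = FA G f)"

lemma fun_eq_functor: "is_functor F \<Longrightarrow> fun_eq F G \<Longrightarrow> is_functor G"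
proof (rule is_functorI)
  assume F: "is_functor F" and e: "fun_eq F G"
  note C = func_Src[OF F] and D = func_Tgt[OF F]
  have e': "Src G = Src F" "Tgt G = Tgt F" using e by (auto simp: fun_eq_def)
  have o: "FO G x = FO F x" if "x \<in> Ob (Src F)" for x using e that by (auto simp: fun_eq_def)
  have a: "FA G x = FA F x" if "x \<in> Ar (Src F)" for x using e that by (auto simp: fun_eq_def)
  show "category (Src G)" "category (Tgt G)" using C D e' by simp_all
  show "FO G x \<in> Ob (Tgt G)" "FA G (Idn (Src G) x) = Idn (Tgt G) (FO G x)" if "x \<in> Ob (Src G)" for x
    using that e' o func_Ob[OF F] func_Idn[OF F] a hom_Ar[OF cat_id[OF C]] by auto
  fix f x y assume f: "f \<in> hom (Src G) x y"
  then have ob: "x \<in> Ob (Src F)" "y \<in> Ob (Src F)" using e' hom_Ob1[OF C] hom_Ob2[OF C] by auto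
  show "FA G f \<in> hom (Tgt G) (FO G x) (FO G y)"
    using f e' func_hom[OF F] o[OF ob(1)] o[OF ob(2)] a hom_Ar by metis
  fix g z assume g: "g \<in> hom (Src G) y z"
  have h: "f \<in> hom (Src F) x y" "g \<in> hom (Src F) y z" using f g e' by auto
  have "FA G f = FA F f" "FA G g = FA F g" "FA G (Cmp (Src G) g f) = FA F (Cmp (Src F) g f)"
    using e' a hom_Ar[OF h(1)] hom_Ar[OF h(2)] hom_Ar[OF cat_comp[OF C h]] by simp_all
  then show "FA G (Cmp (Src G) g f) = Cmp (Tgt G) (FA G g) (FA G f)"
    using f g e' func_Cmp[OF F] by auto
qed

lemma fun_eq_refl: "fun_eq F F" by (auto simp: fun_eq_def)

lemma nat_iso_cong:
  assumes n: "nat_iso \<phi> F G" and e: "fun_eq F F'" "fun_eq G G'" and p: "\<And>x. x \<in> Ob (Src F) \<Longrightarrow> \<phi> x = \<phi>' x"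
  shows "nat_iso \<phi>' F' G'"
proof (rule nat_isoI)
  note F = nat_iso_functor1[OF n] and G = nat_iso_functor2[OF n]
  note C = func_Src[OF F] and S = nat_iso_Src[OF n] and T = nat_iso_Tgt[OF n]
  show "is_functor F'" "is_functor G'" using F G e fun_eq_functor by blast+
  have e': "Src G' = Src F" "Tgt G' = Tgt F" "Src F' = Src F" "Tgt F' = Tgt F"
    using e S T by (auto simp: fun_eq_def)
  then show "Src F' = Src G'" "Tgt F' = Tgt G'" by auto
  have o: "FO G' x = FO G x" "FO F' x = FO F x" if "x \<in> Ob (Src F)" for x
    using e S that by (auto simp: fun_eq_def)
  have a: "FA G' x = FA G x" "FA F' x = FA F x" if "x \<in> Ar (Src F)" for x
    using e S that by (auto simp: fun_eq_def)
  show "\<phi>' x \<in> hom (Tgt F') (FO F' x) (FO G' x)" "invertible (Tgt F') (\<phi>' x)" if "x \<in> Ob (Src F')" for x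
    using that e' o p nat_iso_hom[OF n] nat_iso_invertible[OF n] by metis+
  fix f x y assume f: "f \<in> hom (Src F') x y"
  then have "x \<in> Ob (Src F)" "y \<in> Ob (Src F)" "f \<in> Ar (Src F)"
    using e' hom_Ob1[OF C] hom_Ob2[OF C] hom_Ar by auto
  then show "Cmp (Tgt F') (\<phi>' y) (FA F' f) = Cmp (Tgt F') (FA G' f) (\<phi>' x)"
    using f nat_iso_natural[OF n, of f x y] e' a p by auto
qed

definition iso_func :: "'u func \<Rightarrow> 'u func \<Rightarrow> bool" (infix "\<simeq>" 50) where
  "F \<simeq> G \<longleftrightarrow> (\<exists>\<phi>. nat_iso \<phi> F G)"

lemma iso_funcI: "nat_iso \<phi> F G \<Longrightarrow> F \<simeq> G"
  by (auto simp: iso_func_def)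

lemma iso_refl: "is_functor F \<Longrightarrow> F \<simeq> F"
  using nat_iso_nid by (auto simp: iso_func_def)

lemma iso_sym: "F \<simeq> G \<Longrightarrow> G \<simeq> F"
  using nat_iso_ninv by (fastforce simp: iso_func_def)

lemma iso_trans [trans]: "F \<simeq> G \<Longrightarrow> G \<simeq> H \<Longrightarrow> F \<simeq> H"
  using nat_iso_ncmp by (fastforce simp: iso_func_def)

lemma fun_eq_iso: "is_functor F \<Longrightarrow> fun_eq F G \<Longrightarrow> F \<simeq> G"
  using nat_iso_cong[OF nat_iso_nid fun_eq_refl] iso_funcI by blast

lemma iso_func_simps:
  assumes "F \<simeq> G"
  shows "is_functor F" "is_functor G" "Src G = Src F" "Tgt G = Tgt F"
  using assms unfolding iso_func_def nat_iso_def by auto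

lemma iso_comp:
  assumes "F \<simeq> F'" "G \<simeq> G'" "Tgt F = Src G"
  shows "comp_func G F \<simeq> comp_func G' F'"
proof -
  have "comp_func G F \<simeq> comp_func G F'"
    using assms nat_iso_whisker_left iso_func_simps(1)[OF assms(2)] unfolding iso_func_def by metis
  also have "comp_func G F' \<simeq> comp_func G' F'"
    using assms nat_iso_whisker_right iso_func_simps[OF assms(1)] unfolding iso_func_def by metis
  finally show ?thesis .
qed

lemma Ho_nat_iso: "is_functor G \<Longrightarrow> nat_iso (Ho_iso G) G (Ho G)"
  unfolding Ho_iso_def Ho_def using nat_iso_nid by (metis (mono_tags, lifting) someI_ex)

lemma Ho_iso_func: "is_functor G \<Longrightarrow> G \<simeq> Ho G"
  using Ho_nat_iso iso_funcI by blast

text \<open>The set of functors from which the representative is chosen depends only on the isomorphism class.\<close>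

lemma Ho_eqI: "F \<simeq> G \<Longrightarrow> Ho F = Ho G"
proof -
  assume "F \<simeq> G"
  then have "F \<simeq> H \<longleftrightarrow> G \<simeq> H" for H using iso_sym iso_trans by blast
  then show ?thesis by (simp add: Ho_def iso_func_def)
qed

lemma
  assumes "is_functor G"
  shows is_functor_Ho: "is_functor (Ho G)" and Src_Ho: "Src (Ho G) = Src G" and Tgt_Ho: "Tgt (Ho G) = Tgt G"
    and Ho_Ho: "Ho (Ho G) = Ho G"
  using iso_func_simps[OF Ho_iso_func[OF assms]] Ho_eqI[OF Ho_iso_func[OF assms]] by auto

lemma hCAT_simps [simp]: "Dm hCAT = Src" "Cd hCAT = Tgt" "Idn hCAT I = Ho (id_func I)"
  "Cmp hCAT G F = Ho (comp_func G F)"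
  "I \<in> Ob hCAT \<longleftrightarrow> category I \<and> moderately_small I"
  by (simp_all add: hCAT_def)

text \<open>Being an arrow of \<open>hCAT\<close> amounts to being one's own representative, since choosing a representative
  is idempotent.\<close>

lemma hom_hCAT: "F \<in> hom hCAT I J \<longleftrightarrow>
  is_functor F \<and> Src F = I \<and> Tgt F = J \<and> moderately_small I \<and> moderately_small J \<and> Ho F = F"
  using is_functor_Ho Src_Ho Tgt_Ho Ho_Ho unfolding hom_iff
  by (force simp: hCAT_def)

lemma Ho_hom: "is_functor F \<Longrightarrow> moderately_small (Src F) \<Longrightarrow> moderately_small (Tgt F) \<Longrightarrow>
    Ho F \<in> hom hCAT (Src F) (Tgt F)"
  by (simp add: hom_hCAT is_functor_Ho Src_Ho Tgt_Ho Ho_Ho)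

lemma Ho_comp:
  assumes "F \<simeq> F'" "G \<simeq> G'" "Tgt F = Src G"
  shows "Ho (comp_func G F) = Ho (comp_func G' F')"
  by (rule Ho_eqI) (rule iso_comp[OF assms])

lemma Ho_comp_Ho: 
  assumes "is_functor F" "is_functor G" "Tgt F = Src G"
  shows "Ho (comp_func (Ho G) F) = Ho (comp_func G F)" "Ho (comp_func G (Ho F)) = Ho (comp_func G F)"
    "Ho (comp_func (Ho G) (Ho F)) = Ho (comp_func G F)"
  using assms by (auto intro!: Ho_comp simp: iso_refl Src_Ho Tgt_Ho iso_sym[OF Ho_iso_func])

lemma category_hCAT: "category (hCAT :: ('u::two_universes scat, 'u func) cat)"
proof (rule categoryI)
  show "Dm hCAT f \<in> Ob hCAT \<and> Cd hCAT f \<in> Ob hCAT" if "f \<in> Ar hCAT" for f :: "'u func"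
    using Ar_hom[OF that] by (auto simp: hom_hCAT func_Src func_Tgt)
  show "Idn hCAT x \<in> hom hCAT x x" if "x \<in> Ob hCAT" for x :: "'u scat"
    using that Ho_hom[OF is_functor_id, of x] by auto
  show "Cmp hCAT g f \<in> hom hCAT x z" if "f \<in> hom hCAT x y" "g \<in> hom hCAT y z" for f g :: "'u func" and x y z
    using that Ho_hom[OF is_functor_comp, of f g] by (auto simp: hom_hCAT)
  show "Cmp hCAT f (Idn hCAT x) = f" "Cmp hCAT (Idn hCAT y) f = f" if "f \<in> hom hCAT x y" for f :: "'u func" and x y
    using that by (auto simp: hom_hCAT Ho_comp_Ho is_functor_id func_Src func_Tgt comp_id_left comp_id_right)
  show "Cmp hCAT h (Cmp hCAT g f) = Cmp hCAT (Cmp hCAT h g) f"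
    if "f \<in> hom hCAT w x" "g \<in> hom hCAT x y" "h \<in> hom hCAT y z" for f g h :: "'u func" and w x y z
    using that by (auto simp: hom_hCAT Ho_comp_Ho is_functor_comp comp_func_assoc)
qed

section \<open>Oplax colimits\<close>

text \<open>Strict functors from \<open>B\<close> to the category of moderately small categories.  Functoriality is stated with
  \<open>fun_eq\<close>, because the transition functors have arbitrary values outside their sources.\<close>

definition fam :: "'u::two_universes scat \<Rightarrow> 'u fam \<Rightarrow> bool" where
  "fam B K \<longleftrightarrow> category B \<and> (\<forall>x\<in>Ob B. category (FamO K x) \<and> moderately_small (FamO K x)) \<and>
     (\<forall>x y. \<forall>\<alpha>\<in>hom B x y. is_functor (FamA K \<alpha>) \<and> Src (FamA K \<alpha>) = FamO K x \<and> Tgt (FamA K \<alpha>) = FamO K y) \<and>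
     (\<forall>x\<in>Ob B. fun_eq (id_func (FamO K x)) (FamA K (Idn B x))) \<and>
     (\<forall>x y z. \<forall>\<alpha>\<in>hom B x y. \<forall>\<beta>\<in>hom B y z.
        fun_eq (comp_func (FamA K \<beta>) (FamA K \<alpha>)) (FamA K (Cmp B \<beta> \<alpha>)))"

lemma
  assumes "fam B K"
  shows fam_base: "category B"
    and fam_cat: "x \<in> Ob B \<Longrightarrow> category (FamO K x)"
    and fam_small: "x \<in> Ob B \<Longrightarrow> moderately_small (FamO K x)"
    and fam_functor: "\<alpha> \<in> hom B x y \<Longrightarrow> is_functor (FamA K \<alpha>)"
    and fam_Src: "\<alpha> \<in> hom B x y \<Longrightarrow> Src (FamA K \<alpha>) = FamO K x"
    and fam_Tgt: "\<alpha> \<in> hom B x y \<Longrightarrow> Tgt (FamA K \<alpha>) = FamO K y"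
    and fam_Idn: "x \<in> Ob B \<Longrightarrow> fun_eq (id_func (FamO K x)) (FamA K (Idn B x))"
    and fam_Cmp: "\<alpha> \<in> hom B x y \<Longrightarrow> \<beta> \<in> hom B y z \<Longrightarrow>
        fun_eq (comp_func (FamA K \<beta>) (FamA K \<alpha>)) (FamA K (Cmp B \<beta> \<alpha>))"
  using assms unfolding fam_def by blast+

lemma
  assumes K: "fam B K" and a: "\<alpha> \<in> hom B x y"
  shows fam_Ob: "j \<in> Ob (FamO K x) \<Longrightarrow> FO (FamA K \<alpha>) j \<in> Ob (FamO K y)"
    and fam_hom: "\<beta> \<in> hom (FamO K x) j k \<Longrightarrow>
      FA (FamA K \<alpha>) \<beta> \<in> hom (FamO K y) (FO (FamA K \<alpha>) j) (FO (FamA K \<alpha>) k)"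
    and fam_Idn_fib: "j \<in> Ob (FamO K x) \<Longrightarrow>
      FA (FamA K \<alpha>) (Idn (FamO K x) j) = Idn (FamO K y) (FO (FamA K \<alpha>) j)"
    and fam_Cmp_fib: "\<beta> \<in> hom (FamO K x) j k \<Longrightarrow> \<gamma> \<in> hom (FamO K x) k l \<Longrightarrow>
      FA (FamA K \<alpha>) (Cmp (FamO K x) \<gamma> \<beta>) = Cmp (FamO K y) (FA (FamA K \<alpha>) \<gamma>) (FA (FamA K \<alpha>) \<beta>)"
  using func_Ob[OF fam_functor[OF K a]] func_hom[OF fam_functor[OF K a]] func_Idn[OF fam_functor[OF K a]]
    func_Cmp[OF fam_functor[OF K a]] by (simp_all add: fam_Src[OF K a] fam_Tgt[OF K a])

lemma
  assumes K: "fam B K" and x: "x \<in> Ob B"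
  shows fam_Idn_Ob: "j \<in> Ob (FamO K x) \<Longrightarrow> FO (FamA K (Idn B x)) j = j"
    and fam_Idn_Ar: "\<beta> \<in> hom (FamO K x) j k \<Longrightarrow> FA (FamA K (Idn B x)) \<beta> = \<beta>"
  using fam_Idn[OF K x] by (auto simp: fun_eq_def hom_iff)

lemma
  assumes K: "fam B K" and a: "\<alpha> \<in> hom B x y" "\<beta> \<in> hom B y z"
  shows fam_Cmp_Ob: "j \<in> Ob (FamO K x) \<Longrightarrow> FO (FamA K (Cmp B \<beta> \<alpha>)) j = FO (FamA K \<beta>) (FO (FamA K \<alpha>) j)"
    and fam_Cmp_Ar: "\<gamma> \<in> hom (FamO K x) j k \<Longrightarrow>
      FA (FamA K (Cmp B \<beta> \<alpha>)) \<gamma> = FA (FamA K \<beta>) (FA (FamA K \<alpha>) \<gamma>)"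
  using fam_Cmp[OF K a] fam_Src[OF K a(1)] by (auto simp: fun_eq_def hom_iff)

lemma pre_simps [simp]: "FamO (pre K m) x = FamO K (FO m x)" "FamA (pre K m) \<alpha> = FamA K (FA m \<alpha>)"
  by (simp_all add: pre_def)

lemma pre_id [simp]: "pre K (id_func I) = K"
  by (simp add: pre_def)

lemma fam_pre: "fam B K \<Longrightarrow> is_functor m \<Longrightarrow> Tgt m = B \<Longrightarrow> fam (Src m) (pre K m)"
proof -
  assume K: "fam B K" and m: "is_functor m" and B: "Tgt m = B"
  have "fun_eq (id_func (FamO K (FO m x))) (FamA K (FA m (Idn (Src m) x)))" if "x \<in> Ob (Src m)" for x
    using fam_Idn[OF K] func_Ob[OF m that] func_Idn[OF m that] B by simp
  moreover have "fun_eq (comp_func (FamA K (FA m \<beta>)) (FamA K (FA m \<alpha>))) (FamA K (FA m (Cmp (Src m) \<beta> \<alpha>)))"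
    if "\<alpha> \<in> hom (Src m) x y" "\<beta> \<in> hom (Src m) y z" for \<alpha> \<beta> x y z
    using fam_Cmp[OF K func_hom[OF m that(1), unfolded B] func_hom[OF m that(2), unfolded B]]
      func_Cmp[OF m that] B by simp
  moreover have "FO m x \<in> Ob B" if "x \<in> Ob (Src m)" for x
    using func_Ob[OF m that] B by simp
  moreover have "FA m \<alpha> \<in> hom B (FO m x) (FO m y)" if "\<alpha> \<in> hom (Src m) x y" for \<alpha> x y
    using func_hom[OF m that] B by simp
  ultimately show ?thesis
    unfolding fam_def pre_simps
    by (intro conjI ballI allI func_Src[OF m])
      (blast intro: fam_cat[OF K] fam_small[OF K] fam_functor[OF K] fam_Src[OF K] fam_Tgt[OF K])+
qed

lemma oplax_Ob: "x \<in> Ob (oplax I K) \<longleftrightarrow> (\<exists>i j. x = vpair i j \<and> i \<in> Ob I \<and> j \<in> Ob (FamO K i))"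
  by (auto simp: oplax_def)

lemma oplax_Ob_vpair [simp]: "vpair i j \<in> Ob (oplax I K) \<longleftrightarrow> i \<in> Ob I \<and> j \<in> Ob (FamO K i)"
  by (simp add: oplax_Ob)

lemma oplax_Idn [simp]: "Idn (oplax I K) (vpair i j) = oarr j (Idn I i) (Idn (FamO K i) j)"
  by (simp add: oplax_def)

lemma oplax_Dm [simp]: "Dm (oplax I K) (oarr j \<alpha> \<beta>) = vpair (Dm I \<alpha>) j"
  by (simp add: oplax_def)

lemma oplax_Cd [simp]: "Cd (oplax I K) (oarr j \<alpha> \<beta>) = vpair (Cd I \<alpha>) (Cd (FamO K (Cd I \<alpha>)) \<beta>)"
  by (simp add: oplax_def)

lemma oplax_Cmp: "\<alpha>' \<in> hom I x y \<Longrightarrow> Cmp (oplax I K) (oarr j' \<alpha>' \<beta>') (oarr j \<alpha> \<beta>) =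
    oarr j (Cmp I \<alpha>' \<alpha>) (Cmp (FamO K y) \<beta>' (FA (FamA K \<alpha>') \<beta>))"
  by (simp add: oplax_def hom_iff)

lemma oplax_Ar: "z \<in> Ar (oplax I K) \<longleftrightarrow> (\<exists>j \<alpha> \<beta>. z = oarr j \<alpha> \<beta> \<and> \<alpha> \<in> Ar I \<and>
    j \<in> Ob (FamO K (Dm I \<alpha>)) \<and> \<beta> \<in> Ar (FamO K (Cd I \<alpha>)) \<and> Dm (FamO K (Cd I \<alpha>)) \<beta> = FO (FamA K \<alpha>) j)"
  by (simp add: oplax_def)

lemma oplax_homI: "\<alpha> \<in> hom I i i' \<Longrightarrow> j \<in> Ob (FamO K i) \<Longrightarrow> \<beta> \<in> hom (FamO K i') (FO (FamA K \<alpha>) j) j' \<Longrightarrow>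
    oarr j \<alpha> \<beta> \<in> hom (oplax I K) (vpair i j) (vpair i' j')"
  unfolding hom_iff oplax_Ar by simp

lemma oplax_homE:
  assumes "z \<in> hom (oplax I K) x y"
  obtains i j i' j' \<alpha> \<beta> where "x = vpair i j" "y = vpair i' j'" "z = oarr j \<alpha> \<beta>" "\<alpha> \<in> hom I i i'"
    "j \<in> Ob (FamO K i)" "\<beta> \<in> hom (FamO K i') (FO (FamA K \<alpha>) j) j'"
proof -
  from assms have 1: "z \<in> Ar (oplax I K)" and 2: "Dm (oplax I K) z = x" "Cd (oplax I K) z = y"
    by (auto simp: hom_iff)
  from 1 obtain j \<alpha> \<beta> where "z = oarr j \<alpha> \<beta>" "\<alpha> \<in> Ar I" "j \<in> Ob (FamO K (Dm I \<alpha>))"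
    "\<beta> \<in> Ar (FamO K (Cd I \<alpha>))" "Dm (FamO K (Cd I \<alpha>)) \<beta> = FO (FamA K \<alpha>) j"
    unfolding oplax_Ar by (elim exE conjE) (rule that)
  with 2 show thesis
    by (intro that[of "Dm I \<alpha>" j "Cd I \<alpha>" "Cd (FamO K (Cd I \<alpha>)) \<beta>" \<alpha> \<beta>]) (simp_all add: hom_iff)
qed

lemma category_oplax: assumes K: "fam I K" shows "category (oplax I K)"
proof (rule categoryI)
  note I = fam_base[OF K]
  note Kc = fam_cat[OF K]
  show "Dm (oplax I K) f \<in> Ob (oplax I K) \<and> Cd (oplax I K) f \<in> Ob (oplax I K)" if "f \<in> Ar (oplax I K)" for f
  proof -
    note h = Ar_hom[OF that]
    obtain i j i' j' \<alpha> \<beta> where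
      "Dm (oplax I K) f = vpair i j" "Cd (oplax I K) f = vpair i' j'" and a: "\<alpha> \<in> hom I i i'"
      and "j \<in> Ob (FamO K i)" and b: "\<beta> \<in> hom (FamO K i') (FO (FamA K \<alpha>) j) j'"
      by (rule oplax_homE[OF h])
    then show ?thesis using hom_Ob1[OF I a] hom_Ob2[OF I a] hom_Ob2[OF Kc b] by simp
  qed
  show "Idn (oplax I K) x \<in> hom (oplax I K) x x" if "x \<in> Ob (oplax I K)" for x
    using that unfolding oplax_Ob
    by (auto intro!: oplax_homI simp: cat_id I Kc fam_Idn_Ob[OF K])
  fix f x y assume "f \<in> hom (oplax I K) x y"
  then obtain i j i' j' \<alpha> \<beta> where f: "x = vpair i j" "y = vpair i' j'" "f = oarr j \<alpha> \<beta>" and a: "\<alpha> \<in> hom I i i'"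
    and j: "j \<in> Ob (FamO K i)" and b: "\<beta> \<in> hom (FamO K i') (FO (FamA K \<alpha>) j) j'"
    by (rule oplax_homE)
  have i: "i \<in> Ob I" "i' \<in> Ob I" using hom_Ob1[OF I a] hom_Ob2[OF I a] by auto
  show "Cmp (oplax I K) f (Idn (oplax I K) x) = f"
    using cat_idr[OF I a] fam_Idn_fib[OF K a j] cat_idr[OF Kc[OF i(2)] b] by (simp add: f oplax_Cmp[OF a])
  show "Cmp (oplax I K) (Idn (oplax I K) y) f = f"
    using cat_idl[OF I a] fam_Idn_Ar[OF K i(2) b] cat_idl[OF Kc[OF i(2)] b]
    by (simp add: f oplax_Cmp[OF cat_id[OF I i(2)]])
  fix g z assume "g \<in> hom (oplax I K) y z"
  then obtain i'' j'' \<alpha>' \<beta>' where g: "z = vpair i'' j''" "g = oarr j' \<alpha>' \<beta>'" and a': "\<alpha>' \<in> hom I i' i''"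
    and j': "j' \<in> Ob (FamO K i')" and b': "\<beta>' \<in> hom (FamO K i'') (FO (FamA K \<alpha>') j') j''"
    unfolding f by (rule oplax_homE) auto
  have i'': "i'' \<in> Ob I" using hom_Ob2[OF I a'] by auto
  have "Cmp (FamO K i'') \<beta>' (FA (FamA K \<alpha>') \<beta>) \<in> hom (FamO K i'') (FO (FamA K (Cmp I \<alpha>' \<alpha>)) j) j''"
    using cat_comp[OF Kc[OF i''] fam_hom[OF K a' b] b'] by (simp add: fam_Cmp_Ob[OF K a a' j])
  then show "Cmp (oplax I K) g f \<in> hom (oplax I K) x z"
    unfolding f g oplax_Cmp[OF a'] using j cat_comp[OF I a a'] by (intro oplax_homI)
  fix h w assume "h \<in> hom (oplax I K) z w"
  then obtain i3 j3 \<alpha>'' \<beta>'' where h: "w = vpair i3 j3" "h = oarr j'' \<alpha>'' \<beta>''" and a'': "\<alpha>'' \<in> hom I i'' i3"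
    and j'': "j'' \<in> Ob (FamO K i'')" and b'': "\<beta>'' \<in> hom (FamO K i3) (FO (FamA K \<alpha>'') j'') j3"
    unfolding g by (rule oplax_homE) auto
  have i3: "i3 \<in> Ob I" using hom_Ob2[OF I a''] by auto
  note Kb = fam_hom[OF K a' b]
  show "Cmp (oplax I K) h (Cmp (oplax I K) g f) = Cmp (oplax I K) (Cmp (oplax I K) h g) f"
    unfolding f g h oplax_Cmp[OF a'] oplax_Cmp[OF a''] oplax_Cmp[OF cat_comp[OF I a' a'']]
    using cat_assoc[OF I a a' a''] fam_Cmp_fib[OF K a'' Kb b'] fam_Cmp_Ar[OF K a' a'' b]
      cat_assoc[OF Kc[OF i3] fam_hom[OF K a'' Kb] fam_hom[OF K a'' b'] b''] by simp
qed

lemma oplax_proj_simps [simp]: "Src (oplax_proj I K) = oplax I K" "Tgt (oplax_proj I K) = I"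
  "FO (oplax_proj I K) = vfst" "FA (oplax_proj I K) = obase"
  by (simp_all add: oplax_proj_def)

lemma is_functor_oplax_proj: assumes K: "fam I K" shows "is_functor (oplax_proj I K)"
proof (rule is_functorI)
  show "category (Src (oplax_proj I K))" "category (Tgt (oplax_proj I K))"
    using category_oplax[OF K] fam_base[OF K] by simp_all
  show "FO (oplax_proj I K) x \<in> Ob (Tgt (oplax_proj I K))"
    "FA (oplax_proj I K) (Idn (Src (oplax_proj I K)) x) = Idn (Tgt (oplax_proj I K)) (FO (oplax_proj I K) x)"
    if "x \<in> Ob (Src (oplax_proj I K))" for x
    using that by (auto simp: oplax_Ob)
  fix f x y assume "f \<in> hom (Src (oplax_proj I K)) x y"
  then have f: "f \<in> hom (oplax I K) x y" by simp
  then show "FA (oplax_proj I K) f \<in> hom (Tgt (oplax_proj I K)) (FO (oplax_proj I K) x) (FO (oplax_proj I K) y)"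
    by (auto elim: oplax_homE)
  fix g z assume "g \<in> hom (Src (oplax_proj I K)) y z"
  then have g: "g \<in> hom (oplax I K) y z" by simp
  from f g show "FA (oplax_proj I K) (Cmp (Src (oplax_proj I K)) g f) =
      Cmp (Tgt (oplax_proj I K)) (FA (oplax_proj I K) g) (FA (oplax_proj I K) f)"
    by (auto elim!: oplax_homE simp: oplax_Cmp)
qed

text \<open>The objects and arrows are indexed unions of fibres; regularity of the larger cardinal bounds them.\<close>

lemma moderately_small_oplax:
  fixes I :: "'u::two_universes scat"
  assumes K: "fam I K" and I: "moderately_small I" shows "moderately_small (oplax I K)"
proof -
  have s: "small (Ob (FamO K x))" "small (Ar (FamO K x))" if "x \<in> Ob I" for x
    using fam_small[OF K that] by (auto simp: moderately_small_def small_def)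
  have I': "|Ob I| <o |UNIV::'u set|" "|Ar I| <o |UNIV::'u set|"
    using I by (auto simp: moderately_small_def)
  have "Ob (oplax I K) = (\<Union>i\<in>Ob I. vpair i ` Ob (FamO K i))"
    by (auto simp: oplax_def)
  then have 1: "small (Ob (oplax I K))"
    using s by (auto intro!: small_UNION small_image I')
  have D: "Dm I \<alpha> \<in> Ob I" "Cd I \<alpha> \<in> Ob I" if "\<alpha> \<in> Ar I" for \<alpha>
    using Dm_Ob[OF fam_base[OF K] that] Cd_Ob[OF fam_base[OF K] that] by auto
  have "Ar (oplax I K) \<subseteq> (\<Union>\<alpha>\<in>Ar I. \<Union>j\<in>Ob (FamO K (Dm I \<alpha>)). oarr j \<alpha> ` Ar (FamO K (Cd I \<alpha>)))"
    by (auto simp: oplax_def)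
  moreover have "small (\<Union>\<alpha>\<in>Ar I. \<Union>j\<in>Ob (FamO K (Dm I \<alpha>)). oarr j \<alpha> ` Ar (FamO K (Cd I \<alpha>)))"
    using s[OF D(1)] s[OF D(2)] by (intro small_UNION small_image I') (auto simp: small_def)
  ultimately have "small (Ar (oplax I K))" by (rule small_subset[rotated])
  with 1 show ?thesis by (auto simp: moderately_small_def small_def)
qed

text \<open>The inverse of \<open>(\<alpha>, \<beta>)\<close> is the inverse of \<open>\<alpha>\<close> together with the inverse of \<open>\<beta>\<close>, transported back along
  the inverse of \<open>\<alpha>\<close>.\<close>

lemma oplax_invertible:
  assumes K: "fam I K" and a: "\<alpha> \<in> hom I i i'" "invertible I \<alpha>" and j: "j \<in> Ob (FamO K i)"
    and b: "\<beta> \<in> hom (FamO K i') (FO (FamA K \<alpha>) j) j'" "invertible (FamO K i') \<beta>"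
  shows "invertible (oplax I K) (oarr j \<alpha> \<beta>)"
proof (rule invertibleI)
  note I = fam_base[OF K]
  let ?a = "arr_inv I \<alpha>" and ?b = "arr_inv (FamO K i') \<beta>"
  note ai = arr_inv_hom[OF a(2,1)] and bi = arr_inv_hom[OF b(2,1)]
  have i: "i \<in> Ob I" "i' \<in> Ob I" using hom_Ob1[OF I a(1)] hom_Ob2[OF I a(1)] by auto
  note Kc = fam_cat[OF K i(1)] fam_cat[OF K i(2)]
  have j': "j' \<in> Ob (FamO K i')" using hom_Ob2[OF Kc(2) b(1)] .
  have e: "FO (FamA K ?a) (FO (FamA K \<alpha>) j) = j"
    using fam_Cmp_Ob[OF K a(1) ai j] fam_Idn_Ob[OF K i(1) j] by (simp add: arr_inv_left[OF a(2,1)])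
  show "oarr j \<alpha> \<beta> \<in> hom (oplax I K) (vpair i j) (vpair i' j')"
    using a b j by (intro oplax_homI)
  show "oarr j' ?a (FA (FamA K ?a) ?b) \<in> hom (oplax I K) (vpair i' j') (vpair i j)"
    using fam_hom[OF K ai bi] ai j' by (intro oplax_homI) (simp_all add: e)
  have "Cmp (FamO K i) (FA (FamA K ?a) ?b) (FA (FamA K ?a) \<beta>) = Idn (FamO K i) j"
    using fam_Cmp_fib[OF K ai b(1) bi] fam_Idn_fib[OF K ai fam_Ob[OF K a(1) j]]
    by (simp add: arr_inv_left[OF b(2,1)] e)
  then show "Cmp (oplax I K) (oarr j' ?a (FA (FamA K ?a) ?b)) (oarr j \<alpha> \<beta>) = Idn (oplax I K) (vpair i j)"
    by (simp add: oplax_Cmp[OF ai] arr_inv_left[OF a(2,1)])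
  have "FA (FamA K \<alpha>) (FA (FamA K ?a) ?b) = ?b"
    using fam_Cmp_Ar[OF K ai a(1) bi] fam_Idn_Ar[OF K i(2) bi] by (simp add: arr_inv_right[OF a(2,1)])
  then show "Cmp (oplax I K) (oarr j \<alpha> \<beta>) (oarr j' ?a (FA (FamA K ?a) ?b)) = Idn (oplax I K) (vpair i' j')"
    by (simp add: oplax_Cmp[OF a(1)] arr_inv_right[OF a(2,1)] arr_inv_right[OF b(2,1)])
qed

text \<open>The pairs \<open>(h, \<phi>)\<close> are the morphisms from \<open>n\<close> to \<open>m\<close> in the slice, up to isomorphism, over their common
  target: exactly the data on which \<open>oplax_map\<close> depends functorially.\<close>

definition over :: "'u func \<Rightarrow> 'u func \<Rightarrow> 'u func \<Rightarrow> ('u \<Rightarrow> 'u) \<Rightarrow> bool" where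
  "over n m h \<phi> \<longleftrightarrow> is_functor h \<and> is_functor m \<and> Tgt h = Src m \<and> nat_iso \<phi> n (comp_func m h)"

lemma
  assumes "over n m h \<phi>"
  shows over_h: "is_functor h" and over_m: "is_functor m" and over_n: "is_functor n"
    and over_Tgt_h: "Tgt h = Src m" and over_Src_h: "Src h = Src n" and over_Tgt_m: "Tgt m = Tgt n"
    and over_nat_iso: "nat_iso \<phi> n (comp_func m h)"
    and over_hom: "v \<in> Ob (Src n) \<Longrightarrow> \<phi> v \<in> hom (Tgt n) (FO n v) (FO m (FO h v))"
    and over_natural: "\<alpha> \<in> hom (Src n) v w \<Longrightarrow>
      Cmp (Tgt n) (\<phi> w) (FA n \<alpha>) = Cmp (Tgt n) (FA m (FA h \<alpha>)) (\<phi> v)"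
  using assms nat_iso_functor1[of \<phi> n "comp_func m h"] nat_iso_Src[of \<phi> n "comp_func m h"]
    nat_iso_Tgt[of \<phi> n "comp_func m h"] nat_iso_hom[of \<phi> n "comp_func m h"] nat_iso_natural[of \<phi> n "comp_func m h"]
  by (auto simp: over_def)

lemma over_id: "nat_iso \<phi> n m \<Longrightarrow> over n m (id_func (Src n)) \<phi>"
  unfolding over_def using nat_iso_Src nat_iso_functor2 func_Src is_functor_id comp_id_right id_func_simps
  by metis

lemma over_comp: 
  assumes 1: "over n m h \<phi>" and 2: "over m l g \<psi>"
  shows "over n l (comp_func g h) (ncmp n (\<psi> \<circ> FO h) \<phi>)"
proof -
  have "nat_iso (\<psi> \<circ> FO h) (comp_func m h) (comp_func l (comp_func g h))"
    using nat_iso_whisker_right[OF over_nat_iso[OF 2] over_h[OF 1] over_Tgt_h[OF 1]]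
    by (simp add: comp_func_assoc)
  then have "nat_iso (ncmp n (\<psi> \<circ> FO h) \<phi>) n (comp_func l (comp_func g h))"
    using nat_iso_ncmp[OF over_nat_iso[OF 1]] by blast
  then show ?thesis
    using over_h[OF 1] over_h[OF 2] over_m[OF 2] over_Tgt_h[OF 2] over_Tgt_h[OF 1] over_Src_h[OF 2]
    by (simp add: over_def is_functor_comp)
qed

lemma oplax_map_simps [simp]: "Src (oplax_map K n m h \<phi>) = oplax (Src n) (pre K n)"
  "Tgt (oplax_map K n m h \<phi>) = oplax (Src m) (pre K m)"
  "FO (oplax_map K n m h \<phi>) (vpair v j) = vpair (FO h v) (FO (FamA K (\<phi> v)) j)"
  by (simp_all add: oplax_map_def)

lemma oplax_map_FA: "\<alpha> \<in> hom (Src n) v w \<Longrightarrow> FA (oplax_map K n m h \<phi>) (oarr j \<alpha> \<beta>) =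
    oarr (FO (FamA K (\<phi> v)) j) (FA h \<alpha>) (FA (FamA K (\<phi> w)) \<beta>)"
  by (simp add: oplax_map_def hom_iff)

lemma is_functor_oplax_map:
  assumes K: "fam (Tgt n) K" and o: "over n m h \<phi>"
  shows "is_functor (oplax_map K n m h \<phi>)"
proof (rule is_functorI)
  note n = over_n[OF o] and m = over_m[OF o] and h = over_h[OF o]
  note Kn = fam_pre[OF K n refl] and Km = fam_pre[OF K m over_Tgt_m[OF o]]
  let ?F = "oplax_map K n m h \<phi>"
  show "category (Src ?F)" "category (Tgt ?F)"
    using category_oplax[OF Kn] category_oplax[OF Km] by simp_all
  note ph = over_hom[OF o]
  note nC = func_Src[OF n]
  have hO: "FO h v \<in> Ob (Src m)" if "v \<in> Ob (Src n)" for v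
    using func_Ob[OF h] that over_Src_h[OF o] over_Tgt_h[OF o] by simp
  have hA: "FA h \<alpha> \<in> hom (Src m) (FO h v) (FO h w)" if "\<alpha> \<in> hom (Src n) v w" for \<alpha> v w
    using func_hom[OF h] that over_Src_h[OF o] over_Tgt_h[OF o] by simp
  fix x assume "x \<in> Ob (Src ?F)"
  then obtain v j where x: "x = vpair v j" "v \<in> Ob (Src n)" "j \<in> Ob (FamO K (FO n v))"
    by (auto simp: oplax_Ob)
  show "FO ?F x \<in> Ob (Tgt ?F)"
    using x hO fam_Ob[OF K ph] by simp
  show "FA ?F (Idn (Src ?F) x) = Idn (Tgt ?F) (FO ?F x)"
    using x oplax_map_FA[OF cat_id[OF nC x(2)]] func_Idn[OF h] fam_Idn_fib[OF K ph]
    over_Src_h[OF o] over_Tgt_h[OF o] by simp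
next
  note n = over_n[OF o] and m = over_m[OF o] and h = over_h[OF o]
  note Kn = fam_pre[OF K n refl] and Km = fam_pre[OF K m over_Tgt_m[OF o]]
  let ?F = "oplax_map K n m h \<phi>"
  note ph = over_hom[OF o]
  note nC = func_Src[OF n]
  have hA: "FA h \<alpha> \<in> hom (Src m) (FO h v) (FO h w)" if "\<alpha> \<in> hom (Src n) v w" for \<alpha> v w
    using func_hom[OF h] that over_Src_h[OF o] over_Tgt_h[OF o] by simp
  note Fh = func_hom[OF m] 
  fix f x y assume "f \<in> hom (Src ?F) x y"
  then have "f \<in> hom (oplax (Src n) (pre K n)) x y" by simp
  then obtain v j v' j' \<alpha> \<beta> where f: "x = vpair v j" "y = vpair v' j'" "f = oarr j \<alpha> \<beta>"
      and a: "\<alpha> \<in> hom (Src n) v v'" and j: "j \<in> Ob (FamO K (FO n v))"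
      and b: "\<beta> \<in> hom (FamO K (FO n v')) (FO (FamA K (FA n \<alpha>)) j) j'"
    by (rule oplax_homE) simp
  note v = hom_Ob1[OF nC a] hom_Ob2[OF nC a]
  have mha: "FA m (FA h \<alpha>) \<in> hom (Tgt n) (FO m (FO h v)) (FO m (FO h v'))"
    using Fh[OF hA[OF a]] over_Tgt_m[OF o] by simp
  have e: "FO (FamA K (\<phi> v')) (FO (FamA K (FA n \<alpha>)) j) = FO (FamA K (FA m (FA h \<alpha>))) (FO (FamA K (\<phi> v)) j)"
    using fam_Cmp_Ob[OF K func_hom[OF n a] ph[OF v(2)] j] fam_Cmp_Ob[OF K ph[OF v(1)] mha j]
      over_natural[OF o a] by simp
  show "FA ?F f \<in> hom (Tgt ?F) (FO ?F x) (FO ?F y)"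
    unfolding f oplax_map_FA[OF a] oplax_map_simps
    using hA[OF a] fam_Ob[OF K ph[OF v(1)] j] fam_hom[OF K ph[OF v(2)] b] 
    by (intro oplax_homI) (simp_all add: e)
  fix g z assume "g \<in> hom (Src ?F) y z"
  then have "g \<in> hom (oplax (Src n) (pre K n)) (vpair v' j') z" using f by simp
  then obtain v'' j'' \<alpha>' \<beta>' where g: "z = vpair v'' j''" "g = oarr j' \<alpha>' \<beta>'"
      and a': "\<alpha>' \<in> hom (Src n) v' v''" and j': "j' \<in> Ob (FamO K (FO n v'))"
      and b': "\<beta>' \<in> hom (FamO K (FO n v'')) (FO (FamA K (FA n \<alpha>')) j') j''"
    by (rule oplax_homE) auto
  note v'' = hom_Ob2[OF nC a']
  have mha': "FA m (FA h \<alpha>') \<in> hom (Tgt n) (FO m (FO h v')) (FO m (FO h v''))"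
    using Fh[OF hA[OF a']] over_Tgt_m[OF o] by simp
  note na' = func_hom[OF n a']
  have e': "FA (FamA K (\<phi> v'')) (FA (FamA K (FA n \<alpha>')) \<beta>) = FA (FamA K (FA m (FA h \<alpha>'))) (FA (FamA K (\<phi> v')) \<beta>)"
    using fam_Cmp_Ar[OF K na' ph[OF v''] b] fam_Cmp_Ar[OF K ph[OF v(2)] mha' b]
      over_natural[OF o a'] by simp
  have "FA h (Cmp (Src n) \<alpha>' \<alpha>) = Cmp (Src m) (FA h \<alpha>') (FA h \<alpha>)"
    using func_Cmp[OF h] a a' over_Src_h[OF o] over_Tgt_h[OF o] by simp
  then show "FA ?F (Cmp (Src ?F) g f) = Cmp (Tgt ?F) (FA ?F g) (FA ?F f)"
    unfolding f g
    by (simp add: oplax_map_FA[OF a] oplax_map_FA[OF a'] oplax_Cmp[OF a'] oplax_Cmp[OF hA[OF a']]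
      oplax_map_FA[OF cat_comp[OF nC a a']] fam_Cmp_fib[OF K ph[OF v''] fam_hom[OF K na' b] b'] e')
qed

text \<open>This holds because the family is a strict functor, so that transport along a composite is the
  composite of the transports.\<close>

lemma oplax_map_comp:
  assumes K: "fam (Tgt n) K" and 1: "over n m h \<phi>" and 2: "over m l g \<psi>"
  shows "fun_eq (comp_func (oplax_map K m l g \<psi>) (oplax_map K n m h \<phi>))
    (oplax_map K n l (comp_func g h) (ncmp n (\<psi> \<circ> FO h) \<phi>))"
  unfolding fun_eq_def
proof (intro conjI ballI)
  note n = over_n[OF 1] and h = over_h[OF 1]
  have hO: "FO h v \<in> Ob (Src m)" if "v \<in> Ob (Src n)" for v
    using func_Ob[OF h] that over_Src_h[OF 1] over_Tgt_h[OF 1] by simp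
  have hA: "FA h \<alpha> \<in> hom (Src m) (FO h v) (FO h w)" if "\<alpha> \<in> hom (Src n) v w" for \<alpha> v w
    using func_hom[OF h] that over_Src_h[OF 1] over_Tgt_h[OF 1] by simp
  have ph: "\<psi> (FO h v) \<in> hom (Tgt n) (FO m (FO h v)) (FO l (FO g (FO h v)))" if "v \<in> Ob (Src n)" for v
    using over_hom[OF 2 hO[OF that]] over_Tgt_m[OF 1] by simp
  let ?F = "comp_func (oplax_map K m l g \<psi>) (oplax_map K n m h \<phi>)"
  show "FO ?F x = FO (oplax_map K n l (comp_func g h) (ncmp n (\<psi> \<circ> FO h) \<phi>)) x"
    if "x \<in> Ob (Src ?F)" for x
  proof -
    note xO = that
    obtain v j where x: "x = vpair v j" "v \<in> Ob (Src n)" "j \<in> Ob (FamO K (FO n v))"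
      using xO by (auto simp: oplax_Ob)
    then show ?thesis
      using fam_Cmp_Ob[OF K over_hom[OF 1 x(2)] ph[OF x(2)] x(3)] by (simp add: ncmp_def)
  qed
  show "FA ?F f = FA (oplax_map K n l (comp_func g h) (ncmp n (\<psi> \<circ> FO h) \<phi>)) f"
    if "f \<in> Ar (Src ?F)" for f
  proof -
    have "f \<in> hom (oplax (Src n) (pre K n)) (Dm (Src ?F) f) (Cd (Src ?F) f)"
      using Ar_hom[OF that] by simp
    then obtain v j v' j' \<alpha> \<beta> where f: "f = oarr j \<alpha> \<beta>"
      and a: "\<alpha> \<in> hom (Src n) v v'" and j: "j \<in> Ob (FamO K (FO n v))"
      and b: "\<beta> \<in> hom (FamO K (FO n v')) (FO (FamA K (FA n \<alpha>)) j) j'"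
      by (rule oplax_homE) simp
    note v = hom_Ob1[OF func_Src[OF n] a] hom_Ob2[OF func_Src[OF n] a]
    show ?thesis
      by (simp add: f oplax_map_FA[OF a] oplax_map_FA[OF hA[OF a]] ncmp_def
          fam_Cmp_Ob[OF K over_hom[OF 1 v(1)] ph[OF v(1)] j] fam_Cmp_Ar[OF K over_hom[OF 1 v(2)] ph[OF v(2)] b])
  qed
qed simp_all

text \<open>Changing \<open>h\<close> within its isomorphism class, and \<open>\<phi>\<close> accordingly, changes the induced functor only up to
  isomorphism: the components are the cocartesian lifts of those of \<open>\<sigma>\<close>.\<close>

lemma oplax_map_iso:
  assumes K: "fam (Tgt n) K" and 1: "over n m h \<phi>" and 2: "over n m h' \<phi>'" and s: "nat_iso \<sigma> h h'"
    and c: "\<And>v. v \<in> Ob (Src n) \<Longrightarrow> Cmp (Tgt n) (FA m (\<sigma> v)) (\<phi> v) = \<phi>' v"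
  shows "oplax_map K n m h \<phi> \<simeq> oplax_map K n m h' \<phi>'"
proof (rule iso_funcI, rule nat_isoI)
  note n = over_n[OF 1] and m = over_m[OF 1] and h = over_h[OF 1]
  note nC = func_Src[OF n]
  note Km = fam_pre[OF K m over_Tgt_m[OF 1]]
  let ?F = "oplax_map K n m h \<phi>" and ?G = "oplax_map K n m h' \<phi>'"
  let ?s = "\<lambda>x. oarr (FO (FamA K (\<phi> (vfst x))) (vsnd x)) (\<sigma> (vfst x))
    (Idn (FamO K (FO m (FO h' (vfst x)))) (FO (FamA K (\<phi>' (vfst x))) (vsnd x)))"
  show "is_functor ?F" "is_functor ?G" using is_functor_oplax_map K 1 2 by blast+
  show "Src ?F = Src ?G" "Tgt ?F = Tgt ?G" by simp_all
  have h'S: "Src h' = Src n" "Tgt h' = Src m" "Src h = Src n" "Tgt h = Src m" "Tgt m = Tgt n"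
    using over_Src_h[OF 2] over_Tgt_h[OF 2] over_Src_h[OF 1] over_Tgt_h[OF 1] over_Tgt_m[OF 1] by auto
  have sh: "\<sigma> v \<in> hom (Src m) (FO h v) (FO h' v)" "invertible (Src m) (\<sigma> v)" if "v \<in> Ob (Src n)" for v
    using nat_iso_hom[OF s] nat_iso_invertible[OF s] that h'S by auto
  have msh: "FA m (\<sigma> v) \<in> hom (Tgt n) (FO m (FO h v)) (FO m (FO h' v))" if "v \<in> Ob (Src n)" for v
    using func_hom[OF m sh(1)[OF that]] h'S by simp
  have h'O: "FO m (FO h' v) \<in> Ob (Tgt n)" if "v \<in> Ob (Src n)" for v
    using func_Ob[OF over_h[OF 2]] func_Ob[OF m] that h'S by auto
  have eO: "FO (FamA K (FA m (\<sigma> v))) (FO (FamA K (\<phi> v)) j) = FO (FamA K (\<phi>' v)) j"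
    if "v \<in> Ob (Src n)" "j \<in> Ob (FamO K (FO n v))" for v j
    using fam_Cmp_Ob[OF K over_hom[OF 1 that(1)] msh[OF that(1)] that(2)] c[OF that(1)] by simp
  have eA: "FA (FamA K (FA m (\<sigma> v))) (FA (FamA K (\<phi> v)) \<beta>) = FA (FamA K (\<phi>' v)) \<beta>"
    if "v \<in> Ob (Src n)" "\<beta> \<in> hom (FamO K (FO n v)) j j'" for v \<beta> j j'
    using fam_Cmp_Ar[OF K over_hom[OF 1 that(1)] msh[OF that(1)] that(2)] c[OF that(1)] by simp
  show "?s x \<in> hom (Tgt ?F) (FO ?F x) (FO ?G x)" "invertible (Tgt ?F) (?s x)" if "x \<in> Ob (Src ?F)" for x
  proof -
    note xO = that
    obtain v j where x: "x = vpair v j" and v: "v \<in> Ob (Src n)" and j: "j \<in> Ob (FamO K (FO n v))"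
      using xO by (auto simp: oplax_Ob)
    note pj = fam_Ob[OF K over_hom[OF 2 v] j] and pj0 = fam_Ob[OF K over_hom[OF 1 v] j]
    note Kc = fam_cat[OF K h'O[OF v]]
    have "Idn (FamO K (FO m (FO h' v))) (FO (FamA K (\<phi>' v)) j)
       \<in> hom (FamO (pre K m) (FO h' v)) (FO (FamA (pre K m) (\<sigma> v)) (FO (FamA K (\<phi> v)) j)) (FO (FamA K (\<phi>' v)) j)"
      using cat_id[OF Kc pj] eO[OF v j] by simp
    moreover have "invertible (FamO (pre K m) (FO h' v)) (Idn (FamO K (FO m (FO h' v))) (FO (FamA K (\<phi>' v)) j))"
      using invertible_Idn[OF Kc pj] by simp
    ultimately show "?s x \<in> hom (Tgt ?F) (FO ?F x) (FO ?G x)" "invertible (Tgt ?F) (?s x)"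
      unfolding x using sh[OF v] pj0
      by (auto intro!: oplax_homI oplax_invertible[OF Km])
  qed
  show "Cmp (Tgt ?F) (?s y) (FA ?F f) = Cmp (Tgt ?F) (FA ?G f) (?s x)" if "f \<in> hom (Src ?F) x y" for f x y
  proof -
    from that have "f \<in> hom (oplax (Src n) (pre K n)) x y" by simp
    then obtain v j v' j' \<alpha> \<beta> where f: "x = vpair v j" "y = vpair v' j'" "f = oarr j \<alpha> \<beta>"
        and a: "\<alpha> \<in> hom (Src n) v v'" and j: "j \<in> Ob (FamO K (FO n v))"
        and b: "\<beta> \<in> hom (FamO K (FO n v')) (FO (FamA K (FA n \<alpha>)) j) j'"
      by (rule oplax_homE) simp
    note v = hom_Ob1[OF nC a] hom_Ob2[OF nC a]
    have h'a: "FA h' \<alpha> \<in> hom (Src m) (FO h' v) (FO h' v')"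
      using func_hom[OF over_h[OF 2]] a h'S by simp
    have mh'a: "FA m (FA h' \<alpha>) \<in> hom (Tgt n) (FO m (FO h' v)) (FO m (FO h' v'))"
      using func_hom[OF m h'a] h'S by simp
    note b' = fam_hom[OF K over_hom[OF 2 v(2)] b]
    note pj = fam_Ob[OF K over_hom[OF 2 v(1)] j]
    have nj: "FO (FamA K (FA m (FA h' \<alpha>))) (FO (FamA K (\<phi>' v)) j) = FO (FamA K (\<phi>' v')) (FO (FamA K (FA n \<alpha>)) j)"
      using fam_Cmp_Ob[OF K over_hom[OF 2 v(1)] mh'a j] fam_Cmp_Ob[OF K func_hom[OF n a] over_hom[OF 2 v(2)] j]
        over_natural[OF 2 a] by simp
    have "Cmp (Src m) (\<sigma> v') (FA h \<alpha>) = Cmp (Src m) (FA h' \<alpha>) (\<sigma> v)"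
      using nat_iso_natural[OF s] a h'S by simp
    then show ?thesis
      unfolding f
      using cat_idl[OF fam_cat[OF K h'O[OF v(2)]] b'] cat_idr[OF fam_cat[OF K h'O[OF v(2)]] b']
      by (simp add: oplax_map_FA[OF a] oplax_Cmp[OF sh(1)[OF v(2)]] oplax_Cmp[OF h'a] eA[OF v(2) b]
          fam_Idn_fib[OF K mh'a pj] nj)
  qed
qed

lemma oplax_pb_simps [simp]: "Base (oplax_pb B K) = B" "Total (oplax_pb B K) = oplax B K"
  "Proj (oplax_pb B K) = Ho (oplax_proj B K)" "Pb (oplax_pb B K) m = oplax (Src m) (pre K m)"
  "Pr1 (oplax_pb B K) m = Ho (oplax_proj (Src m) (pre K m))"
  by (simp_all add: oplax_pb_def)

text \<open>The second projection is the functor induced by \<open>m\<close> itself as a morphism from \<open>m\<close> to the identity of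
  the base.  In this form its composites are governed by \<open>oplax_map_comp\<close> and \<open>oplax_map_iso\<close>.\<close>

definition pr2 :: "'u::two_universes fam \<Rightarrow> 'u func \<Rightarrow> 'u func" where
  "pr2 K m = oplax_map K m (id_func (Tgt m)) m (nid m)"

lemma over_target: "is_functor m \<Longrightarrow> over m (id_func (Tgt m)) m (nid m)"
  by (simp add: over_def is_functor_id func_Tgt comp_id_left nat_iso_nid)

lemma
  assumes K: "fam B K" and m: "is_functor m" and B: "Tgt m = B"
  shows is_functor_pr2: "is_functor (pr2 K m)" and Src_pr2: "Src (pr2 K m) = oplax (Src m) (pre K m)"
    and Tgt_pr2: "Tgt (pr2 K m) = oplax B K"
  using is_functor_oplax_map[OF _ over_target[OF m]] K B by (simp_all add: pr2_def)

lemma Pr2_oplax_pb: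
  assumes K: "fam B K" and m: "is_functor m" and B: "Tgt m = B"
  shows "Pr2 (oplax_pb B K) m = Ho (pr2 K m)"
proof -
  let ?P = "\<lparr>Src = oplax (Src m) (pre K m), Tgt = oplax B K,
       FO = (\<lambda>x. vpair (FO m (vfst x)) (vsnd x)), FA = (\<lambda>z. oarr (osrc z) (FA m (obase z)) (ofib z))\<rparr>"
  have "fun_eq (pr2 K m) ?P"
    unfolding fun_eq_def
  proof (intro conjI ballI)
    show "Src (pr2 K m) = Src ?P" "Tgt (pr2 K m) = Tgt ?P" using B by (auto simp: pr2_def)
    show "FO (pr2 K m) x = FO ?P x" if "x \<in> Ob (Src (pr2 K m))" for x
    proof -
      from that obtain v j where x: "x = vpair v j" "v \<in> Ob (Src m)" "j \<in> Ob (FamO K (FO m v))"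
        by (auto simp: oplax_Ob pr2_def)
      then show ?thesis using fam_Idn_Ob[OF K, of "FO m v" j] func_Ob[OF m x(2)] B by (simp add: pr2_def nid_def)
    qed
    show "FA (pr2 K m) f = FA ?P f" if f: "f \<in> Ar (Src (pr2 K m))" for f
    proof -
      have "f \<in> hom (oplax (Src m) (pre K m)) (Dm (Src (pr2 K m)) f) (Cd (Src (pr2 K m)) f)"
        using Ar_hom[OF f] by (simp add: pr2_def)
      then obtain v j v' j' \<alpha> \<beta> where f: "f = oarr j \<alpha> \<beta>"
          and a: "\<alpha> \<in> hom (Src m) v v'" and j: "j \<in> Ob (FamO K (FO m v))"
          and b: "\<beta> \<in> hom (FamO K (FO m v')) (FO (FamA K (FA m \<alpha>)) j) j'"
        by (rule oplax_homE) simp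
      have o: "FO m v \<in> Ob B" "FO m v' \<in> Ob B"
        using func_Ob[OF m] hom_Ob1[OF func_Src[OF m] a] hom_Ob2[OF func_Src[OF m] a] B by auto
      show ?thesis
        using fam_Idn_Ob[OF K o(1) j] fam_Idn_Ar[OF K o(2) b] B by (simp add: f pr2_def oplax_map_FA[OF a] nid_def)
    qed
  qed
  then have "Ho ?P = Ho (pr2 K m)"
    using fun_eq_iso[OF is_functor_pr2[OF assms]] Ho_eqI by metis
  then show ?thesis by (simp add: oplax_pb_def)
qed

lemma oplax_proj_map: "over n m h \<phi> \<Longrightarrow>
  comp_func (oplax_proj (Src m) (pre K m)) (oplax_map K n m h \<phi>) = comp_func h (oplax_proj (Src n) (pre K n))"
  using over_Tgt_h over_Src_h by (fastforce simp: comp_func_def oplax_map_def oplax_proj_def)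

lemma oplax_proj_pr2:
  "comp_func (oplax_proj (Tgt m) K) (pr2 K m) = comp_func m (oplax_proj (Src m) (pre K m))"
  by (auto simp: comp_func_def pr2_def oplax_map_def oplax_proj_def)

text \<open>The isomorphism needed in \<open>oplax_map_iso\<close> is \<open>\<phi>\<close>: it compares \<open>n\<close> and \<open>m \<circ> h\<close> as functors to the base.\<close>

lemma pr2_oplax_map:
  assumes K: "fam (Tgt n) K" and o: "over n m h \<phi>"
  shows "comp_func (pr2 K m) (oplax_map K n m h \<phi>) \<simeq> pr2 K n"
proof -
  note n = over_n[OF o] and m = over_m[OF o] and mT = over_Tgt_m[OF o]
  let ?I = "id_func (Tgt n)"
  note t = over_target[OF m, unfolded mT]
  have f: "is_functor (comp_func (pr2 K m) (oplax_map K n m h \<phi>))"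
    using is_functor_comp[OF is_functor_oplax_map[OF K o] is_functor_pr2[OF K m mT]]
    by (simp add: pr2_def)
  have 1: "comp_func (pr2 K m) (oplax_map K n m h \<phi>) \<simeq>
      oplax_map K n ?I (comp_func m h) (ncmp n (nid m \<circ> FO h) \<phi>)"
    using fun_eq_iso[OF f] oplax_map_comp[OF K o t] by (simp add: pr2_def mT)
  have "pr2 K n \<simeq> oplax_map K n ?I (comp_func m h) (ncmp n (nid m \<circ> FO h) \<phi>)"
    unfolding pr2_def
  proof (rule oplax_map_iso[OF K over_target[OF n] over_comp[OF o t] over_nat_iso[OF o]])
    fix v assume v: "v \<in> Ob (Src n)"
    note h = over_hom[OF o v]
    show "Cmp (Tgt n) (FA (id_func (Tgt n)) (\<phi> v)) (nid n v) = ncmp n (nid m \<circ> FO h) \<phi> v"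
      using cat_idr[OF func_Tgt[OF n] h] cat_idl[OF func_Tgt[OF n] h] mT by (simp add: nid_def ncmp_def)
  qed
  then show ?thesis using 1 iso_sym iso_trans by blast
qed

text \<open>A functor \<open>b\<close> to the total category amounts to its base component \<open>n\<close> together with a section of the
  oplax colimit over \<open>n\<close>.  This separates the part of \<open>b\<close> that can be transported along an isomorphism
  of base components.\<close>

definition oplax_sect :: "'u::two_universes scat \<Rightarrow> 'u fam \<Rightarrow> 'u func \<Rightarrow> 'u func" where
  "oplax_sect B K b = \<lparr>Src = Src b, Tgt = oplax (Src b) (pre K (comp_func (oplax_proj B K) b)),
     FO = (\<lambda>t. vpair t (vsnd (FO b t))), FA = (\<lambda>\<tau>. oarr (osrc (FA b \<tau>)) \<tau> (ofib (FA b \<tau>)))\<rparr>"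

lemma
  assumes K: "fam B K" and b: "is_functor b" and T: "Tgt b = oplax B K"
  shows is_functor_oplax_sect: "is_functor (oplax_sect B K b)" (is ?A)
    and pr2_oplax_sect: "fun_eq b (comp_func (pr2 K (comp_func (oplax_proj B K) b)) (oplax_sect B K b))" (is ?B)
proof -
  define n where "n = comp_func (oplax_proj B K) b"
  note bS = func_Src[OF b]
  have n: "is_functor n" "Tgt n = B" "Src n = Src b"
    using is_functor_comp[OF b is_functor_oplax_proj[OF K]] T by (auto simp: n_def)
  have nO: "FO n t = vfst (FO b t)" "FA n t = obase (FA b t)" for t by (auto simp: n_def)
  have bO: "FO b t = vpair (FO n t) (vsnd (FO b t)) \<and> vsnd (FO b t) \<in> Ob (FamO K (FO n t)) \<and> FO n t \<in> Ob B"
    if "t \<in> Ob (Src b)" for t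
    using func_Ob[OF b that] T nO by (auto simp: oplax_Ob)
  have bA: "FA b \<tau> = oarr (vsnd (FO b t)) (FA n \<tau>) (ofib (FA b \<tau>)) \<and> FA n \<tau> \<in> hom B (FO n t) (FO n t') \<and>
      ofib (FA b \<tau>) \<in> hom (FamO K (FO n t')) (FO (FamA K (FA n \<tau>)) (vsnd (FO b t))) (vsnd (FO b t'))"
    if "\<tau> \<in> hom (Src b) t t'" for \<tau> t t'
    using func_hom[OF b that] unfolding T nO by (rule oplax_homE) simp
  let ?s = "oplax_sect B K b"
  have sS: "Src ?s = Src b" "Tgt ?s = oplax (Src b) (pre K n)" by (auto simp: oplax_sect_def n_def)
  show A: ?A
  proof (rule is_functorI)
    show "category (Src ?s)" "category (Tgt ?s)"
      using bS category_oplax[OF fam_pre[OF K n(1,2)]] sS n(3) by auto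
    show "FO ?s t \<in> Ob (Tgt ?s)" "FA ?s (Idn (Src ?s) t) = Idn (Tgt ?s) (FO ?s t)" if "t \<in> Ob (Src ?s)" for t
    proof -
      have t: "t \<in> Ob (Src b)" using that sS by simp
      show "FO ?s t \<in> Ob (Tgt ?s)" using bO[OF t] t by (auto simp: sS) (simp add: oplax_sect_def)
      have "FA b (Idn (Src b) t) = Idn (oplax B K) (vpair (FO n t) (vsnd (FO b t)))"
        using func_Idn[OF b t] bO[OF t] T by simp
      then show "FA ?s (Idn (Src ?s) t) = Idn (Tgt ?s) (FO ?s t)"
        by (auto simp: sS) (simp add: oplax_sect_def)
    qed
    fix \<tau> t t' assume "\<tau> \<in> hom (Src ?s) t t'"
    then have t: "\<tau> \<in> hom (Src b) t t'" using sS by simp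
    have "oarr (vsnd (FO b t)) \<tau> (ofib (FA b \<tau>)) \<in> hom (oplax (Src b) (pre K n)) (vpair t (vsnd (FO b t))) (vpair t' (vsnd (FO b t')))"
      using bA[OF t] bO[OF hom_Ob1[OF bS t]] t by (intro oplax_homI) auto
    moreover have "osrc (FA b \<tau>) = vsnd (FO b t)" using bA[OF t] by (metis osrc_oarr)
    ultimately show "FA ?s \<tau> \<in> hom (Tgt ?s) (FO ?s t) (FO ?s t')"
      by (simp add: sS) (simp add: oplax_sect_def)
    fix \<tau>' t'' assume "\<tau>' \<in> hom (Src ?s) t' t''"
    then have t': "\<tau>' \<in> hom (Src b) t' t''" using sS by simp
    have e: "FA b \<tau> = oarr (vsnd (FO b t)) (FA n \<tau>) (ofib (FA b \<tau>))"
       "FA b \<tau>' = oarr (vsnd (FO b t')) (FA n \<tau>') (ofib (FA b \<tau>'))"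
      using bA[OF t] bA[OF t'] by auto
    have "FA b (Cmp (Src b) \<tau>' \<tau>) = Cmp (oplax B K) (FA b \<tau>') (FA b \<tau>)"
      using func_Cmp[OF b t t'] T by simp
    also have "\<dots> = oarr (vsnd (FO b t)) (Cmp B (FA n \<tau>') (FA n \<tau>))
        (Cmp (FamO K (FO n t'')) (ofib (FA b \<tau>')) (FA (FamA K (FA n \<tau>')) (ofib (FA b \<tau>))))"
      by (rule trans[OF arg_cong2[OF e(2) e(1), of "Cmp (oplax B K)"] oplax_Cmp]) (rule conjunct1[OF conjunct2[OF bA[OF t']]])
    finally have "FA b (Cmp (Src b) \<tau>' \<tau>) = \<dots>" .
    moreover have "osrc (FA b \<tau>) = vsnd (FO b t)" using bA[OF t] by (metis osrc_oarr)
    ultimately have "FA ?s (Cmp (Src b) \<tau>' \<tau>) = Cmp (Tgt ?s) (FA ?s \<tau>') (FA ?s \<tau>)"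
      unfolding sS by (simp add: oplax_sect_def oplax_Cmp[OF t'])
    then show "FA ?s (Cmp (Src ?s) \<tau>' \<tau>) = Cmp (Tgt ?s) (FA ?s \<tau>') (FA ?s \<tau>)"
      by (simp add: sS)
  qed
  show ?B
    unfolding fun_eq_def n_def[symmetric]
  proof (intro conjI ballI)
    let ?F = "comp_func (pr2 K n) ?s"
    show "Src b = Src ?F" "Tgt b = Tgt ?F" using T sS n by (auto simp: pr2_def)
    show "FO b t = FO ?F t" if "t \<in> Ob (Src b)" for t
      using bO[OF that] fam_Idn_Ob[OF K] n by (simp add: oplax_sect_def pr2_def nid_def)
    show "FA b f = FA ?F f" if "f \<in> Ar (Src b)" for f
    proof -
      let ?t = "Dm (Src b) f" and ?t' = "Cd (Src b) f"
      have f: "f \<in> hom (Src b) ?t ?t'" by (rule Ar_hom[OF that])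
      have e: "osrc (FA b f) = vsnd (FO b ?t)" using bA[OF f] by (metis osrc_oarr)
      note o = hom_Ob1[OF bS f] hom_Ob2[OF bS f]
      have c: "FA b f = oarr (vsnd (FO b ?t)) (FA n f) (ofib (FA b f))" using bA[OF f] by (rule conjunct1)
      have d: "FA (FamA K (Idn B (FO n ?t'))) (ofib (FA b f)) = ofib (FA b f)"
        using bA[OF f] bO[OF o(2)] by (auto intro: fam_Idn_Ar[OF K])
      have "FA ?F f = oarr (vsnd (FO b ?t)) (FA n f) (ofib (FA b f))"
        using bO[OF o(1)] oplax_map_FA[OF f[folded n(3)]]
          fam_Idn_Ob[OF K, of "FO n ?t" "vsnd (FO b ?t)"] n e d
        by (simp add: oplax_sect_def pr2_def nid_def)
      then show ?thesis using c by (rule trans[OF _ sym, rotated])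
    qed
  qed
qed

lemma oplax_proj_sect:
  "comp_func (oplax_proj (Src b) (pre K (comp_func (oplax_proj B K) b))) (oplax_sect B K b) = id_func (Src b)"
  by (auto simp: comp_func_def oplax_proj_def oplax_sect_def id_func_def)

lemma Ind_oplax_pb:
  assumes m: "m \<in> hom hCAT U B" and h: "h \<in> hom hCAT V U" and k: "k \<in> Ind (oplax_pb B K) m h"
  obtains \<phi> where "k = Ho (oplax_map K (Cmp hCAT m h) m h \<phi>)" "over (Cmp hCAT m h) m h \<phi>"
  using assms by (auto simp: oplax_pb_def over_def hom_hCAT)

text \<open>The mediating functor of \<open>a\<close> and \<open>b\<close> is the section of \<open>b\<close> followed by the functor induced by \<open>a\<close> and an
  isomorphism \<open>\<psi>\<close> between the two composites to the base.  It depends on the choice of \<open>\<psi>\<close>, so it need not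
  be unique.\<close>

theorem pb_system_oplax:
  fixes B :: "'u::two_universes scat"
  assumes K: "fam B K" and B: "moderately_small B"
  shows "pb_system hCAT (oplax_pb B K)"
  unfolding pb_system_def
proof (intro conjI ballI impI)
  let ?P = "oplax_pb B K"
  note cB = fam_base[OF K]
  have ms: "moderately_small (oplax (Src m) (pre K m))" "is_functor (oplax_proj (Src m) (pre K m))"
    "category (oplax (Src m) (pre K m))"
    if "is_functor m" "Tgt m = B" "moderately_small (Src m)" for m
    using that fam_pre[OF K] moderately_small_oplax is_functor_oplax_proj category_oplax by blast+
  show "category (hCAT :: ('u scat, 'u func) cat)" by (rule category_hCAT)
  show "Base ?P \<in> Ob hCAT" using cB B by simp
  show "Proj ?P \<in> hom hCAT (Total ?P) (Base ?P)"
    using Ho_hom[OF is_functor_oplax_proj[OF K]] moderately_small_oplax[OF K B] B by simp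
  fix U :: "'u scat" and m assume U: "U \<in> Ob hCAT" and m: "m \<in> hom hCAT U (Base ?P)"
  then have mf: "is_functor m" and mT: "Tgt m = B" and mS: "Src m = U" and Us: "moderately_small U"
    by (auto simp: hom_hCAT)
  note msm = ms[OF mf mT Us[folded mS]]
  note Pr2 = Pr2_oplax_pb[OF K mf mT] and p2 = is_functor_pr2[OF K mf mT] Src_pr2[OF K mf mT] Tgt_pr2[OF K mf mT]
  show "Pr1 ?P m \<in> hom hCAT (Pb ?P m) U"
    using Ho_hom[OF msm(2)] msm Us mS by simp
  show "Pr2 ?P m \<in> hom hCAT (Pb ?P m) (Total ?P)"
    using Ho_hom[OF p2(1)] p2 msm moderately_small_oplax[OF K B] by (simp add: Pr2)
  show "Cmp hCAT m (Pr1 ?P m) = Cmp hCAT (Proj ?P) (Pr2 ?P m)"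
    using oplax_proj_pr2[of m K] by (simp add: Pr2 Ho_comp_Ho msm mf p2 is_functor_oplax_proj[OF K] mT)
  show "\<exists>c\<in>hom hCAT T (Pb ?P m). Cmp hCAT (Pr1 ?P m) c = a \<and> Cmp hCAT (Pr2 ?P m) c = b"
    if T: "T \<in> Ob hCAT" and a: "a \<in> hom hCAT T U" and b: "b \<in> hom hCAT T (Total ?P)"
      and e: "Cmp hCAT m a = Cmp hCAT (Proj ?P) b" for T :: "'u scat" and a b
  proof -
    have af: "is_functor a" "Src a = T" "Tgt a = U" "Ho a = a" and Ts: "moderately_small T"
      and bf: "is_functor b" "Src b = T" "Tgt b = oplax B K" "Ho b = b"
      using a b by (auto simp: hom_hCAT)
    define n where "n = comp_func (oplax_proj B K) b"
    have n: "is_functor n" "Tgt n = B" "Src n = T"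
      using is_functor_comp[OF bf(1) is_functor_oplax_proj[OF K]] bf by (auto simp: n_def)
    have maf: "is_functor (comp_func m a)" using is_functor_comp[OF af(1) mf] af mS by simp
    have "Ho (comp_func m a) = Ho n"
      using e bf by (simp add: Ho_comp_Ho is_functor_oplax_proj[OF K] n_def)
    then have "n \<simeq> comp_func m a"
      using Ho_iso_func[OF n(1)] Ho_iso_func[OF maf] iso_sym iso_trans by metis
    then obtain \<psi> where "nat_iso \<psi> n (comp_func m a)" by (auto simp: iso_func_def)
    then have o: "over n m a \<psi>" using af mf mS by (simp add: over_def)
    note Kn = K[folded n(2)]
    let ?s = "oplax_sect B K b"
    note s = is_functor_oplax_sect[OF K bf(1,3)]
    have sS: "Src ?s = T" "Tgt ?s = oplax T (pre K n)" using bf by (auto simp: oplax_sect_def n_def)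
    note M = is_functor_oplax_map[OF Kn o]
    let ?c = "comp_func (oplax_map K n m a \<psi>) ?s"
    have c: "is_functor ?c" using is_functor_comp[OF s M] sS n by simp
    have "Ho ?c \<in> hom hCAT T (Pb ?P m)"
      using Ho_hom[OF c] sS Ts msm by simp
    moreover have "Cmp hCAT (Pr1 ?P m) (Ho ?c) = a"
    proof -
      have "comp_func (oplax_proj (Src m) (pre K m)) ?c = comp_func a (comp_func (oplax_proj T (pre K n)) ?s)"
        using oplax_proj_map[OF o] n by (simp add: comp_func_assoc)
      also have "\<dots> = a"
        using oplax_proj_sect[of b K B] af bf by (simp add: n_def[symmetric] comp_id_right)
      finally show ?thesis using c msm af by (simp add: Ho_comp_Ho)
    qed
    moreover have "Cmp hCAT (Pr2 ?P m) (Ho ?c) = b"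
    proof -
      have "comp_func (pr2 K m) ?c \<simeq> comp_func (pr2 K n) ?s"
        unfolding comp_func_assoc
        using iso_comp[OF iso_refl[OF s] pr2_oplax_map[OF Kn o]] sS n by simp
      also have "comp_func (pr2 K n) ?s \<simeq> b"
        using fun_eq_iso[OF bf(1) pr2_oplax_sect[OF K bf(1,3)]] iso_sym n_def by simp
      finally have "comp_func (pr2 K m) ?c \<simeq> b" .
      from Ho_eqI[OF this] show ?thesis using c p2 bf by (simp add: Pr2 Ho_comp_Ho)
    qed
    ultimately show ?thesis by blast
  qed
next
  let ?P = "oplax_pb B K"
  fix U V :: "'u scat" and m h
  assume U: "U \<in> Ob hCAT" and V: "V \<in> Ob hCAT" and m: "m \<in> hom hCAT U (Base ?P)" and h: "h \<in> hom hCAT V U"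
  then have mf: "is_functor m" "Tgt m = B" "Src m = U" and Us: "moderately_small U"
    and hf: "is_functor h" "Tgt h = U" "Src h = V" and Vs: "moderately_small V"
    by (auto simp: hom_hCAT)
  let ?n = "Cmp hCAT m h"
  have mhf: "is_functor (comp_func m h)" using is_functor_comp[OF hf(1) mf(1)] hf mf by simp
  then have n: "is_functor ?n" "Tgt ?n = B" "Src ?n = V" using hf mf by (auto simp: is_functor_Ho Src_Ho Tgt_Ho)
  have "nat_iso (ninv (comp_func m h) (Ho_iso (comp_func m h))) ?n (comp_func m h)"
    using nat_iso_ninv[OF Ho_nat_iso[OF mhf]] by simp
  then show "Ind ?P m h \<noteq> {}" by (auto simp: oplax_pb_def)
  note Kn = K[folded n(2)]
  have ms: "moderately_small (oplax (Src m) (pre K m))" "is_functor (oplax_proj (Src m) (pre K m))"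
    if "is_functor m" "Tgt m = B" "moderately_small (Src m)" for m
    using that fam_pre[OF K] moderately_small_oplax is_functor_oplax_proj by blast+
  fix k assume kI: "k \<in> Ind ?P m h"
  obtain \<phi> where k: "k = Ho (oplax_map K ?n m h \<phi>)" and o: "over ?n m h \<phi>"
    by (rule Ind_oplax_pb[OF m[unfolded oplax_pb_simps] h kI])
  note M = is_functor_oplax_map[OF Kn o]
  show "k \<in> hom hCAT (Pb ?P ?n) (Pb ?P m)"
    using Ho_hom[OF M] ms(1)[OF mf(1,2)] ms(1)[OF n(1,2)] mf n Us Vs by (simp add: k)
  show "Cmp hCAT (Pr1 ?P m) k = Cmp hCAT h (Pr1 ?P ?n)"
    using oplax_proj_map[OF o, of K] M ms[OF mf(1,2)] ms[OF n(1,2)] mf n hf Us Vs by (simp add: k Ho_comp_Ho)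
  show "Cmp hCAT (Pr2 ?P m) k = Pr2 ?P ?n"
    unfolding Pr2_oplax_pb[OF K mf(1,2)] Pr2_oplax_pb[OF K n(1,2)] k
    using M is_functor_pr2[OF K mf(1,2)] Src_pr2[OF K mf(1,2)] Ho_eqI[OF pr2_oplax_map[OF Kn o]]
    by (simp add: Ho_comp_Ho)
qed

section \<open>The dependent adder of very small sets\<close>

lemma SetC_simps [simp]: "Ob SetC = VS" "Dm SetC = vsrc" "Cd SetC = vtgt"
  by (simp_all add: SetC_def)

lemma set_arr_simps [simp]: "vsrc (set_arr X Y h) = X" "vtgt (set_arr X Y h) = Y"
  "x \<in> elts X \<Longrightarrow> vapp (set_arr X Y h) x = h x"
  by (simp_all add: set_arr_def vapp_varr small_elts)

lemma set_arr_cong: "(\<And>x. x \<in> elts X \<Longrightarrow> h x = h' x) \<Longrightarrow> set_arr X Y h = set_arr X Y h'"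
  unfolding set_arr_def by (rule varr_cong)

lemma set_arr_hom: "X \<in> VS \<Longrightarrow> Y \<in> VS \<Longrightarrow> h ` elts X \<subseteq> elts Y \<Longrightarrow> set_arr X Y h \<in> hom SetC X Y"
  by (auto simp: hom_iff SetC_def)

lemma
  assumes "f \<in> hom SetC X Y"
  shows set_arr_vapp: "set_arr X Y (vapp f) = f"
    and vapp_elts: "x \<in> elts X \<Longrightarrow> vapp f x \<in> elts Y"
    and SetC_hom_VS: "X \<in> VS" "Y \<in> VS"
proof -
  from assms obtain h where f: "f = set_arr X Y h" "X \<in> VS" "Y \<in> VS" "h ` elts X \<subseteq> elts Y"
    by (auto simp: hom_iff SetC_def)
  then show "X \<in> VS" "Y \<in> VS" "x \<in> elts X \<Longrightarrow> vapp f x \<in> elts Y" by auto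
  show "set_arr X Y (vapp f) = f" unfolding f(1) by (rule set_arr_cong) simp
qed

lemma SetC_eqI:
  "f \<in> hom SetC X Y \<Longrightarrow> g \<in> hom SetC X Y \<Longrightarrow> (\<And>x. x \<in> elts X \<Longrightarrow> vapp f x = vapp g x) \<Longrightarrow> f = g"
  using set_arr_vapp set_arr_cong by metis

lemma SetC_Idn: "Idn SetC X = set_arr X X id"
  by (simp add: SetC_def)

lemma SetC_Cmp: "f \<in> hom SetC X Y \<Longrightarrow> g \<in> hom SetC Y Z \<Longrightarrow> Cmp SetC g f = set_arr X Z (vapp g \<circ> vapp f)"
  by (simp add: SetC_def hom_iff)

lemma category_SetC: "category SetC"
proof (rule categoryI)
  show "Dm SetC f \<in> Ob SetC \<and> Cd SetC f \<in> Ob SetC" if "f \<in> Ar SetC" for f :: 'a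
    using SetC_hom_VS[OF Ar_hom[OF that]] by simp
  show I: "Idn SetC X \<in> hom SetC X X" if "X \<in> Ob SetC" for X :: 'a
    using that by (simp add: SetC_Idn set_arr_hom)
  show c: "Cmp SetC g f \<in> hom SetC X Z" if "f \<in> hom SetC X Y" "g \<in> hom SetC Y Z" for f g X Y Z :: 'a
    unfolding SetC_Cmp[OF that]
    by (rule set_arr_hom[OF SetC_hom_VS(1)[OF that(1)] SetC_hom_VS(2)[OF that(2)]])
      (auto intro!: vapp_elts[OF that(2)] vapp_elts[OF that(1)])
  fix X Y f :: 'a assume f: "f \<in> hom SetC X Y"
  then have o: "X \<in> VS" "Y \<in> VS" by (rule SetC_hom_VS)+
  show "Cmp SetC f (Idn SetC X) = f"
    by (rule SetC_eqI[OF c[OF I f] f]) (simp_all add: o SetC_Cmp[OF I f], simp add: SetC_Idn)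
  show "Cmp SetC (Idn SetC Y) f = f"
    by (rule SetC_eqI[OF c[OF f I] f]) (simp_all add: o SetC_Cmp[OF f I], simp add: SetC_Idn vapp_elts[OF f])
  fix g h Z W assume g: "g \<in> hom SetC Y Z" and h: "h \<in> hom SetC Z W"
  show "Cmp SetC h (Cmp SetC g f) = Cmp SetC (Cmp SetC h g) f"
    by (rule SetC_eqI[OF c[OF c[OF f g] h] c[OF f c[OF g h]]])
      (simp add: SetC_Cmp[OF c[OF f g] h] SetC_Cmp[OF f c[OF g h]], simp add: SetC_Cmp[OF f g] SetC_Cmp[OF g h] vapp_elts[OF f])
qed

lemma moderately_small_VS: "Ob I \<subseteq> VS \<Longrightarrow> Ar I \<subseteq> VS \<Longrightarrow> moderately_small I"
  using small_VS_subset by (auto simp: moderately_small_def small_def)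

lemma moderately_small_SetC: "moderately_small SetC"
proof (rule moderately_small_VS)
  show "Ar SetC \<subseteq> (VS::'a set)"
  proof
    fix f :: 'a assume "f \<in> Ar SetC"
    then obtain X Y h where "f = set_arr X Y h" "X \<in> VS" "Y \<in> VS" "h ` elts X \<subseteq> elts Y"
      by (auto simp: SetC_def)
    then show "f \<in> VS"
      unfolding set_arr_def using vsmall_elts vsmall_subset_VS by (metis order_trans varr_VS)
  qed
qed simp

lemma SetC_invertible:
  assumes f: "f \<in> hom SetC X Y"
  shows "invertible SetC f \<longleftrightarrow> bij_betw (vapp f) (elts X) (elts Y)"
proof
  note o = SetC_hom_VS[OF f]
  assume i: "invertible SetC f"
  let ?g = "arr_inv SetC f"
  note g = arr_inv_hom[OF i f]
  have "vapp ?g (vapp f x) = x" if "x \<in> elts X" for x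
    using arg_cong[OF arr_inv_left[OF i f], of "\<lambda>k. vapp k x"] that by (simp add: SetC_Cmp[OF f g]) (simp add: SetC_Idn)
  moreover have "vapp f (vapp ?g x) = x" if "x \<in> elts Y" for x
    using arg_cong[OF arr_inv_right[OF i f], of "\<lambda>k. vapp k x"] that by (simp add: SetC_Cmp[OF g f]) (simp add: SetC_Idn)
  ultimately show "bij_betw (vapp f) (elts X) (elts Y)"
    using vapp_elts[OF f] vapp_elts[OF g] by (intro bij_betw_byWitness[where f' = "vapp ?g"]) auto
next
  note o = SetC_hom_VS[OF f]
  assume b: "bij_betw (vapp f) (elts X) (elts Y)"
  let ?k = "inv_into (elts X) (vapp f)"
  let ?g = "set_arr Y X ?k"
  have k: "?k y \<in> elts X" "vapp f (?k y) = y" if "y \<in> elts Y" for y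
    using b that by (auto simp: bij_betw_def inv_into_into f_inv_into_f)
  have k': "?k (vapp f x) = x" if "x \<in> elts X" for x
    using b that by (auto simp: bij_betw_def)
  have g: "?g \<in> hom SetC Y X" using o k by (intro set_arr_hom) auto
  show "invertible SetC f"
  proof (rule invertibleI[OF f g])
    show "Cmp SetC ?g f = Idn SetC X"
      unfolding SetC_Cmp[OF f g] SetC_Idn by (rule set_arr_cong) (simp add: vapp_elts[OF f] k')
    show "Cmp SetC f ?g = Idn SetC Y"
      unfolding SetC_Cmp[OF g f] SetC_Idn by (rule set_arr_cong) (simp add: k)
  qed
qed

lemma disc_simps [simp]: "Ob (disc X) = elts X" "Ar (disc X) = elts X" "Dm (disc X) x = x" "Cd (disc X) x = x"
  "Idn (disc X) x = x" "Cmp (disc X) g f = f"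
  by (simp_all add: disc_def)

lemma disc_hom [simp]: "z \<in> hom (disc X) x y \<longleftrightarrow> z \<in> elts X \<and> x = z \<and> y = z"
  by (auto simp: hom_iff)

lemma disc_fam_simps [simp]: "FamO disc_fam X = disc X" "FO (FamA disc_fam f) = vapp f" "FA (FamA disc_fam f) = vapp f"
  "Src (FamA disc_fam f) = disc (vsrc f)" "Tgt (FamA disc_fam f) = disc (vtgt f)"
  by (simp_all add: disc_fam_def)

lemma category_disc: "category (disc X)"
  by (rule categoryI) auto

lemma fam_disc: "fam SetC disc_fam"
  unfolding fam_def
proof (intro conjI ballI allI)
  show "category SetC" by (rule category_SetC)
  fix x :: 'a assume "x \<in> Ob SetC"
  show "category (FamO disc_fam x)" by (simp add: category_disc)
  show "moderately_small (FamO disc_fam x)"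
    using small_elts[of x] by (simp add: moderately_small_def small_def)
  show "fun_eq (id_func (FamO disc_fam x)) (FamA disc_fam (Idn SetC x))"
    by (simp add: fun_eq_def SetC_Idn)
next
  fix x y \<alpha> :: 'a assume a: "\<alpha> \<in> hom SetC x y"
  then have st: "vsrc \<alpha> = x" "vtgt \<alpha> = y" by (auto simp: hom_iff)
  then show "is_functor (FamA disc_fam \<alpha>)" "Src (FamA disc_fam \<alpha>) = FamO disc_fam x" "Tgt (FamA disc_fam \<alpha>) = FamO disc_fam y"
    using vapp_elts[OF a] by (auto simp: is_functor_def category_disc)
  fix z \<beta> assume b: "\<beta> \<in> hom SetC y z"
  then show "fun_eq (comp_func (FamA disc_fam \<beta>) (FamA disc_fam \<alpha>)) (FamA disc_fam (Cmp SetC \<beta> \<alpha>))"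
    using st by (auto simp: fun_eq_def SetC_Cmp[OF a b] hom_iff)
qed

text \<open>Over a family of discrete categories, an arrow is determined by its source and its base component.\<close>

lemma oplax_disc_homI:
  assumes x: "is_functor x" "Tgt x = SetC" and a: "\<alpha> \<in> hom (Src x) u v" and t: "t \<in> elts (FO x u)"
  shows "oarr t \<alpha> (vapp (FA x \<alpha>) t) \<in> hom (oplax (Src x) (pre disc_fam x)) (vpair u t) (vpair v (vapp (FA x \<alpha>) t))"
  using vapp_elts[OF func_hom[OF x(1) a, unfolded x(2)] t] a t by (intro oplax_homI) auto

lemma oplax_disc_homE:
  assumes "z \<in> hom (oplax (Src x) (pre disc_fam x)) a b"
  obtains u v t \<alpha> where "a = vpair u t" "b = vpair v (vapp (FA x \<alpha>) t)" "z = oarr t \<alpha> (vapp (FA x \<alpha>) t)"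
    "\<alpha> \<in> hom (Src x) u v" "t \<in> elts (FO x u)"
  using assms
proof (rule oplax_homE)
  fix i j i' j' \<alpha> \<beta>
  assume "a = vpair i j" "b = vpair i' j'" "z = oarr j \<alpha> \<beta>" "\<alpha> \<in> hom (Src x) i i'" "j \<in> Ob (FamO (pre disc_fam x) i)"
    "\<beta> \<in> hom (FamO (pre disc_fam x) i') (FO (FamA (pre disc_fam x) \<alpha>) j) j'"
  then show thesis by (intro that[of i j i' \<alpha>]) auto
qed

lemma
  assumes "is_functor f" "Tgt f = SetC"
  shows vapp_func_elts: "\<alpha> \<in> hom (Src f) u v \<Longrightarrow> t \<in> elts (FO f u) \<Longrightarrow> vapp (FA f \<alpha>) t \<in> elts (FO f v)"
    and vapp_func_Idn: "u \<in> Ob (Src f) \<Longrightarrow> t \<in> elts (FO f u) \<Longrightarrow> vapp (FA f (Idn (Src f) u)) t = t"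
    and vapp_func_Cmp: "\<alpha> \<in> hom (Src f) u v \<Longrightarrow> \<beta> \<in> hom (Src f) v w \<Longrightarrow> t \<in> elts (FO f u) \<Longrightarrow>
      vapp (FA f (Cmp (Src f) \<beta> \<alpha>)) t = vapp (FA f \<beta>) (vapp (FA f \<alpha>) t)"
    and func_VS: "u \<in> Ob (Src f) \<Longrightarrow> FO f u \<in> VS"
proof -
  note h = func_hom[OF assms(1), unfolded assms(2)]
  show "\<alpha> \<in> hom (Src f) u v \<Longrightarrow> t \<in> elts (FO f u) \<Longrightarrow> vapp (FA f \<alpha>) t \<in> elts (FO f v)"
    using vapp_elts[OF h] by blast
  show "u \<in> Ob (Src f) \<Longrightarrow> t \<in> elts (FO f u) \<Longrightarrow> vapp (FA f (Idn (Src f) u)) t = t"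
    using func_Idn[OF assms(1)] by (simp add: assms(2) SetC_Idn)
  show "\<alpha> \<in> hom (Src f) u v \<Longrightarrow> \<beta> \<in> hom (Src f) v w \<Longrightarrow> t \<in> elts (FO f u) \<Longrightarrow>
      vapp (FA f (Cmp (Src f) \<beta> \<alpha>)) t = vapp (FA f \<beta>) (vapp (FA f \<alpha>) t)"
    using func_Cmp[OF assms(1)] by (simp add: assms(2) SetC_Cmp[OF h h])
  show "u \<in> Ob (Src f) \<Longrightarrow> FO f u \<in> VS"
    using func_Ob[OF assms(1)] assms(2) by simp
qed

lemma set_sum_fun_simps [simp]: "Src (set_sum_fun x f) = Src x" "Tgt (set_sum_fun x f) = SetC"
  by (simp_all add: set_sum_fun_def)

lemma set_sum_fun_FO: "FO (set_sum_fun x f) u = vset (vsigma (FO x u) (\<lambda>t. FO f (vpair u t)))"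
  by (simp add: set_sum_fun_def vsigma_def)

lemma set_sum_fun_FA: "\<alpha> \<in> hom (Src x) u v \<Longrightarrow> FA (set_sum_fun x f) \<alpha> =
    set_arr (FO (set_sum_fun x f) u) (FO (set_sum_fun x f) v)
     (\<lambda>w. vpair (vapp (FA x \<alpha>) (vfst w)) (vapp (FA f (oarr (vfst w) \<alpha> (vapp (FA x \<alpha>) (vfst w)))) (vsnd w)))"
  by (simp add: set_sum_fun_def Let_def hom_iff)

lemma elts_set_sum: "elts (FO (set_sum_fun x f) u) = vsigma (FO x u) (\<lambda>t. FO f (vpair u t))"
  by (simp add: set_sum_fun_FO elts_vset)

lemma vpair_elts_set_sum [simp]: "vpair t s \<in> elts (FO (set_sum_fun x f) u) \<longleftrightarrow> t \<in> elts (FO x u) \<and> s \<in> elts (FO f (vpair u t))"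
  by (simp add: elts_set_sum vsigma_def)

lemma vapp_set_sum: "\<alpha> \<in> hom (Src x) u v \<Longrightarrow> t \<in> elts (FO x u) \<Longrightarrow> s \<in> elts (FO f (vpair u t)) \<Longrightarrow>
    vapp (FA (set_sum_fun x f) \<alpha>) (vpair t s) =
    vpair (vapp (FA x \<alpha>) t) (vapp (FA f (oarr t \<alpha> (vapp (FA x \<alpha>) t))) s)"
  by (simp add: set_sum_fun_FA)

lemma is_functor_set_sum:
  assumes x: "is_functor x" "Tgt x = SetC"
    and f: "is_functor f" "Tgt f = SetC" "Src f = oplax (Src x) (pre disc_fam x)"
  shows "is_functor (set_sum_fun x f)"
proof (rule is_functorI)
  let ?S = "set_sum_fun x f"
  note C = func_Src[OF x(1)]
  note lift = oplax_disc_homI[OF x]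
  show "category (Src ?S)" "category (Tgt ?S)" using C by (auto simp: category_SetC)
  have O: "FO ?S u \<in> VS" if "u \<in> Ob (Src x)" for u
    unfolding set_sum_fun_FO using func_VS[OF x that] that func_VS[OF f(1,2)]
    by (intro vset_VS_I vsmall_vsigma) (auto simp: f(3))
  then show "FO ?S u \<in> Ob (Tgt ?S)" if "u \<in> Ob (Src ?S)" for u using that by simp
  show A: "FA ?S \<alpha> \<in> hom (Tgt ?S) (FO ?S u) (FO ?S v)" if "\<alpha> \<in> hom (Src ?S) u v" for \<alpha> u v
  proof -
    have a: "\<alpha> \<in> hom (Src x) u v" using that by simp
    show ?thesis
      unfolding set_sum_fun_FA[OF a]
      using O[OF hom_Ob1[OF C a]] O[OF hom_Ob2[OF C a]] vapp_func_elts[OF x a]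
        vapp_func_elts[OF f(1,2), unfolded f(3), OF lift[OF a]]
      by (auto intro!: set_arr_hom simp: elts_set_sum vsigma_def)
  qed
  show "FA ?S (Idn (Src ?S) u) = Idn (Tgt ?S) (FO ?S u)" if "u \<in> Ob (Src ?S)" for u
  proof -
    have u: "u \<in> Ob (Src x)" using that by simp
    have "vapp (FA f (oarr t (Idn (Src x) u) t)) s = s" if "t \<in> elts (FO x u)" "s \<in> elts (FO f (vpair u t))" for t s
      using vapp_func_Idn[OF f(1,2), of "vpair u t" s] that u by (simp add: f(3))
    then show ?thesis
      unfolding set_sum_fun_simps SetC_Idn set_sum_fun_FA[OF cat_id[OF C u]]
      using vapp_func_Idn[OF x u] by (intro set_arr_cong) (auto simp: elts_set_sum vsigma_def)
  qed
  fix \<alpha> \<beta> u v w assume "\<alpha> \<in> hom (Src ?S) u v" "\<beta> \<in> hom (Src ?S) v w"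
  then have a: "\<alpha> \<in> hom (Src x) u v" and b: "\<beta> \<in> hom (Src x) v w" by auto
  note S = A[of \<alpha> u v, simplified, OF a] A[of \<beta> v w, simplified, OF b]
  have "vapp (FA f (oarr t (Cmp (Src x) \<beta> \<alpha>) (vapp (FA x (Cmp (Src x) \<beta> \<alpha>)) t))) s =
      vapp (FA f (oarr (vapp (FA x \<alpha>) t) \<beta> (vapp (FA x \<beta>) (vapp (FA x \<alpha>) t)))) (vapp (FA f (oarr t \<alpha> (vapp (FA x \<alpha>) t))) s)"
    if t: "t \<in> elts (FO x u)" "s \<in> elts (FO f (vpair u t))" for t s
    using vapp_func_Cmp[OF f(1,2), unfolded f(3), OF lift[OF a t(1)] lift[OF b vapp_func_elts[OF x a t(1)]] t(2)]
    by (simp add: oplax_Cmp[OF b] vapp_func_Cmp[OF x a b t(1)])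
  then show "FA ?S (Cmp (Src ?S) \<beta> \<alpha>) = Cmp (Tgt ?S) (FA ?S \<beta>) (FA ?S \<alpha>)"
    unfolding set_sum_fun_simps SetC_Cmp[OF S] set_sum_fun_FA[OF cat_comp[OF C a b]]
    using vapp_func_Cmp[OF x a b] vapp_func_elts[OF x a] vapp_func_elts[OF f(1,2), unfolded f(3), OF lift[OF a]]
    by (intro set_arr_cong) (auto simp: elts_set_sum vsigma_def vapp_set_sum[OF a] vapp_set_sum[OF b])
qed

lemma set_flat_fun_simps [simp]: "Src (set_flat_fun x f) = oplax (Src f) (pre disc_fam f)"
  "Tgt (set_flat_fun x f) = oplax (Src x) (pre disc_fam (set_sum_fun x f))"
  "FO (set_flat_fun x f) (vpair (vpair u t) s) = vpair u (vpair t s)"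
  by (simp_all add: set_flat_fun_def Let_def)

lemma set_flat_fun_FA: 
  "oarr t \<alpha> b \<in> hom (Src f) (vpair u t) (vpair v b) \<Longrightarrow> 
    FA (set_flat_fun x f) (oarr s (oarr t \<alpha> b) c) = oarr (vpair t s) \<alpha> (vpair b c)"
  by (simp add: set_flat_fun_def Let_def hom_iff)

lemma is_functor_set_flat:
  assumes x: "is_functor x" "Tgt x = SetC"
    and f: "is_functor f" "Tgt f = SetC" "Src f = oplax (Src x) (pre disc_fam x)"
  shows "is_functor (set_flat_fun x f)"
proof (rule is_functorI)
  let ?S = "set_sum_fun x f" and ?F = "set_flat_fun x f"
  note C = func_Src[OF x(1)]
  note S = is_functor_set_sum[OF x f]
  show "category (Src ?F)" "category (Tgt ?F)"
    using category_oplax[OF fam_pre[OF fam_disc f(1,2)]] category_oplax[OF fam_pre[OF fam_disc S]] by simp_all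
  show "FO ?F a \<in> Ob (Tgt ?F)" "FA ?F (Idn (Src ?F) a) = Idn (Tgt ?F) (FO ?F a)" if "a \<in> Ob (Src ?F)" for a
  proof -
    from that f(3) obtain u t s where a: "a = vpair (vpair u t) s" "u \<in> Ob (Src x)" "t \<in> elts (FO x u)" "s \<in> elts (FO f (vpair u t))"
      by (auto simp: oplax_Ob)
    then show "FO ?F a \<in> Ob (Tgt ?F)" by simp
    have "vpair u t \<in> Ob (Src f)" using a f(3) by simp
    from cat_id[OF func_Src[OF f(1)] this] show "FA ?F (Idn (Src ?F) a) = Idn (Tgt ?F) (FO ?F a)"
      using set_flat_fun_FA[of t "Idn (Src x) u" t f u u x s s] a by (simp add: f(3))
  qed
  have E: thesis if z: "z \<in> hom (Src ?F) a b"
    and th: "\<And>u t s v \<alpha> t' s'. a = vpair (vpair u t) s \<Longrightarrow> z = oarr s (oarr t \<alpha> t') s' \<Longrightarrow> b = vpair (vpair v t') s' \<Longrightarrow>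
      \<alpha> \<in> hom (Src x) u v \<Longrightarrow> t \<in> elts (FO x u) \<Longrightarrow> s \<in> elts (FO f (vpair u t)) \<Longrightarrow>
      t' = vapp (FA x \<alpha>) t \<Longrightarrow> s' = vapp (FA f (oarr t \<alpha> t')) s \<Longrightarrow>
      oarr t \<alpha> t' \<in> hom (Src f) (vpair u t) (vpair v t') \<Longrightarrow> thesis" for z a b thesis
    using z unfolding set_flat_fun_simps
  proof (rule oplax_disc_homE)
    fix p q s \<zeta> assume 1: "a = vpair p s" "b = vpair q (vapp (FA f \<zeta>) s)" "z = oarr s \<zeta> (vapp (FA f \<zeta>) s)"
      and z: "\<zeta> \<in> hom (Src f) p q" and s: "s \<in> elts (FO f p)"
    from z[unfolded f(3)] show thesis
      by (rule oplax_disc_homE) (use z s th 1 f(3) in auto)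
  qed
  show A: "FA ?F z \<in> hom (Tgt ?F) (FO ?F a) (FO ?F b)" if z: "z \<in> hom (Src ?F) a b" for z a b
  proof (rule E[OF z])
    fix u t s v \<alpha> t' s'
    assume a: "a = vpair (vpair u t) s" "z = oarr s (oarr t \<alpha> t') s'" "b = vpair (vpair v t') s'"
      and al: "\<alpha> \<in> hom (Src x) u v" and t: "t \<in> elts (FO x u)" and s: "s \<in> elts (FO f (vpair u t))"
      and t': "t' = vapp (FA x \<alpha>) t" and s': "s' = vapp (FA f (oarr t \<alpha> t')) s"
      and l: "oarr t \<alpha> t' \<in> hom (Src f) (vpair u t) (vpair v t')"
    have "oarr (vpair t s) \<alpha> (vapp (FA ?S \<alpha>) (vpair t s)) \<in> hom (oplax (Src ?S) (pre disc_fam ?S)) (vpair u (vpair t s)) (vpair v (vapp (FA ?S \<alpha>) (vpair t s)))"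
      using al t s by (intro oplax_disc_homI[OF S]) simp_all
    then show ?thesis
      using a set_flat_fun_FA[OF l] by (simp add: vapp_set_sum[OF al t s] t' s')
  qed
  fix z z' a b c assume z: "z \<in> hom (Src ?F) a b" and z': "z' \<in> hom (Src ?F) b c"
  show "FA ?F (Cmp (Src ?F) z' z) = Cmp (Tgt ?F) (FA ?F z') (FA ?F z)"
  proof (rule E[OF z], rule E[OF z'])
    fix u t s v \<alpha> t' s' u1 t1 s1 v1 \<alpha>1 t1' s1'
    assume a: "a = vpair (vpair u t) s" "z = oarr s (oarr t \<alpha> t') s'" "b = vpair (vpair v t') s'"
      and al: "\<alpha> \<in> hom (Src x) u v" and t: "t \<in> elts (FO x u)" and s: "s \<in> elts (FO f (vpair u t))"
      and t': "t' = vapp (FA x \<alpha>) t" and s': "s' = vapp (FA f (oarr t \<alpha> t')) s"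
      and l: "oarr t \<alpha> t' \<in> hom (Src f) (vpair u t) (vpair v t')"
    assume "b = vpair (vpair u1 t1) s1" "z' = oarr s1 (oarr t1 \<alpha>1 t1') s1'" "c = vpair (vpair v1 t1') s1'"
      and "\<alpha>1 \<in> hom (Src x) u1 v1" and "t1 \<in> elts (FO x u1)" and "s1 \<in> elts (FO f (vpair u1 t1))"
      and "t1' = vapp (FA x \<alpha>1) t1" and "s1' = vapp (FA f (oarr t1 \<alpha>1 t1')) s1"
      and "oarr t1 \<alpha>1 t1' \<in> hom (Src f) (vpair u1 t1) (vpair v1 t1')"
    then have a1: "z' = oarr s' (oarr t' \<alpha>1 t1') s1'"
      and al1: "\<alpha>1 \<in> hom (Src x) v v1" and t1: "t' \<in> elts (FO x v)" and s1: "s' \<in> elts (FO f (vpair v t'))"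
      and t1': "t1' = vapp (FA x \<alpha>1) t'" and s1': "s1' = vapp (FA f (oarr t' \<alpha>1 t1')) s'"
      and l1: "oarr t' \<alpha>1 t1' \<in> hom (Src f) (vpair v t') (vpair v1 t1')"
      using a(3) by auto
    have c: "Cmp (Src f) (oarr t' \<alpha>1 t1') (oarr t \<alpha> t') = oarr t (Cmp (Src x) \<alpha>1 \<alpha>) t1'"
      by (simp add: f(3) oplax_Cmp[OF al1] t1')
    have lc: "oarr t (Cmp (Src x) \<alpha>1 \<alpha>) t1' \<in> hom (Src f) (vpair u t) (vpair v1 t1')"
      using cat_comp[OF func_Src[OF f(1)] l l1] unfolding c .
    have "Cmp (Src ?F) z' z = oarr s (oarr t (Cmp (Src x) \<alpha>1 \<alpha>) t1') s1'"
      by (simp add: a(2) a1 oplax_Cmp[OF l1] c s1')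
    moreover have "Cmp (oplax (Src x) (pre disc_fam ?S)) (oarr (vpair t' s') \<alpha>1 (vpair t1' s1')) (oarr (vpair t s) \<alpha> (vpair t' s')) =
        oarr (vpair t s) (Cmp (Src x) \<alpha>1 \<alpha>) (vpair t1' s1')"
      by (simp add: oplax_Cmp[OF al1] vapp_set_sum[OF al1 t1 s1] t1'[symmetric] s1'[symmetric])
    ultimately show ?thesis
      by (simp add: a(2) a1 set_flat_fun_FA[OF l] set_flat_fun_FA[OF l1] set_flat_fun_FA[OF lc])
  qed
qed

lemma oplax_proj_set_flat:
  assumes "Src f = oplax (Src x) (pre disc_fam x)"
  shows "comp_func (oplax_proj (Src x) (pre disc_fam (set_sum_fun x f))) (set_flat_fun x f) =
    comp_func (oplax_proj (Src x) (pre disc_fam x)) (oplax_proj (Src f) (pre disc_fam f))"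
  using assms by (auto simp: comp_func_def oplax_proj_def set_flat_fun_def Let_def)

text \<open>The common form of the two flattening arrows: an explicit flattening functor \<open>F\<close> to the oplax colimit
  of \<open>S\<close>, corrected by the passage from \<open>S\<close> to its representative.\<close>

definition flat_arr :: "'u::two_universes fam \<Rightarrow> 'u func \<Rightarrow> 'u func \<Rightarrow> 'u func" where
  "flat_arr K S F = comp_func (oplax_map K S (Ho S) (id_func (Src S)) (Ho_iso S)) F"

lemma over_Ho: "is_functor S \<Longrightarrow> over S (Ho S) (id_func (Src S)) (Ho_iso S)"
  by (rule over_id[OF Ho_nat_iso])

lemma
  assumes K: "fam B K" and S: "is_functor S" "Tgt S = B"
    and F: "is_functor F" "Tgt F = oplax (Src S) (pre K S)"
  shows is_functor_flat_arr: "is_functor (flat_arr K S F)"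
    and flat_arr_Src: "Src (flat_arr K S F) = Src F"
    and flat_arr_Tgt: "Tgt (flat_arr K S F) = oplax (Src S) (pre K (Ho S))"
    and oplax_proj_flat_arr: "comp_func (oplax_proj (Src S) (pre K (Ho S))) (flat_arr K S F) =
      comp_func (oplax_proj (Src S) (pre K S)) F"
proof -
  note o = over_Ho[OF S(1)]
  show "is_functor (flat_arr K S F)"
    using is_functor_comp[OF F(1) is_functor_oplax_map[OF _ o]] K S F by (simp add: flat_arr_def)
  show "Src (flat_arr K S F) = Src F" "Tgt (flat_arr K S F) = oplax (Src S) (pre K (Ho S))"
    by (simp_all add: flat_arr_def Src_Ho[OF S(1)])
  show "comp_func (oplax_proj (Src S) (pre K (Ho S))) (flat_arr K S F) =
      comp_func (oplax_proj (Src S) (pre K S)) F"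
    using oplax_proj_map[OF o, of K] by (simp add: flat_arr_def Src_Ho[OF S(1)] comp_func_assoc comp_id_left)
qed

lemma Ho_flat_arr:
  assumes K: "fam B K" and S: "is_functor S" "Tgt S = B" "Src S = U"
    and F: "is_functor F" "Src F = E" "Tgt F = oplax U (pre K S)"
    and s: "moderately_small E" "moderately_small U"
  shows "Ho (flat_arr K S F) \<in> hom hCAT E (Pb (oplax_pb B K) (Ho S))"
    and "Cmp hCAT (Pr1 (oplax_pb B K) (Ho S)) (Ho (flat_arr K S F)) = Ho (comp_func (oplax_proj U (pre K S)) F)"
proof -
  note 1 = is_functor_flat_arr[OF K S(1,2) F(1) F(3)[folded S(3)]] flat_arr_Src[OF K S(1,2) F(1) F(3)[folded S(3)]]
    flat_arr_Tgt[OF K S(1,2) F(1) F(3)[folded S(3)]] oplax_proj_flat_arr[OF K S(1,2) F(1) F(3)[folded S(3)]]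
  have h: "is_functor (Ho S)" "Tgt (Ho S) = B" "Src (Ho S) = U"
    using S by (auto simp: is_functor_Ho Src_Ho Tgt_Ho)
  have KH: "fam U (pre K (Ho S))" using fam_pre[OF K h(1,2)] h by simp
  show "Ho (flat_arr K S F) \<in> hom hCAT E (Pb (oplax_pb B K) (Ho S))"
    using Ho_hom[OF 1(1)] 1 F S s moderately_small_oplax[OF KH s(2)] h by simp
  show "Cmp hCAT (Pr1 (oplax_pb B K) (Ho S)) (Ho (flat_arr K S F)) = Ho (comp_func (oplax_proj U (pre K S)) F)"
    using 1 is_functor_oplax_proj[OF KH] h S by (simp add: Ho_comp_Ho)
qed

lemma category_unit: "category unit_cat"
  by (rule categoryI) (auto simp: unit_cat_def hom_iff)

lemma moderately_small_unit: "moderately_small unit_cat"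
  using small_finite[of "{vset {}}"] by (auto simp: moderately_small_def unit_cat_def small_def simp del: small_finite)

definition unit_func :: "'u::two_universes scat \<Rightarrow> 'u func" where
  "unit_func X = \<lparr>Src = X, Tgt = unit_cat, FO = (\<lambda>_. vset {}), FA = (\<lambda>_. vset {})\<rparr>"

lemma is_functor_unit_func: "category X \<Longrightarrow> is_functor (unit_func X)"
  by (simp add: is_functor_def unit_func_def category_unit) (simp add: unit_cat_def hom_iff)

lemma unit_func_unique: assumes "is_functor F" "Tgt F = unit_cat" shows "F \<simeq> unit_func (Src F)"
proof -
  have "FO F x = vset {}" if "x \<in> Ob (Src F)" for x
    using func_Ob[OF assms(1) that] assms(2) by (simp add: unit_cat_def)
  moreover have "FA F a = vset {}" if "a \<in> Ar (Src F)" for a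
    using func_hom[OF assms(1) Ar_hom[OF that]] assms(2) by (simp add: unit_cat_def hom_iff)
  ultimately have "fun_eq F (unit_func (Src F))" using assms by (simp add: fun_eq_def unit_func_def)
  then show ?thesis using assms fun_eq_iso by blast
qed

lemma hom_unit: "X \<in> Ob hCAT \<Longrightarrow> f \<in> hom hCAT X unit_cat \<longleftrightarrow> f = Ho (unit_func X)"
proof
  assume X: "X \<in> Ob hCAT"
  have "Ho (unit_func X) \<in> hom hCAT (Src (unit_func X)) (Tgt (unit_func X))"
    using X moderately_small_unit
    by (intro Ho_hom is_functor_unit_func) (simp_all add: unit_func_def)
  then show "f = Ho (unit_func X) \<Longrightarrow> f \<in> hom hCAT X unit_cat" by (simp add: unit_func_def)
  show "f \<in> hom hCAT X unit_cat \<Longrightarrow> f = Ho (unit_func X)"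
    using unit_func_unique Ho_eqI by (fastforce simp: hom_hCAT)
qed

lemma terminal_unit: "terminal hCAT unit_cat"
  unfolding terminal_def
proof (intro conjI ballI)
  show "unit_cat \<in> Ob hCAT" using category_unit moderately_small_unit by simp
  fix X :: "'a scat" assume "X \<in> Ob hCAT"
  then show "\<exists>!f. f \<in> hom hCAT X unit_cat" using hom_unit[of X] by (intro ex1I[of _ "Ho (unit_func X)"]) auto
qed

definition point_func :: "'u::two_universes scat \<Rightarrow> 'u \<Rightarrow> 'u func" where
  "point_func C x = \<lparr>Src = unit_cat, Tgt = C, FO = (\<lambda>_. x), FA = (\<lambda>_. Idn C x)\<rparr>"

lemma is_functor_point: "category C \<Longrightarrow> x \<in> Ob C \<Longrightarrow> is_functor (point_func C x)"
  using category_unit by (auto simp: is_functor_def point_func_def cat_id cat_idl[OF _ cat_id])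

definition vone :: "'u::two_universes" where "vone = vset {vset {}}"

lemma elts_vone [simp]: "elts vone = {vset {}}" by (simp add: vone_def)

lemma vone_VS: "vone \<in> VS"
  unfolding vone_def by (intro vset_VS_I vsmall_finite) (auto intro!: vset_VS_I)

lemma one_Ob: "vpair vone (vset {}) \<in> Ob (oplax SetC disc_fam)"
  by (simp add: vone_VS)

lemma Set_adder_simps: "Apb Set_adder = oplax_pb SetC disc_fam" "Aterm Set_adder = unit_cat"
  "Aone Set_adder = Ho (point_func (oplax SetC disc_fam) (vpair vone (vset {})))"
  "Asum Set_adder x f = Ho (set_sum_fun x f)"
  "Aflat Set_adder x f = Ho (flat_arr disc_fam (set_sum_fun x f) (set_flat_fun x f))"
  by (simp_all add: Set_adder_def point_func_def vone_def flat_arr_def Let_def)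

theorem adder_data_Set: "adder_data hCAT Set_adder"
  unfolding adder_data_def Set_adder_simps oplax_pb_simps
proof (intro conjI ballI)
  show "pb_system hCAT (oplax_pb SetC disc_fam)"
    by (rule pb_system_oplax[OF fam_disc moderately_small_SetC])
  show "terminal hCAT unit_cat" by (rule terminal_unit)
  show "Ho (point_func (oplax SetC disc_fam) (vpair vone (vset {}))) \<in> hom hCAT unit_cat (oplax SetC disc_fam)"
    using Ho_hom[OF is_functor_point[OF category_oplax[OF fam_disc] one_Ob]] moderately_small_unit
      moderately_small_oplax[OF fam_disc moderately_small_SetC] by (simp add: point_func_def)
  fix U x f assume "U \<in> Ob hCAT" and "x \<in> hom hCAT U SetC" and "f \<in> hom hCAT (oplax (Src x) (pre disc_fam x)) SetC"
  then have x: "is_functor x" "Tgt x = SetC" and xs: "Src x = U" and U: "moderately_small U"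
    and f: "is_functor f" "Tgt f = SetC" "Src f = oplax (Src x) (pre disc_fam x)"
    by (auto simp: hom_hCAT)
  note S = is_functor_set_sum[OF x f]
  note Kx = fam_pre[OF fam_disc x] and Kf = fam_pre[OF fam_disc f(1,2)]
  have sx: "moderately_small (oplax (Src x) (pre disc_fam x))" using moderately_small_oplax[OF Kx] U xs by simp
  have sf: "moderately_small (oplax (Src f) (pre disc_fam f))" using moderately_small_oplax[OF Kf] sx f(3) by simp
  show "Ho (set_sum_fun x f) \<in> hom hCAT U SetC"
    using Ho_hom[OF S] U xs moderately_small_SetC by simp
  have FT: "Tgt (set_flat_fun x f) = oplax U (pre disc_fam (set_sum_fun x f))" using xs by simp
  have SU: "Src (set_sum_fun x f) = U" using xs by simp
  note F = Ho_flat_arr[OF fam_disc S set_sum_fun_simps(2) SU is_functor_set_flat[OF x f] set_flat_fun_simps(1) FT sf U]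
  show "Ho (flat_arr disc_fam (set_sum_fun x f) (set_flat_fun x f))
      \<in> hom hCAT (oplax (Src f) (pre disc_fam f)) (oplax (Src (Ho (set_sum_fun x f))) (pre disc_fam (Ho (set_sum_fun x f))))"
    using F(1) by simp
  show "Cmp hCAT (Ho (oplax_proj (Src (Ho (set_sum_fun x f))) (pre disc_fam (Ho (set_sum_fun x f)))))
      (Ho (flat_arr disc_fam (set_sum_fun x f) (set_flat_fun x f))) =
      Cmp hCAT (Ho (oplax_proj (Src x) (pre disc_fam x))) (Ho (oplax_proj (Src f) (pre disc_fam f)))"
    using F(2) oplax_proj_set_flat[OF f(3)] is_functor_oplax_proj[OF Kx] is_functor_oplax_proj[OF Kf] f(3) xs
    by (simp add: Ho_comp_Ho)
qed

section \<open>Etale spaces\<close>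

text \<open>Presheaves with very small values on a very small space; this makes the germs and hence the etale
  space very small.\<close>

definition psh :: "'u::two_universes presheaf \<Rightarrow> bool" where
  "psh F \<longleftrightarrow> vsmall (topspace (Spc F)) \<and> (\<forall>U. openin (Spc F) U \<longrightarrow> vsmall (Sec F U)) \<and>
     (\<forall>U V s. openin (Spc F) U \<longrightarrow> openin (Spc F) V \<longrightarrow> V \<subseteq> U \<longrightarrow> s \<in> Sec F U \<longrightarrow> Res F U V s \<in> Sec F V) \<and>
     (\<forall>U s. openin (Spc F) U \<longrightarrow> s \<in> Sec F U \<longrightarrow> Res F U U s = s) \<and>
     (\<forall>U V W s. openin (Spc F) U \<longrightarrow> openin (Spc F) V \<longrightarrow> openin (Spc F) W \<longrightarrow> V \<subseteq> U \<longrightarrow> W \<subseteq> V \<longrightarrow> s \<in> Sec F U \<longrightarrow>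
        Res F V W (Res F U V s) = Res F U W s)"

lemma
  assumes "psh F"
  shows psh_vsmall: "vsmall (topspace (Spc F))"
    and psh_Sec: "openin (Spc F) U \<Longrightarrow> vsmall (Sec F U)"
    and psh_Res: "openin (Spc F) U \<Longrightarrow> openin (Spc F) V \<Longrightarrow> V \<subseteq> U \<Longrightarrow> s \<in> Sec F U \<Longrightarrow> Res F U V s \<in> Sec F V"
    and psh_Res_refl: "openin (Spc F) U \<Longrightarrow> s \<in> Sec F U \<Longrightarrow> Res F U U s = s"
    and psh_Res_Res: "openin (Spc F) U \<Longrightarrow> openin (Spc F) V \<Longrightarrow> openin (Spc F) W \<Longrightarrow> V \<subseteq> U \<Longrightarrow> W \<subseteq> V \<Longrightarrow> s \<in> Sec F U \<Longrightarrow>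
      Res F V W (Res F U V s) = Res F U W s"
  using assms unfolding psh_def by auto

text \<open>The germs are treated through their representatives: \<open>same_germ\<close> relates two local sections near \<open>x\<close>.\<close>

definition sect :: "'u::two_universes presheaf \<Rightarrow> 'u \<Rightarrow> 'u set \<Rightarrow> 'u \<Rightarrow> bool" where
  "sect F x U s \<longleftrightarrow> openin (Spc F) U \<and> x \<in> U \<and> s \<in> Sec F U"

definition same_germ :: "'u::two_universes presheaf \<Rightarrow> 'u \<Rightarrow> 'u set \<Rightarrow> 'u \<Rightarrow> 'u set \<Rightarrow> 'u \<Rightarrow> bool" where
  "same_germ F x U s V t \<longleftrightarrow> (\<exists>W. openin (Spc F) W \<and> x \<in> W \<and> W \<subseteq> U \<inter> V \<and> Res F U W s = Res F V W t)"

lemma sect_restrict: "psh F \<Longrightarrow> sect F x U s \<Longrightarrow> openin (Spc F) V \<Longrightarrow> x \<in> V \<Longrightarrow> V \<subseteq> U \<Longrightarrow> sect F x V (Res F U V s)"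
  by (simp add: sect_def psh_Res)

lemma same_germ_sym: "same_germ F x U s V t \<Longrightarrow> same_germ F x V t U s"
  unfolding same_germ_def by (metis Int_commute)

lemma same_germ_trans:
  assumes F: "psh F" and s: "sect F x U s" and t: "sect F x V t" and r: "sect F x V' r"
    and 1: "same_germ F x U s V t" and 2: "same_germ F x V t V' r"
  shows "same_germ F x U s V' r"
proof -
  from 1 obtain W where W: "openin (Spc F) W" "x \<in> W" "W \<subseteq> U" "W \<subseteq> V" "Res F U W s = Res F V W t"
    by (auto simp: same_germ_def)
  from 2 obtain W' where W': "openin (Spc F) W'" "x \<in> W'" "W' \<subseteq> V" "W' \<subseteq> V'" "Res F V W' t = Res F V' W' r"
    by (auto simp: same_germ_def)
  let ?W = "W \<inter> W'"
  have o: "openin (Spc F) ?W" using W W' by blast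
  note R = psh_Res_Res[OF F]
  have "Res F U ?W s = Res F W ?W (Res F U W s)" using R[of U W ?W s] s o W by (simp add: sect_def)
  also have "\<dots> = Res F V ?W t" using R[of V W ?W t] t o W by (simp add: sect_def)
  also have "\<dots> = Res F W' ?W (Res F V W' t)" using R[of V W' ?W t] t o W' by (simp add: sect_def)
  also have "\<dots> = Res F V' ?W r" using R[of V' W' ?W r] r o W' by (simp add: sect_def)
  finally show ?thesis unfolding same_germ_def using o W W' by (intro exI[of _ ?W]) auto
qed

lemma vsmall_opens: assumes "vsmall (topspace T)" shows "vsmall (vset ` {U. openin T U})"
  by (rule vsmall_subset[OF vsmall_Pow[OF assms]]) (auto dest: openin_subset)

lemma elts_vset_open: "vsmall (topspace T) \<Longrightarrow> openin T U \<Longrightarrow> elts (vset U) = U"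
  by (rule elts_vset) (metis openin_subset small_subset vsmall_small)

definition germ_set :: "'u::two_universes presheaf \<Rightarrow> 'u \<Rightarrow> 'u set \<Rightarrow> 'u \<Rightarrow> 'u set" where
  "germ_set F x U s = {vpair (vset V) t | V t. sect F x V t \<and> same_germ F x U s V t}"

lemma germ_eq_vset: "germ F x U s = vset (germ_set F x U s)"
  by (simp add: germ_def germ_set_def sect_def same_germ_def conj_assoc)

lemma vsmall_germ_set: assumes F: "psh F" shows "vsmall (germ_set F x U s)"
proof (rule vsmall_subset)
  let ?O = "vset ` {U. openin (Spc F) U}"
  note v = psh_vsmall[OF F]
  show "vsmall (\<Union>v\<in>?O. vpair v ` Sec F (elts v))"
  proof (rule vsmall_UNION[OF vsmall_opens[OF v]])
    fix o' assume o': "o' \<in> ?O"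
    then have s: "vsmall (Sec F (elts o'))" using psh_Sec[OF F] elts_vset_open[OF v] by auto
    moreover have "o' \<in> VS" using o' vsmallD[OF vsmall_opens[OF v]] by blast
    ultimately show "vsmall (vpair o' ` Sec F (elts o'))" by (intro vsmall_image) (auto dest: vsmallD)
  qed
  show "germ_set F x U s \<subseteq> (\<Union>v\<in>?O. vpair v ` Sec F (elts v))"
    by (auto simp: germ_set_def sect_def elts_vset_open[OF v])
qed

text \<open>A germ is the class of all its representatives, so this expresses that \<open>same_germ\<close> is an equivalence
  relation; transitivity restricts to the intersection of two neighbourhoods.  Smallness enters
  because a class has to be recovered from its code.\<close>

lemma germ_eq:
  assumes F: "psh F" and s: "sect F x U s" and t: "sect F x V t"
  shows "germ F x U s = germ F x V t \<longleftrightarrow> same_germ F x U s V t"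
proof
  note v = psh_vsmall[OF F]
  assume "germ F x U s = germ F x V t"
  then have e: "germ_set F x U s = germ_set F x V t"
    unfolding germ_eq_vset by (intro vset_inj vsmall_small vsmall_germ_set F)
  have "same_germ F x V t V t" using t by (auto simp: same_germ_def sect_def)
  then have "vpair (vset V) t \<in> germ_set F x U s" unfolding e using t by (auto simp: germ_set_def)
  then obtain V' where "vset V' = vset V" "openin (Spc F) V'" "same_germ F x U s V' t"
    by (auto simp: germ_set_def sect_def)
  moreover have "V' = V" using calculation t elts_vset_open[OF v] by (metis sect_def)
  ultimately show "same_germ F x U s V t" by simp
next
  assume e: "same_germ F x U s V t"
  have "same_germ F x U s V' t' \<longleftrightarrow> same_germ F x V t V' t'" if "sect F x V' t'" for V' t'
    using same_germ_trans[OF F s t that e] same_germ_trans[OF F t s that same_germ_sym[OF e]] by blast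
  then have "germ_set F x U s = germ_set F x V t" by (auto simp: germ_set_def)
  then show "germ F x U s = germ F x V t" by (simp add: germ_eq_vset)
qed

abbreviation pt :: "'u::two_universes presheaf \<Rightarrow> 'u \<Rightarrow> 'u set \<Rightarrow> 'u \<Rightarrow> 'u" where
  "pt F x U s \<equiv> vpair x (germ F x U s)"

lemma germ_restrict:
  assumes F: "psh F" and s: "sect F x U s" and V: "openin (Spc F) V" "x \<in> V" "V \<subseteq> U"
  shows "germ F x V (Res F U V s) = germ F x U s"
proof -
  note r = sect_restrict[OF F s V]
  have "same_germ F x V (Res F U V s) U s"
    unfolding same_germ_def using V psh_Res_refl[OF F V(1)] r by (intro exI[of _ V]) (simp add: sect_def)
  then show ?thesis using germ_eq[OF F r s] by simp
qed

lemma pt_eqE: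
  assumes F: "psh F" and s: "sect F x U s" and t: "sect F y V t" and e: "pt F x U s = pt F y V t"
  obtains W where "y = x" "openin (Spc F) W" "x \<in> W" "W \<subseteq> U" "W \<subseteq> V" "Res F U W s = Res F V W t"
proof -
  have "y = x" "germ F x U s = germ F x V t" using e unfolding vpair_eq by metis+
  moreover have "sect F x V t" using t \<open>y = x\<close> by simp
  ultimately have "y = x" "same_germ F x U s V t" using germ_eq[OF F s] by blast+
  then show thesis using that unfolding same_germ_def by blast
qed

lemma eps_pt: "eps F U s = (\<lambda>x. pt F x U s) ` U"
  by (simp add: eps_def)

lemma pt_eps: "x \<in> U \<Longrightarrow> pt F x U s \<in> eps F U s"
  by (simp add: eps_pt)

lemma eps_restrict:
  assumes F: "psh F" and U: "openin (Spc F) U" "s \<in> Sec F U" and V: "openin (Spc F) V" "V \<subseteq> U"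
  shows "eps F V (Res F U V s) = (\<lambda>x. pt F x U s) ` V" "eps F V (Res F U V s) \<subseteq> eps F U s"
proof -
  show "eps F V (Res F U V s) = (\<lambda>x. pt F x U s) ` V"
    unfolding eps_pt using germ_restrict[OF F _ V(1) _ V(2)] U V by (intro image_cong) (auto simp: sect_def)
  then show "eps F V (Res F U V s) \<subseteq> eps F U s" using V by (auto simp: eps_pt)
qed

lemma openin_Et_eps: "openin (Spc F) U \<Longrightarrow> s \<in> Sec F U \<Longrightarrow> openin (Et F) (eps F U s)"
  unfolding Et_def by (rule topology_generated_by_Basis) auto

lemma topspace_Et: "p \<in> topspace (Et F) \<longleftrightarrow> (\<exists>x U s. sect F x U s \<and> p = pt F x U s)"
  by (auto simp: Et_def eps_pt sect_def)

lemma pt_topspace: "sect F x U s \<Longrightarrow> pt F x U s \<in> topspace (Et F)"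
  by (auto simp: topspace_Et)

text \<open>The sets \<open>eps F U s\<close>, given as a subbasis, form a basis: two sections with the same germ at a point
  agree on a neighbourhood of it.\<close>

lemma Et_basis:
  assumes F: "psh F" and W: "openin (Et F) W" and p: "p \<in> W"
  shows "\<exists>U s. openin (Spc F) U \<and> s \<in> Sec F U \<and> p \<in> eps F U s \<and> eps F U s \<subseteq> W"
proof -
  let ?S = "{eps F U s | U s. openin (Spc F) U \<and> s \<in> Sec F U}"
  have "generate_topology_on ?S W" using W by (simp add: Et_def openin_topology_generated_by_iff)
  then show ?thesis using p
  proof (induction arbitrary: p)
    case (Int a b)
    obtain U s where U: "openin (Spc F) U" "s \<in> Sec F U" "p \<in> eps F U s" "eps F U s \<subseteq> a"
      using Int.IH(1)[of p] Int.prems by auto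
    obtain V t where V: "openin (Spc F) V" "t \<in> Sec F V" "p \<in> eps F V t" "eps F V t \<subseteq> b"
      using Int.IH(2)[of p] Int.prems by auto
    obtain x where x: "p = pt F x U s" "sect F x U s" using U by (auto simp: eps_pt sect_def)
    obtain y where y: "p = pt F y V t" "sect F y V t" using V by (auto simp: eps_pt sect_def)
    obtain W where W: "openin (Spc F) W" "x \<in> W" "W \<subseteq> U" "W \<subseteq> V" "Res F U W s = Res F V W t"
      by (rule pt_eqE[OF F x(2) y(2)]) (use x y in auto)
    let ?r = "Res F U W s"
    have "p \<in> eps F W ?r" "eps F W ?r \<subseteq> eps F U s" "eps F W ?r \<subseteq> eps F V t"
      using eps_restrict[OF F U(1,2) W(1,3)] eps_restrict[OF F V(1,2) W(1,4)] W(2,5) x by auto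
    then show ?case using U V W psh_Res[OF F U(1) W(1) W(3) U(2)] by blast
  next
    case (UN K)
    then obtain k where k: "k \<in> K" "p \<in> k" by blast
    from UN.IH[OF k] obtain U s where "openin (Spc F) U" "s \<in> Sec F U" "p \<in> eps F U s" "eps F U s \<subseteq> k" by blast
    then show ?case using k(1) by (intro exI[of _ U] exI[of _ s]) auto
  qed auto
qed

text \<open>The basis in the form used below: neighbourhoods of the germ of \<open>s\<close> are reached by restricting \<open>s\<close>
  itself.\<close>

lemma Et_nbhd:
  assumes F: "psh F" and W: "openin (Et F) W" and s: "sect F x U s" and p: "pt F x U s \<in> W"
  obtains V where "openin (Spc F) V" "x \<in> V" "V \<subseteq> U" "eps F V (Res F U V s) \<subseteq> W"
proof -
  obtain U' s' where U': "openin (Spc F) U'" "s' \<in> Sec F U'" "pt F x U s \<in> eps F U' s'" "eps F U' s' \<subseteq> W"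
    using Et_basis[OF F W p] by blast
  then have s': "sect F x U' s'" "pt F x U s = pt F x U' s'" by (auto simp: eps_pt sect_def)
  obtain V where V: "openin (Spc F) V" "x \<in> V" "V \<subseteq> U" "V \<subseteq> U'" "Res F U V s = Res F U' V s'"
    by (rule pt_eqE[OF F s s'])
  have "eps F V (Res F U V s) \<subseteq> W"
    using eps_restrict(2)[OF F U'(1,2) V(1,4)] U' V(5) by simp
  then show thesis using that V by blast
qed

lemma Et_continuous:
  assumes F: "psh F" and "\<And>x U s. sect F x U s \<Longrightarrow> e (pt F x U s) \<in> topspace Y"
    and nb: "\<And>x U s W. sect F x U s \<Longrightarrow> openin Y W \<Longrightarrow> e (pt F x U s) \<in> W \<Longrightarrow>
      \<exists>V. openin (Spc F) V \<and> x \<in> V \<and> V \<subseteq> U \<and> e ` eps F V (Res F U V s) \<subseteq> W"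
  shows "continuous_map (Et F) Y e"
  unfolding continuous_map_def
proof (intro conjI allI impI)
  show "e \<in> topspace (Et F) \<rightarrow> topspace Y" using assms(2) by (auto simp: topspace_Et)
  fix W assume W: "openin Y W"
  show "openin (Et F) {p \<in> topspace (Et F). e p \<in> W}" (is "openin _ ?P")
  proof (subst openin_subopen, intro ballI)
    fix p assume p: "p \<in> ?P"
    then obtain x U s where s: "sect F x U s" "p = pt F x U s" by (auto simp: topspace_Et)
    with nb[OF s(1) W] p obtain V where V: "openin (Spc F) V" "x \<in> V" "V \<subseteq> U" "e ` eps F V (Res F U V s) \<subseteq> W" by auto
    note r = sect_restrict[OF F s(1) V(1-3)]
    have o: "openin (Et F) (eps F V (Res F U V s))" using r openin_Et_eps by (auto simp: sect_def)
    moreover have "p \<in> eps F V (Res F U V s)"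
      using pt_eps[OF V(2), of F "Res F U V s"] germ_restrict[OF F s(1) V(1-3)] s(2) by simp
    ultimately show "\<exists>T. openin (Et F) T \<and> p \<in> T \<and> T \<subseteq> ?P"
      using openin_subset[OF o] V(4) by (intro exI[of _ "eps F V (Res F U V s)"]) auto
  qed
qed

lemma Et_open_map:
  assumes F: "psh F" and o: "\<And>U s. openin (Spc F) U \<Longrightarrow> s \<in> Sec F U \<Longrightarrow> openin Y (e ` eps F U s)"
  shows "open_map (Et F) Y e"
  unfolding open_map_def
proof (intro allI impI)
  fix W assume W: "openin (Et F) W"
  show "openin Y (e ` W)"
  proof (subst openin_subopen, intro ballI)
    fix q assume "q \<in> e ` W"
    then obtain p where p: "p \<in> W" "q = e p" by blast
    from Et_basis[OF F W p(1)] obtain U s where "openin (Spc F) U" "s \<in> Sec F U" "p \<in> eps F U s" "eps F U s \<subseteq> W" by blast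
    then show "\<exists>T. openin Y T \<and> q \<in> T \<and> T \<subseteq> e ` W"
      using o p by (intro exI[of _ "e ` eps F U s"]) auto
  qed
qed

lemma vsmall_Et: assumes F: "psh F" shows "vsmall (topspace (Et F))"
proof (rule vsmall_subset)
  let ?O = "vset ` {U. openin (Spc F) U}"
  note v = psh_vsmall[OF F]
  show "vsmall (\<Union>v\<in>?O. \<Union>s\<in>Sec F (elts v). eps F (elts v) s)"
  proof (intro vsmall_UNION[OF vsmall_opens[OF v]] vsmall_UNION)
    fix o' s assume o': "o' \<in> ?O"
    show "vsmall (Sec F (elts o'))" using o' psh_Sec[OF F] elts_vset_open[OF v] by auto
    have "vsmall (elts o')" using o' vsmallD[OF vsmall_opens[OF v]] vsmall_elts by blast
    then show "vsmall (eps F (elts o') s)"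
      unfolding eps_pt
      using vset_VS_I[OF vsmall_germ_set[OF F]]
      by (intro vsmall_image) (auto dest: vsmallD simp: germ_eq_vset)
  qed
  show "topspace (Et F) \<subseteq> (\<Union>v\<in>?O. \<Union>s\<in>Sec F (elts v). eps F (elts v) s)"
    by (force simp: topspace_Et sect_def elts_vset_open[OF v] eps_pt)
qed

subsection \<open>Maps induced by morphisms over open maps\<close>

text \<open>A morphism from \<open>F\<close> to the pullback of \<open>G\<close> along the open map \<open>\<phi>\<close>.\<close>

definition pmor :: "'u::two_universes presheaf \<Rightarrow> ('u \<Rightarrow> 'u) \<Rightarrow> ('u set \<Rightarrow> 'u \<Rightarrow> 'u) \<Rightarrow> 'u presheaf \<Rightarrow> bool" where
  "pmor F \<phi> \<tau> G \<longleftrightarrow> psh F \<and> psh G \<and> continuous_map (Spc F) (Spc G) \<phi> \<and> open_map (Spc F) (Spc G) \<phi> \<and>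
     (\<forall>U s. openin (Spc F) U \<longrightarrow> s \<in> Sec F U \<longrightarrow> \<tau> U s \<in> Sec G (\<phi> ` U)) \<and>
     (\<forall>U V s. openin (Spc F) U \<longrightarrow> openin (Spc F) V \<longrightarrow> V \<subseteq> U \<longrightarrow> s \<in> Sec F U \<longrightarrow>
        \<tau> V (Res F U V s) = Res G (\<phi> ` U) (\<phi> ` V) (\<tau> U s))"

lemma
  assumes "pmor F \<phi> \<tau> G"
  shows pmor_F: "psh F" and pmor_G: "psh G" and pmor_cont: "continuous_map (Spc F) (Spc G) \<phi>"
    and pmor_open: "openin (Spc F) U \<Longrightarrow> openin (Spc G) (\<phi> ` U)"
    and pmor_Sec: "openin (Spc F) U \<Longrightarrow> s \<in> Sec F U \<Longrightarrow> \<tau> U s \<in> Sec G (\<phi> ` U)"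
    and pmor_Res: "openin (Spc F) U \<Longrightarrow> openin (Spc F) V \<Longrightarrow> V \<subseteq> U \<Longrightarrow> s \<in> Sec F U \<Longrightarrow>
        \<tau> V (Res F U V s) = Res G (\<phi> ` U) (\<phi> ` V) (\<tau> U s)"
  using assms unfolding pmor_def open_map_def by auto

lemma pmor_sect: "pmor F \<phi> \<tau> G \<Longrightarrow> sect F x U s \<Longrightarrow> sect G (\<phi> x) (\<phi> ` U) (\<tau> U s)"
  by (simp add: sect_def pmor_open pmor_Sec)

lemma pull_simps [simp]: "Spc (pull X \<phi> G) = X" "Sec (pull X \<phi> G) U = Sec G (\<phi> ` U)"
  "Res (pull X \<phi> G) U V = Res G (\<phi> ` U) (\<phi> ` V)"
  by (simp_all add: pull_def)

lemma psh_pull: assumes p: "pmor F \<phi> \<tau> G" shows "psh (pull (Spc F) \<phi> G)"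
  unfolding psh_def pull_simps
  using psh_vsmall[OF pmor_F[OF p]] psh_Sec[OF pmor_G[OF p]] psh_Res[OF pmor_G[OF p]] psh_Res_refl[OF pmor_G[OF p]]
    psh_Res_Res[OF pmor_G[OF p]] pmor_open[OF p] image_mono[of _ _ \<phi>] by simp

lemma same_germ_map:
  assumes p: "pmor F \<phi> \<tau> G" and s: "sect F x U s" and t: "sect F x V t" and e: "same_germ F x U s V t"
  shows "same_germ (pull (Spc F) \<phi> G) x U (\<tau> U s) V (\<tau> V t)"
proof -
  from e obtain W where W: "openin (Spc F) W" "x \<in> W" "W \<subseteq> U \<inter> V" "Res F U W s = Res F V W t"
    by (auto simp: same_germ_def)
  then have "Res G (\<phi> ` U) (\<phi> ` W) (\<tau> U s) = Res G (\<phi> ` V) (\<phi> ` W) (\<tau> V t)"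
    using pmor_Res[OF p, of U W s] pmor_Res[OF p, of V W t] s t by (simp add: sect_def)
  then show ?thesis using W by (auto simp: same_germ_def)
qed

lemma same_germ_pull:
  assumes p: "pmor F \<phi> \<tau> G" and e: "same_germ (pull (Spc F) \<phi> G) x U s V t"
  shows "same_germ G (\<phi> x) (\<phi> ` U) s (\<phi> ` V) t"
proof -
  from e obtain W where W: "openin (Spc F) W" "x \<in> W" "W \<subseteq> U \<inter> V" "Res G (\<phi> ` U) (\<phi> ` W) s = Res G (\<phi> ` V) (\<phi> ` W) t"
    by (auto simp: same_germ_def)
  then show ?thesis unfolding same_germ_def using pmor_open[OF p] by (intro exI[of _ "\<phi> ` W"]) auto
qed

abbreviation Et_map :: "'u::two_universes presheaf \<Rightarrow> ('u \<Rightarrow> 'u) \<Rightarrow> ('u set \<Rightarrow> 'u \<Rightarrow> 'u) \<Rightarrow> 'u presheaf \<Rightarrow> 'u \<Rightarrow> 'u" where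
  "Et_map F \<phi> \<tau> G \<equiv> Et_pull (Spc F) \<phi> G \<circ> Et_mor F (pull (Spc F) \<phi> G) \<tau>"

lemma Et_map_pt:
  assumes p: "pmor F \<phi> \<tau> G" and s: "sect F x U s"
  shows "Et_map F \<phi> \<tau> G (pt F x U s) = pt G (\<phi> x) (\<phi> ` U) (\<tau> U s)"
proof -
  let ?P = "pull (Spc F) \<phi> G"
  note F = pmor_F[OF p] and G = pmor_G[OF p] and P = psh_pull[OF p]
  have sP: "sect ?P x V (\<tau> V t)" if "sect F x V t" for V t
    using that pmor_Sec[OF p] by (simp add: sect_def)
  have "(THE \<gamma>. \<exists>V t. openin (Spc F) V \<and> x \<in> V \<and> t \<in> Sec F V \<and> germ F x U s = germ F x V t \<and> \<gamma> = germ ?P x V (\<tau> V t)) =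
      germ ?P x U (\<tau> U s)"
  proof (rule the_equality)
    show "\<exists>V t. openin (Spc F) V \<and> x \<in> V \<and> t \<in> Sec F V \<and> germ F x U s = germ F x V t \<and> germ ?P x U (\<tau> U s) = germ ?P x V (\<tau> V t)"
      using s by (auto simp: sect_def)
    fix \<gamma> assume "\<exists>V t. openin (Spc F) V \<and> x \<in> V \<and> t \<in> Sec F V \<and> germ F x U s = germ F x V t \<and> \<gamma> = germ ?P x V (\<tau> V t)"
    then obtain V t where t: "sect F x V t" "germ F x U s = germ F x V t" "\<gamma> = germ ?P x V (\<tau> V t)"
      by (auto simp: sect_def)
    then show "\<gamma> = germ ?P x U (\<tau> U s)"
      using same_germ_map[OF p s t(1)] germ_eq[OF F s t(1)] germ_eq[OF P sP[OF s] sP[OF t(1)]] by simp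
  qed
  then have 1: "Et_mor F ?P \<tau> (pt F x U s) = pt ?P x U (\<tau> U s)" by (simp add: Et_mor_def Let_def)
  have sG: "sect G (\<phi> x) (\<phi> ` V) t" if "sect ?P x V t" for V t
    using that pmor_open[OF p] by (simp add: sect_def)
  let ?t = "\<tau> U s"
  have "(THE \<gamma>. \<exists>V t. openin (Spc F) V \<and> x \<in> V \<and> t \<in> Sec G (\<phi> ` V) \<and> germ ?P x U ?t = germ ?P x V t \<and> \<gamma> = germ G (\<phi> x) (\<phi> ` V) t) =
      germ G (\<phi> x) (\<phi> ` U) ?t"
  proof (rule the_equality)
    show "\<exists>V t. openin (Spc F) V \<and> x \<in> V \<and> t \<in> Sec G (\<phi> ` V) \<and> germ ?P x U ?t = germ ?P x V t \<and> germ G (\<phi> x) (\<phi> ` U) ?t = germ G (\<phi> x) (\<phi> ` V) t"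
      using sP[OF s] by (auto simp: sect_def)
    fix \<gamma> assume "\<exists>V t. openin (Spc F) V \<and> x \<in> V \<and> t \<in> Sec G (\<phi> ` V) \<and> germ ?P x U ?t = germ ?P x V t \<and> \<gamma> = germ G (\<phi> x) (\<phi> ` V) t"
    then obtain V t where t: "sect ?P x V t" "germ ?P x U ?t = germ ?P x V t" "\<gamma> = germ G (\<phi> x) (\<phi> ` V) t"
      by (auto simp: sect_def)
    then have "same_germ ?P x U ?t V t" using germ_eq[OF P sP[OF s] t(1)] by simp
    from same_germ_pull[OF p this] show "\<gamma> = germ G (\<phi> x) (\<phi> ` U) ?t"
      using t germ_eq[OF G sG[OF sP[OF s]] sG[OF t(1)]] by simp
  qed
  then have 2: "Et_pull (Spc F) \<phi> G (pt ?P x U ?t) = pt G (\<phi> x) (\<phi> ` U) ?t" by (simp add: Et_pull_def Let_def)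
  show ?thesis using 1 2 by simp
qed

lemma Et_map_eps:
  assumes p: "pmor F \<phi> \<tau> G" and U: "openin (Spc F) U" "s \<in> Sec F U"
  shows "Et_map F \<phi> \<tau> G ` eps F U s = eps G (\<phi> ` U) (\<tau> U s)"
proof -
  have "Et_map F \<phi> \<tau> G (pt F x U s) = pt G (\<phi> x) (\<phi> ` U) (\<tau> U s)" if "x \<in> U" for x
    using Et_map_pt[OF p] U that by (simp add: sect_def)
  then show ?thesis unfolding eps_pt image_image by (intro image_cong) auto
qed

lemma continuous_Et_map:
  assumes p: "pmor F \<phi> \<tau> G" shows "continuous_map (Et F) (Et G) (Et_map F \<phi> \<tau> G)"
proof (rule Et_continuous[OF pmor_F[OF p]])
  note F = pmor_F[OF p] and G = pmor_G[OF p]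
  fix x U s assume s: "sect F x U s"
  then have U: "openin (Spc F) U" "s \<in> Sec F U" "x \<in> U" by (auto simp: sect_def)
  note Gs = pmor_sect[OF p s] and e = Et_map_pt[OF p s]
  show "Et_map F \<phi> \<tau> G (pt F x U s) \<in> topspace (Et G)" unfolding e by (rule pt_topspace[OF Gs])
  fix W assume W: "openin (Et G) W" and "Et_map F \<phi> \<tau> G (pt F x U s) \<in> W"
  then have "pt G (\<phi> x) (\<phi> ` U) (\<tau> U s) \<in> W" unfolding e by blast
  from Et_nbhd[OF G W Gs this] obtain V where V: "openin (Spc G) V" "\<phi> x \<in> V" "V \<subseteq> \<phi> ` U"
    "eps G V (Res G (\<phi> ` U) V (\<tau> U s)) \<subseteq> W" .
  let ?V = "{z \<in> U. \<phi> z \<in> V}"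
  have "?V = U \<inter> {z \<in> topspace (Spc F). \<phi> z \<in> V}" using openin_subset[OF U(1)] by blast
  then have oV: "openin (Spc F) ?V"
    using U(1) openin_continuous_map_preimage[OF pmor_cont[OF p] V(1)] by auto
  have iV: "\<phi> ` ?V = V" using V(3) by auto
  have "Et_map F \<phi> \<tau> G ` eps F ?V (Res F U ?V s) = eps G V (Res G (\<phi> ` U) V (\<tau> U s))"
    using Et_map_eps[OF p oV psh_Res[OF F U(1) oV _ U(2)]] pmor_Res[OF p U(1) oV _ U(2)] iV by simp
  then show "\<exists>V. openin (Spc F) V \<and> x \<in> V \<and> V \<subseteq> U \<and> Et_map F \<phi> \<tau> G ` eps F V (Res F U V s) \<subseteq> W"
    using oV V U by (intro exI[of _ ?V]) auto
qed

lemma open_Et_map: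
  assumes p: "pmor F \<phi> \<tau> G" shows "open_map (Et F) (Et G) (Et_map F \<phi> \<tau> G)"
  by (rule Et_open_map[OF pmor_F[OF p]])
    (simp only: Et_map_eps[OF p] openin_Et_eps pmor_open[OF p] pmor_Sec[OF p])

text \<open>Since \<open>\<phi>\<close> is bijective, every open set of the target is the image of its preimage; hence sections and
  equations between germs can be pulled back through the bijections \<open>\<tau> U\<close>.\<close>

lemma bij_Et_map:
  assumes p: "pmor F \<phi> \<tau> G" and b: "bij_betw \<phi> (topspace (Spc F)) (topspace (Spc G))"
    and t: "\<And>U. openin (Spc F) U \<Longrightarrow> bij_betw (\<tau> U) (Sec F U) (Sec G (\<phi> ` U))"
  shows "bij_betw (Et_map F \<phi> \<tau> G) (topspace (Et F)) (topspace (Et G))"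
  unfolding bij_betw_def
proof (intro conjI inj_onI)
  note F = pmor_F[OF p] and G = pmor_G[OF p]
  let ?e = "Et_map F \<phi> \<tau> G"
  have inj: "inj_on \<phi> (topspace (Spc F))" using b by (simp add: bij_betw_def)
  fix a a' assume "a \<in> topspace (Et F)" "a' \<in> topspace (Et F)" and e: "?e a = ?e a'"
  then obtain x U s x' U' s' where s: "sect F x U s" "a = pt F x U s" and s': "sect F x' U' s'" "a' = pt F x' U' s'"
    by (auto simp: topspace_Et)
  from s s' have U: "openin (Spc F) U" "x \<in> U" "s \<in> Sec F U" and U': "openin (Spc F) U'" "x' \<in> U'" "s' \<in> Sec F U'"
    by (auto simp: sect_def)
  note sub = openin_subset[OF U(1)] openin_subset[OF U'(1)]
  have e': "pt G (\<phi> x) (\<phi> ` U) (\<tau> U s) = pt G (\<phi> x') (\<phi> ` U') (\<tau> U' s')"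
    using e unfolding s(2) s'(2) Et_map_pt[OF p s(1)] Et_map_pt[OF p s'(1)] .
  then have x': "x' = x" using inj U(2) U'(2) sub by (auto dest: inj_onD)
  obtain W where W: "openin (Spc G) W" "\<phi> x \<in> W" "W \<subseteq> \<phi> ` U" "W \<subseteq> \<phi> ` U'"
    "Res G (\<phi> ` U) W (\<tau> U s) = Res G (\<phi> ` U') W (\<tau> U' s')"
    by (rule pt_eqE[OF G pmor_sect[OF p s(1)] pmor_sect[OF p s'(1)] e'])
  let ?V = "{z \<in> topspace (Spc F). \<phi> z \<in> W}"
  have oV: "openin (Spc F) ?V" using openin_continuous_map_preimage[OF pmor_cont[OF p] W(1)] .
  have VU: "?V \<subseteq> A" if A: "W \<subseteq> \<phi> ` A" "A \<subseteq> topspace (Spc F)" for A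
  proof
    fix z assume z: "z \<in> ?V"
    then obtain u where u: "u \<in> A" "\<phi> z = \<phi> u" using A by blast
    have "z = u" using inj_onD[OF inj u(2)] z u A by auto
    then show "z \<in> A" using u by simp
  qed
  note VU = VU[OF W(3) sub(1)] VU[OF W(4) sub(2)]
  have iV: "\<phi> ` ?V = W" using W(3) sub by auto
  have "\<tau> ?V (Res F U ?V s) = \<tau> ?V (Res F U' ?V s')"
    using pmor_Res[OF p U(1) oV VU(1) U(3)] pmor_Res[OF p U'(1) oV VU(2) U'(3)] iV W(5) by simp
  then have "Res F U ?V s = Res F U' ?V s'"
    using t[OF oV] psh_Res[OF F U(1) oV VU(1) U(3)] psh_Res[OF F U'(1) oV VU(2) U'(3)]
    by (auto simp: bij_betw_def dest: inj_onD)
  then have "same_germ F x U s U' s'"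
    unfolding same_germ_def using oV VU W(2) U sub by (intro exI[of _ ?V]) auto
  then show "a = a'" using germ_eq[OF F s(1)] s' s(2) x' by simp
next
  note F = pmor_F[OF p] and G = pmor_G[OF p]
  let ?e = "Et_map F \<phi> \<tau> G"
  show "?e ` topspace (Et F) = topspace (Et G)"
  proof
    show "?e ` topspace (Et F) \<subseteq> topspace (Et G)"
      by (rule continuous_map_image_subset_topspace[OF continuous_Et_map[OF p]])
    show "topspace (Et G) \<subseteq> ?e ` topspace (Et F)"
    proof
      fix q assume "q \<in> topspace (Et G)"
      then obtain y V r where r: "openin (Spc G) V" "y \<in> V" "r \<in> Sec G V" "q = pt G y V r"
        by (auto simp: topspace_Et sect_def)
      have sur: "\<phi> ` topspace (Spc F) = topspace (Spc G)" using b by (simp add: bij_betw_def)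
      let ?U = "{z \<in> topspace (Spc F). \<phi> z \<in> V}"
      have oU: "openin (Spc F) ?U" using openin_continuous_map_preimage[OF pmor_cont[OF p] r(1)] .
      have iU: "\<phi> ` ?U = V"
      proof
        show "V \<subseteq> \<phi> ` ?U"
        proof
          fix v assume v: "v \<in> V"
          then have "v \<in> \<phi> ` topspace (Spc F)" using sur openin_subset[OF r(1)] by blast
          then show "v \<in> \<phi> ` ?U" using v by blast
        qed
      qed blast
      obtain x where x: "x \<in> ?U" "y = \<phi> x" using iU r(2) by blast
      have "r \<in> \<tau> ?U ` Sec F ?U" using t[OF oU] r(3) iU by (simp add: bij_betw_def)
      then obtain s where s: "s \<in> Sec F ?U" "r = \<tau> ?U s" by blast
      have sx: "sect F x ?U s" using oU x(1) s(1) by (simp add: sect_def)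
      have "?e (pt F x ?U s) = q"
        unfolding Et_map_pt[OF p sx] iU x(2)[symmetric] s(2)[symmetric] r(4) ..
      then show "q \<in> ?e ` topspace (Et F)" using pt_topspace[OF sx] by blast
    qed
  qed
qed

subsection \<open>Etale spaces over etale spaces\<close>

text \<open>\<open>Q\<close> is, up to isomorphism, the presheaf of pairs of a section \<open>s\<close> of \<open>F\<close> over \<open>U\<close> and a section of \<open>G\<close> over
  the open set \<open>eps F U s\<close>: the function \<open>p\<close> gives the first component and \<open>l U\<close> the second.\<close>

definition psum :: "'u::two_universes presheaf \<Rightarrow> 'u presheaf \<Rightarrow> 'u presheaf \<Rightarrow> ('u \<Rightarrow> 'u) \<Rightarrow> ('u set \<Rightarrow> 'u \<Rightarrow> 'u) \<Rightarrow> bool" where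
  "psum Q F G p l \<longleftrightarrow> psh Q \<and> psh F \<and> psh G \<and> Spc Q = Spc F \<and> Spc G = Et F \<and>
     (\<forall>U. openin (Spc F) U \<longrightarrow> (\<forall>q\<in>Sec Q U. p q \<in> Sec F U \<and> l U q \<in> Sec G (eps F U (p q)))) \<and>
     (\<forall>U V. openin (Spc F) U \<longrightarrow> openin (Spc F) V \<longrightarrow> V \<subseteq> U \<longrightarrow> (\<forall>q\<in>Sec Q U.
        p (Res Q U V q) = Res F U V (p q) \<and>
        l V (Res Q U V q) = Res G (eps F U (p q)) (eps F V (Res F U V (p q))) (l U q))) \<and>
     (\<forall>U. openin (Spc F) U \<longrightarrow> (\<forall>q\<in>Sec Q U. \<forall>q'\<in>Sec Q U. p q = p q' \<longrightarrow> l U q = l U q' \<longrightarrow> q = q')) \<and>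
     (\<forall>U. openin (Spc F) U \<longrightarrow> (\<forall>s\<in>Sec F U. \<forall>t\<in>Sec G (eps F U s). \<exists>q\<in>Sec Q U. p q = s \<and> l U q = t))"

text \<open>The germ of a pair \<open>(s, t)\<close> goes to the germ of \<open>t\<close> at the germ of \<open>s\<close>.  The representative is chosen;
  \<open>Et_sum_pt\<close> shows that the choice does not matter.\<close>

definition Et_sum :: "'u::two_universes presheaf \<Rightarrow> 'u presheaf \<Rightarrow> 'u presheaf \<Rightarrow> ('u \<Rightarrow> 'u) \<Rightarrow> ('u set \<Rightarrow> 'u \<Rightarrow> 'u) \<Rightarrow> 'u \<Rightarrow> 'u" where
  "Et_sum Q F G p l z = (SOME w. \<exists>U q. sect Q (vfst z) U q \<and> z = pt Q (vfst z) U q \<and>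
     w = pt G (pt F (vfst z) U (p q)) (eps F U (p q)) (l U q))"

context
  fixes Q F G :: "'u::two_universes presheaf" and p l
  assumes ps: "psum Q F G p l"
begin

lemma psum_psh: "psh Q" "psh F" "psh G" and psum_Spc: "Spc Q = Spc F" "Spc G = Et F"
  using ps by (auto simp: psum_def)

lemma psum_Sec: "openin (Spc F) U \<Longrightarrow> q \<in> Sec Q U \<Longrightarrow> p q \<in> Sec F U"
  "openin (Spc F) U \<Longrightarrow> q \<in> Sec Q U \<Longrightarrow> l U q \<in> Sec G (eps F U (p q))"
  using ps by (auto simp: psum_def)

lemma psum_Res: "openin (Spc F) U \<Longrightarrow> openin (Spc F) V \<Longrightarrow> V \<subseteq> U \<Longrightarrow> q \<in> Sec Q U \<Longrightarrow> p (Res Q U V q) = Res F U V (p q)"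
  "openin (Spc F) U \<Longrightarrow> openin (Spc F) V \<Longrightarrow> V \<subseteq> U \<Longrightarrow> q \<in> Sec Q U \<Longrightarrow>
    l V (Res Q U V q) = Res G (eps F U (p q)) (eps F V (Res F U V (p q))) (l U q)"
  using ps by (simp_all add: psum_def)

lemma psum_inj: "openin (Spc F) U \<Longrightarrow> q \<in> Sec Q U \<Longrightarrow> q' \<in> Sec Q U \<Longrightarrow> p q = p q' \<Longrightarrow> l U q = l U q' \<Longrightarrow> q = q'"
  using ps by (simp add: psum_def)

lemma psum_surj: "openin (Spc F) U \<Longrightarrow> s \<in> Sec F U \<Longrightarrow> t \<in> Sec G (eps F U s) \<Longrightarrow> \<exists>q\<in>Sec Q U. p q = s \<and> l U q = t"
  using ps by (simp add: psum_def)

lemma psum_sect: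
  assumes "sect Q x U q" shows "sect F x U (p q)" "sect G (pt F x U (p q)) (eps F U (p q)) (l U q)"
proof -
  have U: "openin (Spc F) U" "x \<in> U" "q \<in> Sec Q U" using assms psum_Spc by (auto simp: sect_def)
  then show "sect F x U (p q)" by (simp add: sect_def psum_Sec)
  show "sect G (pt F x U (p q)) (eps F U (p q)) (l U q)"
    using U openin_Et_eps[OF U(1) psum_Sec(1)[OF U(1,3)]] by (simp add: sect_def psum_Spc psum_Sec pt_eps)
qed

lemma psum_restrict:
  assumes q: "sect Q x U q" and V: "openin (Spc F) V" "x \<in> V" "V \<subseteq> U"
  shows "pt G (pt F x V (p (Res Q U V q))) (eps F V (p (Res Q U V q))) (l V (Res Q U V q)) =
    pt G (pt F x U (p q)) (eps F U (p q)) (l U q)"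
proof -
  have U: "openin (Spc F) U" "x \<in> U" "q \<in> Sec Q U" using q psum_Spc by (auto simp: sect_def)
  note pF = psum_psh(2) and s = psum_sect[OF q]
  have pU: "p q \<in> Sec F U" using psum_Sec U by auto
  note r = sect_restrict[OF pF s(1) V]
  have e: "pt F x V (Res F U V (p q)) = pt F x U (p q)" using germ_restrict[OF pF s(1) V] by simp
  have "openin (Spc G) (eps F V (Res F U V (p q)))"
    using openin_Et_eps r psum_Spc by (auto simp: sect_def)
  moreover have "pt F x U (p q) \<in> eps F V (Res F U V (p q))" using pt_eps[OF V(2), of F "Res F U V (p q)"] e by simp
  moreover have "eps F V (Res F U V (p q)) \<subseteq> eps F U (p q)" using eps_restrict[OF pF U(1) pU V(1,3)] by blast
  ultimately show ?thesis
    using germ_restrict[OF psum_psh(3) s(2)] psum_Res[OF U(1) V(1,3) U(3)] e by simp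
qed

lemma Et_sum_pt:
  assumes q: "sect Q x U q"
  shows "Et_sum Q F G p l (pt Q x U q) = pt G (pt F x U (p q)) (eps F U (p q)) (l U q)"
proof -
  have u: "pt G (pt F x V (p r)) (eps F V (p r)) (l V r) = pt G (pt F x U (p q)) (eps F U (p q)) (l U q)"
    if r: "sect Q x V r" and e: "pt Q x U q = pt Q x V r" for V r
  proof -
    obtain W where W: "openin (Spc Q) W" "x \<in> W" "W \<subseteq> U" "W \<subseteq> V" "Res Q U W q = Res Q V W r"
      by (rule pt_eqE[OF psum_psh(1) q r e])
    have W1: "openin (Spc F) W" using W(1) psum_Spc by simp
    show ?thesis
      using psum_restrict[OF q W1 W(2,3)] psum_restrict[OF r W1 W(2,4)] unfolding W(5) by metis
  qed
  have e: "Et_sum Q F G p l (pt Q x U q) = (SOME w. \<exists>V r. sect Q x V r \<and> pt Q x U q = pt Q x V r \<and>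
     w = pt G (pt F x V (p r)) (eps F V (p r)) (l V r))"
    by (simp only: Et_sum_def vfst_vpair)
  have "\<exists>w V r. sect Q x V r \<and> pt Q x U q = pt Q x V r \<and> w = pt G (pt F x V (p r)) (eps F V (p r)) (l V r)"
    using q by blast
  from someI_ex[OF this, folded e] obtain V r where "sect Q x V r" "pt Q x U q = pt Q x V r"
    "Et_sum Q F G p l (pt Q x U q) = pt G (pt F x V (p r)) (eps F V (p r)) (l V r)" by blast
  then show ?thesis using u by metis
qed

lemma Et_sum_eps:
  assumes U: "openin (Spc F) U" "q \<in> Sec Q U"
  shows "Et_sum Q F G p l ` eps Q U q = eps G (eps F U (p q)) (l U q)"
proof -
  have "Et_sum Q F G p l (pt Q x U q) = pt G (pt F x U (p q)) (eps F U (p q)) (l U q)" if "x \<in> U" for x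
    using Et_sum_pt[of x U q] U that psum_Spc by (simp add: sect_def)
  then show ?thesis unfolding eps_pt image_image by (intro image_cong) auto
qed

lemma open_Et_sum: "open_map (Et Q) (Et G) (Et_sum Q F G p l)"
proof (rule Et_open_map[OF psum_psh(1)])
  fix U q assume U: "openin (Spc Q) U" "q \<in> Sec Q U"
  then show "openin (Et G) (Et_sum Q F G p l ` eps Q U q)"
    using Et_sum_eps[of U q] psum_Spc openin_Et_eps psum_Sec by metis
qed

lemma continuous_Et_sum: "continuous_map (Et Q) (Et G) (Et_sum Q F G p l)"
proof (rule Et_continuous[OF psum_psh(1)])
  fix x U q assume q: "sect Q x U q"
  note e = Et_sum_pt[OF q] and s = psum_sect[OF q]
  show "Et_sum Q F G p l (pt Q x U q) \<in> topspace (Et G)" unfolding e by (rule pt_topspace[OF s(2)])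
  fix W assume W: "openin (Et G) W" and "Et_sum Q F G p l (pt Q x U q) \<in> W"
  then have "pt G (pt F x U (p q)) (eps F U (p q)) (l U q) \<in> W" unfolding e by blast
  from Et_nbhd[OF psum_psh(3) W s(2) this] obtain V where
    V: "openin (Spc G) V" "pt F x U (p q) \<in> V" "V \<subseteq> eps F U (p q)" "eps G V (Res G (eps F U (p q)) V (l U q)) \<subseteq> W" .
  obtain U' where U': "openin (Spc F) U'" "x \<in> U'" "U' \<subseteq> U" "eps F U' (Res F U U' (p q)) \<subseteq> V"
    using Et_nbhd[OF psum_psh(2) V(1)[unfolded psum_Spc] s(1) V(2)] .
  have U: "openin (Spc F) U" "q \<in> Sec Q U" using q psum_Spc by (auto simp: sect_def)
  let ?E = "eps F U (p q)" and ?E' = "eps F U' (Res F U U' (p q))"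
  have pU: "p q \<in> Sec F U" "l U q \<in> Sec G ?E" using psum_Sec U by auto
  have E: "openin (Spc G) ?E" "openin (Spc G) ?E'"
    using openin_Et_eps U(1) U'(1) pU(1) psh_Res[OF psum_psh(2) U(1) U'(1,3) pU(1)] psum_Spc by auto
  have "Et_sum Q F G p l ` eps Q U' (Res Q U U' q) = eps G ?E' (Res G ?E ?E' (l U q))"
    using Et_sum_eps[OF U'(1)] psh_Res[OF psum_psh(1), of U U' q] U U'(1,3) psum_Spc psum_Res[OF U(1) U'(1,3) U(2)] by simp
  also have "Res G ?E ?E' (l U q) = Res G V ?E' (Res G ?E V (l U q))"
    using psh_Res_Res[OF psum_psh(3) E(1) V(1) E(2) V(3) U'(4) pU(2)] by simp
  also have "eps G ?E' \<dots> \<subseteq> eps G V (Res G ?E V (l U q))"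
    using eps_restrict(2)[OF psum_psh(3) V(1) psh_Res[OF psum_psh(3) E(1) V(1,3) pU(2)] E(2) U'(4)] .
  finally show "\<exists>V. openin (Spc Q) V \<and> x \<in> V \<and> V \<subseteq> U \<and> Et_sum Q F G p l ` eps Q V (Res Q U V q) \<subseteq> W"
    using U' V(4) psum_Spc by (intro exI[of _ U']) auto
qed

text \<open>Restricting a section of \<open>G\<close> near the germ of \<open>s\<close> to some \<open>eps F V (Res F U V s)\<close> turns it into the second
  component of a section of \<open>Q\<close> (surjectivity), and brings an equality of germs of \<open>G\<close> to a set of this
  form, where it becomes an equality in \<open>Q\<close> (injectivity).\<close>

lemma bij_Et_sum: "bij_betw (Et_sum Q F G p l) (topspace (Et Q)) (topspace (Et G))"
  unfolding bij_betw_def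
proof (intro conjI inj_onI)
  note pQ = psum_psh(1) and pF = psum_psh(2) and pG = psum_psh(3)
  fix a a' assume "a \<in> topspace (Et Q)" "a' \<in> topspace (Et Q)" and e: "Et_sum Q F G p l a = Et_sum Q F G p l a'"
  then obtain x U q x' U' q' where q: "sect Q x U q" "a = pt Q x U q" and q': "sect Q x' U' q'" "a' = pt Q x' U' q'"
    by (auto simp: topspace_Et)
  have e': "pt G (pt F x U (p q)) (eps F U (p q)) (l U q) = pt G (pt F x' U' (p q')) (eps F U' (p q')) (l U' q')"
    using e unfolding q(2) q'(2) Et_sum_pt[OF q(1)] Et_sum_pt[OF q'(1)] .
  then have "pt F x U (p q) = pt F x' U' (p q')" by (metis vpair_eq)
  then obtain V where V: "x' = x" "openin (Spc F) V" "x \<in> V" "V \<subseteq> U" "V \<subseteq> U'" "Res F U V (p q) = Res F U' V (p q')"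
    by (rule pt_eqE[OF pF psum_sect(1)[OF q(1)] psum_sect(1)[OF q'(1)]])
  have VQ: "openin (Spc Q) V" using V psum_Spc by simp
  define r where "r = Res Q U V q"
  define r' where "r' = Res Q U' V q'"
  have q'1: "sect Q x U' q'" using q'(1) V(1) by simp
  have r: "sect Q x V r" "sect Q x V r'"
    unfolding r_def r'_def by (rule sect_restrict[OF pQ q(1) VQ V(3,4)] sect_restrict[OF pQ q'1 VQ V(3,5)])+
  have UO: "openin (Spc F) U" "q \<in> Sec Q U" "openin (Spc F) U'" "q' \<in> Sec Q U'"
    using q q' psum_Spc by (auto simp: sect_def)
  have pr: "p r' = p r"
    using psum_Res(1)[OF UO(1) V(2,4) UO(2)] psum_Res(1)[OF UO(3) V(2,5) UO(4)] V(6) by (simp add: r_def r'_def)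
  have a: "pt Q x V r = a" "pt Q x V r' = a'"
    using germ_restrict[OF pQ q(1) VQ V(3,4)] germ_restrict[OF pQ q'1 VQ V(3,5)] q q' V(1) by (auto simp: r_def r'_def)
  have er: "pt G (pt F x V (p r)) (eps F V (p r)) (l V r) = pt G (pt F x V (p r')) (eps F V (p r')) (l V r')"
    unfolding r_def r'_def psum_restrict[OF q(1) V(2,3,4)] psum_restrict[OF q'1 V(2,3,5)]
    using e' unfolding V(1) .
  obtain W where W: "openin (Spc G) W" "pt F x V (p r) \<in> W" "W \<subseteq> eps F V (p r)" "Res G (eps F V (p r)) W (l V r) = Res G (eps F V (p r)) W (l V r')"
    by (rule pt_eqE[OF pG psum_sect(2)[OF r(1)] psum_sect(2)[OF r(2)] er]) (simp add: pr)
  obtain V' where V': "openin (Spc F) V'" "x \<in> V'" "V' \<subseteq> V" "eps F V' (Res F V V' (p r)) \<subseteq> W"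
    using Et_nbhd[OF pF W(1)[unfolded psum_Spc] psum_sect(1)[OF r(1)] W(2)] .
  have rV: "r \<in> Sec Q V" "r' \<in> Sec Q V" using r by (auto simp: sect_def)
  let ?E = "eps F V (p r)" and ?E' = "eps F V' (Res F V V' (p r))"
  have pS: "p r \<in> Sec F V" "l V r \<in> Sec G ?E" "l V r' \<in> Sec G ?E"
    using psum_Sec[OF V(2) rV(1)] psum_Sec[OF V(2) rV(2)] pr by auto
  have E: "openin (Spc G) ?E" "openin (Spc G) ?E'"
    using openin_Et_eps V(2) V'(1) pS(1) psh_Res[OF pF V(2) V'(1,3) pS(1)] psum_Spc by auto
  have "Res G ?E ?E' (l V r) = Res G ?E ?E' (l V r')"
    using psh_Res_Res[OF pG E(1) W(1) E(2) W(3) V'(4) pS(2)] psh_Res_Res[OF pG E(1) W(1) E(2) W(3) V'(4) pS(3)] W(4) by simp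
  then have l: "l V' (Res Q V V' r) = l V' (Res Q V V' r')"
    using psum_Res(2)[OF V(2) V'(1,3) rV(1)] psum_Res(2)[OF V(2) V'(1,3) rV(2)] pr by simp
  have V'Q: "openin (Spc Q) V'" using V' psum_Spc by simp
  have "Res Q V V' r = Res Q V V' r'"
    using psum_inj[OF V'(1) _ _ _ l] psh_Res[OF pQ VQ V'Q V'(3)] rV psum_Res(1)[OF V(2) V'(1,3)] pr by simp
  then have "same_germ Q x V r V r'" unfolding same_germ_def using V'Q V' by (intro exI[of _ V']) auto
  then show "a = a'" using germ_eq[OF pQ r] a by simp
next
  let ?e = "Et_sum Q F G p l"
  show "?e ` topspace (Et Q) = topspace (Et G)"
  proof
    show "?e ` topspace (Et Q) \<subseteq> topspace (Et G)"
      by (rule continuous_map_image_subset_topspace[OF continuous_Et_sum])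
    show "topspace (Et G) \<subseteq> ?e ` topspace (Et Q)"
    proof
      fix y assume "y \<in> topspace (Et G)"
      then obtain z W t where t: "sect G z W t" "y = pt G z W t" by (auto simp: topspace_Et)
      then have W: "openin (Et F) W" "z \<in> W" "t \<in> Sec G W" and WG: "openin (Spc G) W" using psum_Spc by (auto simp: sect_def)
      obtain x U s where s: "sect F x U s" "z = pt F x U s"
        using W openin_subset by (force simp: topspace_Et)
      obtain V where V: "openin (Spc F) V" "x \<in> V" "V \<subseteq> U" "eps F V (Res F U V s) \<subseteq> W"
        using Et_nbhd[OF psum_psh(2) W(1) s(1)] W(2) s(2) by blast
      let ?s = "Res F U V s" let ?E = "eps F V ?s"
      have sV: "sect F x V ?s" using sect_restrict[OF psum_psh(2) s(1) V(1-3)] .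
      then have sS: "?s \<in> Sec F V" by (simp add: sect_def)
      have z: "z = pt F x V ?s" using germ_restrict[OF psum_psh(2) s(1) V(1-3)] s(2) by simp
      have E: "openin (Spc G) ?E" using openin_Et_eps[OF V(1) sS] psum_Spc by simp
      have zE: "z \<in> ?E" using z pt_eps[OF V(2)] by simp
      obtain q where q: "q \<in> Sec Q V" "p q = ?s" "l V q = Res G W ?E t"
        using psum_surj[OF V(1) sS psh_Res[OF psum_psh(3) WG E V(4) W(3)]] by blast
      have qs: "sect Q x V q" using q V psum_Spc by (simp add: sect_def)
      have "?e (pt Q x V q) = y"
        using Et_sum_pt[OF qs] germ_restrict[OF psum_psh(3) t(1) E zE V(4)] t(2) z q by simp
      then show "y \<in> ?e ` topspace (Et Q)" using pt_topspace[OF qs] by blast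
    qed
  qed
qed

end

subsection \<open>Projection to the base\<close>

lemma continuous_Et_proj: assumes F: "psh F" shows "continuous_map (Et F) (Spc F) vfst"
proof (rule Et_continuous[OF F])
  fix x U s assume s: "sect F x U s"
  then have U: "openin (Spc F) U" "x \<in> U" by (auto simp: sect_def)
  then show "vfst (pt F x U s) \<in> topspace (Spc F)" using openin_subset by auto
  fix W assume "openin (Spc F) W" "vfst (pt F x U s) \<in> W"
  then show "\<exists>V. openin (Spc F) V \<and> x \<in> V \<and> V \<subseteq> U \<and> vfst ` eps F V (Res F U V s) \<subseteq> W"
    using U by (intro exI[of _ "U \<inter> W"]) (auto simp: eps_pt)
qed

lemma open_Et_proj: assumes F: "psh F" shows "open_map (Et F) (Spc F) vfst"
  by (rule Et_open_map[OF F]) (simp add: eps_pt image_image)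

text \<open>Surjectivity comes from the unique section over the whole space.\<close>

lemma bij_Et_proj:
  assumes F: "psh F" and 1: "\<And>U. openin (Spc F) U \<Longrightarrow> \<exists>s. Sec F U = {s}"
  shows "bij_betw vfst (topspace (Et F)) (topspace (Spc F))"
  unfolding bij_betw_def
proof (intro conjI inj_onI)
  fix a a' assume "a \<in> topspace (Et F)" "a' \<in> topspace (Et F)" and e: "vfst a = vfst a'"
  then obtain x U s x' U' s' where s: "sect F x U s" "a = pt F x U s" and s': "sect F x' U' s'" "a' = pt F x' U' s'"
    by (auto simp: topspace_Et)
  then have x': "x' = x" using e by simp
  have U: "openin (Spc F) U" "x \<in> U" "s \<in> Sec F U" "openin (Spc F) U'" "x \<in> U'" "s' \<in> Sec F U'"
    using s s' x' by (auto simp: sect_def)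
  have o: "openin (Spc F) (U \<inter> U')" using U by blast
  have "Res F U (U \<inter> U') s = Res F U' (U \<inter> U') s'"
    using 1[OF o] psh_Res[OF F U(1) o _ U(3)] psh_Res[OF F U(4) o _ U(6)] by auto
  then have "same_germ F x U s U' s'" unfolding same_germ_def using U o by (intro exI[of _ "U \<inter> U'"]) auto
  then show "a = a'" using germ_eq[OF F s(1)] s' s(2) x' by simp
next
  show "vfst ` topspace (Et F) = topspace (Spc F)"
  proof
    show "vfst ` topspace (Et F) \<subseteq> topspace (Spc F)"
      by (rule continuous_map_image_subset_topspace[OF continuous_Et_proj[OF F]])
    show "topspace (Spc F) \<subseteq> vfst ` topspace (Et F)"
    proof
      fix x assume x: "x \<in> topspace (Spc F)"
      obtain s where "Sec F (topspace (Spc F)) = {s}" using 1[of "topspace (Spc F)"] by auto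
      then have "sect F x (topspace (Spc F)) s" using x by (simp add: sect_def)
      from pt_topspace[OF this] show "x \<in> vfst ` topspace (Et F)" by (metis image_eqI vfst_vpair)
    qed
  qed
qed

section \<open>Very small spaces and open maps\<close>

lemma top_of_top_code: "vsmall (topspace T) \<Longrightarrow> top_of (top_code T) = T"
proof -
  assume v: "vsmall (topspace T)"
  have "elts (top_code T) = vset ` {U. openin T U}"
    unfolding top_code_def by (rule elts_vset[OF vsmall_small[OF vsmall_opens[OF v]]])
  then have "elts ` elts (top_code T) = (\<lambda>U. elts (vset U)) ` {U. openin T U}" by (simp add: image_image)
  also have "\<dots> = (\<lambda>U. U) ` {U. openin T U}" by (rule image_cong) (simp_all add: elts_vset_open[OF v])
  finally have "(\<lambda>U. U \<in> elts ` elts (top_code T)) = openin T" by auto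
  then show ?thesis by (simp add: top_of_def openin_inverse)
qed

lemma TopC_simps [simp]: "Dm TopC = vsrc" "Cd TopC = vtgt"
  by (simp_all add: TopC_def)

lemma TopC_Ob: "c \<in> Ob TopC \<longleftrightarrow> (\<exists>T. c = top_code T \<and> vsmall (topspace T))"
  by (auto simp: TopC_def vsmall_def)

lemma TopC_ObD:
  assumes "c \<in> Ob TopC" shows "top_code (top_of c) = c" "vsmall (topspace (top_of c))"
  using assms by (auto simp: TopC_Ob top_of_top_code)

lemma top_code_Ob: "vsmall (topspace T) \<Longrightarrow> top_code T \<in> Ob TopC"
  by (auto simp: TopC_Ob)

lemma top_arr_simps [simp]: "vsrc (top_arr S T h) = top_code S" "vtgt (top_arr S T h) = top_code T"
  by (simp_all add: top_arr_def)

lemma vapp_top_arr: "vsmall (topspace S) \<Longrightarrow> x \<in> topspace S \<Longrightarrow> vapp (top_arr S T h) x = h x"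
  by (simp add: top_arr_def vapp_varr vsmall_small)

lemma top_arr_cong: "(\<And>x. x \<in> topspace S \<Longrightarrow> h x = h' x) \<Longrightarrow> top_arr S T h = top_arr S T h'"
  unfolding top_arr_def by (rule varr_cong)

lemma top_arr_hom: 
  assumes "vsmall (topspace S)" "vsmall (topspace T)" "continuous_map S T h" "open_map S T h"
  shows "top_arr S T h \<in> hom TopC (top_code S) (top_code T)"
proof -
  have "top_arr S T h \<in> Ar TopC"
    using assms by (auto simp: TopC_def vsmall_def[symmetric])
  then show ?thesis by (simp add: hom_iff)
qed

lemma
  assumes "f \<in> hom TopC a b"
  shows top_arr_vapp: "top_arr (top_of a) (top_of b) (vapp f) = f"
    and TopC_cont: "continuous_map (top_of a) (top_of b) (vapp f)"
    and TopC_open: "open_map (top_of a) (top_of b) (vapp f)"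
    and TopC_hom_Ob: "a \<in> Ob TopC" "b \<in> Ob TopC"
proof -
  from assms have "f \<in> Ar TopC" "vsrc f = a" "vtgt f = b" by (auto simp: hom_iff)
  then obtain S T h where f: "f = top_arr S T h" "vsmall (topspace S)" "vsmall (topspace T)" "continuous_map S T h" "open_map S T h"
    by (auto simp: TopC_def vsmall_def[symmetric])
  then have a: "a = top_code S" "b = top_code T" using \<open>vsrc f = a\<close> \<open>vtgt f = b\<close> by auto
  have t: "top_of a = S" "top_of b = T" using a f top_of_top_code by auto
  have e: "h x = vapp f x" if "x \<in> topspace S" for x using vapp_top_arr[OF f(2) that] f(1) by simp
  show "a \<in> Ob TopC" "b \<in> Ob TopC" using a f top_code_Ob by auto
  show "top_arr (top_of a) (top_of b) (vapp f) = f" unfolding t by (subst (2) f(1)) (rule top_arr_cong, simp add: e)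
  show "continuous_map (top_of a) (top_of b) (vapp f)" unfolding t by (rule continuous_map_eq[OF f(4) e])
  have "vapp f ` U = h ` U" if "openin S U" for U
    using openin_subset[OF that] e by (intro image_cong) auto
  then show "open_map (top_of a) (top_of b) (vapp f)" unfolding t open_map_def using f(5) by (simp add: open_map_def)
qed

lemma TopC_elts: "f \<in> hom TopC a b \<Longrightarrow> x \<in> topspace (top_of a) \<Longrightarrow> vapp f x \<in> topspace (top_of b)"
  using TopC_cont continuous_map_image_subset_topspace by blast

lemma TopC_eqI:
  assumes "f \<in> hom TopC a b" "g \<in> hom TopC a b" "\<And>x. x \<in> topspace (top_of a) \<Longrightarrow> vapp f x = vapp g x"
  shows "f = g"
  by (rule trans[OF top_arr_vapp[OF assms(1), symmetric] trans[OF top_arr_cong[OF assms(3)] top_arr_vapp[OF assms(2)]]])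

lemma TopC_Idn: "Idn TopC c = top_arr (top_of c) (top_of c) id"
  by (simp add: TopC_def)

lemma vapp_TopC_Idn: "c \<in> Ob TopC \<Longrightarrow> x \<in> topspace (top_of c) \<Longrightarrow> vapp (Idn TopC c) x = x"
  by (simp add: TopC_Idn vapp_top_arr TopC_ObD)

lemma TopC_Cmp: "f \<in> hom TopC a b \<Longrightarrow> g \<in> hom TopC b c \<Longrightarrow> Cmp TopC g f = top_arr (top_of a) (top_of c) (vapp g \<circ> vapp f)"
  by (simp add: TopC_def hom_iff)

lemma vapp_TopC_Cmp: "f \<in> hom TopC a b \<Longrightarrow> g \<in> hom TopC b c \<Longrightarrow> x \<in> topspace (top_of a) \<Longrightarrow>
    vapp (Cmp TopC g f) x = vapp g (vapp f x)"
  by (simp add: TopC_Cmp vapp_top_arr TopC_ObD(2)[OF TopC_hom_Ob(1)])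

lemma category_TopC: "category TopC"
proof (rule categoryI)
  show "Dm TopC f \<in> Ob TopC \<and> Cd TopC f \<in> Ob TopC" if "f \<in> Ar TopC" for f :: 'a
    using TopC_hom_Ob[OF Ar_hom[OF that]] by simp
  show I: "Idn TopC c \<in> hom TopC c c" if "c \<in> Ob TopC" for c :: 'a
    using top_arr_hom[of "top_of c" "top_of c" id] TopC_ObD[OF that] 
    by (simp add: TopC_Idn) (simp add: open_map_def)
  show c: "Cmp TopC g f \<in> hom TopC a c" if f: "f \<in> hom TopC a b" and g: "g \<in> hom TopC b c" for f g a b c :: 'a
  proof -
    note o = TopC_ObD[OF TopC_hom_Ob(1)[OF f]] TopC_ObD[OF TopC_hom_Ob(2)[OF g]]
    have "top_arr (top_of a) (top_of c) (vapp g \<circ> vapp f) \<in> hom TopC (top_code (top_of a)) (top_code (top_of c))"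
      by (rule top_arr_hom[OF o(2,4) continuous_map_compose[OF TopC_cont[OF f] TopC_cont[OF g]]
          open_map_compose[OF TopC_open[OF f] TopC_open[OF g]]])
    then show ?thesis unfolding TopC_Cmp[OF f g] o .
  qed
  fix a b f :: 'a assume f: "f \<in> hom TopC a b"
  note o = TopC_hom_Ob[OF f]
  show "Cmp TopC f (Idn TopC a) = f"
    by (rule TopC_eqI[OF c[OF I[OF o(1)] f] f]) (simp add: vapp_TopC_Cmp[OF I[OF o(1)] f] vapp_TopC_Idn[OF o(1)])
  show "Cmp TopC (Idn TopC b) f = f"
    by (rule TopC_eqI[OF c[OF f I[OF o(2)]] f])
      (simp add: vapp_TopC_Cmp[OF f I[OF o(2)]] vapp_TopC_Idn[OF o(2)] TopC_elts[OF f])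
  fix g h d e assume g: "g \<in> hom TopC b d" and h: "h \<in> hom TopC d e"
  show "Cmp TopC h (Cmp TopC g f) = Cmp TopC (Cmp TopC h g) f"
    by (rule TopC_eqI[OF c[OF c[OF f g] h] c[OF f c[OF g h]]])
      (simp add: vapp_TopC_Cmp[OF c[OF f g] h] vapp_TopC_Cmp[OF f c[OF g h]] vapp_TopC_Cmp[OF f g] vapp_TopC_Cmp[OF g h] TopC_elts[OF f])
qed

lemma top_code_VS: "vsmall (topspace T) \<Longrightarrow> top_code T \<in> VS"
  unfolding top_code_def by (intro vset_VS_I vsmall_opens)

lemma moderately_small_TopC: "moderately_small TopC"
proof (rule moderately_small_VS)
  show "Ob TopC \<subseteq> (VS::'a set)" by (auto simp: TopC_Ob top_code_VS)
  show "Ar TopC \<subseteq> (VS::'a set)"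
  proof
    fix f :: 'a assume "f \<in> Ar TopC"
    then have f: "f \<in> hom TopC (vsrc f) (vtgt f)" by (simp add: hom_iff)
    note o = TopC_ObD[OF TopC_hom_Ob(1)[OF f]] TopC_ObD[OF TopC_hom_Ob(2)[OF f]]
    have "vapp f ` topspace (top_of (vsrc f)) \<subseteq> VS"
      using TopC_elts[OF f] vsmallD[OF o(4)] by auto
    then have "top_arr (top_of (vsrc f)) (top_of (vtgt f)) (vapp f) \<in> VS"
      unfolding top_arr_def using o(2,4) by (intro varr_VS top_code_VS)
    then show "f \<in> VS" using top_arr_vapp[OF f] by simp
  qed
qed

lemma TopC_invertibleD:
  assumes f: "f \<in> hom TopC a b" and i: "invertible TopC f"
  shows "bij_betw (vapp f) (topspace (top_of a)) (topspace (top_of b))"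
proof -
  let ?g = "arr_inv TopC f"
  note g = arr_inv_hom[OF i f] and o = TopC_hom_Ob[OF f]
  have "vapp ?g (vapp f x) = x" if "x \<in> topspace (top_of a)" for x
    using vapp_TopC_Cmp[OF f g that] vapp_TopC_Idn[OF o(1) that] by (simp add: arr_inv_left[OF i f])
  moreover have "vapp f (vapp ?g x) = x" if "x \<in> topspace (top_of b)" for x
    using vapp_TopC_Cmp[OF g f that] vapp_TopC_Idn[OF o(2) that] by (simp add: arr_inv_right[OF i f])
  ultimately show ?thesis
    using TopC_elts[OF f] TopC_elts[OF g] by (intro bij_betw_byWitness[where f' = "vapp ?g"]) auto
qed

text \<open>A bijective open and continuous map is a homeomorphism.\<close>

lemma TopC_invertibleI:
  assumes f: "f \<in> hom TopC a b" and b: "bij_betw (vapp f) (topspace (top_of a)) (topspace (top_of b))"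
  shows "invertible TopC f"
proof -
  note o = TopC_hom_Ob[OF f]
  let ?k = "inv_into (topspace (top_of a)) (vapp f)"
  have k: "?k y \<in> topspace (top_of a)" "vapp f (?k y) = y" if "y \<in> topspace (top_of b)" for y
    using b that by (auto simp: bij_betw_def inv_into_into f_inv_into_f)
  have k': "?k (vapp f x) = x" if "x \<in> topspace (top_of a)" for x
    using b that by (auto simp: bij_betw_def)
  have cont: "continuous_map (top_of b) (top_of a) ?k"
    unfolding continuous_map_def
  proof (intro conjI allI impI)
    show "?k \<in> topspace (top_of b) \<rightarrow> topspace (top_of a)" using k by auto
    fix U assume U: "openin (top_of a) U"
    have e: "{y \<in> topspace (top_of b). ?k y \<in> U} = vapp f ` U"
    proof
      show "{y \<in> topspace (top_of b). ?k y \<in> U} \<subseteq> vapp f ` U" using k(2) by (metis (mono_tags, lifting) image_eqI mem_Collect_eq subsetI)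
      show "vapp f ` U \<subseteq> {y \<in> topspace (top_of b). ?k y \<in> U}" using openin_subset[OF U] k' TopC_elts[OF f] by auto
    qed
    show "openin (top_of b) {y \<in> topspace (top_of b). ?k y \<in> U}"
      unfolding e using TopC_open[OF f] U by (simp add: open_map_def)
  qed
  have opn: "open_map (top_of b) (top_of a) ?k"
    unfolding open_map_def
  proof (intro allI impI)
    fix U assume U: "openin (top_of b) U"
    have e: "?k ` U = {x \<in> topspace (top_of a). vapp f x \<in> U}"
    proof
      show "{x \<in> topspace (top_of a). vapp f x \<in> U} \<subseteq> ?k ` U" using k' by (metis (mono_tags, lifting) image_eqI mem_Collect_eq subsetI)
      show "?k ` U \<subseteq> {x \<in> topspace (top_of a). vapp f x \<in> U}" using openin_subset[OF U] k by auto
    qed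
    show "openin (top_of a) (?k ` U)"
      unfolding e by (rule openin_continuous_map_preimage[OF TopC_cont[OF f] U])
  qed
  let ?g = "top_arr (top_of b) (top_of a) ?k"
  have g: "?g \<in> hom TopC b a"
    using top_arr_hom[OF _ _ cont opn] TopC_ObD[OF o(1)] TopC_ObD[OF o(2)] by simp
  have vg: "vapp ?g y = ?k y" if "y \<in> topspace (top_of b)" for y
    using vapp_top_arr[OF TopC_ObD(2)[OF o(2)] that] .
  note cI = cat_id[OF category_TopC] and cC = cat_comp[OF category_TopC]
  show ?thesis
  proof (rule invertibleI[OF f g])
    show "Cmp TopC ?g f = Idn TopC a"
      by (rule TopC_eqI[OF cC[OF f g] cI[OF o(1)]])
        (simp add: vapp_TopC_Cmp[OF f g] vapp_TopC_Idn[OF o(1)] vg TopC_elts[OF f] k')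
    show "Cmp TopC f ?g = Idn TopC b"
      by (rule TopC_eqI[OF cC[OF g f] cI[OF o(2)]])
        (simp add: vapp_TopC_Cmp[OF g f] vapp_TopC_Idn[OF o(2)] vg k)
  qed
qed

lemma vimg_vset: "small U \<Longrightarrow> vimg f (vset U) = vset (vapp f ` U)"
  by (simp add: vimg_def elts_vset)

lemma open_small: "c \<in> Ob TopC \<Longrightarrow> openin (top_of c) U \<Longrightarrow> small U"
  using TopC_ObD openin_subset small_subset vsmall_small by metis

lemma ouv_op_Ob: "c \<in> Ob TopC \<Longrightarrow> u \<in> Ob (ouv_op c) \<longleftrightarrow> openin (top_of c) (elts u)"
  by (auto simp: ouv_op_def elts_vset open_small intro: exI[of _ "elts u"])

lemma ouv_op_hom: 
  assumes "c \<in> Ob TopC"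
  shows "z \<in> hom (ouv_op c) u v \<longleftrightarrow> z = vpair u v \<and> openin (top_of c) (elts u) \<and> openin (top_of c) (elts v) \<and> elts v \<subseteq> elts u"
proof
  assume "z \<in> hom (ouv_op c) u v"
  then show "z = vpair u v \<and> openin (top_of c) (elts u) \<and> openin (top_of c) (elts v) \<and> elts v \<subseteq> elts u"
    using elts_vset[OF open_small[OF assms]] by (auto simp: hom_iff ouv_op_def)
next
  assume a: "z = vpair u v \<and> openin (top_of c) (elts u) \<and> openin (top_of c) (elts v) \<and> elts v \<subseteq> elts u"
  then have "\<exists>U V. z = vpair (vset U) (vset V) \<and> openin (top_of c) U \<and> openin (top_of c) V \<and> V \<subseteq> U"
    by (intro exI[of _ "elts u"] exI[of _ "elts v"]) simp
  with a show "z \<in> hom (ouv_op c) u v" by (simp add: hom_iff ouv_op_def)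
qed

lemma ouv_op_simps [simp]: "Idn (ouv_op c) u = vpair u u" "Cmp (ouv_op c) g f = vpair (vfst f) (vsnd g)"
  "Dm (ouv_op c) = vfst" "Cd (ouv_op c) = vsnd"
  by (simp_all add: ouv_op_def)

lemma category_ouv: assumes c: "c \<in> Ob TopC" shows "category (ouv_op c)"
proof (rule categoryI)
  show "Dm (ouv_op c) f \<in> Ob (ouv_op c) \<and> Cd (ouv_op c) f \<in> Ob (ouv_op c)" if "f \<in> Ar (ouv_op c)" for f
    using Ar_hom[OF that] by (simp add: ouv_op_hom[OF c] ouv_op_Ob[OF c])
qed (auto simp: ouv_op_hom[OF c] ouv_op_Ob[OF c])

lemma moderately_small_ouv: assumes c: "c \<in> Ob TopC" shows "moderately_small (ouv_op c)"
proof (rule moderately_small_VS)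
  note v = TopC_ObD(2)[OF c]
  have o: "u \<in> VS" if "openin (top_of c) (elts u)" for u
    using vset_VS_I[OF vsmall_subset[OF v openin_subset[OF that]]] by simp
  show "Ob (ouv_op c) \<subseteq> VS" using o by (auto simp: ouv_op_Ob[OF c])
  show "Ar (ouv_op c) \<subseteq> VS"
  proof
    fix z assume "z \<in> Ar (ouv_op c)"
    from Ar_hom[OF this] show "z \<in> VS" unfolding ouv_op_hom[OF c] using o by (metis vpair_VS)
  qed
qed

lemma ouv_fam_simps [simp]: "FamO ouv_fam c = ouv_op c" "FO (FamA ouv_fam f) = vimg f"
  "Src (FamA ouv_fam f) = ouv_op (vsrc f)" "Tgt (FamA ouv_fam f) = ouv_op (vtgt f)"
  "FA (FamA ouv_fam f) b = vpair (vimg f (vfst b)) (vimg f (vsnd b))"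
  by (simp_all add: ouv_fam_def)

lemma elts_vimg [simp]: "elts (vimg f u) = vapp f ` elts u"
  by (simp add: vimg_def elts_vset small_image small_elts)

lemma vimg_eqI: "vapp f ` elts u = elts v \<Longrightarrow> vimg f u = v"
  by (metis vimg_def vset_elts)

lemma TopC_image_open: "f \<in> hom TopC a b \<Longrightarrow> openin (top_of a) U \<Longrightarrow> openin (top_of b) (vapp f ` U)"
  using TopC_open by (auto simp: open_map_def)

lemma image_Idn: assumes c: "c \<in> Ob TopC" and U: "openin (top_of c) U" shows "vapp (Idn TopC c) ` U = U"
proof -
  have "vapp (Idn TopC c) ` U = (\<lambda>x. x) ` U"
    by (rule image_cong) (use openin_subset[OF U] vapp_TopC_Idn[OF c] in auto)
  then show ?thesis by simp
qed

lemma image_Cmp: assumes f: "f \<in> hom TopC a b" and g: "g \<in> hom TopC b c" and U: "openin (top_of a) U"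
  shows "vapp (Cmp TopC g f) ` U = vapp g ` vapp f ` U"
  unfolding image_image by (rule image_cong) (use openin_subset[OF U] vapp_TopC_Cmp[OF f g] in auto)

lemma fam_ouv: "fam TopC ouv_fam"
  unfolding fam_def
proof (intro conjI ballI allI)
  show "category TopC" by (rule category_TopC)
  fix c :: 'a assume c: "c \<in> Ob TopC"
  show "category (FamO ouv_fam c)" "moderately_small (FamO ouv_fam c)"
    using category_ouv[OF c] moderately_small_ouv[OF c] by simp_all
  have i: "vimg (Idn TopC c) u = u" if "openin (top_of c) (elts u)" for u
    by (rule vimg_eqI[OF image_Idn[OF c that]])
  show "fun_eq (id_func (FamO ouv_fam c)) (FamA ouv_fam (Idn TopC c))"
    unfolding fun_eq_def
  proof (intro conjI ballI)
    show "Src (id_func (FamO ouv_fam c)) = Src (FamA ouv_fam (Idn TopC c))"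
      "Tgt (id_func (FamO ouv_fam c)) = Tgt (FamA ouv_fam (Idn TopC c))"
      using TopC_ObD(1)[OF c] by (simp_all add: TopC_Idn)
    show "FO (id_func (FamO ouv_fam c)) u = FO (FamA ouv_fam (Idn TopC c)) u" if "u \<in> Ob (Src (id_func (FamO ouv_fam c)))" for u
      using that i by (simp add: ouv_op_Ob[OF c])
    fix z assume "z \<in> Ar (Src (id_func (FamO ouv_fam c)))"
    then have "z \<in> Ar (ouv_op c)" by simp
    from Ar_hom[OF this, unfolded ouv_op_hom[OF c]]
    have "z = vpair (vfst z) (vsnd z)" "openin (top_of c) (elts (vfst z))" "openin (top_of c) (elts (vsnd z))" by auto
    with i show "FA (id_func (FamO ouv_fam c)) z = FA (FamA ouv_fam (Idn TopC c)) z" by simp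
  qed
next
  fix a b f :: 'a assume f: "f \<in> hom TopC a b"
  then have st: "vsrc f = a" "vtgt f = b" by (auto simp: hom_iff)
  note o = TopC_hom_Ob[OF f]
  show "Src (FamA ouv_fam f) = FamO ouv_fam a" "Tgt (FamA ouv_fam f) = FamO ouv_fam b" using st by auto
  show "is_functor (FamA ouv_fam f)"
    by (rule is_functorI)
      (auto simp: st category_ouv o ouv_op_Ob[OF o(1)] ouv_op_Ob[OF o(2)] ouv_op_hom[OF o(1)] ouv_op_hom[OF o(2)]
        TopC_image_open[OF f] image_mono)
  fix c g assume g: "g \<in> hom TopC b c"
  have i: "vimg (Cmp TopC g f) u = vimg g (vimg f u)" if "openin (top_of a) (elts u)" for u
    by (rule vimg_eqI) (simp add: image_Cmp[OF f g that])
  show "fun_eq (comp_func (FamA ouv_fam g) (FamA ouv_fam f)) (FamA ouv_fam (Cmp TopC g f))"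
    unfolding fun_eq_def
  proof (intro conjI ballI)
    let ?F = "comp_func (FamA ouv_fam g) (FamA ouv_fam f)"
    have "vsrc (Cmp TopC g f) = a" "vtgt (Cmp TopC g f) = c" 
      using cat_comp[OF category_TopC f g] by (auto simp: hom_iff)
    then show "Src ?F = Src (FamA ouv_fam (Cmp TopC g f))" "Tgt ?F = Tgt (FamA ouv_fam (Cmp TopC g f))"
      using st g by (auto simp: hom_iff)
    show "FO ?F u = FO (FamA ouv_fam (Cmp TopC g f)) u" if "u \<in> Ob (Src ?F)" for u
      using that i st by (simp add: ouv_op_Ob[OF o(1)])
    fix z assume "z \<in> Ar (Src ?F)"
    then have "z \<in> Ar (ouv_op a)" using st by simp
    from Ar_hom[OF this, unfolded ouv_op_hom[OF o(1)]]
    have "openin (top_of a) (elts (vfst z))" "openin (top_of a) (elts (vsnd z))" by auto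
    with i show "FA ?F z = FA (FamA ouv_fam (Cmp TopC g f)) z" by simp
  qed
qed

subsection \<open>The category of open sets of a family of spaces\<close>

abbreviation spc :: "'u::two_universes func \<Rightarrow> 'u \<Rightarrow> 'u topology" where
  "spc m d \<equiv> top_of (FO m d)"

text \<open>The arrow over \<open>\<alpha>\<close> from an open set \<open>U\<close> to an open subset \<open>V\<close> of its image.  As the fibres are posets, all
  arrows of the oplax colimit are of this form.\<close>

definition oar :: "'u::two_universes func \<Rightarrow> 'u set \<Rightarrow> 'u \<Rightarrow> 'u set \<Rightarrow> 'u" where
  "oar m U \<alpha> V = oarr (vset U) \<alpha> (vpair (vset (vapp (FA m \<alpha>) ` U)) (vset V))"

context
  fixes m :: "'u::two_universes func"
  assumes m: "is_functor m" "Tgt m = TopC"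
begin

lemma top_Ob: "d \<in> Ob (Src m) \<Longrightarrow> FO m d \<in> Ob TopC"
  using func_Ob[OF m(1)] m(2) by simp

lemma top_hom: "\<alpha> \<in> hom (Src m) d e \<Longrightarrow> FA m \<alpha> \<in> hom TopC (FO m d) (FO m e)"
  using func_hom[OF m(1)] m(2) by simp

lemma top_vsmall: "d \<in> Ob (Src m) \<Longrightarrow> vsmall (topspace (spc m d))"
  using TopC_ObD(2)[OF top_Ob] .

lemma top_open_small: "d \<in> Ob (Src m) \<Longrightarrow> openin (spc m d) U \<Longrightarrow> small U"
  using open_small[OF top_Ob] .

lemma top_open_elts: "d \<in> Ob (Src m) \<Longrightarrow> openin (spc m d) U \<Longrightarrow> elts (vset U) = U"
  using elts_vset top_open_small by blast

lemma top_image_open: "\<alpha> \<in> hom (Src m) d e \<Longrightarrow> openin (spc m d) U \<Longrightarrow> openin (spc m e) (vapp (FA m \<alpha>) ` U)"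
  using TopC_image_open[OF top_hom] .

lemma top_image_Idn: "d \<in> Ob (Src m) \<Longrightarrow> openin (spc m d) U \<Longrightarrow> vapp (FA m (Idn (Src m) d)) ` U = U"
  using image_Idn[OF top_Ob] func_Idn[OF m(1)] m(2) by simp

lemma top_image_Cmp: "\<alpha> \<in> hom (Src m) d e \<Longrightarrow> \<beta> \<in> hom (Src m) e c \<Longrightarrow> openin (spc m d) U \<Longrightarrow>
    vapp (FA m (Cmp (Src m) \<beta> \<alpha>)) ` U = vapp (FA m \<beta>) ` vapp (FA m \<alpha>) ` U"
  using image_Cmp[OF top_hom top_hom] func_Cmp[OF m(1)] m(2) by simp

lemma ouv_Ob: "vpair d (vset U) \<in> Ob (oplax (Src m) (pre ouv_fam m))" if "d \<in> Ob (Src m)" "openin (spc m d) U"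
  using that by (simp add: ouv_op_Ob[OF top_Ob] top_open_elts)

lemma ouv_ObE:
  assumes "x \<in> Ob (oplax (Src m) (pre ouv_fam m))"
  obtains d U where "x = vpair d (vset U)" "d \<in> Ob (Src m)" "openin (spc m d) U"
proof -
  from assms obtain d u where 1: "x = vpair d u" "d \<in> Ob (Src m)" "u \<in> Ob (ouv_op (FO m d))" by (auto simp: oplax_Ob)
  then show thesis using that[of d "elts u"] ouv_op_Ob[OF top_Ob[OF 1(2)]] by simp
qed

lemma oar_hom:
  assumes a: "\<alpha> \<in> hom (Src m) d e" and U: "openin (spc m d) U" and V: "openin (spc m e) V" "V \<subseteq> vapp (FA m \<alpha>) ` U"
  shows "oar m U \<alpha> V \<in> hom (oplax (Src m) (pre ouv_fam m)) (vpair d (vset U)) (vpair e (vset V))"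
proof -
  note de = hom_Ob1[OF func_Src[OF m(1)] a] hom_Ob2[OF func_Src[OF m(1)] a]
  note iU = top_image_open[OF a U]
  show ?thesis
    unfolding oar_def using a U V iU de
    by (intro oplax_homI) (simp_all add: ouv_op_Ob ouv_op_hom top_Ob top_open_elts vimg_vset top_open_small)
qed

lemma oar_homE:
  assumes z: "z \<in> hom (oplax (Src m) (pre ouv_fam m)) x y"
  obtains d U e V \<alpha> where "x = vpair d (vset U)" "y = vpair e (vset V)" "z = oar m U \<alpha> V" "\<alpha> \<in> hom (Src m) d e"
    "openin (spc m d) U" "openin (spc m e) V" "V \<subseteq> vapp (FA m \<alpha>) ` U" "d \<in> Ob (Src m)" "e \<in> Ob (Src m)"
  using z
proof (rule oplax_homE)
  fix d u e v \<alpha> \<beta>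
  assume 1: "x = vpair d u" "y = vpair e v" "z = oarr u \<alpha> \<beta>" and a: "\<alpha> \<in> hom (Src m) d e" and u: "u \<in> Ob (FamO (pre ouv_fam m) d)"
    and b: "\<beta> \<in> hom (FamO (pre ouv_fam m) e) (FO (FamA (pre ouv_fam m) \<alpha>) u) v"
  note de = hom_Ob1[OF func_Src[OF m(1)] a] hom_Ob2[OF func_Src[OF m(1)] a]
  have U: "openin (spc m d) (elts u)" using u ouv_op_Ob[OF top_Ob[OF de(1)]] by simp
  have V: "\<beta> = vpair (vimg (FA m \<alpha>) u) v" "openin (spc m e) (elts v)" "elts v \<subseteq> vapp (FA m \<alpha>) ` elts u"
    using b ouv_op_hom[OF top_Ob[OF de(2)]] by auto
  show thesis
    by (rule that[of d "elts u" e "elts v" \<alpha>]) (use 1 a U V de in \<open>simp_all add: oar_def vimg_def\<close>)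
qed

lemma oar_Idn: "d \<in> Ob (Src m) \<Longrightarrow> openin (spc m d) U \<Longrightarrow>
    Idn (oplax (Src m) (pre ouv_fam m)) (vpair d (vset U)) = oar m U (Idn (Src m) d) U"
  by (simp add: oar_def top_image_Idn)

lemma oar_Cmp:
  assumes "\<alpha> \<in> hom (Src m) d e" "\<beta> \<in> hom (Src m) e c" "openin (spc m d) U"
  shows "Cmp (oplax (Src m) (pre ouv_fam m)) (oar m V \<beta> W) (oar m U \<alpha> V) = oar m U (Cmp (Src m) \<beta> \<alpha>) W"
proof -
  note d = hom_Ob2[OF func_Src[OF m(1)] assms(1)]
  show ?thesis
    using top_open_small[OF d top_image_open[OF assms(1,3)]] 
    by (simp add: oar_def oplax_Cmp[OF assms(2)] vimg_vset top_image_Cmp[OF assms])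
qed

end

lemma oplax_map_ouv_FO:
  assumes o: "over n m h \<phi>" and T: "Tgt n = TopC" and v: "v \<in> Ob (Src n)" and U: "openin (spc n v) U"
  shows "FO (oplax_map ouv_fam n m h \<phi>) (vpair v (vset U)) = vpair (FO h v) (vset (vapp (\<phi> v) ` U))"
  using top_open_small[OF over_n[OF o] T v U] by (simp add: vimg_vset)

lemma oplax_map_oar:
  assumes o: "over n m h \<phi>" and T: "Tgt n = TopC" and a: "\<alpha> \<in> hom (Src n) v w"
    and U: "openin (spc n v) U" and V: "openin (spc n w) V"
  shows "FA (oplax_map ouv_fam n m h \<phi>) (oar n U \<alpha> V) = oar m (vapp (\<phi> v) ` U) (FA h \<alpha>) (vapp (\<phi> w) ` V)"
proof -
  note n = over_n[OF o] and m = over_m[OF o] and h = over_h[OF o]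
  have mT: "Tgt m = TopC" using over_Tgt_m[OF o] T by simp
  note vw = hom_Ob1[OF func_Src[OF n] a] hom_Ob2[OF func_Src[OF n] a]
  note p = over_hom[OF o vw(1), unfolded T] over_hom[OF o vw(2), unfolded T]
  have ha: "FA h \<alpha> \<in> hom (Src m) (FO h v) (FO h w)"
    using func_hom[OF h] a over_Src_h[OF o] over_Tgt_h[OF o] by simp
  have "vapp (\<phi> w) ` vapp (FA n \<alpha>) ` U = vapp (FA m (FA h \<alpha>)) ` vapp (\<phi> v) ` U"
    using image_Cmp[OF top_hom[OF n T a] p(2) U] image_Cmp[OF p(1) top_hom[OF m mT ha] U] over_natural[OF o a] T by simp
  then show ?thesis
    using top_open_small[OF n T vw(1) U] top_open_small[OF n T vw(2) V] top_open_small[OF n T vw(2) top_image_open[OF n T a U]]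
    by (simp add: oar_def oplax_map_FA[OF a] vimg_vset)
qed

section \<open>The sum functor of the module and its naturality\<close>

definition Et_arr :: "'u::two_universes presheaf \<Rightarrow> ('u \<Rightarrow> 'u) \<Rightarrow> ('u set \<Rightarrow> 'u \<Rightarrow> 'u) \<Rightarrow> 'u presheaf \<Rightarrow> 'u" where
  "Et_arr F \<phi> \<tau> G = top_arr (Et F) (Et G) (Et_map F \<phi> \<tau> G)"

lemma top_of_Et: "psh F \<Longrightarrow> top_of (top_code (Et F)) = Et F"
  by (rule top_of_top_code[OF vsmall_Et])

lemma Et_arr_hom: "pmor F \<phi> \<tau> G \<Longrightarrow> Et_arr F \<phi> \<tau> G \<in> hom TopC (top_code (Et F)) (top_code (Et G))"
  unfolding Et_arr_def
  by (rule top_arr_hom[OF vsmall_Et[OF pmor_F] vsmall_Et[OF pmor_G] continuous_Et_map open_Et_map])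

lemma vapp_Et_arr:
  assumes "pmor F \<phi> \<tau> G" "sect F x U s"
  shows "vapp (Et_arr F \<phi> \<tau> G) (pt F x U s) = pt G (\<phi> x) (\<phi> ` U) (\<tau> U s)"
  unfolding Et_arr_def vapp_top_arr[OF vsmall_Et[OF pmor_F[OF assms(1)]] pt_topspace[OF assms(2)]] 
  by (rule Et_map_pt[OF assms])

lemma vapp_Et_arr_eps:
  assumes p: "pmor F \<phi> \<tau> G" and U: "openin (Spc F) U" "s \<in> Sec F U"
  shows "vapp (Et_arr F \<phi> \<tau> G) ` eps F U s = eps G (\<phi> ` U) (\<tau> U s)"
proof -
  have "vapp (Et_arr F \<phi> \<tau> G) ` eps F U s = Et_map F \<phi> \<tau> G ` eps F U s"
    unfolding Et_arr_def using openin_subset[OF openin_Et_eps[OF U]] vapp_top_arr[OF vsmall_Et[OF pmor_F[OF p]]]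
    by (intro image_cong) auto
  then show ?thesis using Et_map_eps[OF p U] by simp
qed

lemma Et_arr_eqI:
  assumes "psh F" "f \<in> hom TopC (top_code (Et F)) b" "g \<in> hom TopC (top_code (Et F)) b"
    and "\<And>x U s. sect F x U s \<Longrightarrow> vapp f (pt F x U s) = vapp g (pt F x U s)"
  shows "f = g"
  using assms(4) by (intro TopC_eqI[OF assms(2,3)]) (auto simp: top_of_Et[OF assms(1)] topspace_Et)

lemma invertible_Et_arr:
  assumes p: "pmor F \<phi> \<tau> G" and b: "bij_betw \<phi> (topspace (Spc F)) (topspace (Spc G))"
    and t: "\<And>U. openin (Spc F) U \<Longrightarrow> bij_betw (\<tau> U) (Sec F U) (Sec G (\<phi> ` U))"
  shows "invertible TopC (Et_arr F \<phi> \<tau> G)"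
proof (rule TopC_invertibleI[OF Et_arr_hom[OF p]])
  have "bij_betw (vapp (Et_arr F \<phi> \<tau> G)) (topspace (Et F)) (topspace (Et G)) \<longleftrightarrow>
      bij_betw (Et_map F \<phi> \<tau> G) (topspace (Et F)) (topspace (Et G))"
    by (rule bij_betw_cong) (simp add: Et_arr_def vapp_top_arr[OF vsmall_Et[OF pmor_F[OF p]]])
  then show "bij_betw (vapp (Et_arr F \<phi> \<tau> G)) (topspace (top_of (top_code (Et F)))) (topspace (top_of (top_code (Et G))))"
    unfolding top_of_Et[OF pmor_F[OF p]] top_of_Et[OF pmor_G[OF p]] using bij_Et_map[OF assms] by blast
qed

definition module_arg :: "'u::two_universes func \<Rightarrow> 'u func \<Rightarrow> bool" where
  "module_arg m f \<longleftrightarrow> is_functor m \<and> Tgt m = TopC \<and>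
     is_functor f \<and> Tgt f = SetC \<and> Src f = oplax (Src m) (pre ouv_fam m)"

abbreviation act :: "'u::two_universes func \<Rightarrow> 'u func \<Rightarrow> 'u set \<Rightarrow> 'u \<Rightarrow> 'u set \<Rightarrow> 'u \<Rightarrow> 'u" where
  "act m f U \<alpha> V \<equiv> vapp (FA f (oar m U \<alpha> V))"

lemma psh_at_simps: "Spc (psh_at m f d) = spc m d" "Sec (psh_at m f d) U = elts (FO f (vpair d (vset U)))"
  by (simp_all add: psh_at_def)

context
  fixes m f :: "'u::two_universes func"
  assumes mf: "module_arg m f"
begin

lemma mod_m: "is_functor m" "Tgt m = TopC"
  and mod_f: "is_functor f" "Tgt f = SetC" "Src f = oplax (Src m) (pre ouv_fam m)"
  using mf by (auto simp: module_arg_def)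

lemmas mod_C = func_Src[OF mod_m(1)]

lemma sec_VS: "d \<in> Ob (Src m) \<Longrightarrow> openin (spc m d) U \<Longrightarrow> FO f (vpair d (vset U)) \<in> VS"
  using func_VS[OF mod_f(1,2)] ouv_Ob[OF mod_m] mod_f(3) by simp

lemma act_elts: "\<alpha> \<in> hom (Src m) d e \<Longrightarrow> openin (spc m d) U \<Longrightarrow> openin (spc m e) V \<Longrightarrow> V \<subseteq> vapp (FA m \<alpha>) ` U \<Longrightarrow>
    s \<in> elts (FO f (vpair d (vset U))) \<Longrightarrow> act m f U \<alpha> V s \<in> elts (FO f (vpair e (vset V)))"
  by (rule vapp_func_elts[OF mod_f(1,2)]) (auto simp: mod_f(3) intro: oar_hom[OF mod_m])

lemma act_Idn: "d \<in> Ob (Src m) \<Longrightarrow> openin (spc m d) U \<Longrightarrow> s \<in> elts (FO f (vpair d (vset U))) \<Longrightarrow>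
    act m f U (Idn (Src m) d) U s = s"
  using vapp_func_Idn[OF mod_f(1,2), unfolded mod_f(3), OF ouv_Ob[OF mod_m]] oar_Idn[OF mod_m] by simp

lemma act_Cmp:
  assumes "\<alpha> \<in> hom (Src m) d e" "\<beta> \<in> hom (Src m) e c" "openin (spc m d) U" "openin (spc m e) V" "openin (spc m c) W"
    "V \<subseteq> vapp (FA m \<alpha>) ` U" "W \<subseteq> vapp (FA m \<beta>) ` V" "s \<in> elts (FO f (vpair d (vset U)))"
  shows "act m f V \<beta> W (act m f U \<alpha> V s) = act m f U (Cmp (Src m) \<beta> \<alpha>) W s"
  using vapp_func_Cmp[OF mod_f(1,2), unfolded mod_f(3), OF oar_hom[OF mod_m assms(1,3,4,6)] oar_hom[OF mod_m assms(2,4,5,7)] assms(8)]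
  by (simp add: oar_Cmp[OF mod_m assms(1-3)])

lemma psh_at_Res: "d \<in> Ob (Src m) \<Longrightarrow> openin (spc m d) U \<Longrightarrow> Res (psh_at m f d) U V = act m f U (Idn (Src m) d) V"
  by (simp add: psh_at_def oar_def top_image_Idn[OF mod_m])

text \<open>Restrictions are the actions of arrows over an identity, so they are absorbed on either side of an
  action.\<close>

lemma act_Res_left:
  assumes a: "\<alpha> \<in> hom (Src m) d e" and U: "openin (spc m d) U" and V: "openin (spc m e) V" "V \<subseteq> vapp (FA m \<alpha>) ` U"
    and W: "openin (spc m e) W" "W \<subseteq> V" and s: "s \<in> elts (FO f (vpair d (vset U)))"
  shows "Res (psh_at m f e) V W (act m f U \<alpha> V s) = act m f U \<alpha> W s"
proof -
  note e = hom_Ob2[OF mod_C a]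
  show ?thesis
    unfolding psh_at_Res[OF e V(1)]
    using act_Cmp[OF a cat_id[OF mod_C e] U V(1) W(1) V(2) _ s] W(2) top_image_Idn[OF mod_m e V(1)] cat_idl[OF mod_C a] by simp
qed

lemma act_Res_right:
  assumes a: "\<alpha> \<in> hom (Src m) d e" and U: "openin (spc m d) U" and V: "openin (spc m d) V" "V \<subseteq> U"
    and W: "openin (spc m e) W" "W \<subseteq> vapp (FA m \<alpha>) ` V" and s: "s \<in> elts (FO f (vpair d (vset U)))"
  shows "act m f V \<alpha> W (Res (psh_at m f d) U V s) = act m f U \<alpha> W s"
proof -
  note d = hom_Ob1[OF mod_C a]
  show ?thesis
    unfolding psh_at_Res[OF d U]
    using act_Cmp[OF cat_id[OF mod_C d] a U V(1) W(1) _ W(2) s] V(2) top_image_Idn[OF mod_m d U] cat_idr[OF mod_C a] by simp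
qed

lemma psh_psh_at: assumes d: "d \<in> Ob (Src m)" shows "psh (psh_at m f d)"
  unfolding psh_def psh_at_simps
proof (intro conjI allI impI)
  note I = cat_id[OF mod_C d]
  show "vsmall (topspace (spc m d))" using top_vsmall[OF mod_m d] .
  show "vsmall (elts (FO f (vpair d (vset U))))" if "openin (spc m d) U" for U
    using vsmall_elts[OF sec_VS[OF d that]] .
  fix U V s assume U: "openin (spc m d) U" and V: "openin (spc m d) V" "V \<subseteq> U" and s: "s \<in> elts (FO f (vpair d (vset U)))"
  show "Res (psh_at m f d) U V s \<in> elts (FO f (vpair d (vset V)))"
    unfolding psh_at_Res[OF d U] using act_elts[OF I U V(1) _ s] V(2) top_image_Idn[OF mod_m d U] by simp
  fix W assume W: "openin (spc m d) W" "W \<subseteq> V"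
  show "Res (psh_at m f d) V W (Res (psh_at m f d) U V s) = Res (psh_at m f d) U W s"
    using act_Res_left[OF I U V(1) _ W s] V(2) top_image_Idn[OF mod_m d U] by (simp add: psh_at_Res[OF d U])
next
  fix U s assume U: "openin (spc m d) U" and s: "s \<in> elts (FO f (vpair d (vset U)))"
  show "Res (psh_at m f d) U U s = s" unfolding psh_at_Res[OF d U] by (rule act_Idn[OF d U s])
qed

lemma pmor_act:
  assumes a: "\<alpha> \<in> hom (Src m) d e"
  shows "pmor (psh_at m f d) (vapp (FA m \<alpha>)) (\<lambda>U. act m f U \<alpha> (vapp (FA m \<alpha>) ` U)) (psh_at m f e)"
  unfolding pmor_def psh_at_simps
proof (intro conjI allI impI)
  note d = hom_Ob1[OF mod_C a] and e = hom_Ob2[OF mod_C a] and h = top_hom[OF mod_m a] and i = top_image_open[OF mod_m a]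
  show "psh (psh_at m f d)" "psh (psh_at m f e)" using psh_psh_at d e by auto
  show "continuous_map (spc m d) (spc m e) (vapp (FA m \<alpha>))" "open_map (spc m d) (spc m e) (vapp (FA m \<alpha>))"
    using TopC_cont[OF h] TopC_open[OF h] by auto
  fix U s assume U: "openin (spc m d) U" and s: "s \<in> elts (FO f (vpair d (vset U)))"
  show "act m f U \<alpha> (vapp (FA m \<alpha>) ` U) s \<in> elts (FO f (vpair e (vset (vapp (FA m \<alpha>) ` U))))"
    using act_elts[OF a U i[OF U] _ s] by simp
  fix V assume V: "openin (spc m d) V" "V \<subseteq> U"
  show "act m f V \<alpha> (vapp (FA m \<alpha>) ` V) (Res (psh_at m f d) U V s) =
       Res (psh_at m f e) (vapp (FA m \<alpha>) ` U) (vapp (FA m \<alpha>) ` V) (act m f U \<alpha> (vapp (FA m \<alpha>) ` U) s)"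
    using act_Res_right[OF a U V i[OF V(1)] _ s] act_Res_left[OF a U i[OF U] _ i[OF V(1)] _ s] V(2) by (simp add: image_mono)
qed

lemma top_sum_simps [simp]: "Src (top_sum_fun m f) = Src m" "Tgt (top_sum_fun m f) = TopC"
  "FO (top_sum_fun m f) d = top_code (Et (psh_at m f d))"
  by (simp_all add: top_sum_fun_def)

lemma top_sum_FA: "\<alpha> \<in> hom (Src m) d e \<Longrightarrow> FA (top_sum_fun m f) \<alpha> =
    Et_arr (psh_at m f d) (vapp (FA m \<alpha>)) (\<lambda>U. act m f U \<alpha> (vapp (FA m \<alpha>) ` U)) (psh_at m f e)"
  by (simp add: top_sum_fun_def Let_def Et_arr_def hom_iff oar_def psh_at_simps)

lemma top_sum_pt:
  assumes "\<alpha> \<in> hom (Src m) d e" "sect (psh_at m f d) x U s"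
  shows "vapp (FA (top_sum_fun m f) \<alpha>) (pt (psh_at m f d) x U s) =
    pt (psh_at m f e) (vapp (FA m \<alpha>) x) (vapp (FA m \<alpha>) ` U) (act m f U \<alpha> (vapp (FA m \<alpha>) ` U) s)"
  unfolding top_sum_FA[OF assms(1)] by (rule vapp_Et_arr[OF pmor_act[OF assms(1)] assms(2)])

lemma top_sum_eps:
  assumes "\<alpha> \<in> hom (Src m) d e" "openin (spc m d) U" "s \<in> elts (FO f (vpair d (vset U)))"
  shows "vapp (FA (top_sum_fun m f) \<alpha>) ` eps (psh_at m f d) U s =
    eps (psh_at m f e) (vapp (FA m \<alpha>) ` U) (act m f U \<alpha> (vapp (FA m \<alpha>) ` U) s)"
  unfolding top_sum_FA[OF assms(1)] by (rule vapp_Et_arr_eps[OF pmor_act[OF assms(1)]]) (simp_all add: psh_at_simps assms)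

lemma top_sum_hom: "\<alpha> \<in> hom (Src m) d e \<Longrightarrow>
    FA (top_sum_fun m f) \<alpha> \<in> hom TopC (top_code (Et (psh_at m f d))) (top_code (Et (psh_at m f e)))"
  using top_sum_FA Et_arr_hom[OF pmor_act] by simp

lemma top_sum_Ob: "d \<in> Ob (Src m) \<Longrightarrow> top_code (Et (psh_at m f d)) \<in> Ob TopC"
  by (rule top_code_Ob[OF vsmall_Et[OF psh_psh_at]])

lemma spc_top_sum: "d \<in> Ob (Src m) \<Longrightarrow> spc (top_sum_fun m f) d = Et (psh_at m f d)"
  by (simp add: top_of_Et[OF psh_psh_at])

lemma sect_act:
  assumes "\<alpha> \<in> hom (Src m) d e" "sect (psh_at m f d) x U s"
  shows "sect (psh_at m f e) (vapp (FA m \<alpha>) x) (vapp (FA m \<alpha>) ` U) (act m f U \<alpha> (vapp (FA m \<alpha>) ` U) s)"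
  by (rule pmor_sect[OF pmor_act[OF assms(1)] assms(2)])

lemma is_functor_top_sum: "is_functor (top_sum_fun m f)"
proof (rule is_functorI)
  let ?S = "top_sum_fun m f"
  show "category (Src ?S)" "category (Tgt ?S)" using mod_C category_TopC by simp_all
  show "FO ?S d \<in> Ob (Tgt ?S)" if "d \<in> Ob (Src ?S)" for d using that top_sum_Ob by simp
  show "FA ?S \<alpha> \<in> hom (Tgt ?S) (FO ?S d) (FO ?S e)" if "\<alpha> \<in> hom (Src ?S) d e" for \<alpha> d e
    using that top_sum_hom by simp
  show "FA ?S (Idn (Src ?S) d) = Idn (Tgt ?S) (FO ?S d)" if "d \<in> Ob (Src ?S)" for d
  proof -
    have d: "d \<in> Ob (Src m)" using that by simp
    note I = cat_id[OF mod_C d]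
    have "vapp (FA ?S (Idn (Src m) d)) (pt (psh_at m f d) x U s) = vapp (Idn TopC (top_code (Et (psh_at m f d)))) (pt (psh_at m f d) x U s)"
      if s: "sect (psh_at m f d) x U s" for x U s
    proof -
      have U: "openin (spc m d) U" "x \<in> U" "s \<in> elts (FO f (vpair d (vset U)))" using s by (auto simp: sect_def psh_at_simps)
      have "vapp (FA m (Idn (Src m) d)) x = x"
        using vapp_TopC_Idn[OF top_Ob[OF mod_m d]] func_Idn[OF mod_m(1) d] openin_subset[OF U(1)] U(2) mod_m(2) by auto
      then show ?thesis
        using top_sum_pt[OF I s] top_image_Idn[OF mod_m d U(1)] act_Idn[OF d U(1,3)]
          vapp_TopC_Idn[OF top_sum_Ob[OF d]] pt_topspace[OF s] top_of_Et[OF psh_psh_at[OF d]] by simp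
    qed
    then show ?thesis
      using Et_arr_eqI[OF psh_psh_at[OF d] top_sum_hom[OF I] cat_id[OF category_TopC top_sum_Ob[OF d]]] by simp
  qed
  fix \<alpha> \<beta> d e c assume "\<alpha> \<in> hom (Src ?S) d e" and "\<beta> \<in> hom (Src ?S) e c"
  then have a: "\<alpha> \<in> hom (Src m) d e" and b: "\<beta> \<in> hom (Src m) e c" by auto
  note ba = cat_comp[OF mod_C a b] and d = hom_Ob1[OF mod_C a]
  have "vapp (FA ?S (Cmp (Src m) \<beta> \<alpha>)) (pt (psh_at m f d) x U s) = vapp (Cmp TopC (FA ?S \<beta>) (FA ?S \<alpha>)) (pt (psh_at m f d) x U s)"
    if s: "sect (psh_at m f d) x U s" for x U s
  proof -
    have U: "openin (spc m d) U" "x \<in> U" "s \<in> elts (FO f (vpair d (vset U)))" using s by (auto simp: sect_def psh_at_simps)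
    have x: "vapp (FA m (Cmp (Src m) \<beta> \<alpha>)) x = vapp (FA m \<beta>) (vapp (FA m \<alpha>) x)"
      using vapp_TopC_Cmp[OF top_hom[OF mod_m a] top_hom[OF mod_m b]] func_Cmp[OF mod_m(1) a b] openin_subset[OF U(1)] U(2) mod_m(2) by auto
    note i = top_image_open[OF mod_m a U(1)] top_image_Cmp[OF mod_m a b U(1)]
    note j = top_image_open[OF mod_m b i(1)]
    have t: "pt (psh_at m f d) x U s \<in> topspace (top_of (top_code (Et (psh_at m f d))))"
      using pt_topspace[OF s] top_of_Et[OF psh_psh_at[OF d]] by simp
    show ?thesis
      using top_sum_pt[OF ba s] vapp_TopC_Cmp[OF top_sum_hom[OF a] top_sum_hom[OF b] t]
        top_sum_pt[OF b sect_act[OF a s]] top_sum_pt[OF a s] x i(2)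
        act_Cmp[OF a b U(1) i(1) j subset_refl subset_refl U(3)] by simp
  qed
  then show "FA ?S (Cmp (Src ?S) \<beta> \<alpha>) = Cmp (Tgt ?S) (FA ?S \<beta>) (FA ?S \<alpha>)"
    using Et_arr_eqI[OF psh_psh_at[OF d] top_sum_hom[OF ba] cat_comp[OF category_TopC top_sum_hom[OF a] top_sum_hom[OF b]]] by simp
qed

end

text \<open>The homeomorphism of etale spaces at \<open>v\<close>: it moves points by \<open>\<phi>\<close> and sections by \<open>\<theta>\<close>.\<close>

definition sum_iso :: "'u::two_universes func \<Rightarrow> 'u func \<Rightarrow> 'u func \<Rightarrow> ('u \<Rightarrow> 'u) \<Rightarrow> 'u func \<Rightarrow> 'u func \<Rightarrow> ('u \<Rightarrow> 'u) \<Rightarrow> 'u \<Rightarrow> 'u" where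
  "sum_iso n m h \<phi> g f \<theta> v = Et_arr (psh_at n g v) (vapp (\<phi> v)) (\<lambda>U. vapp (\<theta> (vpair v (vset U)))) (psh_at m f (FO h v))"

context
  fixes n m h :: "'u::two_universes func" and \<phi> and g f :: "'u func" and \<theta>
  assumes ng: "module_arg n g" and mf: "module_arg m f"
    and o: "over n m h \<phi>" and t: "over g f (oplax_map ouv_fam n m h \<phi>) \<theta>"
begin

lemma over_pmor:
  assumes v: "v \<in> Ob (Src n)"
  shows "pmor (psh_at n g v) (vapp (\<phi> v)) (\<lambda>U. vapp (\<theta> (vpair v (vset U)))) (psh_at m f (FO h v))"
    and "bij_betw (vapp (\<phi> v)) (topspace (spc n v)) (topspace (spc m (FO h v)))"
    and "openin (spc n v) U \<Longrightarrow> bij_betw (vapp (\<theta> (vpair v (vset U)))) (elts (FO g (vpair v (vset U))))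
      (elts (FO f (vpair (FO h v) (vset (vapp (\<phi> v) ` U)))))"
proof -
  note nT = mod_m(2)[OF ng] and gS = mod_f(3)[OF ng] and gT = mod_f(2)[OF ng]
  have hv: "FO h v \<in> Ob (Src m)" using func_Ob[OF over_h[OF o]] v over_Src_h[OF o] over_Tgt_h[OF o] by simp
  note p = over_hom[OF o v, unfolded nT]
  have pi: "invertible TopC (\<phi> v)" using nat_iso_invertible[OF over_nat_iso[OF o] v] nT by simp
  note i = TopC_image_open[OF p]
  have x: "vpair v (vset U) \<in> Ob (Src g)" if "openin (spc n v) U" for U
    using ouv_Ob[OF mod_m[OF ng] v that] gS by simp
  note hO = oplax_map_ouv_FO[OF o nT v]
  have th: "\<theta> (vpair v (vset U)) \<in> hom SetC (FO g (vpair v (vset U))) (FO f (vpair (FO h v) (vset (vapp (\<phi> v) ` U))))"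
    if "openin (spc n v) U" for U
    using over_hom[OF t x[OF that]] hO[OF that] gT by simp
  show "bij_betw (vapp (\<phi> v)) (topspace (spc n v)) (topspace (spc m (FO h v)))"
    by (rule TopC_invertibleD[OF p pi])
  show "bij_betw (vapp (\<theta> (vpair v (vset U)))) (elts (FO g (vpair v (vset U))))
      (elts (FO f (vpair (FO h v) (vset (vapp (\<phi> v) ` U)))))" if "openin (spc n v) U"
    using SetC_invertible[OF th[OF that]] nat_iso_invertible[OF over_nat_iso[OF t] x[OF that]] gT by simp
  show "pmor (psh_at n g v) (vapp (\<phi> v)) (\<lambda>U. vapp (\<theta> (vpair v (vset U)))) (psh_at m f (FO h v))"
    unfolding pmor_def psh_at_simps
  proof (intro conjI allI impI)
    show "psh (psh_at n g v)" "psh (psh_at m f (FO h v))" using psh_psh_at ng mf v hv by auto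
    show "continuous_map (spc n v) (spc m (FO h v)) (vapp (\<phi> v))" "open_map (spc n v) (spc m (FO h v)) (vapp (\<phi> v))"
      using TopC_cont[OF p] TopC_open[OF p] by auto
    fix U s assume U: "openin (spc n v) U" and s: "s \<in> elts (FO g (vpair v (vset U)))"
    show "vapp (\<theta> (vpair v (vset U))) s \<in> elts (FO f (vpair (FO h v) (vset (vapp (\<phi> v) ` U))))"
      by (rule vapp_elts[OF th[OF U] s])
    fix V assume V: "openin (spc n v) V" "V \<subseteq> U"
    note I = cat_id[OF mod_C[OF ng] v]
    have r: "oar n U (Idn (Src n) v) V \<in> hom (Src g) (vpair v (vset U)) (vpair v (vset V))"
      using oar_hom[OF mod_m[OF ng] I U V(1)] V(2) top_image_Idn[OF mod_m[OF ng] v U] gS by simp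
    have hI: "FA h (Idn (Src n) v) = Idn (Src m) (FO h v)"
      using func_Idn[OF over_h[OF o]] v over_Src_h[OF o] over_Tgt_h[OF o] by simp
    note nat = over_natural[OF t r, unfolded oplax_map_oar[OF o nT I U V(1)] hI gT]
    have r': "oar m (vapp (\<phi> v) ` U) (Idn (Src m) (FO h v)) (vapp (\<phi> v) ` V) \<in>
        hom (Src f) (vpair (FO h v) (vset (vapp (\<phi> v) ` U))) (vpair (FO h v) (vset (vapp (\<phi> v) ` V)))"
      using oar_hom[OF mod_m[OF mf] cat_id[OF mod_C[OF mf] hv] i[OF U] i[OF V(1)]] V(2)
        top_image_Idn[OF mod_m[OF mf] hv i[OF U]] mod_f(3)[OF mf] by (simp add: image_mono)
    note gr = func_hom[OF mod_f(1)[OF ng] r, unfolded gT] and fr = func_hom[OF mod_f(1)[OF mf] r', unfolded mod_f(2)[OF mf]]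
    have "vapp (Cmp SetC (\<theta> (vpair v (vset V))) (FA g (oar n U (Idn (Src n) v) V))) s =
        vapp (Cmp SetC (FA f (oar m (vapp (\<phi> v) ` U) (Idn (Src m) (FO h v)) (vapp (\<phi> v) ` V))) (\<theta> (vpair v (vset U)))) s"
      using nat by simp
    then show "vapp (\<theta> (vpair v (vset V))) (Res (psh_at n g v) U V s) =
         Res (psh_at m f (FO h v)) (vapp (\<phi> v) ` U) (vapp (\<phi> v) ` V) (vapp (\<theta> (vpair v (vset U))) s)"
      unfolding psh_at_Res[OF ng v U] psh_at_Res[OF mf hv i[OF U]] SetC_Cmp[OF gr th[OF V(1)]] SetC_Cmp[OF th[OF U] fr]
      using s by simp
  qed
qed

lemma over_act:
  assumes a: "\<alpha> \<in> hom (Src n) v w" and U: "openin (spc n v) U" and V: "openin (spc n w) V" "V \<subseteq> vapp (FA n \<alpha>) ` U"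
    and s: "s \<in> elts (FO g (vpair v (vset U)))"
  shows "vapp (\<theta> (vpair w (vset V))) (act n g U \<alpha> V s) =
    act m f (vapp (\<phi> v) ` U) (FA h \<alpha>) (vapp (\<phi> w) ` V) (vapp (\<theta> (vpair v (vset U))) s)"
proof -
  note nT = mod_m(2)[OF ng] and gS = mod_f(3)[OF ng] and gT = mod_f(2)[OF ng]
  note vw = hom_Ob1[OF mod_C[OF ng] a] hom_Ob2[OF mod_C[OF ng] a]
  have r: "oar n U \<alpha> V \<in> hom (Src g) (vpair v (vset U)) (vpair w (vset V))"
    using oar_hom[OF mod_m[OF ng] a U V] gS by simp
  have x: "vpair v (vset U) \<in> Ob (Src g)" if "v \<in> Ob (Src n)" "openin (spc n v) U" for v U
    using ouv_Ob[OF mod_m[OF ng] that] gS by simp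
  note th = over_hom[OF t x[OF vw(1) U], unfolded gT] and th' = over_hom[OF t x[OF vw(2) V(1)], unfolded gT]
  note H = over_h[OF t]
  have "FA (oplax_map ouv_fam n m h \<phi>) (oar n U \<alpha> V) \<in> hom (Src f) (FO (oplax_map ouv_fam n m h \<phi>) (vpair v (vset U))) (FO (oplax_map ouv_fam n m h \<phi>) (vpair w (vset V)))"
    using func_hom[OF H] r over_Src_h[OF t] over_Tgt_h[OF t] by (simp del: oplax_map_simps(3))
  note fr = func_hom[OF mod_f(1)[OF mf] this, unfolded mod_f(2)[OF mf]]
  note gr = func_hom[OF mod_f(1)[OF ng] r, unfolded gT]
  have "vapp (Cmp SetC (\<theta> (vpair w (vset V))) (FA g (oar n U \<alpha> V))) s =
      vapp (Cmp SetC (FA f (FA (oplax_map ouv_fam n m h \<phi>) (oar n U \<alpha> V))) (\<theta> (vpair v (vset U)))) s"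
    using over_natural[OF t r] gT by simp
  then show ?thesis
    unfolding SetC_Cmp[OF gr th'] SetC_Cmp[OF th fr] using s by (simp add: oplax_map_oar[OF o nT a U V(1)])
qed

lemma sum_iso_hom: "v \<in> Ob (Src n) \<Longrightarrow> sum_iso n m h \<phi> g f \<theta> v \<in> hom TopC (top_code (Et (psh_at n g v))) (top_code (Et (psh_at m f (FO h v))))"
  unfolding sum_iso_def by (rule Et_arr_hom[OF over_pmor(1)])

lemma sum_iso_eps:
  assumes "v \<in> Ob (Src n)" "openin (spc n v) U" "s \<in> elts (FO g (vpair v (vset U)))"
  shows "vapp (sum_iso n m h \<phi> g f \<theta> v) ` eps (psh_at n g v) U s =
    eps (psh_at m f (FO h v)) (vapp (\<phi> v) ` U) (vapp (\<theta> (vpair v (vset U))) s)"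
  unfolding sum_iso_def by (rule vapp_Et_arr_eps[OF over_pmor(1)[OF assms(1)]]) (simp_all add: psh_at_simps assms)

text \<open>The naturality square at a germ reduces to naturality of \<open>\<phi>\<close> at its base point and to naturality of \<open>\<theta>\<close>
  at the arrow from \<open>U\<close> to its image.\<close>

theorem top_sum_over: "over (top_sum_fun n g) (top_sum_fun m f) h (sum_iso n m h \<phi> g f \<theta>)"
proof -
  let ?N = "top_sum_fun n g" and ?M = "top_sum_fun m f" and ?E = "sum_iso n m h \<phi> g f \<theta>"
  note hf = over_h[OF o] and hS = over_Src_h[OF o] and hT = over_Tgt_h[OF o]
  note N = is_functor_top_sum[OF ng] and M = is_functor_top_sum[OF mf] and nT = mod_m(2)[OF ng]
  have "nat_iso ?E ?N (comp_func ?M h)"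
  proof (rule nat_isoI)
    show "is_functor ?N" "is_functor (comp_func ?M h)" using N is_functor_comp[OF hf M] hT by (auto simp: top_sum_simps[OF mf])
    show "Src ?N = Src (comp_func ?M h)" "Tgt ?N = Tgt (comp_func ?M h)"
      using hS by (auto simp: top_sum_simps[OF mf] top_sum_simps[OF ng])
    show "?E v \<in> hom (Tgt ?N) (FO ?N v) (FO (comp_func ?M h) v)" "invertible (Tgt ?N) (?E v)" if "v \<in> Ob (Src ?N)" for v
    proof -
      have v: "v \<in> Ob (Src n)" using that by (simp add: top_sum_simps[OF ng])
      show "?E v \<in> hom (Tgt ?N) (FO ?N v) (FO (comp_func ?M h) v)"
        using sum_iso_hom[OF v] by (simp add: top_sum_simps[OF mf] top_sum_simps[OF ng])
      have "invertible TopC (?E v)"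
        unfolding sum_iso_def
        by (rule invertible_Et_arr[OF over_pmor(1)[OF v]]) (simp_all add: psh_at_simps over_pmor(2,3)[OF v])
      then show "invertible (Tgt ?N) (?E v)" by (simp add: top_sum_simps[OF ng])
    qed
    fix \<alpha> v w assume "\<alpha> \<in> hom (Src ?N) v w"
    then have a: "\<alpha> \<in> hom (Src n) v w" by (simp add: top_sum_simps[OF ng])
    note vw = hom_Ob1[OF mod_C[OF ng] a] hom_Ob2[OF mod_C[OF ng] a]
    have ha: "FA h \<alpha> \<in> hom (Src m) (FO h v) (FO h w)" using func_hom[OF hf] a hS hT by simp
    note pv = over_pmor(1)[OF vw(1)] and pw = over_pmor(1)[OF vw(2)]
    note hN = top_sum_hom[OF ng a] and hM = top_sum_hom[OF mf ha] and Ev = sum_iso_hom[OF vw(1)] and Ew = sum_iso_hom[OF vw(2)]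
    have "Cmp TopC (?E w) (FA ?N \<alpha>) = Cmp TopC (FA ?M (FA h \<alpha>)) (?E v)"
    proof (rule Et_arr_eqI[OF pmor_F[OF pv] cat_comp[OF category_TopC hN Ew] cat_comp[OF category_TopC Ev hM]])
      fix x U s assume s: "sect (psh_at n g v) x U s"
      have U: "openin (spc n v) U" "x \<in> U" "s \<in> elts (FO g (vpair v (vset U)))" using s by (auto simp: sect_def psh_at_simps)
      have tp: "pt (psh_at n g v) x U s \<in> topspace (top_of (top_code (Et (psh_at n g v))))"
        using pt_topspace[OF s] top_of_Et[OF pmor_F[OF pv]] by simp
      note p = over_hom[OF o vw(1), unfolded nT] over_hom[OF o vw(2), unfolded nT]
      note nat = over_natural[OF o a, unfolded nT]
      note mha = top_hom[OF mod_m[OF mf] ha] and na = top_hom[OF mod_m[OF ng] a]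
      have x: "vapp (\<phi> w) (vapp (FA n \<alpha>) x) = vapp (FA m (FA h \<alpha>)) (vapp (\<phi> v) x)"
        using vapp_TopC_Cmp[OF na p(2)] vapp_TopC_Cmp[OF p(1) mha] nat openin_subset[OF U(1)] U(2) by (metis subsetD)
      have i: "vapp (\<phi> w) ` vapp (FA n \<alpha>) ` U = vapp (FA m (FA h \<alpha>)) ` vapp (\<phi> v) ` U"
        using image_Cmp[OF na p(2) U(1)] image_Cmp[OF p(1) mha U(1)] nat by simp
      have "vapp (\<theta> (vpair w (vset (vapp (FA n \<alpha>) ` U)))) (act n g U \<alpha> (vapp (FA n \<alpha>) ` U) s) =
          act m f (vapp (\<phi> v) ` U) (FA h \<alpha>) (vapp (FA m (FA h \<alpha>)) ` vapp (\<phi> v) ` U) (vapp (\<theta> (vpair v (vset U))) s)"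
        using over_act[OF a U(1) top_image_open[OF mod_m[OF ng] a U(1)] subset_refl U(3)] i by simp
      then show "vapp (Cmp TopC (?E w) (FA ?N \<alpha>)) (pt (psh_at n g v) x U s) =
          vapp (Cmp TopC (FA ?M (FA h \<alpha>)) (?E v)) (pt (psh_at n g v) x U s)"
        unfolding vapp_TopC_Cmp[OF hN Ew tp] vapp_TopC_Cmp[OF Ev hM tp] top_sum_pt[OF ng a s]
        unfolding sum_iso_def vapp_Et_arr[OF pw sect_act[OF ng a s]] vapp_Et_arr[OF pv s]
          top_sum_pt[OF mf ha pmor_sect[OF pv s]] using x i by simp
    qed
    then show "Cmp (Tgt ?N) (?E w) (FA ?N \<alpha>) = Cmp (Tgt ?N) (FA (comp_func ?M h) \<alpha>) (?E v)"
      by (simp add: top_sum_simps[OF ng])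
  qed
  then show ?thesis using hf M hT by (simp add: over_def top_sum_simps[OF mf])
qed

end

section \<open>The flattening functor of the module\<close>

context
  fixes m f :: "'u::two_universes func"
  assumes mf: "module_arg m f"
begin

lemma top_flat_simps [simp]: "Src (top_flat_fun m f) = oplax (Src f) (pre disc_fam f)"
  "Tgt (top_flat_fun m f) = oplax (Src m) (pre ouv_fam (top_sum_fun m f))"
  by (simp_all add: top_flat_fun_def Let_def)

lemma oar_Src: "\<alpha> \<in> hom (Src m) d e \<Longrightarrow> openin (spc m d) U \<Longrightarrow> openin (spc m e) V \<Longrightarrow> V \<subseteq> vapp (FA m \<alpha>) ` U \<Longrightarrow>
    oar m U \<alpha> V \<in> hom (Src f) (vpair d (vset U)) (vpair e (vset V))"
  using oar_hom[OF mod_m[OF mf]] mod_f(3)[OF mf] by simp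

lemma flat_ObE:
  assumes "x \<in> Ob (oplax (Src f) (pre disc_fam f))"
  obtains d U s where "x = vpair (vpair d (vset U)) s" "d \<in> Ob (Src m)" "openin (spc m d) U" "s \<in> elts (FO f (vpair d (vset U)))"
proof -
  from assms obtain y s where y: "x = vpair y s" "y \<in> Ob (oplax (Src m) (pre ouv_fam m))" "s \<in> elts (FO f y)"
    unfolding oplax_Ob[of x] by (auto simp: mod_f(3)[OF mf])
  show thesis by (rule ouv_ObE[OF mod_m[OF mf] y(2)]) (use y that in blast)
qed

lemma flat_homE:
  assumes "z \<in> hom (oplax (Src f) (pre disc_fam f)) a b"
  obtains d U e V \<alpha> s where "a = vpair (vpair d (vset U)) s" "b = vpair (vpair e (vset V)) (act m f U \<alpha> V s)"
    "z = oarr s (oar m U \<alpha> V) (act m f U \<alpha> V s)" "\<alpha> \<in> hom (Src m) d e" "openin (spc m d) U" "openin (spc m e) V"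
    "V \<subseteq> vapp (FA m \<alpha>) ` U" "s \<in> elts (FO f (vpair d (vset U)))"
  using assms
proof (rule oplax_disc_homE)
  fix u v s \<zeta> assume 1: "a = vpair u s" "b = vpair v (vapp (FA f \<zeta>) s)" "z = oarr s \<zeta> (vapp (FA f \<zeta>) s)"
    and z: "\<zeta> \<in> hom (Src f) u v" and s: "s \<in> elts (FO f u)"
  show thesis
    by (rule oar_homE[OF mod_m[OF mf] z[unfolded mod_f(3)[OF mf]]]) (use that 1 s in blast)
qed

lemma top_flat_FO: "d \<in> Ob (Src m) \<Longrightarrow> openin (spc m d) U \<Longrightarrow>
    FO (top_flat_fun m f) (vpair (vpair d (vset U)) s) = vpair d (vset (eps (psh_at m f d) U s))"
  by (simp add: top_flat_fun_def Let_def top_open_elts[OF mod_m[OF mf]])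

lemma top_flat_FA:
  assumes a: "\<alpha> \<in> hom (Src m) d e" and U: "openin (spc m d) U" and V: "openin (spc m e) V" "V \<subseteq> vapp (FA m \<alpha>) ` U"
  shows "FA (top_flat_fun m f) (oarr s (oar m U \<alpha> V) s') =
    oar (top_sum_fun m f) (eps (psh_at m f d) U s) \<alpha> (eps (psh_at m f e) V s')"
proof -
  note de = hom_Ob1[OF mod_C[OF mf] a] hom_Ob2[OF mod_C[OF mf] a]
  have "Dm (Src f) (oar m U \<alpha> V) = vpair d (vset U)" "Cd (Src f) (oar m U \<alpha> V) = vpair e (vset V)"
    using oar_Src[OF a U V] by (auto simp: hom_iff)
  moreover have "small (eps (psh_at m f d) U s)"
    unfolding eps_pt by (rule small_image[OF top_open_small[OF mod_m[OF mf] de(1) U]])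
  ultimately show ?thesis
    using top_open_elts[OF mod_m[OF mf] de(1) U] top_open_elts[OF mod_m[OF mf] de(2) V(1)]
    by (simp add: top_flat_fun_def Let_def oar_def vimg_vset)
qed

lemma openin_sum_eps: "d \<in> Ob (Src m) \<Longrightarrow> openin (spc m d) U \<Longrightarrow> s \<in> elts (FO f (vpair d (vset U))) \<Longrightarrow>
    openin (spc (top_sum_fun m f) d) (eps (psh_at m f d) U s)"
  unfolding spc_top_sum[OF mf] by (rule openin_Et_eps) (simp_all add: psh_at_simps)

lemma eps_act_subset:
  assumes a: "\<alpha> \<in> hom (Src m) d e" and U: "openin (spc m d) U" and V: "openin (spc m e) V" "V \<subseteq> vapp (FA m \<alpha>) ` U"
    and s: "s \<in> elts (FO f (vpair d (vset U)))"
  shows "eps (psh_at m f e) V (act m f U \<alpha> V s) \<subseteq> vapp (FA (top_sum_fun m f) \<alpha>) ` eps (psh_at m f d) U s"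
proof -
  note e = hom_Ob2[OF mod_C[OF mf] a] and i = top_image_open[OF mod_m[OF mf] a U]
  have "eps (psh_at m f e) V (Res (psh_at m f e) (vapp (FA m \<alpha>) ` U) V (act m f U \<alpha> (vapp (FA m \<alpha>) ` U) s)) \<subseteq>
      eps (psh_at m f e) (vapp (FA m \<alpha>) ` U) (act m f U \<alpha> (vapp (FA m \<alpha>) ` U) s)"
    using eps_restrict(2)[OF psh_psh_at[OF mf e], unfolded psh_at_simps, OF i act_elts[OF mf a U i subset_refl s] V] .
  then show ?thesis
    unfolding act_Res_left[OF mf a U i subset_refl V s] top_sum_eps[OF mf a U s] .
qed

lemma is_functor_top_flat: "is_functor (top_flat_fun m f)"
proof (rule is_functorI)
  let ?F = "top_flat_fun m f" and ?S = "top_sum_fun m f"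
  note S = is_functor_top_sum[OF mf] top_sum_simps(2)[OF mf] and SS = top_sum_simps(1)[OF mf]
  note C = mod_C[OF mf]
  note Kf = fam_pre[OF fam_disc mod_f(1,2)[OF mf]]
  have KS: "fam (Src m) (pre ouv_fam ?S)" using fam_pre[OF fam_ouv S] SS by simp
  show "category (Src ?F)" "category (Tgt ?F)" using category_oplax[OF Kf] category_oplax[OF KS] by simp_all
  show "FO ?F x \<in> Ob (Tgt ?F)" "FA ?F (Idn (Src ?F) x) = Idn (Tgt ?F) (FO ?F x)" if "x \<in> Ob (Src ?F)" for x
  proof -
    from that have "x \<in> Ob (oplax (Src f) (pre disc_fam f))" by simp
    then obtain d U s where x: "x = vpair (vpair d (vset U)) s" "d \<in> Ob (Src m)" "openin (spc m d) U" "s \<in> elts (FO f (vpair d (vset U)))"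
      by (rule flat_ObE)
    note o = openin_sum_eps[OF x(2-4)]
    show "FO ?F x \<in> Ob (Tgt ?F)"
      using ouv_Ob[OF S, unfolded SS, OF x(2) o] by (simp add: x(1) top_flat_FO[OF x(2,3)])
    have i: "Idn (Src f) (vpair d (vset U)) = oar m U (Idn (Src m) d) U"
      using oar_Idn[OF mod_m[OF mf] x(2,3)] mod_f(3)[OF mf] by simp
    have "U \<subseteq> vapp (FA m (Idn (Src m) d)) ` U" using top_image_Idn[OF mod_m[OF mf] x(2,3)] by simp
    then show "FA ?F (Idn (Src ?F) x) = Idn (Tgt ?F) (FO ?F x)"
      using top_flat_FA[OF cat_id[OF C x(2)] x(3) x(3)] oar_Idn[OF S, unfolded SS, OF x(2) o]
      by (simp add: x(1) top_flat_FO[OF x(2,3)] i)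
  qed
  show "FA ?F z \<in> hom (Tgt ?F) (FO ?F a) (FO ?F b)" if "z \<in> hom (Src ?F) a b" for z a b
  proof -
    from that have "z \<in> hom (oplax (Src f) (pre disc_fam f)) a b" by simp
    then obtain d U e V \<alpha> s where ab: "a = vpair (vpair d (vset U)) s" "b = vpair (vpair e (vset V)) (act m f U \<alpha> V s)"
        "z = oarr s (oar m U \<alpha> V) (act m f U \<alpha> V s)"
      and a: "\<alpha> \<in> hom (Src m) d e" and U: "openin (spc m d) U" and V: "openin (spc m e) V" "V \<subseteq> vapp (FA m \<alpha>) ` U"
      and s: "s \<in> elts (FO f (vpair d (vset U)))" by (rule flat_homE)
    note de = hom_Ob1[OF C a] hom_Ob2[OF C a]
    show ?thesis
      using oar_hom[OF S, unfolded SS, OF a openin_sum_eps[OF de(1) U s] openin_sum_eps[OF de(2) V(1) act_elts[OF mf a U V s]] eps_act_subset[OF a U V s]]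
      by (simp add: ab top_flat_FO[OF de(1) U] top_flat_FO[OF de(2) V(1)] top_flat_FA[OF a U V])
  qed
  fix z z' a b c assume "z \<in> hom (Src ?F) a b" "z' \<in> hom (Src ?F) b c"
  then have z: "z \<in> hom (oplax (Src f) (pre disc_fam f)) a b" and z': "z' \<in> hom (oplax (Src f) (pre disc_fam f)) b c" by auto
  obtain d U e V \<alpha> s where ab: "a = vpair (vpair d (vset U)) s" "b = vpair (vpair e (vset V)) (act m f U \<alpha> V s)"
      "z = oarr s (oar m U \<alpha> V) (act m f U \<alpha> V s)"
    and a: "\<alpha> \<in> hom (Src m) d e" and U: "openin (spc m d) U" and V: "openin (spc m e) V" "V \<subseteq> vapp (FA m \<alpha>) ` U"
    and s: "s \<in> elts (FO f (vpair d (vset U)))" by (rule flat_homE[OF z])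
  note de = hom_Ob1[OF C a] hom_Ob2[OF C a]
  let ?s = "act m f U \<alpha> V s"
  obtain d' U' e' W \<beta> s' where bc: "b = vpair (vpair d' (vset U')) s'" "c = vpair (vpair e' (vset W)) (act m f U' \<beta> W s')"
      "z' = oarr s' (oar m U' \<beta> W) (act m f U' \<beta> W s')"
    and b': "\<beta> \<in> hom (Src m) d' e'" and U': "openin (spc m d') U'" and W': "openin (spc m e') W" "W \<subseteq> vapp (FA m \<beta>) ` U'"
    by (rule flat_homE[OF z'])
  have e1: "d' = e" "vset U' = vset V" "s' = ?s" using bc(1) ab(2) by auto
  have e2: "U' = V" using e1(2) top_open_elts[OF mod_m[OF mf] de(2) V(1)] top_open_elts[OF mod_m[OF mf] _ U'] hom_Ob1[OF C b'] by metis
  have b: "\<beta> \<in> hom (Src m) e e'" and W: "openin (spc m e') W" "W \<subseteq> vapp (FA m \<beta>) ` V"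
    and zz: "z' = oarr ?s (oar m V \<beta> W) (act m f V \<beta> W ?s)" using b' W' bc(3) e1 e2 by auto
  have V': "V \<subseteq> vapp (FA m \<alpha>) ` U" by (rule V(2))
  have W3: "W \<subseteq> vapp (FA m (Cmp (Src m) \<beta> \<alpha>)) ` U"
    unfolding top_image_Cmp[OF mod_m[OF mf] a b U] by (rule order_trans[OF W(2) image_mono[OF V']])
  have "Cmp (Src f) (oar m V \<beta> W) (oar m U \<alpha> V) = oar m U (Cmp (Src m) \<beta> \<alpha>) W"
    using oar_Cmp[OF mod_m[OF mf] a b U] mod_f(3)[OF mf] by simp
  then have "Cmp (Src ?F) z' z = oarr s (oar m U (Cmp (Src m) \<beta> \<alpha>) W) (act m f V \<beta> W ?s)"
    unfolding ab(3) zz by (simp add: oplax_Cmp[OF oar_Src[OF b V(1) W]])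
  then show "FA ?F (Cmp (Src ?F) z' z) = Cmp (Tgt ?F) (FA ?F z') (FA ?F z)"
    using oar_Cmp[OF S, unfolded SS, OF a b openin_sum_eps[OF de(1) U s]]
    by (simp add: ab(3) zz top_flat_FA[OF a U V] top_flat_FA[OF b V(1) W] top_flat_FA[OF cat_comp[OF C a b] U W(1) W3])
qed

lemma oplax_proj_top_flat:
  "comp_func (oplax_proj (Src m) (pre ouv_fam (top_sum_fun m f))) (top_flat_fun m f) =
   comp_func (oplax_proj (Src m) (pre ouv_fam m)) (oplax_proj (Src f) (pre disc_fam f))"
  using mod_f(3)[OF mf] by (auto simp: comp_func_def oplax_proj_def top_flat_fun_def Let_def)

end

text \<open>On objects this is the formula \<open>sum_iso_eps\<close> for the images of basic open sets.  On arrows nothing else has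
  to be compared, because an arrow of an oplax colimit of posets is given by its base component and
  the open sets at its ends.\<close>

theorem top_flat_over:
  assumes ng: "module_arg n g" and mf: "module_arg m f"
    and o: "over n m h \<phi>" and t: "over g f (oplax_map ouv_fam n m h \<phi>) \<theta>"
  shows "fun_eq (comp_func (top_flat_fun m f) (oplax_map disc_fam g f (oplax_map ouv_fam n m h \<phi>) \<theta>))
    (comp_func (oplax_map ouv_fam (top_sum_fun n g) (top_sum_fun m f) h (sum_iso n m h \<phi> g f \<theta>)) (top_flat_fun n g))"
    (is "fun_eq ?L ?R")
  unfolding fun_eq_def
proof (intro conjI ballI)
  note nT = mod_m(2)[OF ng] and hf = over_h[OF o] and hS = over_Src_h[OF o] and hT = over_Tgt_h[OF o]
  note E = top_sum_over[OF ng mf o t] and NT = top_sum_simps(2)[OF ng]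
  show "Src ?L = Src ?R" "Tgt ?L = Tgt ?R"
    by (simp_all add: top_flat_simps[OF ng] top_flat_simps[OF mf] top_sum_simps[OF mf])
  have hO: "FO h v \<in> Ob (Src m)" if "v \<in> Ob (Src n)" for v using func_Ob[OF hf] that hS hT by simp
  have i: "openin (spc m (FO h v)) (vapp (\<phi> v) ` U)" if "v \<in> Ob (Src n)" "openin (spc n v) U" for v U
    using TopC_image_open[OF over_hom[OF o that(1), unfolded nT] that(2)] .
  show "FO ?L x = FO ?R x" if "x \<in> Ob (Src ?L)" for x
  proof -
    from that have "x \<in> Ob (oplax (Src g) (pre disc_fam g))" by simp
    then obtain v U s where x: "x = vpair (vpair v (vset U)) s" and v: "v \<in> Ob (Src n)" and U: "openin (spc n v) U"
      and s: "s \<in> elts (FO g (vpair v (vset U)))" by (rule flat_ObE[OF ng])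
    have "FO ?L x = FO (top_flat_fun m f) (vpair (FO (oplax_map ouv_fam n m h \<phi>) (vpair v (vset U))) (vapp (\<theta> (vpair v (vset U))) s))"
      by (simp add: x)
    also have "\<dots> = vpair (FO h v) (vset (eps (psh_at m f (FO h v)) (vapp (\<phi> v) ` U) (vapp (\<theta> (vpair v (vset U))) s)))"
      unfolding oplax_map_ouv_FO[OF o nT v U] by (rule top_flat_FO[OF mf hO[OF v] i[OF v U]])
    also have "\<dots> = FO ?R x"
      using oplax_map_ouv_FO[OF E NT, unfolded top_sum_simps(1)[OF ng], OF v openin_sum_eps[OF ng v U s]]
      unfolding sum_iso_eps[OF ng mf o t v U s] by (simp add: x top_flat_FO[OF ng v U])
    finally show ?thesis .
  qed
  show "FA ?L z = FA ?R z" if "z \<in> Ar (Src ?L)" for z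
  proof -
    have "z \<in> hom (oplax (Src g) (pre disc_fam g)) (Dm (Src ?L) z) (Cd (Src ?L) z)" using Ar_hom[OF that] by simp
    then obtain v U w V \<alpha> s where z: "z = oarr s (oar n U \<alpha> V) (act n g U \<alpha> V s)"
      and a: "\<alpha> \<in> hom (Src n) v w" and U: "openin (spc n v) U" and V: "openin (spc n w) V" "V \<subseteq> vapp (FA n \<alpha>) ` U"
      and s: "s \<in> elts (FO g (vpair v (vset U)))" by (rule flat_homE[OF ng])
    note vw = hom_Ob1[OF mod_C[OF ng] a] hom_Ob2[OF mod_C[OF ng] a]
    have ha: "FA h \<alpha> \<in> hom (Src m) (FO h v) (FO h w)" using func_hom[OF hf] a hS hT by simp
    note p = over_hom[OF o vw(1), unfolded nT] over_hom[OF o vw(2), unfolded nT]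
    have "vapp (\<phi> w) ` vapp (FA n \<alpha>) ` U = vapp (FA m (FA h \<alpha>)) ` vapp (\<phi> v) ` U"
      using image_Cmp[OF top_hom[OF mod_m[OF ng] a] p(2) U] image_Cmp[OF p(1) top_hom[OF mod_m[OF mf] ha] U]
        over_natural[OF o a, unfolded nT] by simp
    then have sub: "vapp (\<phi> w) ` V \<subseteq> vapp (FA m (FA h \<alpha>)) ` vapp (\<phi> v) ` U" using image_mono[OF V(2), of "vapp (\<phi> w)"] by simp
    let ?t = "vapp (\<theta> (vpair v (vset U))) s" and ?t' = "vapp (\<theta> (vpair w (vset V))) (act n g U \<alpha> V s)"
    have "FA ?L z = FA (top_flat_fun m f) (oarr ?t (FA (oplax_map ouv_fam n m h \<phi>) (oar n U \<alpha> V)) ?t')"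
      by (simp add: z oplax_map_FA[OF oar_Src[OF ng a U V]])
    also have "\<dots> = oar (top_sum_fun m f) (eps (psh_at m f (FO h v)) (vapp (\<phi> v) ` U) ?t) (FA h \<alpha>)
        (eps (psh_at m f (FO h w)) (vapp (\<phi> w) ` V) ?t')"
      unfolding oplax_map_oar[OF o nT a U V(1)]
      by (rule top_flat_FA[OF mf ha i[OF vw(1) U] i[OF vw(2) V(1)] sub])
    also have "\<dots> = FA ?R z"
      using oplax_map_oar[OF E NT, unfolded top_sum_simps(1)[OF ng], OF a openin_sum_eps[OF ng vw(1) U s]
          openin_sum_eps[OF ng vw(2) V(1) act_elts[OF ng a U V s]]]
      unfolding sum_iso_eps[OF ng mf o t vw(1) U s] sum_iso_eps[OF ng mf o t vw(2) V(1) act_elts[OF ng a U V s]]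
      by (simp add: z top_flat_FA[OF ng a U V])
    finally show ?thesis .
  qed
qed

section \<open>Associativity of sums\<close>

text \<open>The isomorphism \<open>\<theta>\<close> identifies \<open>gf\<close> with the composite of \<open>g\<close> and the flattening functor.  Keeping \<open>gf\<close> a
  separate parameter admits the chosen representative of this composite.\<close>

locale flat_data =
  fixes m f g gf :: "'u::two_universes func" and \<theta>
  assumes mf: "module_arg m f" and Sg: "module_arg (top_sum_fun m f) g"
    and gf: "is_functor gf" "Tgt gf = SetC" "Src gf = oplax (Src f) (pre disc_fam f)"
    and t: "over gf g (top_flat_fun m f) \<theta>"
begin

abbreviation (input) "S \<equiv> top_sum_fun m f"
abbreviation (input) "Q \<equiv> set_sum_fun f gf"

lemma module_arg_Q: "module_arg m Q"
  using mf is_functor_set_sum[OF mod_f(1,2)[OF mf] gf] by (simp add: module_arg_def)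

definition pair_sec :: "'u \<Rightarrow> 'u set \<Rightarrow> 'u \<Rightarrow> 'u" where
  "pair_sec d U q = vapp (\<theta> (vpair (vpair d (vset U)) (vfst q))) (vsnd q)"

lemma gf_Ob: "d \<in> Ob (Src m) \<Longrightarrow> openin (spc m d) U \<Longrightarrow> s \<in> elts (FO f (vpair d (vset U))) \<Longrightarrow>
    vpair (vpair d (vset U)) s \<in> Ob (Src gf)"
  using ouv_Ob[OF mod_m[OF mf], of d U] mod_f(3)[OF mf] gf(3) by simp

lemma theta_hom:
  assumes "d \<in> Ob (Src m)" "openin (spc m d) U" "s \<in> elts (FO f (vpair d (vset U)))"
  shows "\<theta> (vpair (vpair d (vset U)) s) \<in> hom SetC (FO gf (vpair (vpair d (vset U)) s))
    (FO g (vpair d (vset (eps (psh_at m f d) U s))))"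
    and "bij_betw (vapp (\<theta> (vpair (vpair d (vset U)) s))) (elts (FO gf (vpair (vpair d (vset U)) s)))
      (elts (FO g (vpair d (vset (eps (psh_at m f d) U s)))))"
proof -
  show h: "\<theta> (vpair (vpair d (vset U)) s) \<in> hom SetC (FO gf (vpair (vpair d (vset U)) s))
    (FO g (vpair d (vset (eps (psh_at m f d) U s))))"
    using over_hom[OF t gf_Ob[OF assms]] gf(2) by (simp add: top_flat_FO[OF mf assms(1,2)])
  have "invertible SetC (\<theta> (vpair (vpair d (vset U)) s))"
    using nat_iso_invertible[OF over_nat_iso[OF t] gf_Ob[OF assms]] gf(2) by simp
  then show "bij_betw (vapp (\<theta> (vpair (vpair d (vset U)) s))) (elts (FO gf (vpair (vpair d (vset U)) s)))
      (elts (FO g (vpair d (vset (eps (psh_at m f d) U s)))))" using SetC_invertible[OF h] by simp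
qed

lemma gf_hom:
  assumes a: "\<alpha> \<in> hom (Src m) d e" and U: "openin (spc m d) U" and V: "openin (spc m e) V" "V \<subseteq> vapp (FA m \<alpha>) ` U"
    and s: "s \<in> elts (FO f (vpair d (vset U)))"
  shows "oarr s (oar m U \<alpha> V) (act m f U \<alpha> V s) \<in> hom (Src gf) (vpair (vpair d (vset U)) s) (vpair (vpair e (vset V)) (act m f U \<alpha> V s))"
  unfolding gf(3) by (rule oplax_disc_homI[OF mod_f(1,2)[OF mf] oar_Src[OF mf a U V] s])

text \<open>The second component of a section of \<open>Q\<close> moves as \<open>g\<close> prescribes, by naturality of \<open>\<theta>\<close> at an arrow
  between sections.\<close>

lemma sum_act:
  assumes a: "\<alpha> \<in> hom (Src m) d e" and U: "openin (spc m d) U" and V: "openin (spc m e) V" "V \<subseteq> vapp (FA m \<alpha>) ` U"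
    and q: "q \<in> elts (FO Q (vpair d (vset U)))"
  shows "vfst (act m Q U \<alpha> V q) = act m f U \<alpha> V (vfst q)"
    and "pair_sec e V (act m Q U \<alpha> V q) =
      act S g (eps (psh_at m f d) U (vfst q)) \<alpha> (eps (psh_at m f e) V (act m f U \<alpha> V (vfst q))) (pair_sec d U q)"
proof -
  obtain s r where q': "q = vpair s r" and s: "s \<in> elts (FO f (vpair d (vset U)))" and r: "r \<in> elts (FO gf (vpair (vpair d (vset U)) s))"
    using q by (auto simp: elts_set_sum vsigma_def)
  note de = hom_Ob1[OF mod_C[OF mf] a] hom_Ob2[OF mod_C[OF mf] a]
  let ?s = "act m f U \<alpha> V s"
  let ?z = "oarr s (oar m U \<alpha> V) ?s"
  note z = gf_hom[OF a U V s]
  have A: "act m Q U \<alpha> V q = vpair ?s (vapp (FA gf ?z) r)"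
    unfolding q' by (rule vapp_set_sum[OF oar_Src[OF mf a U V] s r])
  show "vfst (act m Q U \<alpha> V q) = act m f U \<alpha> V (vfst q)" unfolding A by (simp add: q')
  note s' = act_elts[OF mf a U V s]
  note th = theta_hom(1)[OF de(1) U s] and th' = theta_hom(1)[OF de(2) V(1) s']
  note gz = func_hom[OF gf(1) z, unfolded gf(2)]
  have o: "oar S (eps (psh_at m f d) U s) \<alpha> (eps (psh_at m f e) V ?s) \<in> hom (Src g) (vpair d (vset (eps (psh_at m f d) U s))) (vpair e (vset (eps (psh_at m f e) V ?s)))"
    using oar_Src[OF Sg, unfolded top_sum_simps[OF mf], OF a openin_sum_eps[OF mf de(1) U s, unfolded top_sum_simps[OF mf]] openin_sum_eps[OF mf de(2) V(1) s', unfolded top_sum_simps[OF mf]] eps_act_subset[OF mf a U V s]] .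
  note gS = func_hom[OF mod_f(1)[OF Sg] o, unfolded mod_f(2)[OF Sg]]
  have "vapp (Cmp SetC (\<theta> (vpair (vpair e (vset V)) ?s)) (FA gf ?z)) r =
      vapp (Cmp SetC (FA g (FA (top_flat_fun m f) ?z)) (\<theta> (vpair (vpair d (vset U)) s))) r"
    using over_natural[OF t z] gf(2) by simp
  then show "pair_sec e V (act m Q U \<alpha> V q) =
      act S g (eps (psh_at m f d) U (vfst q)) \<alpha> (eps (psh_at m f e) V (act m f U \<alpha> V (vfst q))) (pair_sec d U q)"
    unfolding A top_flat_FA[OF mf a U V] SetC_Cmp[OF gz th'] SetC_Cmp[OF th gS] using r by (simp add: pair_sec_def q')
qed

lemma psum_module:
  assumes d: "d \<in> Ob (Src m)"
  shows "psum (psh_at m Q d) (psh_at m f d) (psh_at S g d) vfst (pair_sec d)"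
  unfolding psum_def psh_at_simps
proof (intro conjI allI impI ballI)
  have dS: "d \<in> Ob (Src S)" using d by (simp add: top_sum_simps[OF mf])
  note I = cat_id[OF mod_C[OF mf] d]
  show "psh (psh_at m Q d)" "psh (psh_at m f d)" "psh (psh_at S g d)"
    using psh_psh_at module_arg_Q mf Sg d dS by blast+
  show "spc m d = spc m d" "spc S d = Et (psh_at m f d)" using spc_top_sum[OF mf d] by simp_all
  fix U assume U: "openin (spc m d) U"
  have qE: "\<exists>s r. q = vpair s r \<and> s \<in> elts (FO f (vpair d (vset U))) \<and> r \<in> elts (FO gf (vpair (vpair d (vset U)) s))"
    if "q \<in> elts (FO Q (vpair d (vset U)))" for q
    using that by (auto simp: elts_set_sum vsigma_def)
  show "vfst q \<in> elts (FO f (vpair d (vset U)))" "pair_sec d U q \<in> elts (FO g (vpair d (vset (eps (psh_at m f d) U (vfst q)))))"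
    if "q \<in> elts (FO Q (vpair d (vset U)))" for q
    using qE[OF that] vapp_elts[OF theta_hom(1)[OF d U]] by (auto simp: pair_sec_def)
  show "q = q'" if "q \<in> elts (FO Q (vpair d (vset U)))" "q' \<in> elts (FO Q (vpair d (vset U)))" "vfst q = vfst q'" "pair_sec d U q = pair_sec d U q'" for q q'
  proof -
    note e = qE[OF that(1)] qE[OF that(2)] that(3)
    obtain s r where q: "q = vpair s r" "s \<in> elts (FO f (vpair d (vset U)))" "r \<in> elts (FO gf (vpair (vpair d (vset U)) s))"
      using e(1) by blast
    obtain r' where q': "q' = vpair s r'" "r' \<in> elts (FO gf (vpair (vpair d (vset U)) s))"
      using e(2,3) q(1) by auto
    have "r = r'"
      using inj_onD[OF bij_betw_imp_inj_on[OF theta_hom(2)[OF d U q(2)]]] that(4) q q' by (simp add: pair_sec_def)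
    then show ?thesis using q q' by simp
  qed
  show "\<exists>q\<in>elts (FO Q (vpair d (vset U))). vfst q = s \<and> pair_sec d U q = r"
    if s: "s \<in> elts (FO f (vpair d (vset U)))" and r: "r \<in> elts (FO g (vpair d (vset (eps (psh_at m f d) U s))))" for s r
  proof -
    obtain r' where "r' \<in> elts (FO gf (vpair (vpair d (vset U)) s))" "r = vapp (\<theta> (vpair (vpair d (vset U)) s)) r'"
      using bij_betw_imp_surj_on[OF theta_hom(2)[OF d U s]] r by blast
    then show ?thesis using s by (intro bexI[of _ "vpair s r'"]) (simp_all add: pair_sec_def)
  qed
  fix V q assume V: "openin (spc m d) V" "V \<subseteq> U" and q: "q \<in> elts (FO Q (vpair d (vset U)))"
  have V2: "V \<subseteq> vapp (FA m (Idn (Src m) d)) ` U" using V(2) top_image_Idn[OF mod_m[OF mf] d U] by simp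
  note A = sum_act[OF I U V(1) V2 q]
  have s: "vfst q \<in> elts (FO f (vpair d (vset U)))" using qE[OF q] by auto
  note R = psh_at_Res[OF module_arg_Q d U] psh_at_Res[OF mf d U] psh_at_Res[OF Sg dS openin_sum_eps[OF mf d U s]]
  show "vfst (Res (psh_at m Q d) U V q) = Res (psh_at m f d) U V (vfst q)"
    using A(1) by (simp add: R)
  show "pair_sec d V (Res (psh_at m Q d) U V q) =
       Res (psh_at S g d) (eps (psh_at m f d) U (vfst q)) (eps (psh_at m f d) V (Res (psh_at m f d) U V (vfst q))) (pair_sec d U q)"
    using A(2) by (simp add: R top_sum_simps[OF mf])
qed

definition assoc_iso :: "'u \<Rightarrow> 'u" where
  "assoc_iso d = top_arr (Et (psh_at m Q d)) (Et (psh_at S g d))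
     (Et_sum (psh_at m Q d) (psh_at m f d) (psh_at S g d) vfst (pair_sec d))"

context
  fixes d assumes d: "d \<in> Ob (Src m)"
begin

lemmas psm = psum_module[OF d]

lemma assoc_iso_hom: "assoc_iso d \<in> hom TopC (top_code (Et (psh_at m Q d))) (top_code (Et (psh_at S g d)))"
  unfolding assoc_iso_def
  by (rule top_arr_hom[OF vsmall_Et[OF psum_psh(1)[OF psm]] vsmall_Et[OF psum_psh(3)[OF psm]] continuous_Et_sum[OF psm] open_Et_sum[OF psm]])

lemma vapp_assoc_iso: "p \<in> topspace (Et (psh_at m Q d)) \<Longrightarrow>
    vapp (assoc_iso d) p = Et_sum (psh_at m Q d) (psh_at m f d) (psh_at S g d) vfst (pair_sec d) p"
  unfolding assoc_iso_def by (rule vapp_top_arr[OF vsmall_Et[OF psum_psh(1)[OF psm]]])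

lemma assoc_iso_pt:
  assumes "sect (psh_at m Q d) x U q"
  shows "vapp (assoc_iso d) (pt (psh_at m Q d) x U q) =
    pt (psh_at S g d) (pt (psh_at m f d) x U (vfst q)) (eps (psh_at m f d) U (vfst q)) (pair_sec d U q)"
  unfolding vapp_assoc_iso[OF pt_topspace[OF assms]] by (rule Et_sum_pt[OF psm assms])

lemma assoc_iso_eps:
  assumes U: "openin (spc m d) U" "q \<in> elts (FO Q (vpair d (vset U)))"
  shows "vapp (assoc_iso d) ` eps (psh_at m Q d) U q = eps (psh_at S g d) (eps (psh_at m f d) U (vfst q)) (pair_sec d U q)"
proof -
  have "eps (psh_at m Q d) U q \<subseteq> topspace (Et (psh_at m Q d))"
    by (rule openin_subset[OF openin_Et_eps]) (simp_all add: psh_at_simps U)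
  then have "vapp (assoc_iso d) ` eps (psh_at m Q d) U q =
      Et_sum (psh_at m Q d) (psh_at m f d) (psh_at S g d) vfst (pair_sec d) ` eps (psh_at m Q d) U q"
    using vapp_assoc_iso by (intro image_cong) auto
  then show ?thesis using Et_sum_eps[OF psm, of U q] U by (simp add: psh_at_simps)
qed

lemma invertible_assoc_iso: "invertible TopC (assoc_iso d)"
proof (rule TopC_invertibleI[OF assoc_iso_hom])
  have "bij_betw (vapp (assoc_iso d)) (topspace (Et (psh_at m Q d))) (topspace (Et (psh_at S g d)))"
    by (rule iffD2[OF bij_betw_cong[OF vapp_assoc_iso] bij_Et_sum[OF psm]])
  then show "bij_betw (vapp (assoc_iso d)) (topspace (top_of (top_code (Et (psh_at m Q d))))) (topspace (top_of (top_code (Et (psh_at S g d)))))"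
    unfolding top_of_Et[OF psum_psh(1)[OF psm]] top_of_Et[OF psum_psh(3)[OF psm]] .
qed

end

text \<open>Both composites send the germ of a pair \<open>(s, t)\<close> to the germ of the image of \<open>t\<close> at the germ of the image
  of \<open>s\<close>, by \<open>sum_act\<close>.\<close>

theorem nat_iso_assoc: "nat_iso assoc_iso (top_sum_fun m Q) (top_sum_fun S g)"
proof (rule nat_isoI)
  let ?N = "top_sum_fun m Q" and ?M = "top_sum_fun S g"
  note mQ = module_arg_Q
  note smp = top_sum_simps[OF mQ] top_sum_simps[OF Sg] top_sum_simps(1)[OF mf]
  show "is_functor ?N" "is_functor ?M" using is_functor_top_sum mQ Sg by blast+
  show "Src ?N = Src ?M" "Tgt ?N = Tgt ?M" by (simp_all add: smp)
  show "assoc_iso d \<in> hom (Tgt ?N) (FO ?N d) (FO ?M d)" "invertible (Tgt ?N) (assoc_iso d)" if "d \<in> Ob (Src ?N)" for d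
    using that assoc_iso_hom invertible_assoc_iso by (simp_all add: smp)
  fix \<alpha> d e assume "\<alpha> \<in> hom (Src ?N) d e"
  then have a: "\<alpha> \<in> hom (Src m) d e" by (simp add: smp)
  then have aS: "\<alpha> \<in> hom (Src S) d e" by (simp add: smp)
  note de = hom_Ob1[OF mod_C[OF mf] a] hom_Ob2[OF mod_C[OF mf] a]
  note hN = top_sum_hom[OF mQ a] and hM = top_sum_hom[OF Sg aS] and id = assoc_iso_hom[OF de(1)] and ie = assoc_iso_hom[OF de(2)]
  have "Cmp TopC (assoc_iso e) (FA ?N \<alpha>) = Cmp TopC (FA ?M \<alpha>) (assoc_iso d)"
  proof (rule Et_arr_eqI[OF psh_psh_at[OF mQ de(1)] cat_comp[OF category_TopC hN ie] cat_comp[OF category_TopC id hM]])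
    fix x U q assume q: "sect (psh_at m Q d) x U q"
    then have U: "openin (spc m d) U" "x \<in> U" and qs: "q \<in> elts (FO Q (vpair d (vset U)))" by (auto simp: sect_def psh_at_simps)
    have tp: "pt (psh_at m Q d) x U q \<in> topspace (top_of (top_code (Et (psh_at m Q d))))"
      using pt_topspace[OF q] top_of_Et[OF psh_psh_at[OF mQ de(1)]] by simp
    let ?U = "vapp (FA m \<alpha>) ` U"
    note i = top_image_open[OF mod_m[OF mf] a U(1)]
    note A = sum_act[OF a U(1) i subset_refl qs]
    note ps = psum_sect[OF psum_module[OF de(1)] q]
    have s: "vfst q \<in> elts (FO f (vpair d (vset U)))" using ps(1) by (simp add: sect_def psh_at_simps)
    have "vapp (Cmp TopC (assoc_iso e) (FA ?N \<alpha>)) (pt (psh_at m Q d) x U q) =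
        pt (psh_at S g e) (pt (psh_at m f e) (vapp (FA m \<alpha>) x) ?U (act m f U \<alpha> ?U (vfst q))) (eps (psh_at m f e) ?U (act m f U \<alpha> ?U (vfst q)))
          (pair_sec e ?U (act m Q U \<alpha> ?U q))"
      unfolding vapp_TopC_Cmp[OF hN ie tp] top_sum_pt[OF mQ a q] assoc_iso_pt[OF de(2) sect_act[OF mQ a q]] A(1) ..
    also have "\<dots> = vapp (Cmp TopC (FA ?M \<alpha>) (assoc_iso d)) (pt (psh_at m Q d) x U q)"
      unfolding vapp_TopC_Cmp[OF id hM tp] assoc_iso_pt[OF de(1) q] top_sum_pt[OF Sg aS ps(2)] A(2)
        top_sum_pt[OF mf a ps(1)] top_sum_eps[OF mf a U(1) s] ..
    finally show "vapp (Cmp TopC (assoc_iso e) (FA ?N \<alpha>)) (pt (psh_at m Q d) x U q) =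
        vapp (Cmp TopC (FA ?M \<alpha>) (assoc_iso d)) (pt (psh_at m Q d) x U q)" .
  qed
  then show "Cmp (Tgt ?N) (assoc_iso e) (FA ?N \<alpha>) = Cmp (Tgt ?N) (FA ?M \<alpha>) (assoc_iso d)" by (simp add: smp)
qed

text \<open>Flattening a pair in one step or in two steps gives \<open>eps(U, (s, t))\<close> and \<open>eps(eps(U, s), t)\<close>, which
  correspond to each other by \<open>assoc_iso_eps\<close>.\<close>

theorem top_flat_assoc:
  "fun_eq (comp_func (oplax_map ouv_fam (top_sum_fun m Q) (top_sum_fun S g) (id_func (Src m)) assoc_iso)
      (comp_func (top_flat_fun m Q) (set_flat_fun f gf)))
    (comp_func (top_flat_fun S g) (oplax_map disc_fam gf g (top_flat_fun m f) \<theta>))"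
    (is "fun_eq ?L ?R")
  unfolding fun_eq_def
proof (intro conjI ballI)
  note mQ = module_arg_Q
  note smp = top_sum_simps[OF mQ] top_sum_simps[OF Sg] top_sum_simps(1)[OF mf]
  have o: "over (top_sum_fun m Q) (top_sum_fun S g) (id_func (Src m)) assoc_iso"
    using over_id[OF nat_iso_assoc] by (simp add: smp)
  note NT = top_sum_simps(2)[OF mQ]
  show "Src ?L = Src ?R" "Tgt ?L = Tgt ?R"
    by (simp_all add: top_flat_simps[OF Sg] smp)
  show "FO ?L x = FO ?R x" if "x \<in> Ob (Src ?L)" for x
  proof -
    from that have "x \<in> Ob (oplax (Src gf) (pre disc_fam gf))" by simp
    then obtain y r where y: "x = vpair y r" "y \<in> Ob (oplax (Src f) (pre disc_fam f))" and r0: "r \<in> elts (FO gf y)"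
      unfolding oplax_Ob[of x] by (auto simp: gf(3))
    obtain d U s where y': "y = vpair (vpair d (vset U)) s" and d: "d \<in> Ob (Src m)" and U: "openin (spc m d) U"
      and s: "s \<in> elts (FO f (vpair d (vset U)))" by (rule flat_ObE[OF mf y(2)])
    have dS: "d \<in> Ob (Src S)" using d by (simp add: smp)
    have q: "vpair s r \<in> elts (FO Q (vpair d (vset U)))" using s r0 y' by simp
    have "FO ?L x = vpair d (vset (vapp (assoc_iso d) ` eps (psh_at m Q d) U (vpair s r)))"
      using oplax_map_ouv_FO[OF o NT, unfolded top_sum_simps(1)[OF mQ], OF d openin_sum_eps[OF mQ d U q]]
      by (simp add: y(1) y' top_flat_FO[OF mQ d U])
    also have "\<dots> = FO ?R x"
      using top_flat_FO[OF Sg dS openin_sum_eps[OF mf d U s]] 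
      by (simp add: assoc_iso_eps[OF d U q] y(1) y' top_flat_FO[OF mf d U] pair_sec_def)
    finally show ?thesis .
  qed
  show "FA ?L z = FA ?R z" if "z \<in> Ar (Src ?L)" for z
  proof -
    have "z \<in> hom (oplax (Src gf) (pre disc_fam gf)) (Dm (Src ?L) z) (Cd (Src ?L) z)" using Ar_hom[OF that] by simp
    then obtain y y' r \<xi> where z: "z = oarr r \<xi> (vapp (FA gf \<xi>) r)" and xi: "\<xi> \<in> hom (Src gf) y y'" and r0: "r \<in> elts (FO gf y)"
      by (rule oplax_disc_homE)
    obtain d U e V \<alpha> s where y: "y = vpair (vpair d (vset U)) s" and x: "\<xi> = oarr s (oar m U \<alpha> V) (act m f U \<alpha> V s)"
      and a: "\<alpha> \<in> hom (Src m) d e" and U: "openin (spc m d) U" and V: "openin (spc m e) V" "V \<subseteq> vapp (FA m \<alpha>) ` U"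
      and s: "s \<in> elts (FO f (vpair d (vset U)))" by (rule flat_homE[OF mf xi[unfolded gf(3)]])
    note de = hom_Ob1[OF mod_C[OF mf] a] hom_Ob2[OF mod_C[OF mf] a]
    have aS: "\<alpha> \<in> hom (Src S) d e" using a by (simp add: smp)
    let ?s = "act m f U \<alpha> V s" and ?r = "vapp (FA gf \<xi>) r"
    have r: "r \<in> elts (FO gf (vpair (vpair d (vset U)) s))" using r0 y by simp
    have q: "vpair s r \<in> elts (FO Q (vpair d (vset U)))" using s r by simp
    have A: "act m Q U \<alpha> V (vpair s r) = vpair ?s ?r"
      unfolding x by (rule vapp_set_sum[OF oar_Src[OF mf a U V] s r])
    have q': "vpair ?s ?r \<in> elts (FO Q (vpair e (vset V)))" using act_elts[OF mQ a U V q] A by simp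
    note gz = gf_hom[OF a U V s]
    have "FA ?L z = FA (oplax_map ouv_fam (top_sum_fun m Q) (top_sum_fun S g) (id_func (Src m)) assoc_iso)
        (oar (top_sum_fun m Q) (eps (psh_at m Q d) U (vpair s r)) \<alpha> (eps (psh_at m Q e) V (vpair ?s ?r)))"
      using set_flat_fun_FA[OF gz, of f r ?r] top_flat_FA[OF mQ a U V, of "vpair s r" "vpair ?s ?r"]
      by (simp add: z x)
    also have "\<dots> = oar (top_sum_fun S g) (vapp (assoc_iso d) ` eps (psh_at m Q d) U (vpair s r)) \<alpha>
        (vapp (assoc_iso e) ` eps (psh_at m Q e) V (vpair ?s ?r))"
      using oplax_map_oar[OF o NT, unfolded top_sum_simps(1)[OF mQ], OF a openin_sum_eps[OF mQ de(1) U q] openin_sum_eps[OF mQ de(2) V(1) q']]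
      by simp
    also have "\<dots> = oar (top_sum_fun S g) (eps (psh_at S g d) (eps (psh_at m f d) U s) (pair_sec d U (vpair s r))) \<alpha>
        (eps (psh_at S g e) (eps (psh_at m f e) V ?s) (pair_sec e V (vpair ?s ?r)))"
      by (simp add: assoc_iso_eps[OF de(1) U q] assoc_iso_eps[OF de(2) V(1) q'])
    also have "\<dots> = FA (top_flat_fun S g) (oarr (pair_sec d U (vpair s r)) (FA (top_flat_fun m f) \<xi>) (pair_sec e V (vpair ?s ?r)))"
      unfolding x top_flat_FA[OF mf a U V]
      by (rule top_flat_FA[OF Sg aS openin_sum_eps[OF mf de(1) U s] openin_sum_eps[OF mf de(2) V(1) act_elts[OF mf a U V s]] eps_act_subset[OF mf a U V s], symmetric])
    also have "\<dots> = FA ?R z"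
      using oplax_map_FA[OF gz, of disc_fam g "top_flat_fun m f" \<theta> r ?r]
      by (simp add: z pair_sec_def x)
    finally show ?thesis .
  qed
qed

end

section \<open>The left module\<close>

lemma iso_comp_left: "F \<simeq> F' \<Longrightarrow> is_functor G \<Longrightarrow> Tgt F = Src G \<Longrightarrow> comp_func G F \<simeq> comp_func G F'"
  by (rule iso_comp[OF _ iso_refl])

lemma iso_comp_right: "G \<simeq> G' \<Longrightarrow> is_functor F \<Longrightarrow> Tgt F = Src G \<Longrightarrow> comp_func G F \<simeq> comp_func G' F"
  by (rule iso_comp[OF iso_refl])

text \<open>The components are the projections from the etale spaces to their base spaces; over each point there
  is exactly one germ.\<close>

lemma top_sum_unit:
  assumes mf: "module_arg m f" and 1: "\<And>x. x \<in> Ob (Src f) \<Longrightarrow> \<exists>s. elts (FO f x) = {s}"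
  shows "top_sum_fun m f \<simeq> m"
proof (rule iso_funcI, rule nat_isoI)
  let ?S = "top_sum_fun m f"
  let ?p = "\<lambda>d. top_arr (Et (psh_at m f d)) (spc m d) vfst"
  note m = mod_m[OF mf] and smp = top_sum_simps[OF mf]
  show "is_functor ?S" "is_functor m" using is_functor_top_sum[OF mf] m by auto
  show "Src ?S = Src m" "Tgt ?S = Tgt m" using m by (simp_all add: smp)
  have h: "?p d \<in> hom TopC (top_code (Et (psh_at m f d))) (FO m d)" if d: "d \<in> Ob (Src m)" for d
    using top_arr_hom[OF vsmall_Et[OF psh_psh_at[OF mf d]] top_vsmall[OF m d]
        continuous_Et_proj[OF psh_psh_at[OF mf d], unfolded psh_at_simps] open_Et_proj[OF psh_psh_at[OF mf d], unfolded psh_at_simps]]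
      TopC_ObD(1)[OF top_Ob[OF m d]] by simp
  have v: "vapp (?p d) p = vfst p" if d: "d \<in> Ob (Src m)" and "p \<in> topspace (Et (psh_at m f d))" for d p
    by (rule vapp_top_arr[OF vsmall_Et[OF psh_psh_at[OF mf d]] that(2)])
  show "?p d \<in> hom (Tgt ?S) (FO ?S d) (FO m d)" "invertible (Tgt ?S) (?p d)" if "d \<in> Ob (Src ?S)" for d
  proof -
    have d: "d \<in> Ob (Src m)" using that by (simp add: smp)
    show "?p d \<in> hom (Tgt ?S) (FO ?S d) (FO m d)" using h[OF d] by (simp add: smp)
    have b: "bij_betw vfst (topspace (Et (psh_at m f d))) (topspace (spc m d))"
      using bij_Et_proj[OF psh_psh_at[OF mf d]] 1 ouv_Ob[OF m d] mod_f(3)[OF mf] by (simp add: psh_at_simps)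
    have "bij_betw (vapp (?p d)) (topspace (Et (psh_at m f d))) (topspace (spc m d))"
      by (rule iffD2[OF bij_betw_cong[OF v[OF d]] b])
    then have "invertible TopC (?p d)"
      using TopC_invertibleI[OF h[OF d]] by (simp add: top_of_Et[OF psh_psh_at[OF mf d]])
    then show "invertible (Tgt ?S) (?p d)" by (simp add: smp)
  qed
  fix \<alpha> d e assume "\<alpha> \<in> hom (Src ?S) d e"
  then have a: "\<alpha> \<in> hom (Src m) d e" by (simp add: smp)
  note de = hom_Ob1[OF mod_C[OF mf] a] hom_Ob2[OF mod_C[OF mf] a]
  note Sa = top_sum_hom[OF mf a] and ma = top_hom[OF m a]
  have "Cmp TopC (?p e) (FA ?S \<alpha>) = Cmp TopC (FA m \<alpha>) (?p d)"
  proof (rule Et_arr_eqI[OF psh_psh_at[OF mf de(1)] cat_comp[OF category_TopC Sa h[OF de(2)]] cat_comp[OF category_TopC h[OF de(1)] ma]])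
    fix x U s assume s: "sect (psh_at m f d) x U s"
    have tp: "pt (psh_at m f d) x U s \<in> topspace (top_of (top_code (Et (psh_at m f d))))"
      using pt_topspace[OF s] top_of_Et[OF psh_psh_at[OF mf de(1)]] by simp
    show "vapp (Cmp TopC (?p e) (FA ?S \<alpha>)) (pt (psh_at m f d) x U s) = vapp (Cmp TopC (FA m \<alpha>) (?p d)) (pt (psh_at m f d) x U s)"
      unfolding vapp_TopC_Cmp[OF Sa h[OF de(2)] tp] vapp_TopC_Cmp[OF h[OF de(1)] ma tp] top_sum_pt[OF mf a s]
        v[OF de(2) pt_topspace[OF sect_act[OF mf a s]]] v[OF de(1) pt_topspace[OF s]] by simp
  qed
  then show "Cmp (Tgt ?S) (?p e) (FA ?S \<alpha>) = Cmp (Tgt ?S) (FA m \<alpha>) (?p d)" by (simp add: smp)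
qed

text \<open>Up to isomorphism the unit arrow is constant at a one-element set, and isomorphisms of sets are
  bijective.\<close>

lemma const_one_singleton:
  fixes X :: "'u::two_universes scat"
  assumes X: "X \<in> Ob hCAT" and x: "x \<in> Ob X"
  shows "\<exists>s. elts (FO (const_one hCAT Set_adder X) x) = {s}"
proof -
  let ?T = "oplax SetC disc_fam :: 'u scat"
  let ?p = "oplax_proj SetC disc_fam :: 'u func" and ?q = "point_func ?T (vpair vone (vset {}))"
  have t: "(THE t. t \<in> hom hCAT X unit_cat) = Ho (unit_func X)"
    using hom_unit[OF X] by simp
  have u: "is_functor (unit_func X)" "Src (unit_func X) = X" "Tgt (unit_func X) = unit_cat"
    using is_functor_unit_func X by (auto simp: unit_func_def)
  have q: "is_functor ?q" "Src ?q = unit_cat" "Tgt ?q = ?T"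
    using is_functor_point[OF category_oplax[OF fam_disc] one_Ob] by (auto simp: point_func_def)
  note p = is_functor_oplax_proj[OF fam_disc]
  have pq: "is_functor (comp_func ?p ?q)" using is_functor_comp[OF q(1) p] q by simp
  let ?k = "comp_func (comp_func ?p ?q) (unit_func X)"
  have k: "is_functor ?k" by (rule is_functor_comp[OF u(1) pq]) (simp add: q(2) u(3))
  have c: "const_one hCAT Set_adder X = Ho ?k"
    unfolding const_one_def Set_adder_simps t
    by (simp add: Ho_comp_Ho p q u pq)
  have kx: "FO ?k x = vone" by (simp add: point_func_def)
  note n = Ho_nat_iso[OF k]
  have "x \<in> Ob (Src ?k)" using x u by simp
  note h = nat_iso_hom[OF n this] and i = nat_iso_invertible[OF n this]
  have T: "Tgt ?k = SetC" by simp
  have "bij_betw (vapp (Ho_iso ?k x)) (elts (FO ?k x)) (elts (FO (Ho ?k) x))"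
    using SetC_invertible[OF h[unfolded T]] i[unfolded T] by blast
  then have "elts (FO (Ho ?k) x) = vapp (Ho_iso ?k x) ` {vset {}}"
    using kx by (metis bij_betw_imp_surj_on elts_vone)
  then show ?thesis unfolding c by auto
qed

lemma over_id_iso: "over N M (id_func I) E \<Longrightarrow> N \<simeq> M"
  using over_nat_iso iso_funcI comp_id_right over_Tgt_h by (metis id_func_simps(2))

lemma oplax_map_id:
  assumes K: "fam B K" and m: "is_functor m" "Tgt m = B"
  shows "fun_eq (id_func (oplax (Src m) (pre K m))) (oplax_map K m m (id_func (Src m)) (nid m))"
  unfolding fun_eq_def
proof (intro conjI ballI)
  let ?O = "oplax (Src m) (pre K m)" and ?M = "oplax_map K m m (id_func (Src m)) (nid m)"
  have mO: "FO m v \<in> Ob B" if "v \<in> Ob (Src m)" for v using func_Ob[OF m(1) that] m(2) by simp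
  show "FO (id_func ?O) x = FO ?M x" if "x \<in> Ob (Src (id_func ?O))" for x
    using that fam_Idn_Ob[OF K mO] m(2) by (auto simp: oplax_Ob nid_def)
  fix f assume "f \<in> Ar (Src (id_func ?O))"
  then have "f \<in> hom ?O (Dm ?O f) (Cd ?O f)" by (simp add: Ar_hom)
  then obtain v j v' j' \<alpha> \<beta> where f: "f = oarr j \<alpha> \<beta>"
      and a: "\<alpha> \<in> hom (Src m) v v'" and j: "j \<in> Ob (FamO K (FO m v))"
      and b: "\<beta> \<in> hom (FamO K (FO m v')) (FO (FamA K (FA m \<alpha>)) j) j'"
    by (rule oplax_homE) simp
  note o = mO[OF hom_Ob1[OF func_Src[OF m(1)] a]] mO[OF hom_Ob2[OF func_Src[OF m(1)] a]]
  show "FA (id_func ?O) f = FA ?M f"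
    using fam_Idn_Ob[OF K o(1) j] fam_Idn_Ar[OF K o(2) b] m(2) by (simp add: f oplax_map_FA[OF a] nid_def)
qed simp_all

text \<open>Two identifications of \<open>N\<close> with \<open>n\<close> differ by an automorphism of \<open>n\<close>.  Combined with the isomorphism
  between the identity functor and its representative, the automorphism gives one of the arrows
  that count as the identity.\<close>

lemma pb_eq_oplax:
  assumes K: "fam B K" and n: "n \<in> hom hCAT U B"
    and 1: "over N n (id_func U) \<beta>1" and 2: "over N n (id_func U) \<beta>2"
    and Y: "is_functor Y" "Tgt Y = oplax U (pre K N)"
  shows "pb_eq hCAT (oplax_pb B K) n (Ho (comp_func (oplax_map K N n (id_func U) \<beta>1) Y))
    (Ho (comp_func (oplax_map K N n (id_func U) \<beta>2) Y))"
proof -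
  have nf: "is_functor n" "Src n = U" "Tgt n = B" using n by (auto simp: hom_hCAT)
  have NS: "Src N = U" "Tgt N = B" using over_Src_h[OF 1] over_Tgt_m[OF 1] nf by auto
  note N = over_n[OF 1]
  have ni: "comp_func n (id_func U) = n" by (rule comp_id_right[OF nf(2)])
  note l1 = over_nat_iso[OF 1, unfolded ni] and l2 = over_nat_iso[OF 2, unfolded ni]
  let ?I = "id_func U" let ?H = "Ho ?I"
  have cU: "category U" using func_Src[OF nf(1)] nf(2) by simp
  note If = is_functor_id[OF cU]
  have H: "is_functor ?H" "Src ?H = U" "Tgt ?H = U"
    using is_functor_Ho[OF If] Src_Ho[OF If] Tgt_Ho[OF If] by auto
  define \<sigma> where "\<sigma> = Ho_iso ?I"
  have s: "nat_iso \<sigma> ?I ?H" unfolding \<sigma>_def by (rule Ho_nat_iso[OF If])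
  have ns: "nat_iso (FA n \<circ> \<sigma>) n (comp_func n ?H)"
    using nat_iso_whisker_left[OF s nf(1)] nf(2) ni by simp
  \<comment> \<open>\<open>\<beta>2\<close> after the inverse of \<open>\<beta>1\<close> is the automorphism; \<open>\<sigma>\<close> corrects for the representative of the identity\<close>
  define \<rho> where "\<rho> = ncmp n (FA n \<circ> \<sigma>) (ncmp n \<beta>2 (ninv N \<beta>1))"
  have c: "nat_iso \<rho> n (comp_func n ?H)"
    unfolding \<rho>_def by (rule nat_iso_ncmp[OF nat_iso_ncmp[OF nat_iso_ninv[OF l1] l2] ns])
  have oc: "over n n ?H \<rho>" using c H nf by (simp add: over_def)
  have nn: "Cmp hCAT n (Idn hCAT U) = n"
    using cat_idr[OF category_hCAT n] .
  let ?j = "oplax_map K n n ?H \<rho>"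
  have "Ho ?j \<in> Ind (oplax_pb B K) n (Idn hCAT (Dm hCAT n))"
    using c nn nf by (auto simp: oplax_pb_def)
  moreover have "Cmp hCAT (Ho ?j) (Ho (comp_func (oplax_map K N n ?I \<beta>1) Y)) = Ho (comp_func (oplax_map K N n ?I \<beta>2) Y)"
  proof -
    note KN = K[folded NS(2)] and Kn = K[folded nf(3)]
    note M1 = is_functor_oplax_map[OF KN 1] and M2 = is_functor_oplax_map[OF KN 2] and J = is_functor_oplax_map[OF Kn oc]
    have HI: "comp_func ?H ?I = ?H" by (rule comp_id_right[OF H(2)])
    let ?mu = "ncmp N (\<rho> \<circ> FO ?I) \<beta>1"
    have mu: "over N n ?H ?mu" using over_comp[OF 1 oc] HI by simp
    have JM: "is_functor (comp_func ?j (oplax_map K N n ?I \<beta>1))"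
      using is_functor_comp[OF M1 J] by simp
    have "comp_func ?j (oplax_map K N n ?I \<beta>1) \<simeq> oplax_map K N n ?H ?mu"
      using fun_eq_iso[OF JM] oplax_map_comp[OF KN 1 oc] HI by simp
    moreover have "oplax_map K N n ?I \<beta>2 \<simeq> oplax_map K N n ?H ?mu"
    proof (rule oplax_map_iso[OF KN 2 mu s])
      fix v assume v: "v \<in> Ob (Src N)"
      have vn: "v \<in> Ob (Src n)" using v NS nf by simp
      note a = nat_iso_hom[OF l1 v] and a' = nat_iso_invertible[OF l1 v] and b = nat_iso_hom[OF l2 v]
      note ai = arr_inv_hom[OF a' a] 
      have e: "FA n (\<sigma> v) \<in> hom (Tgt N) (FO n v) (FO n (FO ?H v))"
        using nat_iso_hom[OF ns vn] nf NS by simp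
      note CN = func_Tgt[OF N]
      have "?mu v = Cmp (Tgt N) (Cmp (Tgt N) (FA n (\<sigma> v)) (Cmp (Tgt N) (\<beta>2 v) (arr_inv (Tgt N) (\<beta>1 v)))) (\<beta>1 v)"
        using nf NS by (simp add: \<rho>_def ncmp_def ninv_def)
      also have "\<dots> = Cmp (Tgt N) (FA n (\<sigma> v)) (Cmp (Tgt N) (\<beta>2 v) (Cmp (Tgt N) (arr_inv (Tgt N) (\<beta>1 v)) (\<beta>1 v)))"
        by (simp add: cat_assoc[OF CN a cat_comp[OF CN ai b] e, symmetric] cat_assoc[OF CN a ai b, symmetric])
      also have "\<dots> = Cmp (Tgt N) (FA n (\<sigma> v)) (\<beta>2 v)"
        by (simp add: arr_inv_left[OF a' a] cat_idr[OF CN b])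
      finally show "Cmp (Tgt N) (FA n (\<sigma> v)) (\<beta>2 v) = ?mu v" by simp
    qed
    ultimately have i: "comp_func ?j (oplax_map K N n ?I \<beta>1) \<simeq> oplax_map K N n ?I \<beta>2"
      using iso_sym iso_trans by blast
    have YT: "Tgt Y = Src (oplax_map K N n ?I \<beta>1)" using Y NS by simp
    have "Cmp hCAT (Ho ?j) (Ho (comp_func (oplax_map K N n ?I \<beta>1) Y)) = Ho (comp_func (comp_func ?j (oplax_map K N n ?I \<beta>1)) Y)"
      using is_functor_comp[OF Y(1) M1 YT] J by (simp add: Ho_comp_Ho comp_func_assoc)
    also have "\<dots> = Ho (comp_func (oplax_map K N n ?I \<beta>2) Y)"
      using Ho_eqI[OF iso_comp_right[OF i Y(1)]] YT by simp
    finally show ?thesis .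
  qed
  ultimately show ?thesis by (auto simp: pb_eq_def)
qed

lemma Top_module_simps: "Mpb Top_module = oplax_pb TopC ouv_fam"
  "Msum Top_module m f = Ho (top_sum_fun m f)"
  "module_arg m f \<Longrightarrow> Mflat Top_module m f = Ho (flat_arr ouv_fam (top_sum_fun m f) (top_flat_fun m f))"
  by (simp_all add: Top_module_def flat_arr_def Let_def top_sum_simps)

lemma
  assumes mf: "module_arg m f" and s: "moderately_small (Src m)"
  shows Ho_top_sum_hom: "Ho (top_sum_fun m f) \<in> hom hCAT (Src m) TopC"
    and Ho_flat_hom: "Mflat Top_module m f \<in> hom hCAT (oplax (Src f) (pre disc_fam f)) (Pb (oplax_pb TopC ouv_fam) (Ho (top_sum_fun m f)))"
    and Ho_flat_over: "Cmp hCAT (Pr1 (oplax_pb TopC ouv_fam) (Ho (top_sum_fun m f))) (Mflat Top_module m f) =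
      Cmp hCAT (Ho (oplax_proj (Src m) (pre ouv_fam m))) (Ho (oplax_proj (Src f) (pre disc_fam f)))"
proof -
  note S = is_functor_top_sum[OF mf] and smp = top_sum_simps[OF mf]
  note Km = fam_pre[OF fam_ouv mod_m[OF mf]] and Kf = fam_pre[OF fam_disc mod_f(1,2)[OF mf]]
  have sf: "moderately_small (oplax (Src f) (pre disc_fam f))"
    using moderately_small_oplax[OF Kf] moderately_small_oplax[OF Km s] mod_f(3)[OF mf] by simp
  show "Ho (top_sum_fun m f) \<in> hom hCAT (Src m) TopC" using Ho_hom[OF S] s moderately_small_TopC by (simp add: smp)
  note F = Ho_flat_arr[OF fam_ouv S smp(2,1) is_functor_top_flat[OF mf] top_flat_simps[OF mf] sf s]
  show "Mflat Top_module m f \<in> hom hCAT (oplax (Src f) (pre disc_fam f)) (Pb (oplax_pb TopC ouv_fam) (Ho (top_sum_fun m f)))"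
    using F(1) by (simp add: Top_module_simps(3)[OF mf])
  show "Cmp hCAT (Pr1 (oplax_pb TopC ouv_fam) (Ho (top_sum_fun m f))) (Mflat Top_module m f) =
      Cmp hCAT (Ho (oplax_proj (Src m) (pre ouv_fam m))) (Ho (oplax_proj (Src f) (pre disc_fam f)))"
    using F(2) oplax_proj_top_flat[OF mf] is_functor_oplax_proj[OF Km] is_functor_oplax_proj[OF Kf] mod_f(3)[OF mf]
    by (simp add: Top_module_simps(3)[OF mf] Ho_comp_Ho)
qed

text \<open>The precomposite of \<open>f\<close> with any arrow \<open>k\<close> that counts as \<open>h \<times> id\<close> is isomorphic to the precomposite with
  the functor that \<open>k\<close> represents, which is the situation of \<open>top_sum_over\<close>.\<close>

lemma Msum_natural:
  assumes mf: "module_arg m f" and m: "m \<in> hom hCAT U TopC" and h: "h \<in> hom hCAT V U"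
    and k: "k \<in> Ind (oplax_pb TopC ouv_fam) m h"
  shows "Ho (top_sum_fun (Cmp hCAT m h) (Cmp hCAT f k)) = Cmp hCAT (Ho (top_sum_fun m f)) h"
proof -
  obtain \<phi> where kM: "k = Ho (oplax_map ouv_fam (Cmp hCAT m h) m h \<phi>)" and o: "over (Cmp hCAT m h) m h \<phi>"
    by (rule Ind_oplax_pb[OF m h k])
  let ?n = "Cmp hCAT m h" let ?M = "oplax_map ouv_fam ?n m h \<phi>" let ?g = "Cmp hCAT f k"
  note nT = over_Tgt_m[OF o, unfolded mod_m(2)[OF mf], symmetric]
  have M: "is_functor ?M" using is_functor_oplax_map[OF _ o] fam_ouv nT by simp
  have fM: "is_functor (comp_func f ?M)" using is_functor_comp[OF M mod_f(1)[OF mf]] mod_f(3)[OF mf] by simp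
  have g: "?g = Ho (comp_func f ?M)" using M mod_f[OF mf] by (simp add: kM Ho_comp_Ho)
  have "nat_iso (ninv (comp_func f ?M) (Ho_iso (comp_func f ?M))) ?g (comp_func f ?M)"
    unfolding g by (rule nat_iso_ninv[OF Ho_nat_iso[OF fM]])
  then have t: "over ?g f ?M (ninv (comp_func f ?M) (Ho_iso (comp_func f ?M)))"
    using M mod_f[OF mf] by (simp add: over_def)
  have ng: "module_arg ?n ?g"
    unfolding module_arg_def g using over_n[OF o] nT is_functor_Ho[OF fM] Src_Ho[OF fM] Tgt_Ho[OF fM] mod_f(2)[OF mf] by simp
  have "top_sum_fun ?n ?g \<simeq> comp_func (top_sum_fun m f) h"
    using over_nat_iso[OF top_sum_over[OF ng mf o t]] by (rule iso_funcI)
  from Ho_eqI[OF this] show ?thesis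
    using is_functor_top_sum[OF mf] over_h[OF o] over_Tgt_h[OF o] by (simp add: Ho_comp_Ho top_sum_simps[OF mf])
qed

text \<open>The data of the associativity laws.  The isomorphism \<open>\<phi>\<close> is arbitrary, because flatten associativity is
  required for all arrows that count as \<open>flat \<times> id\<close>.  The abbreviation \<open>fl\<close> is the functor represented by
  \<open>flat\<close>, and \<open>g'\<close> is \<open>g\<close> as a presheaf on the explicit sum \<open>S\<close>.\<close>

locale assoc_data =
  fixes m f g gf flat q :: "'u::two_universes func" and \<phi>
  assumes mf: "module_arg m f" and sm: "moderately_small (Src m)"
    and n1g: "module_arg (Ho (top_sum_fun m f)) g"
    and flat: "flat = Mflat Top_module m f" and gf: "gf = Ho (comp_func g flat)"
    and q: "q = Ho (set_sum_fun f gf)"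
    and ph: "nat_iso \<phi> gf (comp_func g flat)"
begin

abbreviation (input) "S \<equiv> top_sum_fun m f"
abbreviation (input) "Q \<equiv> set_sum_fun f gf"
abbreviation (input) "Tm \<equiv> oplax_map ouv_fam S (Ho S) (id_func (Src m)) (Ho_iso S)"
abbreviation (input) "fl \<equiv> comp_func Tm (top_flat_fun m f)"
abbreviation (input) "g' \<equiv> comp_func g Tm"
abbreviation (input) "\<phi>' \<equiv> ncmp gf (FA g \<circ> ninv fl (Ho_iso fl)) \<phi>"

lemma S_f: "is_functor S" "Src S = Src m" "Tgt S = TopC"
  using is_functor_top_sum[OF mf] top_sum_simps[OF mf] by auto

lemma over_S: "over S (Ho S) (id_func (Src m)) (Ho_iso S)"
  using over_Ho[OF S_f(1)] S_f(2) by simp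

lemma Tm_f: "is_functor Tm" "Src Tm = oplax (Src m) (pre ouv_fam S)" "Tgt Tm = Src g"
  using is_functor_oplax_map[OF _ over_S] fam_ouv S_f mod_f(3)[OF n1g] by auto

lemma fl_f: "is_functor fl" "Src fl = oplax (Src f) (pre disc_fam f)" "Tgt fl = Src g" "flat = Ho fl"
proof -
  show "is_functor fl" using is_functor_comp[OF is_functor_top_flat[OF mf] Tm_f(1)] Tm_f(2) top_flat_simps[OF mf] by simp
  show "Src fl = oplax (Src f) (pre disc_fam f)" "Tgt fl = Src g"
    using top_flat_simps[OF mf] Tm_f(3) by simp_all
  show "flat = Ho fl" by (simp add: flat Top_module_simps(3)[OF mf] flat_arr_def S_f(2))
qed

lemma flat_f: "is_functor flat" "Src flat = oplax (Src f) (pre disc_fam f)" "Tgt flat = Src g"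
  unfolding fl_f(4) using is_functor_Ho[OF fl_f(1)] Src_Ho[OF fl_f(1)] Tgt_Ho[OF fl_f(1)] fl_f by auto

lemma gf_f: "is_functor gf" "Src gf = oplax (Src f) (pre disc_fam f)" "Tgt gf = SetC"
proof -
  have "is_functor (comp_func g flat)" using is_functor_comp[OF flat_f(1) mod_f(1)[OF n1g] flat_f(3)] .
  from is_functor_Ho[OF this] Src_Ho[OF this] Tgt_Ho[OF this]
  show "is_functor gf" "Src gf = oplax (Src f) (pre disc_fam f)" "Tgt gf = SetC"
    using flat_f mod_f(2)[OF n1g] by (simp_all add: gf)
qed

lemma Q_f: "is_functor Q" "Src Q = Src f" "Tgt Q = SetC"
  using is_functor_set_sum[OF mod_f(1,2)[OF mf] gf_f(1,3,2)] by simp_all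

lemma mQ: "module_arg m Q"
  using mf Q_f by (simp add: module_arg_def)

lemma mq: "module_arg m q"
  unfolding q using mf is_functor_Ho[OF Q_f(1)] Src_Ho[OF Q_f(1)] Tgt_Ho[OF Q_f(1)] Q_f by (simp add: module_arg_def)

lemma Sg': "module_arg S g'"
  using S_f Tm_f is_functor_comp[OF Tm_f(1) mod_f(1)[OF n1g] Tm_f(3)] mod_f(2)[OF n1g] by (simp add: module_arg_def)

lemma over_g': "over g' g Tm (nid g')"
  using mod_f(1)[OF n1g] Tm_f nat_iso_nid[OF mod_f(1)[OF Sg']] by (simp add: over_def)

lemma phi'_nat_iso: "nat_iso \<phi>' gf (comp_func g fl)"
  using nat_iso_ncmp[OF ph[unfolded fl_f(4)] nat_iso_whisker_left[OF nat_iso_ninv[OF Ho_nat_iso[OF fl_f(1)]] mod_f(1)[OF n1g]]]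
    Tgt_Ho[OF fl_f(1)] fl_f(3) by simp

lemma over_gf: "over gf g' (top_flat_fun m f) \<phi>'"
  using phi'_nat_iso is_functor_top_flat[OF mf] top_flat_simps[OF mf] mod_f(1)[OF Sg'] Tm_f(2)
  by (simp add: over_def comp_func_assoc)

lemma over_flat: "over gf g flat \<phi>"
  using ph flat_f mod_f(1)[OF n1g] by (simp add: over_def)

lemma over_E1: "over (top_sum_fun S g') (top_sum_fun (Ho S) g) (id_func (Src m))
    (sum_iso S (Ho S) (id_func (Src m)) (Ho_iso S) g' g (nid g'))"
  by (rule top_sum_over[OF Sg' n1g over_S over_g'])

lemma flat_data: "flat_data m f g' gf \<phi>'"
  by (rule flat_data.intro[OF mf Sg' gf_f(1,3,2) over_gf])

lemma over_assoc: "over (top_sum_fun m Q) (top_sum_fun S g') (id_func (Src m)) (flat_data.assoc_iso m f g' gf \<phi>')"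
  using over_id[OF flat_data.nat_iso_assoc[OF flat_data]] top_sum_simps(1)[OF mQ] by simp

lemma over_m: "over m m (id_func (Src m)) (nid m)"
  by (rule over_id[OF nat_iso_nid[OF mod_m(1)[OF mf]]])

lemma over_Q: "over Q q (oplax_map ouv_fam m m (id_func (Src m)) (nid m)) (Ho_iso Q)"
proof -
  let ?M = "oplax_map ouv_fam m m (id_func (Src m)) (nid m)"
  note e = oplax_map_id[OF fam_ouv mod_m[OF mf]]
  have M: "is_functor ?M" using is_functor_oplax_map[OF _ over_m] fam_ouv mod_m[OF mf] by simp
  have "fun_eq q (comp_func q ?M)"
    using e mod_f(3)[OF mq] by (simp add: fun_eq_def)
  then have "nat_iso (Ho_iso Q) Q (comp_func q ?M)"
    using nat_iso_cong[OF Ho_nat_iso[OF Q_f(1)] fun_eq_refl] q by simp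
  then show ?thesis using M mod_f[OF mq] by (simp add: over_def)
qed

lemma over_E2: "over (top_sum_fun m Q) (top_sum_fun m q) (id_func (Src m))
    (sum_iso m m (id_func (Src m)) (nid m) Q q (Ho_iso Q))"
  by (rule top_sum_over[OF mQ mq over_m over_Q])

lemma Msum_assoc: "Ho (top_sum_fun (Ho S) g) = Ho (top_sum_fun m q)"
  using over_id_iso[OF over_E1] over_id_iso[OF over_assoc] over_id_iso[OF over_E2] Ho_eqI by metis

text \<open>Starting from the representatives, naturality of flattening (\<open>top_flat_over\<close>) brings both sides to
  composites of an identification of the sum of \<open>Q\<close> with the common representative and of a functor to
  the oplax colimit of that sum.  By \<open>top_flat_assoc\<close> the latter functor is the same on both sides, and
  \<open>pb_eq_oplax\<close> compares the identifications.\<close>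

lemma Mflat_assoc:
  "pb_eq hCAT (oplax_pb TopC ouv_fam) (Ho (top_sum_fun m q))
    (Cmp hCAT (Mflat Top_module (Ho S) g) (Ho (oplax_map disc_fam gf g flat \<phi>)))
    (Cmp hCAT (Mflat Top_module m q) (Ho (flat_arr disc_fam Q (set_flat_fun f gf))))"
proof -
  let ?I = "id_func (Src m)"
  let ?N = "top_sum_fun m Q" and ?R' = "top_sum_fun S g'" and ?R1 = "top_sum_fun (Ho S) g" and ?R2 = "top_sum_fun m q"
  let ?E1 = "sum_iso S (Ho S) ?I (Ho_iso S) g' g (nid g')" and ?L = "flat_data.assoc_iso m f g' gf \<phi>'"
  let ?E2 = "sum_iso m m ?I (nid m) Q q (Ho_iso Q)"
  let ?Y = "comp_func (top_flat_fun m Q) (set_flat_fun f gf)"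
  have HS: "Src (Ho S) = Src m" using Src_Ho[OF S_f(1)] S_f(2) by simp
  note N = is_functor_top_sum[OF mQ] and R' = is_functor_top_sum[OF Sg'] and R1 = is_functor_top_sum[OF n1g] and R2 = is_functor_top_sum[OF mq]
  note sN = top_sum_simps[OF mQ] and sR' = top_sum_simps[OF Sg'] and sR1 = top_sum_simps[OF n1g] and sR2 = top_sum_simps[OF mq]
  note TF = is_functor_top_flat and tfs = top_flat_simps
  note SF = is_functor_set_flat[OF mod_f(1,2)[OF mf] gf_f(1,3,2)]
  have Y: "is_functor ?Y" "Tgt ?Y = oplax (Src m) (pre ouv_fam ?N)" "Src ?Y = oplax (Src gf) (pre disc_fam gf)"
    using is_functor_comp[OF SF TF[OF mQ]] tfs[OF mQ] by simp_all
  have oJ1: "over ?R1 (Ho ?R1) ?I (Ho_iso ?R1)" using over_Ho[OF R1] sR1 HS by simp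
  have oJ2: "over ?R2 (Ho ?R2) ?I (Ho_iso ?R2)" using over_Ho[OF R2] sR2 by simp
  have II: "comp_func ?I ?I = ?I" by (rule comp_id_left) simp
  have famT: "fam (Tgt F) ouv_fam" if "Tgt F = TopC" for F :: "'u func" using fam_ouv that by simp
  note fN = famT[OF sN(2)] and fR' = famT[OF sR'(2)] and fR1 = famT[OF sR1(2)] and fR2 = famT[OF sR2(2)]
  have famD: "fam (Tgt F) disc_fam" if "Tgt F = SetC" for F :: "'u func" using fam_disc that by simp
  let ?m1 = "oplax_map ouv_fam ?N ?R' ?I ?L" and ?m2 = "oplax_map ouv_fam ?R' ?R1 ?I ?E1" and ?m3 = "oplax_map ouv_fam ?R1 (Ho ?R1) ?I (Ho_iso ?R1)"
  note m1 = is_functor_oplax_map[OF fN over_assoc] and m2 = is_functor_oplax_map[OF fR' over_E1] and m3 = is_functor_oplax_map[OF fR1 oJ1]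
  let ?k1 = "oplax_map ouv_fam ?N ?R2 ?I ?E2" and ?k2 = "oplax_map ouv_fam ?R2 (Ho ?R2) ?I (Ho_iso ?R2)"
  note k1 = is_functor_oplax_map[OF fN over_E2] and k2 = is_functor_oplax_map[OF fR2 oJ2]
  define \<beta>0 where "\<beta>0 = ncmp ?N (?E1 \<circ> FO ?I) ?L"
  define \<beta>1 where "\<beta>1 = ncmp ?N (Ho_iso ?R1 \<circ> FO ?I) \<beta>0"
  define \<beta>2 where "\<beta>2 = ncmp ?N (Ho_iso ?R2 \<circ> FO ?I) ?E2"
  have o0: "over ?N ?R1 ?I \<beta>0" using over_comp[OF over_assoc over_E1] unfolding II \<beta>0_def .
  have o1: "over ?N (Ho ?R1) ?I \<beta>1" using over_comp[OF o0 oJ1] unfolding II \<beta>1_def .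
  have o2: "over ?N (Ho ?R2) ?I \<beta>2" using over_comp[OF over_E2 oJ2] unfolding II \<beta>2_def .
  note lam0 = is_functor_oplax_map[OF fN o0]
  have c0: "comp_func ?m2 ?m1 \<simeq> oplax_map ouv_fam ?N ?R1 ?I \<beta>0"
    using fun_eq_iso[OF is_functor_comp[OF m1 m2]] oplax_map_comp[OF fN over_assoc over_E1] unfolding II \<beta>0_def by simp
  have c1: "comp_func ?m3 (oplax_map ouv_fam ?N ?R1 ?I \<beta>0) \<simeq> oplax_map ouv_fam ?N (Ho ?R1) ?I \<beta>1"
    using fun_eq_iso[OF is_functor_comp[OF lam0 m3]] oplax_map_comp[OF fN o0 oJ1] unfolding II \<beta>1_def by simp
  have c2: "comp_func ?k2 ?k1 \<simeq> oplax_map ouv_fam ?N (Ho ?R2) ?I \<beta>2"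
    using fun_eq_iso[OF is_functor_comp[OF k1 k2]] oplax_map_comp[OF fN over_E2 oJ2] unfolding II \<beta>2_def by simp
  \<comment> \<open>\<open>flat\<close> is replaced by the functor \<open>fl\<close> that it represents, and \<open>\<phi>\<close> by \<open>\<phi>'\<close> accordingly\<close>
  let ?K = "oplax_map disc_fam gf g flat \<phi>" and ?X = "oplax_map disc_fam gf g' (top_flat_fun m f) \<phi>'"
    and ?A = "oplax_map disc_fam g' g Tm (nid g')"
  note Dgf = famD[OF gf_f(3)] and Dg' = famD[OF mod_f(2)[OF Sg']]
  note Kf = is_functor_oplax_map[OF Dgf over_flat] and Xf = is_functor_oplax_map[OF Dgf over_gf] and Af = is_functor_oplax_map[OF Dg' over_g']
  have KX: "?K \<simeq> comp_func ?A ?X"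
  proof -
    note oc = over_comp[OF over_gf over_g']
    have s: "nat_iso (ninv fl (Ho_iso fl)) flat fl" using nat_iso_ninv[OF Ho_nat_iso[OF fl_f(1)]] fl_f(4) by simp
    have "?K \<simeq> oplax_map disc_fam gf g fl (ncmp gf (nid g' \<circ> FO (top_flat_fun m f)) \<phi>')"
    proof (rule oplax_map_iso[OF Dgf over_flat oc s])
      fix v assume v: "v \<in> Ob (Src gf)"
      note h = over_hom[OF over_gf v]
      have "Cmp (Tgt gf) (nid g' (FO (top_flat_fun m f) v)) (\<phi>' v) = \<phi>' v"
        using cat_idl[OF func_Tgt[OF gf_f(1)] h] gf_f(3) mod_f(2)[OF n1g] by (simp add: nid_def)
      then show "Cmp (Tgt gf) (FA g (ninv fl (Ho_iso fl) v)) (\<phi> v) = ncmp gf (nid g' \<circ> FO (top_flat_fun m f)) \<phi>' v"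
        by (simp add: ncmp_def)
    qed
    also have "\<dots> \<simeq> comp_func ?A ?X"
      using iso_sym[OF fun_eq_iso[OF is_functor_comp[OF Xf Af] oplax_map_comp[OF Dgf over_gf over_g']]] by simp
    finally show ?thesis .
  qed
  have "comp_func (flat_arr ouv_fam ?R1 (top_flat_fun (Ho S) g)) ?K \<simeq> comp_func (oplax_map ouv_fam ?N (Ho ?R1) ?I \<beta>1) ?Y"
  proof -
    let ?t = "top_flat_fun (Ho S) g"
    have 1: "comp_func ?t ?K \<simeq> comp_func ?t (comp_func ?A ?X)"
      by (rule iso_comp_left[OF KX TF[OF n1g]]) (simp add: tfs[OF n1g])
    have tA: "is_functor (comp_func ?t ?A)" using is_functor_comp[OF Af TF[OF n1g]] by (simp add: tfs[OF n1g])
    have 2: "comp_func (comp_func ?t ?A) ?X \<simeq> comp_func (comp_func ?m2 (top_flat_fun S g')) ?X"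
      by (rule iso_comp_right[OF fun_eq_iso[OF tA top_flat_over[OF Sg' n1g over_S over_g']] Xf]) simp
    have mY: "is_functor (comp_func ?m1 ?Y)" using is_functor_comp[OF Y(1) m1] Y(2) sN by simp
    have 3: "comp_func ?m2 (comp_func (top_flat_fun S g') ?X) \<simeq> comp_func ?m2 (comp_func ?m1 ?Y)"
      using iso_comp_left[OF iso_sym[OF fun_eq_iso[OF mY flat_data.top_flat_assoc[OF flat_data]]] m2]
      by (simp add: tfs[OF Sg'] sR')
    have 4: "comp_func (comp_func ?m2 ?m1) ?Y \<simeq> comp_func (oplax_map ouv_fam ?N ?R1 ?I \<beta>0) ?Y"
      by (rule iso_comp_right[OF c0 Y(1)]) (use Y sN in simp)
    have 5: "comp_func ?t ?K \<simeq> comp_func (oplax_map ouv_fam ?N ?R1 ?I \<beta>0) ?Y"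
      using 1 2 3 4 iso_trans unfolding comp_func_assoc by blast
    have 6: "comp_func ?m3 (comp_func ?t ?K) \<simeq> comp_func ?m3 (comp_func (oplax_map ouv_fam ?N ?R1 ?I \<beta>0) ?Y)"
      by (rule iso_comp_left[OF 5 m3]) (simp add: tfs[OF n1g] sR1)
    have 7: "comp_func (comp_func ?m3 (oplax_map ouv_fam ?N ?R1 ?I \<beta>0)) ?Y \<simeq> comp_func (oplax_map ouv_fam ?N (Ho ?R1) ?I \<beta>1) ?Y"
      by (rule iso_comp_right[OF c1 Y(1)]) (use Y sN in simp)
    from 6 7 iso_trans show ?thesis
      unfolding comp_func_assoc flat_arr_def sR1 HS by blast
  qed
  moreover have "is_functor (flat_arr ouv_fam ?R1 (top_flat_fun (Ho S) g))" "Src (flat_arr ouv_fam ?R1 (top_flat_fun (Ho S) g)) = oplax (Src g) (pre disc_fam g)"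
    using is_functor_flat_arr[OF fam_ouv R1 sR1(2) TF[OF n1g]] flat_arr_Src[OF fam_ouv R1 sR1(2) TF[OF n1g]] by (simp_all add: tfs[OF n1g] sR1)
  ultimately have lhs: "Cmp hCAT (Mflat Top_module (Ho S) g) (Ho ?K) = Ho (comp_func (oplax_map ouv_fam ?N (Ho ?R1) ?I \<beta>1) ?Y)"
    using Ho_eqI Kf by (simp add: Top_module_simps(3)[OF n1g] Ho_comp_Ho)
  \<comment> \<open>\<open>top_flat_over\<close> needs \<open>?M\<close>, which agrees with the identity functor on objects and arrows only\<close>
  let ?M = "oplax_map ouv_fam m m ?I (nid m)"
  let ?B = "oplax_map disc_fam Q q (id_func (Src Q)) (Ho_iso Q)" and ?B' = "oplax_map disc_fam Q q ?M (Ho_iso Q)"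
  note DQ = famD[OF Q_f(3)]
  have oB: "over Q q (id_func (Src Q)) (Ho_iso Q)" using over_Ho[OF Q_f(1)] q by simp
  note Bf = is_functor_oplax_map[OF DQ oB] and B'f = is_functor_oplax_map[OF DQ over_Q]
  have BB: "?B \<simeq> ?B'"
  proof -
    have s: "nat_iso (nid (id_func (Src Q))) (id_func (Src Q)) ?M"
      using nat_iso_cong[OF nat_iso_nid[OF is_functor_id[OF func_Src[OF Q_f(1)]]] fun_eq_refl]
        oplax_map_id[OF fam_ouv mod_m[OF mf]] mod_f(3)[OF mQ] by simp
    show ?thesis
    proof (rule oplax_map_iso[OF DQ oB over_Q s])
      fix v assume v: "v \<in> Ob (Src Q)"
      have vq: "v \<in> Ob (Src q)" using v Src_Ho[OF Q_f(1)] q by simp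
      have "FA q (Idn (Src q) v) = Idn (Tgt q) (FO q v)" using func_Idn[OF mod_f(1)[OF mq] vq] .
      then show "Cmp (Tgt Q) (FA q (nid (id_func (Src Q)) v)) (Ho_iso Q v) = Ho_iso Q v"
        using cat_idl[OF func_Tgt[OF Q_f(1)] nat_iso_hom[OF Ho_nat_iso[OF Q_f(1)] v]] Src_Ho[OF Q_f(1)] Tgt_Ho[OF Q_f(1)] q
        by (simp add: nid_def)
    qed
  qed
  have "comp_func (flat_arr ouv_fam ?R2 (top_flat_fun m q)) (flat_arr disc_fam Q (set_flat_fun f gf)) \<simeq> comp_func (oplax_map ouv_fam ?N (Ho ?R2) ?I \<beta>2) ?Y"
  proof -
    let ?t = "top_flat_fun m q"
    have 1: "comp_func ?t ?B \<simeq> comp_func ?t ?B'"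
      by (rule iso_comp_left[OF BB TF[OF mq]]) (simp add: tfs[OF mq])
    have tB: "is_functor (comp_func ?t ?B')" using is_functor_comp[OF B'f TF[OF mq]] by (simp add: tfs[OF mq])
    have 2: "comp_func ?t ?B' \<simeq> comp_func ?k1 (top_flat_fun m Q)"
      by (rule fun_eq_iso[OF tB top_flat_over[OF mQ mq over_m over_Q]])
    have 3: "comp_func (comp_func ?t ?B) (set_flat_fun f gf) \<simeq> comp_func (comp_func ?k1 (top_flat_fun m Q)) (set_flat_fun f gf)"
      by (rule iso_comp_right[OF iso_trans[OF 1 2] SF]) simp
    have 4: "comp_func ?k2 (comp_func (comp_func ?t ?B) (set_flat_fun f gf)) \<simeq> comp_func ?k2 (comp_func (comp_func ?k1 (top_flat_fun m Q)) (set_flat_fun f gf))"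
      by (rule iso_comp_left[OF 3 k2]) (simp add: tfs[OF mq] sR2)
    have 5: "comp_func (comp_func ?k2 ?k1) ?Y \<simeq> comp_func (oplax_map ouv_fam ?N (Ho ?R2) ?I \<beta>2) ?Y"
      by (rule iso_comp_right[OF c2 Y(1)]) (use Y sN in simp)
    from 4 5 iso_trans show ?thesis
      unfolding comp_func_assoc flat_arr_def sR2 q[symmetric] by blast
  qed
  moreover have "is_functor (flat_arr ouv_fam ?R2 (top_flat_fun m q))" "Src (flat_arr ouv_fam ?R2 (top_flat_fun m q)) = oplax (Src q) (pre disc_fam q)"
    using is_functor_flat_arr[OF fam_ouv R2 sR2(2) TF[OF mq]] flat_arr_Src[OF fam_ouv R2 sR2(2) TF[OF mq]] by (simp_all add: tfs[OF mq] sR2)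
  moreover have "is_functor (flat_arr disc_fam Q (set_flat_fun f gf))" "Tgt (flat_arr disc_fam Q (set_flat_fun f gf)) = oplax (Src q) (pre disc_fam q)"
    using is_functor_flat_arr[OF fam_disc Q_f(1,3) SF] flat_arr_Tgt[OF fam_disc Q_f(1,3) SF] Src_Ho[OF Q_f(1)] q by simp_all
  ultimately have rhs: "Cmp hCAT (Mflat Top_module m q) (Ho (flat_arr disc_fam Q (set_flat_fun f gf))) = Ho (comp_func (oplax_map ouv_fam ?N (Ho ?R2) ?I \<beta>2) ?Y)"
    using Ho_eqI by (simp add: Top_module_simps(3)[OF mq] Ho_comp_Ho)
  have e: "Ho ?R1 = Ho ?R2" by (rule Msum_assoc)
  show ?thesis
    unfolding lhs rhs e
    by (rule pb_eq_oplax[OF fam_ouv Ho_top_sum_hom[OF mq sm] o1[unfolded e] o2 Y(1,2)])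
qed

end

theorem mainTheorem6:
  shows "dep_left_module (hCAT :: ('u::two_universes scat, 'u func) cat) Set_adder Top_module"
  unfolding dep_left_module_def Let_def Top_module_simps(1,2) Set_adder_simps(1) oplax_pb_simps(1)
proof (intro conjI ballI)
  let ?P = "oplax_pb TopC ouv_fam :: ('u scat, 'u func) pb_system"
  show "adder_data (hCAT :: ('u scat, 'u func) cat) Set_adder" by (rule adder_data_Set)
  show "pb_system hCAT ?P" by (rule pb_system_oplax[OF fam_ouv moderately_small_TopC])
  fix U :: "'u scat" and m assume U: "U \<in> Ob hCAT" and m: "m \<in> hom hCAT U TopC"
  then have mf: "is_functor m" "Src m = U" "Tgt m = TopC" "Ho m = m" and sU: "moderately_small U"
    by (auto simp: hom_hCAT)
  note Km = fam_pre[OF fam_ouv mf(1,3)]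
  have sP: "moderately_small (Pb ?P m)" "category (Pb ?P m)"
    using moderately_small_oplax[OF Km] category_oplax[OF Km] sU mf by simp_all
  have arg: "module_arg m f" if "f \<in> hom hCAT (Pb ?P m) SetC" for f
    using that mf by (auto simp: module_arg_def hom_hCAT)
  show "Ho (top_sum_fun m (const_one hCAT Set_adder (Pb ?P m))) = m"
  proof -
    have X: "Pb ?P m \<in> Ob hCAT" using sP by simp
    have "Proj (oplax_pb SetC disc_fam) \<in> hom (hCAT :: ('u scat, 'u func) cat) (oplax SetC disc_fam) SetC"
      "Aone Set_adder \<in> hom (hCAT :: ('u scat, 'u func) cat) unit_cat (oplax SetC disc_fam)"
      using adder_data_Set[where ?'a = 'u] by (auto simp: adder_data_def pb_system_def Set_adder_simps)
    moreover have "(THE t. t \<in> hom hCAT (Pb ?P m) unit_cat) \<in> hom hCAT (Pb ?P m) unit_cat"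
      using hom_unit[OF X] by simp
    ultimately have "const_one hCAT Set_adder (Pb ?P m) \<in> hom hCAT (Pb ?P m) SetC"
      unfolding const_one_def Set_adder_simps(1,2) by (intro cat_comp[OF category_hCAT])
    from arg[OF this] have a: "module_arg m (const_one hCAT Set_adder (Pb ?P m))" .
    have "top_sum_fun m (const_one hCAT Set_adder (Pb ?P m)) \<simeq> m"
      using const_one_singleton[OF X] mod_f(3)[OF a] by (intro top_sum_unit[OF a]) simp
    from Ho_eqI[OF this] mf(4) show ?thesis by simp
  qed
  fix f assume f: "f \<in> hom hCAT (Pb ?P m) SetC"
  note a = arg[OF f]
  show sum: "Ho (top_sum_fun m f) \<in> hom hCAT U TopC" using Ho_top_sum_hom[OF a] mf sU by simp
  show "Mflat Top_module m f \<in> hom hCAT (Pb (oplax_pb SetC disc_fam) f) (Pb ?P (Ho (top_sum_fun m f)))"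
    using Ho_flat_hom[OF a] mf sU by simp
  show "Cmp hCAT (Pr1 ?P (Ho (top_sum_fun m f))) (Mflat Top_module m f) =
      Cmp hCAT (Pr1 ?P m) (Pr1 (oplax_pb SetC disc_fam) f)"
    using Ho_flat_over[OF a] mf sU by simp
  show "Ho (top_sum_fun (Cmp hCAT m h) (Cmp hCAT f k)) = Cmp hCAT (Ho (top_sum_fun m f)) h"
    if "V \<in> Ob hCAT" "h \<in> hom hCAT V U" "k \<in> Ind ?P m h" for V :: "'u scat" and h k
    by (rule Msum_natural[OF a m that(2,3)])
  fix g assume g: "g \<in> hom hCAT (Pb ?P (Ho (top_sum_fun m f))) SetC"
  let ?flat = "Mflat Top_module m f"
  have n1g: "module_arg (Ho (top_sum_fun m f)) g"
    using sum g by (auto simp: module_arg_def hom_hCAT)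
  have flat: "?flat \<in> hom hCAT (Pb (oplax_pb SetC disc_fam) f) (Pb ?P (Ho (top_sum_fun m f)))"
    using Ho_flat_hom[OF a] mf sU by simp
  have gfl: "is_functor (comp_func g ?flat)"
    using flat g by (intro is_functor_comp) (auto simp: hom_hCAT)
  have box: "boxtimes hCAT Set_adder Top_module m f g = Ho (set_sum_fun f (Ho (comp_func g ?flat)))"
    by (simp add: boxtimes_def Set_adder_simps)
  have sm: "moderately_small (Src m)" using sU mf by simp
  show "Ho (top_sum_fun (Ho (top_sum_fun m f)) g) = Ho (top_sum_fun m (boxtimes hCAT Set_adder Top_module m f g))"
    unfolding box
    by (rule assoc_data.Msum_assoc[OF assoc_data.intro[OF a sm n1g refl refl refl nat_iso_ninv[OF Ho_nat_iso[OF gfl]]]])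
  fix k assume k: "k \<in> Ind (oplax_pb SetC disc_fam) g ?flat"
  obtain \<phi> where k: "k = Ho (oplax_map disc_fam (Cmp hCAT g ?flat) g ?flat \<phi>)" and o: "over (Cmp hCAT g ?flat) g ?flat \<phi>"
    by (rule Ind_oplax_pb[OF g flat k])
  have ph: "nat_iso \<phi> (Ho (comp_func g ?flat)) (comp_func g ?flat)" using over_nat_iso[OF o] by simp
  show "pb_eq hCAT ?P (Ho (top_sum_fun m (boxtimes hCAT Set_adder Top_module m f g)))
      (Cmp hCAT (Mflat Top_module (Ho (top_sum_fun m f)) g) k)
      (Cmp hCAT (Mflat Top_module m (boxtimes hCAT Set_adder Top_module m f g)) (Aflat Set_adder f (Cmp hCAT g ?flat)))"
    unfolding box k Set_adder_simps hCAT_simps(4)[of g ?flat]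
    by (rule assoc_data.Mflat_assoc[OF assoc_data.intro[OF a sm n1g refl refl refl ph]])
qed

end
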